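(* For every integer $k$ there are isomorphisms of $\mathcal V$-modules $$NL_{2k}(\mathbb{Z}_2)\cong NL_2(\mathbb{Z})\cong \mathcal V/\langle 2,V_2-1\rangle,$$ and isomorphisms of $\mathcal V_{\mathrm{od}}$-modules $$N^-L_2(\mathbb{Z})\cong N^-L_0(\mathbb{Z})\cong\mathcal V_{\mathrm{od}}/\langle 2\rangle,$$ and $NL_0(\mathbb{Z})=0$.
   Context: A ring with involution is a ring $R$ with an additive map $r\mapsto\overline r$ with $\overline{1}=1$, $\overline{\overline r}=r$, $\overline{rs}=\overline s\,\overline r$. A nonsingular $(-1)^k$-quadratic form over $R$ is a triple $(M,\lambda,\mu)$: $M$ a finitely generated stably free left $R$-module; $\lambda: M\times M\to R$ biadditive with $\lambda(x,y)=(-1)^k\overline{\lambda(y,x)}$, $\lambda(x,ry)=r\lambda(x,y)$, and $x\mapsto\lambda(x,\cdot)$ an isomorphism $M\to \mathrm{Hom}_R(M,R)$; and $\mu: M\to R/\{a-(-1)^k\overline a : a\in R\}$ with $\lambda(x,x)=\mu(x)+(-1)^k\overline{\mu(x)}$, $[\lambda(x,y)]=\mu(x+y)-\mu(x)-\mu(y)$, $\mu(rx)=r\mu(x)\overline r$. A Lagrangian is a submodule $L$ with $M/L$ finitely generated stably free, $\mu(L)=0$ and $L=L^\perp:=\{x:\lambda(x,L)=0\}$. $L_{2k}(R)$ is the Witt group: forms $m,m'$ are equivalent if $m\oplus m_0\cong m'\oplus m_0'$ for some forms $m_0,m_0'$ admitting Lagrangians; addition is orthogonal sum. It depends only on $k$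 mod 2. $R[t^{\pm}]$ is the polynomial ring $R[t]$ with the involution $\sum r_it^i\mapsto\sum(\pm1)^i\overline{r_i}t^i$; $R[t]$ means $R[t^+]$; $\mathbb{Z}$ and $\mathbb{Z}_2=\mathbb{Z}/2$ have the trivial involution. $\varepsilon_0:R[t^\pm]\to R$ is $f(t)\mapsto f(0)$, and $N^\pm L_n(R)=\ker(\varepsilon_{0*}:L_n(R[t^\pm])\to L_n(R))$; $NL_n=N^+L_n$. For $i>0$ let $V_i:R[t]\to R[t]$ be the ring endomorphism $p(t)\mapsto p(t^i)$; $V_iV_j=V_{ij}$. The Verschiebung algebra is $\mathcal V=\mathbb{Z}[V_2,V_3,V_5,\dots]$, the polynomial ring on $\{V_p: p\text{ prime}\}$, i.e. the monoid ring of $\{V_1,V_2,\dots\}$; $\mathcal V_{\mathrm{od}}=\mathbb{Z}[V_3,V_5,V_7,\dots]$ is the subalgebra on the odd primes. $\mathcal V$ acts on $NL_n(R)$ through the maps induced by the $V_i$, and $\mathcal V_{\mathrm{od}}$ acts on $N^-L_n(R)$ (for $i$ odd, $V_i$ respects the involution of $R[t^-]$). Angle brackets denote ideals generated by the listed elements. *)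

theory Defs
  imports "HOL-Library.Poly_Mapping" "HOL-Number_Theory.Residues" "HOL-Algebra.UnivPoly" "HOL-Algebra.IntRing"
begin

section \<open>Rings with involution and left modules\<close>

locale involution_ring = ring R for R :: "('a, 'x) ring_scheme" (structure) +
  fixes \<sigma> :: "'a \<Rightarrow> 'a"
  assumes inv_closed [simp, intro]: "a \<in> carrier R \<Longrightarrow> \<sigma> a \<in> carrier R"
    and inv_one: "\<sigma> \<one> = \<one>"
    and inv_inv: "a \<in> carrier R \<Longrightarrow> \<sigma> (\<sigma> a) = a"
    and inv_add: "a \<in> carrier R \<Longrightarrow> b \<in> carrier R \<Longrightarrow> \<sigma> (a \<oplus> b) = \<sigma> a \<oplus> \<sigma> b"
    and inv_mult: "a \<in> carrier R \<Longrightarrow> b \<in> carrier R \<Longrightarrow> \<sigma> (a \<otimes> b) = \<sigma> b \<otimes> \<sigma> a"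

text \<open>The locale \<^locale>\<open>module\<close> with the commutativity of the ring of scalars removed.\<close>

locale left_module = R?: ring R + M?: abelian_group M
  for R :: "('a, 'x) ring_scheme" (structure)
    and M :: "('a, 'm, 'y) module_scheme" (structure) +
  assumes smult_closed:
      "\<lbrakk>a \<in> carrier R; x \<in> carrier M\<rbrakk> \<Longrightarrow> a \<odot>\<^bsub>M\<^esub> x \<in> carrier M"
    and smult_l_distr:
      "\<lbrakk>a \<in> carrier R; b \<in> carrier R; x \<in> carrier M\<rbrakk> \<Longrightarrow>
        (a \<oplus> b) \<odot>\<^bsub>M\<^esub> x = a \<odot>\<^bsub>M\<^esub> x \<oplus>\<^bsub>M\<^esub> b \<odot>\<^bsub>M\<^esub> x"
    and smult_r_distr:
      "\<lbrakk>a \<in> carrier R; x \<in> carrier M; y \<in> carrier M\<rbrakk> \<Longrightarrow>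
        a \<odot>\<^bsub>M\<^esub> (x \<oplus>\<^bsub>M\<^esub> y) = a \<odot>\<^bsub>M\<^esub> x \<oplus>\<^bsub>M\<^esub> a \<odot>\<^bsub>M\<^esub> y"
    and smult_assoc1:
      "\<lbrakk>a \<in> carrier R; b \<in> carrier R; x \<in> carrier M\<rbrakk> \<Longrightarrow>
        (a \<otimes> b) \<odot>\<^bsub>M\<^esub> x = a \<odot>\<^bsub>M\<^esub> (b \<odot>\<^bsub>M\<^esub> x)"
    and smult_one: "x \<in> carrier M \<Longrightarrow> \<one> \<odot>\<^bsub>M\<^esub> x = x"

text \<open>Records of type \<^type>\<open>module_scheme\<close> inherit the fields \<^const>\<open>monoid.mult\<close> and \<^const>\<open>monoid.one\<close>
  from rings; these play no role for modules and are left \<^const>\<open>undefined\<close> below.\<close>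

definition semilinear_maps ::
    "('a, 'x) ring_scheme \<Rightarrow> ('a \<Rightarrow> 'b) \<Rightarrow> ('a, 'm, 'y) module_scheme
      \<Rightarrow> ('b, 'n, 'z) module_scheme \<Rightarrow> ('m \<Rightarrow> 'n) set" where
  "semilinear_maps R f M N =
    {h \<in> carrier M \<rightarrow> carrier N.
      (\<forall>x\<in>carrier M. \<forall>y\<in>carrier M. h (x \<oplus>\<^bsub>M\<^esub> y) = h x \<oplus>\<^bsub>N\<^esub> h y) \<and>
      (\<forall>r\<in>carrier R. \<forall>x\<in>carrier M. h (r \<odot>\<^bsub>M\<^esub> x) = f r \<odot>\<^bsub>N\<^esub> h x)}"

abbreviation linear_maps ::
    "('a, 'x) ring_scheme \<Rightarrow> ('a, 'm, 'y) module_scheme \<Rightarrow> ('a, 'n, 'z) module_scheme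
      \<Rightarrow> ('m \<Rightarrow> 'n) set" where
  "linear_maps R M N \<equiv> semilinear_maps R (\<lambda>r. r) M N"

definition module_iso ::
    "('a, 'x) ring_scheme \<Rightarrow> ('a, 'm, 'y) module_scheme \<Rightarrow> ('a, 'n, 'z) module_scheme \<Rightarrow> bool" where
  "module_iso R M N \<longleftrightarrow> left_module R M \<and> left_module R N \<and>
    (\<exists>h\<in>linear_maps R M N. bij_betw h (carrier M) (carrier N))"

definition regular_module :: "('a, 'x) ring_scheme \<Rightarrow> ('a, 'a) module" where
  "regular_module R = \<lparr>carrier = carrier R, monoid.mult = undefined, one = undefined,
     zero = \<zero>\<^bsub>R\<^esub>, add = add R, smult = monoid.mult R\<rparr>"

text \<open>The module \<open>R\<^sup>n\<close>; vectors are extended by zero outside \<open>{..<n}\<close>.\<close>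

definition free_module :: "('a, 'x) ring_scheme \<Rightarrow> nat \<Rightarrow> ('a, nat \<Rightarrow> 'a) module" where
  "free_module R n = \<lparr>carrier = {v. (\<forall>i<n. v i \<in> carrier R) \<and> (\<forall>i\<ge>n. v i = \<zero>\<^bsub>R\<^esub>)},
     monoid.mult = undefined, one = undefined, zero = (\<lambda>_. \<zero>\<^bsub>R\<^esub>),
     add = (\<lambda>v w i. v i \<oplus>\<^bsub>R\<^esub> w i), smult = (\<lambda>r v i. r \<otimes>\<^bsub>R\<^esub> v i)\<rparr>"

definition direct_sum ::
    "('a, 'm, 'y) module_scheme \<Rightarrow> ('a, 'n, 'z) module_scheme \<Rightarrow> ('a, 'm \<times> 'n) module" where
  "direct_sum M N = \<lparr>carrier = carrier M \<times> carrier N, monoid.mult = undefined, one = undefined,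
     zero = (\<zero>\<^bsub>M\<^esub>, \<zero>\<^bsub>N\<^esub>),
     add = (\<lambda>x y. (fst x \<oplus>\<^bsub>M\<^esub> fst y, snd x \<oplus>\<^bsub>N\<^esub> snd y)),
     smult = (\<lambda>r x. (r \<odot>\<^bsub>M\<^esub> fst x, r \<odot>\<^bsub>N\<^esub> snd x))\<rparr>"

definition quotient_module :: "('a, 'm, 'y) module_scheme \<Rightarrow> 'm set \<Rightarrow> ('a, 'm set) module" where
  "quotient_module M L = \<lparr>carrier = a_rcosets\<^bsub>M\<^esub> L, monoid.mult = undefined, one = undefined,
     zero = L, add = set_add M, smult = (\<lambda>r U. \<Union>x\<in>U. L +>\<^bsub>M\<^esub> (r \<odot>\<^bsub>M\<^esub> x))\<rparr>"

definition fg_stably_free :: "('a, 'x) ring_scheme \<Rightarrow> ('a, 'm, 'y) module_scheme \<Rightarrow> bool" where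
  "fg_stably_free R M \<longleftrightarrow>
    left_module R M \<and> (\<exists>m n. module_iso R (direct_sum M (free_module R m)) (free_module R n))"


section \<open>Nonsingular quadratic forms\<close>

text \<open>Multiplication by \<open>(-1)\<^sup>k\<close>.\<close>

definition signed :: "('a, 'x) ring_scheme \<Rightarrow> int \<Rightarrow> 'a \<Rightarrow> 'a" where
  "signed R k a = (if even k then a else \<ominus>\<^bsub>R\<^esub> a)"

definition indeterminacy :: "('a, 'x) ring_scheme \<Rightarrow> ('a \<Rightarrow> 'a) \<Rightarrow> int \<Rightarrow> 'a set" where
  "indeterminacy R \<sigma> k = {a \<ominus>\<^bsub>R\<^esub> signed R k (\<sigma> a) |a. a \<in> carrier R}"

text \<open>The values of \<open>\<mu>\<close> are cosets of \<^const>\<open>indeterminacy\<close>.\<close>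

record ('a, 'm) qform = "('a, 'm) module" +
  lam :: "'m \<Rightarrow> 'm \<Rightarrow> 'a"
  mu :: "'m \<Rightarrow> 'a set"

text \<open>In \<open>nonsingular\<close>, linear functionals are represented by functions that are
  \<^const>\<open>undefined\<close> outside the carrier. The map \<open>x \<mapsto> \<lambda>(x,-)\<close> is additive by
  \<open>lam_add_left\<close>, and it is \<open>R\<close>-linear for the usual left module structure
  \<open>(r\<cdot>f)(y) = f(y) \<sigma>(r)\<close> on the dual by \<open>lam_smult\<close> and \<open>lam_sym\<close>.
  In the axioms on \<open>\<mu>\<close>, the representative \<open>b\<close> ranges over the whole coset \<open>\<mu>(x)\<close>.\<close>

locale nonsingular_form = involution_ring R \<sigma>
  for k :: int and R :: "('a, 'x) ring_scheme" (structure) and \<sigma>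
  and M :: "('a, 'm, 'y) qform_scheme" (structure) +
  assumes stably_free: "fg_stably_free R M"
    and lam_closed: "x \<in> carrier M \<Longrightarrow> y \<in> carrier M \<Longrightarrow> lam M x y \<in> carrier R"
    and lam_add_left: "x \<in> carrier M \<Longrightarrow> x' \<in> carrier M \<Longrightarrow> y \<in> carrier M \<Longrightarrow>
      lam M (x \<oplus>\<^bsub>M\<^esub> x') y = lam M x y \<oplus>\<^bsub>R\<^esub> lam M x' y"
    and lam_add_right: "x \<in> carrier M \<Longrightarrow> y \<in> carrier M \<Longrightarrow> y' \<in> carrier M \<Longrightarrow>
      lam M x (y \<oplus>\<^bsub>M\<^esub> y') = lam M x y \<oplus>\<^bsub>R\<^esub> lam M x y'"
    and lam_sym: "x \<in> carrier M \<Longrightarrow> y \<in> carrier M \<Longrightarrow>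
      lam M x y = signed R k (\<sigma> (lam M y x))"
    and lam_smult: "r \<in> carrier R \<Longrightarrow> x \<in> carrier M \<Longrightarrow> y \<in> carrier M \<Longrightarrow>
      lam M x (r \<odot>\<^bsub>M\<^esub> y) = r \<otimes>\<^bsub>R\<^esub> lam M x y"
    and nonsingular: "bij_betw (\<lambda>x. restrict (lam M x) (carrier M)) (carrier M)
      (linear_maps R M (regular_module R) \<inter> extensional (carrier M))"
    and mu_closed: "x \<in> carrier M \<Longrightarrow> mu M x \<in> a_rcosets\<^bsub>R\<^esub> (indeterminacy R \<sigma> k)"
    and mu_lam: "x \<in> carrier M \<Longrightarrow> b \<in> mu M x \<Longrightarrow>
      lam M x x = b \<oplus>\<^bsub>R\<^esub> signed R k (\<sigma> b)"
    and mu_add: "x \<in> carrier M \<Longrightarrow> y \<in> carrier M \<Longrightarrow>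
      mu M (x \<oplus>\<^bsub>M\<^esub> y) =
        mu M x <+>\<^bsub>R\<^esub> mu M y <+>\<^bsub>R\<^esub> (indeterminacy R \<sigma> k +>\<^bsub>R\<^esub> lam M x y)"
    and mu_smult: "r \<in> carrier R \<Longrightarrow> x \<in> carrier M \<Longrightarrow> b \<in> mu M x \<Longrightarrow>
      mu M (r \<odot>\<^bsub>M\<^esub> x) = indeterminacy R \<sigma> k +>\<^bsub>R\<^esub> (r \<otimes>\<^bsub>R\<^esub> b \<otimes>\<^bsub>R\<^esub> \<sigma> r)"

definition lagrangian ::
    "int \<Rightarrow> ('a, 'x) ring_scheme \<Rightarrow> ('a \<Rightarrow> 'a) \<Rightarrow> ('a, 'm, 'y) qform_scheme \<Rightarrow> 'm set \<Rightarrow> bool" where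
  "lagrangian k R \<sigma> M L \<longleftrightarrow> submodule L R M \<and> fg_stably_free R (quotient_module M L) \<and>
    (\<forall>x\<in>L. mu M x = indeterminacy R \<sigma> k) \<and>
    L = {x \<in> carrier M. \<forall>y\<in>L. lam M x y = \<zero>\<^bsub>R\<^esub>}"

definition isometric ::
    "('a, 'x) ring_scheme \<Rightarrow> ('a, 'm, 'y) qform_scheme \<Rightarrow> ('a, 'n, 'z) qform_scheme \<Rightarrow> bool" where
  "isometric R M N \<longleftrightarrow> (\<exists>h\<in>linear_maps R M N. bij_betw h (carrier M) (carrier N) \<and>
    (\<forall>x\<in>carrier M. \<forall>y\<in>carrier M. lam N (h x) (h y) = lam M x y) \<and>
    (\<forall>x\<in>carrier M. mu N (h x) = mu M x))"

definition orthogonal_sum ::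
    "('a, 'x) ring_scheme \<Rightarrow> ('a, 'm, 'y) qform_scheme \<Rightarrow> ('a, 'n, 'z) qform_scheme
      \<Rightarrow> ('a, 'm \<times> 'n) qform" where
  "orthogonal_sum R M N = module.extend (direct_sum M N)
    (qform.fields
      (\<lambda>x y. lam M (fst x) (fst y) \<oplus>\<^bsub>R\<^esub> lam N (snd x) (snd y))
      (\<lambda>x. mu M (fst x) <+>\<^bsub>R\<^esub> mu N (snd x)))"

definition zero_form ::
    "int \<Rightarrow> ('a, 'x) ring_scheme \<Rightarrow> ('a \<Rightarrow> 'a) \<Rightarrow> ('a, nat \<Rightarrow> 'a) qform" where
  "zero_form k R \<sigma> = module.extend (free_module R 0)
    (qform.fields (\<lambda>x y. \<zero>\<^bsub>R\<^esub>) (\<lambda>x. indeterminacy R \<sigma> k))"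


section \<open>The Witt group \<open>L\<^sub>2\<^sub>k(R)\<close>\<close>

text \<open>Every finitely generated left module over a ring with elements of type \<open>'a\<close> is isomorphic to
  one with elements of type \<open>nat \<Rightarrow> 'a\<close>. Forms on modules with elements of this type,
  with arbitrary module operations, thus represent all isomorphism classes.\<close>

definition witt_equivalent ::
    "int \<Rightarrow> ('a, 'x) ring_scheme \<Rightarrow> ('a \<Rightarrow> 'a) \<Rightarrow> ('a, 'm, 'y) qform_scheme
      \<Rightarrow> ('a, 'n, 'z) qform_scheme \<Rightarrow> bool" where
  "witt_equivalent k R \<sigma> M M' \<longleftrightarrow>
    (\<exists>(M\<^sub>0 :: ('a, nat \<Rightarrow> 'a) qform) (M\<^sub>0' :: ('a, nat \<Rightarrow> 'a) qform).
      nonsingular_form k R \<sigma> M\<^sub>0 \<and> (\<exists>L. lagrangian k R \<sigma> M\<^sub>0 L) \<and>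
      nonsingular_form k R \<sigma> M\<^sub>0' \<and> (\<exists>L. lagrangian k R \<sigma> M\<^sub>0' L) \<and>
      isometric R (orthogonal_sum R M M\<^sub>0) (orthogonal_sum R M' M\<^sub>0'))"

definition witt_class ::
    "int \<Rightarrow> ('a, 'x) ring_scheme \<Rightarrow> ('a \<Rightarrow> 'a) \<Rightarrow> ('a, 'm, 'y) qform_scheme
      \<Rightarrow> ('a, nat \<Rightarrow> 'a) qform set" where
  "witt_class k R \<sigma> M = {N. nonsingular_form k R \<sigma> N \<and> witt_equivalent k R \<sigma> M N}"

text \<open>An abelian group in the sense of \<^locale>\<open>abelian_group\<close>: the multiplicative fields of the
  record are irrelevant.\<close>

definition L_group ::
    "int \<Rightarrow> ('a, 'x) ring_scheme \<Rightarrow> ('a \<Rightarrow> 'a) \<Rightarrow> ('a, nat \<Rightarrow> 'a) qform set ring" where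
  "L_group k R \<sigma> =
    \<lparr>carrier = {witt_class k R \<sigma> M |M :: ('a, nat \<Rightarrow> 'a) qform. nonsingular_form k R \<sigma> M},
     monoid.mult = undefined, one = undefined,
     zero = witt_class k R \<sigma> (zero_form k R \<sigma>),
     add = (\<lambda>U W. \<Union>M\<in>U. \<Union>N\<in>W. witt_class k R \<sigma> (orthogonal_sum R M N))\<rparr>"

text \<open>\<open>\<phi> : M \<rightarrow> N\<close> exhibits \<open>N\<close> as \<open>S \<otimes>\<^sub>R M\<close> along \<open>f : R \<rightarrow> S\<close>. For finitely generated \<open>M\<close>
  and \<open>N\<close> it suffices to state the universal property for target modules with elements of
  type \<open>nat \<Rightarrow> 'b\<close>, since both \<open>N\<close> and \<open>S \<otimes>\<^sub>R M\<close> are isomorphic to such modules.\<close>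

definition extension_of_scalars ::
    "('a, 'x) ring_scheme \<Rightarrow> ('b, 'w) ring_scheme \<Rightarrow> ('a \<Rightarrow> 'b) \<Rightarrow> ('a, 'm, 'y) module_scheme
      \<Rightarrow> ('b, 'n, 'z) module_scheme \<Rightarrow> ('m \<Rightarrow> 'n) \<Rightarrow> bool" where
  "extension_of_scalars R S f M N \<phi> \<longleftrightarrow> left_module S N \<and> \<phi> \<in> semilinear_maps R f M N \<and>
    (\<forall>P :: ('b, nat \<Rightarrow> 'b) module. left_module S P \<longrightarrow>
      (\<forall>\<psi>\<in>semilinear_maps R f M P.
        \<exists>!h. h \<in> linear_maps S N P \<inter> extensional (carrier N) \<and>
             (\<forall>x\<in>carrier M. h (\<phi> x) = \<psi> x)))"

text \<open>\<open>N\<close> is the form \<open>S \<otimes>\<^sub>R M\<close>. Since \<open>\<phi>(M)\<close> generates \<open>N\<close>, the two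
  equations determine the form on \<open>N\<close>.\<close>

definition base_change_form ::
    "int \<Rightarrow> ('a, 'x) ring_scheme \<Rightarrow> ('b, 'w) ring_scheme \<Rightarrow> ('b \<Rightarrow> 'b) \<Rightarrow> ('a \<Rightarrow> 'b)
      \<Rightarrow> ('a, 'm, 'y) qform_scheme \<Rightarrow> ('b, 'n, 'z) qform_scheme \<Rightarrow> bool" where
  "base_change_form k R S \<tau> f M N \<longleftrightarrow> nonsingular_form k S \<tau> N \<and>
    (\<exists>\<phi>. extension_of_scalars R S f M N \<phi> \<and>
      (\<forall>x\<in>carrier M. \<forall>y\<in>carrier M. lam N (\<phi> x) (\<phi> y) = f (lam M x y)) \<and>
      (\<forall>x\<in>carrier M. \<forall>b\<in>mu M x. mu N (\<phi> x) = indeterminacy S \<tau> k +>\<^bsub>S\<^esub> f b))"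

text \<open>The map \<open>L\<^sub>2\<^sub>k(R) \<rightarrow> L\<^sub>2\<^sub>k(S)\<close> induced by a morphism \<open>f\<close> of rings with involution.\<close>

definition L_map ::
    "int \<Rightarrow> ('a, 'x) ring_scheme \<Rightarrow> ('b, 'w) ring_scheme \<Rightarrow> ('b \<Rightarrow> 'b) \<Rightarrow> ('a \<Rightarrow> 'b)
      \<Rightarrow> ('a, nat \<Rightarrow> 'a) qform set \<Rightarrow> ('b, nat \<Rightarrow> 'b) qform set" where
  "L_map k R S \<tau> f U =
    (\<Union>M\<in>U. \<Union>N\<in>{N :: ('b, nat \<Rightarrow> 'b) qform. base_change_form k R S \<tau> f M N}. witt_class k S \<tau> N)"


section \<open>Polynomial rings and the Verschiebung algebra\<close>

text \<open>The involution of \<open>R[t\<^sup>\<plusminus>]\<close>, where \<open>e = 1\<close> or \<open>e = -1\<close>.\<close>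

definition poly_inv ::
    "int \<Rightarrow> ('a, 'x) ring_scheme \<Rightarrow> ('a \<Rightarrow> 'a) \<Rightarrow> (nat \<Rightarrow> 'a) \<Rightarrow> (nat \<Rightarrow> 'a)" where
  "poly_inv e R \<sigma> p = (\<lambda>i. add_pow R (e ^ i) (\<sigma> (coeff (UP R) p i)))"

definition eval_zero :: "('a, 'x) ring_scheme \<Rightarrow> (nat \<Rightarrow> 'a) \<Rightarrow> 'a" where
  "eval_zero R = eval R R (\<lambda>a. a) \<zero>\<^bsub>R\<^esub>"

definition V_map :: "('a, 'x) ring_scheme \<Rightarrow> nat \<Rightarrow> (nat \<Rightarrow> 'a) \<Rightarrow> (nat \<Rightarrow> 'a)" where
  "V_map R i = eval R (UP R) (\<lambda>a. monom (UP R) a 0) (monom (UP R) \<one>\<^bsub>R\<^esub> i)"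

text \<open>The polynomial ring \<open>\<int>[V\<^sub>p : p \<in> I]\<close>. Monomials are multisets of indices, so that for a set
  \<open>I\<close> of primes the multiset \<open>m\<close> stands for \<open>V\<^sub>i\<close> with \<open>i = \<Prod>\<^sub># m\<close>.\<close>

definition V_ring :: "nat set \<Rightarrow> (nat multiset \<Rightarrow>\<^sub>0 int) ring" where
  "V_ring I = \<lparr>carrier = {P. \<forall>m\<in>Poly_Mapping.keys P. set_mset m \<subseteq> I},
     monoid.mult = (*), one = 1, zero = 0, add = (+)\<rparr>"

definition V_var :: "nat \<Rightarrow> nat multiset \<Rightarrow>\<^sub>0 int" where
  "V_var p = Poly_Mapping.single {#p#} 1"

abbreviation V_alg :: "(nat multiset \<Rightarrow>\<^sub>0 int) ring" (\<open>\<V>\<close>) where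
  "\<V> \<equiv> V_ring {p. prime p}"

abbreviation V_alg_od :: "(nat multiset \<Rightarrow>\<^sub>0 int) ring" (\<open>\<V>\<^sub>o\<^sub>d\<close>) where
  "\<V>\<^sub>o\<^sub>d \<equiv> V_ring {p. prime p \<and> odd p}"

text \<open>\<open>NL e k R \<sigma>\<close> is \<open>N\<^sup>\<plusminus>L\<^sub>2\<^sub>k(R)\<close> for \<open>e = \<plusminus>1\<close>. The scalar multiplication is meaningful
  for scalars in \<open>\<V>\<close> if \<open>e = 1\<close>, and for scalars in \<open>\<V>\<^sub>o\<^sub>d\<close> if \<open>e = -1\<close>.\<close>

definition NL ::
    "int \<Rightarrow> int \<Rightarrow> ('a, 'x) ring_scheme \<Rightarrow> ('a \<Rightarrow> 'a)
      \<Rightarrow> (nat multiset \<Rightarrow>\<^sub>0 int, (nat \<Rightarrow> 'a, nat \<Rightarrow> nat \<Rightarrow> 'a) qform set) module" where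
  "NL e k R \<sigma> = (let \<tau> = poly_inv e R \<sigma>; L = L_group k (UP R) \<tau> in
    \<lparr>carrier = a_kernel L (L_group k R \<sigma>) (L_map k (UP R) R \<sigma> (eval_zero R)),
     monoid.mult = undefined, one = undefined, zero = \<zero>\<^bsub>L\<^esub>, add = add L,
     smult = (\<lambda>P U. \<Oplus>\<^bsub>L\<^esub>m\<in>Poly_Mapping.keys P.
       add_pow L (Poly_Mapping.lookup P m) (L_map k (UP R) (UP R) \<tau> (V_map R (\<Prod>\<^sub># m)) U))\<rparr>)"

end

theory Submission
  imports Defs "HOL-Library.Z2" "HOL-Computational_Algebra.Polynomial"
begin

text \<open>Every form is stably based, so its class is given by a matrix. Over \<open>\<int>[t\<^sup>\<plusminus>]\<close> Higman's trick makes the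
  matrix linear in \<open>t\<close>, the leading coefficient of the inverse of a linear hermitian matrix provides
  isotropic vectors, and over \<open>\<FF>\<^sub>2[t]\<close> a basis vector is isotropic. Hence every class in the kernel of the
  augmentation is a sum of classes \<open>sy a b\<close> of hyperbolic planes with \<open>\<mu>\<close>-values \<open>a\<close> and \<open>b\<close> on the
  standard basis. Relations between these symbols show that \<open>sy a b\<close> depends only on the reduction of
  \<open>ab\<close> in \<open>\<FF>\<^sub>2[t]\<close> modulo \<open>w + w\<^sup>2\<close>, and the Arf invariant shows that there are no further
  relations. The module structure is then read off from \<open>t \<cdot> \<FF>\<^sub>2[t]\<close> modulo \<open>w + w\<^sup>2\<close>.\<close>

section \<open>Modules\<close>

text \<open>The possible \<mu>-values of the planes explain the shape of the result. On the standard
  basis of a plane they lie in \<open>Hh = {a. a + eps * s a = 0}\<close> and matter modulo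
  \<open>Lam = {a - eps * s a}\<close>; the quotient is a Tate cohomology group of the involution.
  For Z[t] it is F_2[t] if k is odd and 0 if k is even; for Z[t^-] it is spanned by the even powers
  of t if k is odd, by the odd powers if k is even. Hence NL_0(Z) = 0, NL_2(Z) looks as over F_2,
  and the two N^-L agree: products of two values are squares (uv)^2 or (tuv)^2, and a square is
  equivalent to its root modulo w + w^2. The obstacle is the constant part of a form over Z[t],
  which can be a nontrivial class of L(Z). Vanishing of the augmentation removes it, but only up to
  a change of \<mu>, which is absorbed by further planes. On t F_2[t] the operator V_2 is squaring,
  so it is the identity modulo w + w^2, and the powers t^n with n odd form a basis of the quotient.
  Unique factorization of n matches them with the monomials in the V_p for odd p.\<close>

lemma left_moduleD:
  assumes "left_module R M"
  shows "ring R" "abelian_group M"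
    "\<And>a x. a \<in> carrier R \<Longrightarrow> x \<in> carrier M \<Longrightarrow> a \<odot>\<^bsub>M\<^esub> x \<in> carrier M"
    "\<And>a b x. a \<in> carrier R \<Longrightarrow> b \<in> carrier R \<Longrightarrow> x \<in> carrier M \<Longrightarrow>
        (a \<oplus>\<^bsub>R\<^esub> b) \<odot>\<^bsub>M\<^esub> x = a \<odot>\<^bsub>M\<^esub> x \<oplus>\<^bsub>M\<^esub> b \<odot>\<^bsub>M\<^esub> x"
    "\<And>a x y. a \<in> carrier R \<Longrightarrow> x \<in> carrier M \<Longrightarrow> y \<in> carrier M \<Longrightarrow>
        a \<odot>\<^bsub>M\<^esub> (x \<oplus>\<^bsub>M\<^esub> y) = a \<odot>\<^bsub>M\<^esub> x \<oplus>\<^bsub>M\<^esub> a \<odot>\<^bsub>M\<^esub> y"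
    "\<And>a b x. a \<in> carrier R \<Longrightarrow> b \<in> carrier R \<Longrightarrow> x \<in> carrier M \<Longrightarrow>
        (a \<otimes>\<^bsub>R\<^esub> b) \<odot>\<^bsub>M\<^esub> x = a \<odot>\<^bsub>M\<^esub> (b \<odot>\<^bsub>M\<^esub> x)"
    "\<And>x. x \<in> carrier M \<Longrightarrow> \<one>\<^bsub>R\<^esub> \<odot>\<^bsub>M\<^esub> x = x"
  using left_module.smult_closed[OF assms] left_module.smult_l_distr[OF assms]
    left_module.smult_r_distr[OF assms] left_module.smult_assoc1[OF assms] left_module.smult_one[OF assms]
    left_module.axioms(1,2)[OF assms] by - (assumption | blast)+

lemma semilinearD:
  assumes "h \<in> semilinear_maps R f M N"
  shows "\<And>x. x \<in> carrier M \<Longrightarrow> h x \<in> carrier N"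
    "\<And>x y. x \<in> carrier M \<Longrightarrow> y \<in> carrier M \<Longrightarrow> h (x \<oplus>\<^bsub>M\<^esub> y) = h x \<oplus>\<^bsub>N\<^esub> h y"
    "\<And>r x. r \<in> carrier R \<Longrightarrow> x \<in> carrier M \<Longrightarrow> h (r \<odot>\<^bsub>M\<^esub> x) = f r \<odot>\<^bsub>N\<^esub> h x"
  using assms unfolding semilinear_maps_def by blast+

lemma semilinearI:
  assumes "\<And>x. x \<in> carrier M \<Longrightarrow> h x \<in> carrier N"
    "\<And>x y. x \<in> carrier M \<Longrightarrow> y \<in> carrier M \<Longrightarrow> h (x \<oplus>\<^bsub>M\<^esub> y) = h x \<oplus>\<^bsub>N\<^esub> h y"
    "\<And>r x. r \<in> carrier R \<Longrightarrow> x \<in> carrier M \<Longrightarrow> h (r \<odot>\<^bsub>M\<^esub> x) = f r \<odot>\<^bsub>N\<^esub> h x"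
  shows "h \<in> semilinear_maps R f M N"
  using assms unfolding semilinear_maps_def by blast+

text \<open>Transports the module axioms along a surjection that preserves the operations.
  Quotients, orthogonal sums, matrix forms and \<open>NL\<close> are all recognized as modules in
  this way.\<close>

lemma image_left_module:
  assumes M: "left_module R M" and h: "h \<in> linear_maps R M N"
    and onto: "h ` carrier M = carrier N" and zero: "h \<zero>\<^bsub>M\<^esub> = \<zero>\<^bsub>N\<^esub>"
  shows "left_module R N"
proof -
  interpret M: abelian_group M using left_moduleD(2)[OF M] .
  note hD = semilinearD[OF h] and MD = left_moduleD[OF M]
  have ex: "\<exists>x\<in>carrier M. y = h x" if "y \<in> carrier N" for y using onto that by auto
  have "abelian_group N"
  proof (rule abelian_groupI)
    fix x y assume "x \<in> carrier N" "y \<in> carrier N"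
    then obtain x' y' where [simp]: "x' \<in> carrier M" "y' \<in> carrier M" "x = h x'" "y = h y'" using ex by blast
    show "x \<oplus>\<^bsub>N\<^esub> y \<in> carrier N" using hD(1)[of "x' \<oplus>\<^bsub>M\<^esub> y'"] hD(2)[of x' y'] by simp
    show "x \<oplus>\<^bsub>N\<^esub> y = y \<oplus>\<^bsub>N\<^esub> x" using hD(2)[of x' y'] hD(2)[of y' x'] by (simp add: M.a_comm)
  next
    show "\<zero>\<^bsub>N\<^esub> \<in> carrier N" using hD(1)[of "\<zero>\<^bsub>M\<^esub>"] zero by simp
  next
    fix x y z assume "x \<in> carrier N" "y \<in> carrier N" "z \<in> carrier N"
    obtain x' y' z' where [simp]: "x' \<in> carrier M" "x = h x'" "y' \<in> carrier M" "y = h y'" "z' \<in> carrier M" "z = h z'"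
      using ex[OF \<open>x \<in> carrier N\<close>] ex[OF \<open>y \<in> carrier N\<close>] ex[OF \<open>z \<in> carrier N\<close>] by auto
    show "x \<oplus>\<^bsub>N\<^esub> y \<oplus>\<^bsub>N\<^esub> z = x \<oplus>\<^bsub>N\<^esub> (y \<oplus>\<^bsub>N\<^esub> z)"
      by (simp add: hD(2)[symmetric] M.a_assoc)
  next
    fix x assume "x \<in> carrier N"
    then obtain x' where [simp]: "x' \<in> carrier M" "x = h x'" using ex by blast
    show "\<zero>\<^bsub>N\<^esub> \<oplus>\<^bsub>N\<^esub> x = x" by (simp add: zero[symmetric] hD(2)[symmetric])
    have "h (\<ominus>\<^bsub>M\<^esub> x') \<in> carrier N" "h (\<ominus>\<^bsub>M\<^esub> x') \<oplus>\<^bsub>N\<^esub> x = \<zero>\<^bsub>N\<^esub>"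
      by (auto simp add: hD(1) zero[symmetric] hD(2)[symmetric] M.l_neg)
    then show "\<exists>y\<in>carrier N. y \<oplus>\<^bsub>N\<^esub> x = \<zero>\<^bsub>N\<^esub>" by blast
  qed
  moreover have "left_module_axioms R N"
  proof
    fix a x assume [simp]: "a \<in> carrier R" and "x \<in> carrier N"
    then obtain x' where [simp]: "x' \<in> carrier M" "x = h x'" using ex by blast
    show "a \<odot>\<^bsub>N\<^esub> x \<in> carrier N" using hD(1)[of "a \<odot>\<^bsub>M\<^esub> x'"] hD(3)[of a x'] MD(3)[of a x'] by simp
  next
    fix a b x assume [simp]: "a \<in> carrier R" "b \<in> carrier R" and "x \<in> carrier N"
    then obtain x' where [simp]: "x' \<in> carrier M" "x = h x'" using ex by blast
    interpret R: ring R by (rule MD(1))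
    show "(a \<oplus>\<^bsub>R\<^esub> b) \<odot>\<^bsub>N\<^esub> x = a \<odot>\<^bsub>N\<^esub> x \<oplus>\<^bsub>N\<^esub> b \<odot>\<^bsub>N\<^esub> x"
      by (simp add: hD(2,3)[symmetric] MD)
    show "(a \<otimes>\<^bsub>R\<^esub> b) \<odot>\<^bsub>N\<^esub> x = a \<odot>\<^bsub>N\<^esub> (b \<odot>\<^bsub>N\<^esub> x)"
      by (simp add: hD(3)[symmetric] MD)
  next
    fix a x y assume [simp]: "a \<in> carrier R" and "x \<in> carrier N" "y \<in> carrier N"
    then obtain x' y' where [simp]: "x' \<in> carrier M" "x = h x'" "y' \<in> carrier M" "y = h y'" using ex by blast
    show "a \<odot>\<^bsub>N\<^esub> (x \<oplus>\<^bsub>N\<^esub> y) = a \<odot>\<^bsub>N\<^esub> x \<oplus>\<^bsub>N\<^esub> a \<odot>\<^bsub>N\<^esub> y"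
      by (simp add: hD(2,3)[symmetric] MD)
  next
    fix x assume "x \<in> carrier N"
    then obtain x' where [simp]: "x' \<in> carrier M" "x = h x'" using ex by blast
    interpret R: ring R by (rule MD(1))
    show "\<one>\<^bsub>R\<^esub> \<odot>\<^bsub>N\<^esub> x = x" by (simp add: hD(3)[symmetric] MD)
  qed
  ultimately show ?thesis using MD(1) by (simp add: left_module_def)
qed

lemma linear_zero:
  assumes "left_module R M" "left_module R N" "h \<in> linear_maps R M N"
  shows "h \<zero>\<^bsub>M\<^esub> = \<zero>\<^bsub>N\<^esub>"
proof -
  interpret M: abelian_group M using left_moduleD(2)[OF assms(1)] .
  interpret N: abelian_group N using left_moduleD(2)[OF assms(2)] .
  note hD = semilinearD[OF assms(3)]
  have "h \<zero>\<^bsub>M\<^esub> \<oplus>\<^bsub>N\<^esub> h \<zero>\<^bsub>M\<^esub> = h \<zero>\<^bsub>M\<^esub> \<oplus>\<^bsub>N\<^esub> \<zero>\<^bsub>N\<^esub>" using hD(1) hD(2)[of "\<zero>\<^bsub>M\<^esub>" "\<zero>\<^bsub>M\<^esub>"] by simp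
  then show ?thesis using hD(1)[of "\<zero>\<^bsub>M\<^esub>"] by (simp del: N.r_zero)
qed

lemma linear_inverse:
  assumes M: "left_module R M" and h: "h \<in> linear_maps R M N" and bij: "bij_betw h (carrier M) (carrier N)"
  shows "inv_into (carrier M) h \<in> linear_maps R N M"
    "bij_betw (inv_into (carrier M) h) (carrier N) (carrier M)"
proof -
  let ?g = "inv_into (carrier M) h"
  interpret M: abelian_group M using left_moduleD(2)[OF M] .
  note hD = semilinearD[OF h] and MD = left_moduleD[OF M]
  show bg: "bij_betw ?g (carrier N) (carrier M)" using bij by (rule bij_betw_inv_into)
  have g[simp]: "?g y \<in> carrier M" if "y \<in> carrier N" for y using bg that by (auto simp: bij_betw_def)
  have hg[simp]: "h (?g y) = y" if "y \<in> carrier N" for y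
    using bij that by (simp add: bij_betw_inv_into_right)
  have gh: "?g (h x) = x" if "x \<in> carrier M" for x
    using bij that by (simp add: bij_betw_inv_into_left)
  show "?g \<in> linear_maps R N M"
  proof (rule semilinearI)
    fix x y assume [simp]: "x \<in> carrier N" "y \<in> carrier N"
    show "?g x \<in> carrier M" by simp
    show "?g (x \<oplus>\<^bsub>N\<^esub> y) = ?g x \<oplus>\<^bsub>M\<^esub> ?g y"
      using gh[of "?g x \<oplus>\<^bsub>M\<^esub> ?g y"] hD(2)[of "?g x" "?g y"] by simp
  next
    fix r x assume [simp]: "r \<in> carrier R" "x \<in> carrier N"
    show "?g (r \<odot>\<^bsub>N\<^esub> x) = r \<odot>\<^bsub>M\<^esub> ?g x"
      using gh[of "r \<odot>\<^bsub>M\<^esub> ?g x"] hD(3)[of r "?g x"] MD(3)[of r "?g x"] by simp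
  qed
qed

lemma linear_comp:
  assumes "h \<in> linear_maps R M N" "g \<in> linear_maps R N P"
  shows "g \<circ> h \<in> linear_maps R M P"
  by (rule semilinearI) (simp_all add: semilinearD[OF assms(1)] semilinearD[OF assms(2)])

lemma module_iso_sym: "module_iso R M N \<Longrightarrow> module_iso R N M"
  unfolding module_iso_def using linear_inverse by blast

lemma module_iso_trans: "module_iso R M N \<Longrightarrow> module_iso R N P \<Longrightarrow> module_iso R M P"
  unfolding module_iso_def using linear_comp bij_betw_trans by blast

text \<open>The first isomorphism theorem. The cosets of \<open>L\<close> are the fibres
  \<open>fib\<close> of \<open>h\<close>, so coset arithmetic becomes arithmetic in
  \<open>N\<close>. The map constructed is \<open>fib\<close>, from \<open>N\<close> to the
  quotient, and the isomorphism is inverted at the end.\<close>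

lemma quotient_module_iso:
  assumes M: "left_module R M" and N: "left_module R N"
    and h: "h \<in> linear_maps R M N" and onto: "h ` carrier M = carrier N"
    and L: "L = {x \<in> carrier M. h x = \<zero>\<^bsub>N\<^esub>}"
  shows "module_iso R (quotient_module M L) N"
proof -
  interpret M: abelian_group M using left_moduleD(2)[OF M] .
  interpret N: abelian_group N using left_moduleD(2)[OF N] .
  note hD = semilinearD[OF h] and MD = left_moduleD[OF M] and ND = left_moduleD[OF N]
  have h0: "h \<zero>\<^bsub>M\<^esub> = \<zero>\<^bsub>N\<^esub>" by (rule linear_zero[OF M N h])
  have hneg: "h (\<ominus>\<^bsub>M\<^esub> x) = \<ominus>\<^bsub>N\<^esub> h x" if "x \<in> carrier M" for x
    using hD(2)[of "\<ominus>\<^bsub>M\<^esub> x" x] that h0 hD(1) by (simp add: M.l_neg N.minus_equality)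
  define fib where "fib n = {z \<in> carrier M. h z = n}" for n
  have coset: "L +>\<^bsub>M\<^esub> x = fib (h x)" if x: "x \<in> carrier M" for x
  proof -
    have "z \<in> L +>\<^bsub>M\<^esub> x" if "z \<in> fib (h x)" for z
    proof -
      have z: "z \<in> carrier M" "h z = h x" using that by (auto simp: fib_def)
      have "z \<ominus>\<^bsub>M\<^esub> x \<in> L" using z x by (simp add: L M.minus_eq hD hneg N.r_neg)
      moreover have "z = (z \<ominus>\<^bsub>M\<^esub> x) \<oplus>\<^bsub>M\<^esub> x" using z x by (simp add: M.minus_eq M.a_assoc M.l_neg)
      ultimately show ?thesis unfolding a_r_coset_def' by blast
    qed
    then show ?thesis using x by (auto simp: a_r_coset_def' fib_def L hD)
  qed
  have ex: "\<exists>x\<in>carrier M. y = h x" if "y \<in> carrier N" for y using onto that by auto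
  have car: "carrier (quotient_module M L) = fib ` carrier N"
    unfolding quotient_module_def by (auto simp: A_RCOSETS_def' coset onto[symmetric])
  have fibL: "L = fib \<zero>\<^bsub>N\<^esub>" by (simp add: L fib_def)
  have inj: "inj_on fib (carrier N)"
  proof (rule inj_onI)
    fix a b assume "a \<in> carrier N" "b \<in> carrier N" "fib a = fib b"
    moreover obtain x where "x \<in> carrier M" "a = h x" using ex[OF \<open>a \<in> carrier N\<close>] by blast
    ultimately have "x \<in> fib b" by (auto simp: fib_def)
    then show "a = b" using \<open>a = h x\<close> by (simp add: fib_def)
  qed
  have add: "fib a <+>\<^bsub>M\<^esub> fib b = fib (a \<oplus>\<^bsub>N\<^esub> b)" if ab: "a \<in> carrier N" "b \<in> carrier N" for a b
  proof -
    obtain x y where x: "x \<in> carrier M" "a = h x" and y: "y \<in> carrier M" "b = h y" using ab ex by blast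
    have "z \<in> fib a <+>\<^bsub>M\<^esub> fib b" if z: "z \<in> fib (a \<oplus>\<^bsub>N\<^esub> b)" for z
    proof -
      have z': "z \<in> carrier M" "h z = h x \<oplus>\<^bsub>N\<^esub> h y" using z x y by (auto simp: fib_def)
      have "z \<ominus>\<^bsub>M\<^esub> y \<in> fib a"
        using z' x y by (simp add: fib_def M.minus_eq hD hneg N.a_assoc N.r_neg)
      moreover have "z = (z \<ominus>\<^bsub>M\<^esub> y) \<oplus>\<^bsub>M\<^esub> y" using z' y by (simp add: M.minus_eq M.a_assoc M.l_neg)
      moreover have "y \<in> fib b" using y by (simp add: fib_def)
      ultimately show ?thesis unfolding set_add_def' by blast
    qed
    then show ?thesis by (auto simp: set_add_def' fib_def hD)
  qed
  have smult: "(\<Union>x\<in>fib a. L +>\<^bsub>M\<^esub> (r \<odot>\<^bsub>M\<^esub> x)) = fib (r \<odot>\<^bsub>N\<^esub> a)"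
    if ra: "r \<in> carrier R" "a \<in> carrier N" for r a
  proof -
    obtain x where x: "x \<in> carrier M" "a = h x" using ex[OF ra(2)] by blast
    have "L +>\<^bsub>M\<^esub> (r \<odot>\<^bsub>M\<^esub> y) = fib (r \<odot>\<^bsub>N\<^esub> a)" if "y \<in> fib a" for y
      using that ra by (auto simp: fib_def coset MD hD)
    moreover have "x \<in> fib a" using x by (simp add: fib_def)
    ultimately show ?thesis by blast
  qed
  have lin: "fib \<in> linear_maps R N (quotient_module M L)"
    by (rule semilinearI) (auto simp: car, auto simp: quotient_module_def add smult)
  have "left_module R (quotient_module M L)"
    by (rule image_left_module[OF N lin]) (simp add: car, simp add: quotient_module_def fibL)
  then have "module_iso R N (quotient_module M L)"
    using N lin inj car unfolding module_iso_def bij_betw_def by blast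
  then show ?thesis by (rule module_iso_sym)
qed

section \<open>Forms with scalars in a type\<close>

text \<open>Identifies the carrier of \<open>R\<close> with a whole type \<open>'b\<close> of class
  \<open>comm_ring_1\<close>, so that matrix computations become type class algebra. Since
  \<open>'b\<close> is commutative, the involution \<open>s\<close> is an automorphism and keeps the
  order of factors.\<close>

locale fmodel =
  fixes R :: "('a, 'x) ring_scheme" (structure) and \<sigma> :: "'a \<Rightarrow> 'a"
    and \<rho> :: "'b::comm_ring_1 \<Rightarrow> 'a" and s :: "'b \<Rightarrow> 'b" and k :: int
  assumes ring_R: "ring R" and bij_rho: "bij_betw \<rho> UNIV (carrier R)"
    and rho_add: "\<rho> (a + b) = \<rho> a \<oplus> \<rho> b" and rho_mult: "\<rho> (a * b) = \<rho> a \<otimes> \<rho> b"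
    and rho_one: "\<rho> 1 = \<one>" and sigma_rho: "\<sigma> (\<rho> a) = \<rho> (s a)"
    and s_add: "s (a + b) = s a + s b" and s_mult: "s (a * b) = s a * s b"
    and s_one [simp]: "s 1 = 1" and s_s [simp]: "s (s a) = a"
begin

definition un :: "'a \<Rightarrow> 'b" where "un = the_inv \<rho>"
definition eps :: 'b where "eps = (if even k then 1 else - 1)"
definition Lam :: "'b set" where "Lam = {a - eps * s a |a. True}"
definition cs :: "'b \<Rightarrow> 'a set" where "cs b = indeterminacy R \<sigma> k +> \<rho> b"
definition act :: "('a, 'm, 'y) module_scheme \<Rightarrow> 'b \<Rightarrow> 'm \<Rightarrow> 'm" where "act M a x = \<rho> a \<odot>\<^bsub>M\<^esub> x"
definition lm :: "('a, 'm, 'y) qform_scheme \<Rightarrow> 'm \<Rightarrow> 'm \<Rightarrow> 'b" where "lm M x y = un (lam M x y)"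

lemma rho_inj [simp]: "\<rho> a = \<rho> b \<longleftrightarrow> a = b"
  using bij_rho by (auto simp: bij_betw_def inj_on_def)

lemma rho_car [simp]: "\<rho> a \<in> carrier R"
  using bij_rho by (auto simp: bij_betw_def)

lemma un_rho [simp]: "un (\<rho> a) = a"
  unfolding un_def by (rule the_inv_f_f) (simp add: inj_on_def)

lemma rho_un [simp]: "x \<in> carrier R \<Longrightarrow> \<rho> (un x) = x"
  using bij_rho un_rho unfolding bij_betw_def by (metis imageE)

lemma rho_ex: "x \<in> carrier R \<Longrightarrow> \<exists>a. x = \<rho> a"
  using rho_un by metis

lemma rho_zero: "\<rho> 0 = \<zero>"
proof -
  interpret ring R by (rule ring_R)
  have "\<rho> 0 \<oplus> \<rho> 0 = \<rho> 0 \<oplus> \<zero>" by (simp add: rho_add[symmetric])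
  then show ?thesis by (simp del: r_zero)
qed

lemma rho_neg: "\<rho> (- a) = \<ominus> \<rho> a"
proof -
  interpret ring R by (rule ring_R)
  have "\<rho> (- a) \<oplus> \<rho> a = \<zero>" by (simp add: rho_add[symmetric] rho_zero)
  then show ?thesis by (simp add: minus_equality)
qed

lemma rho_diff: "\<rho> (a - b) = \<rho> a \<ominus> \<rho> b"
  using rho_add[of a "- b"] by (simp add: rho_neg a_minus_def)

lemma un_add: "x \<in> carrier R \<Longrightarrow> y \<in> carrier R \<Longrightarrow> un (x \<oplus> y) = un x + un y"
  by (metis rho_add rho_un un_rho)

lemma un_mult: "x \<in> carrier R \<Longrightarrow> y \<in> carrier R \<Longrightarrow> un (x \<otimes> y) = un x * un y"
  by (metis rho_mult rho_un un_rho)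

lemma s_zero [simp]: "s 0 = 0"
  using s_add[of 0 0] by simp

lemma s_neg: "s (- a) = - s a"
  using s_add[of a "- a"] by (simp add: minus_unique)

lemma s_diff: "s (a - b) = s a - s b"
  using s_add[of a "- b"] by (simp add: s_neg)

lemma s_sum: "s (\<Sum>i\<in>A. f i) = (\<Sum>i\<in>A. s (f i))"
  by (induction A rule: infinite_finite_induct) (auto simp: s_add)

lemma s_eps [simp]: "s eps = eps"
  by (simp add: eps_def s_neg)

lemma eps_eps [simp]: "eps * eps = 1" "eps * (eps * a) = a"
  by (simp_all add: eps_def)

lemmas s_simps = s_add s_mult s_neg s_diff s_sum

lemma involution_ring: "involution_ring R \<sigma>"
proof (intro involution_ring.intro involution_ring_axioms.intro ring_R)
  fix a b assume "a \<in> carrier R" "b \<in> carrier R"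
  then obtain a' b' where [simp]: "a = \<rho> a'" "b = \<rho> b'" using rho_ex by blast
  show "\<sigma> (a \<oplus> b) = \<sigma> a \<oplus> \<sigma> b" by (simp add: rho_add[symmetric] sigma_rho s_add)
  show "\<sigma> (a \<otimes> b) = \<sigma> b \<otimes> \<sigma> a" by (simp add: rho_mult[symmetric] sigma_rho s_mult mult.commute)
next
  fix a assume "a \<in> carrier R"
  then obtain a' where [simp]: "a = \<rho> a'" using rho_ex by blast
  show "\<sigma> a \<in> carrier R" "\<sigma> (\<sigma> a) = a" by (simp_all add: sigma_rho)
next
  show "\<sigma> \<one> = \<one>" by (simp add: rho_one[symmetric] sigma_rho)
qed

lemma signed_rho: "signed R k (\<rho> a) = \<rho> (eps * a)"
  by (simp add: signed_def eps_def rho_neg)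

lemma LamI [intro]: "a - eps * s a \<in> Lam"
  by (auto simp: Lam_def)

lemma Lam_zero [simp]: "0 \<in> Lam"
  using LamI[of 0] by simp

lemma Lam_add: "a \<in> Lam \<Longrightarrow> b \<in> Lam \<Longrightarrow> a + b \<in> Lam"
proof -
  assume "a \<in> Lam" "b \<in> Lam"
  then obtain x y where eq: "a = x - eps * s x" "b = y - eps * s y" unfolding Lam_def by blast
  have "a + b = (x + y) - eps * s (x + y)" unfolding eq by (simp add: s_add algebra_simps)
  then show ?thesis using LamI by metis
qed

lemma Lam_neg: "a \<in> Lam \<Longrightarrow> - a \<in> Lam"
proof -
  assume "a \<in> Lam"
  then obtain x where eq: "a = x - eps * s x" unfolding Lam_def by blast
  have "- a = (- x) - eps * s (- x)" unfolding eq by (simp add: s_neg algebra_simps)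
  then show ?thesis using LamI by metis
qed

lemma Lam_diff: "a \<in> Lam \<Longrightarrow> b \<in> Lam \<Longrightarrow> a - b \<in> Lam"
  using Lam_add[OF _ Lam_neg, of a b] by simp

lemma Lam_conj: "u \<in> Lam \<Longrightarrow> a * u * s a \<in> Lam"
proof -
  assume "u \<in> Lam"
  then obtain x where eq: "u = x - eps * s x" unfolding Lam_def by blast
  have "a * u * s a = (a * x * s a) - eps * s (a * x * s a)" unfolding eq by (simp add: s_mult algebra_simps)
  then show ?thesis using LamI by metis
qed

lemma Lam_herm: "u \<in> Lam \<Longrightarrow> u + eps * s u = 0"
  unfolding Lam_def by (clarsimp simp: s_simps right_diff_distrib)

lemma indet: "indeterminacy R \<sigma> k = \<rho> ` Lam"
proof -
  have "a \<ominus> signed R k (\<sigma> a) = \<rho> (un a - eps * s (un a))" if "a \<in> carrier R" for a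
    using that signed_rho[of "s (un a)"] sigma_rho[of "un a"] by (simp add: rho_diff)
  note 1 = this
  show ?thesis
  proof (intro equalityI subsetI)
    fix y assume "y \<in> indeterminacy R \<sigma> k"
    then obtain a where "a \<in> carrier R" "y = a \<ominus> signed R k (\<sigma> a)" unfolding indeterminacy_def by blast
    then show "y \<in> \<rho> ` Lam" using 1 LamI[of "un a"] by simp
  next
    fix y assume "y \<in> \<rho> ` Lam"
    then obtain a where "y = \<rho> (a - eps * s a)" unfolding Lam_def by blast
    then have "y = \<rho> a \<ominus> signed R k (\<sigma> (\<rho> a))" using 1[of "\<rho> a"] by simp
    then show "y \<in> indeterminacy R \<sigma> k" unfolding indeterminacy_def using rho_car by blast
  qed
qed

lemma mem_cs: "x \<in> cs b \<longleftrightarrow> (\<exists>u\<in>Lam. x = \<rho> (b + u))"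
  unfolding cs_def indet a_r_coset_def' by (auto simp: rho_add[symmetric] add.commute)

lemma rho_cs: "\<rho> b \<in> cs b"
  unfolding mem_cs using Lam_zero by force

lemma cs_eq: "cs b = cs c \<longleftrightarrow> b - c \<in> Lam"
proof
  assume "cs b = cs c"
  then have "\<rho> b \<in> cs c" using rho_cs by blast
  then show "b - c \<in> Lam" by (auto simp: mem_cs)
next
  assume a: "b - c \<in> Lam"
  have "x \<in> cs c" if "x \<in> cs b" for x
  proof -
    from that obtain u where "u \<in> Lam" "x = \<rho> (c + ((b - c) + u))" by (auto simp: mem_cs)
    then show ?thesis using a Lam_add unfolding mem_cs by blast
  qed
  moreover have "x \<in> cs b" if "x \<in> cs c" for x
  proof -
    from that obtain u where "u \<in> Lam" "x = \<rho> (b + (- (b - c) + u))" by (auto simp: mem_cs)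
    then show ?thesis using a Lam_add Lam_neg unfolding mem_cs by blast
  qed
  ultimately show "cs b = cs c" by blast
qed

lemma cs_mem_eq: "\<rho> b \<in> cs c \<longleftrightarrow> cs b = cs c"
  by (auto simp: mem_cs cs_eq intro: bexI[of _ "b - c"])

lemma cs_add: "cs b <+> cs c = cs (b + c)"
proof -
  have "\<exists>u\<in>Lam. x = \<rho> (b + c + u)" if "u \<in> Lam" "v \<in> Lam" "x = \<rho> (b + u + (c + v))" for u v x
    using that Lam_add[of u v] by (intro bexI[of _ "u + v"]) (simp_all add: algebra_simps)
  moreover have "\<exists>p\<in>cs b. \<exists>q\<in>cs c. \<rho> (b + c + u) = p \<oplus> q" if "u \<in> Lam" for u
    using that by (intro bexI[of _ "\<rho> b"] bexI[of _ "\<rho> (c + u)"])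
      (auto simp: mem_cs rho_add[symmetric] algebra_simps intro: bexI[of _ 0])
  ultimately show ?thesis
    unfolding set_add_def' set_eq_iff by (auto simp: mem_cs rho_add[symmetric])
qed

lemma cs_zero: "indeterminacy R \<sigma> k = cs 0"
  by (auto simp: indet mem_cs)

lemma cs_cosets: "a_rcosets (indeterminacy R \<sigma> k) = range cs"
proof -
  have "carrier R = range \<rho>" using bij_rho by (simp add: bij_betw_def)
  then show ?thesis
    by (simp only: A_RCOSETS_def' cs_def[abs_def] UNION_singleton_eq_range image_image)
qed

text \<open>The conditions of \<open>nonsingular_form\<close> other than stable freeness, with
  scalars in \<open>'b\<close>. Nonsingularity is split into representability of every functional
  and triviality of the radical, and \<mu> is described through arbitrary representatives of its
  cosets.\<close>

definition qf :: "('a, 'm, 'y) qform_scheme \<Rightarrow> bool" where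
  "qf M \<longleftrightarrow> left_module R M \<and>
    (\<forall>x\<in>carrier M. \<forall>y\<in>carrier M. lam M x y \<in> carrier R) \<and>
    (\<forall>x\<in>carrier M. \<forall>y\<in>carrier M. \<forall>z\<in>carrier M. lm M x (y \<oplus>\<^bsub>M\<^esub> z) = lm M x y + lm M x z) \<and>
    (\<forall>a. \<forall>x\<in>carrier M. \<forall>y\<in>carrier M. lm M x (act M a y) = a * lm M x y) \<and>
    (\<forall>x\<in>carrier M. \<forall>y\<in>carrier M. lm M x y = eps * s (lm M y x)) \<and>
    (\<forall>f. (\<forall>x\<in>carrier M. \<forall>y\<in>carrier M. f (x \<oplus>\<^bsub>M\<^esub> y) = f x + f y) \<longrightarrow>
      (\<forall>a. \<forall>x\<in>carrier M. f (act M a x) = a * f x) \<longrightarrow>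
      (\<exists>x\<in>carrier M. \<forall>y\<in>carrier M. lm M x y = f y)) \<and>
    (\<forall>x\<in>carrier M. (\<forall>y\<in>carrier M. lm M x y = 0) \<longrightarrow> x = \<zero>\<^bsub>M\<^esub>) \<and>
    (\<forall>x\<in>carrier M. \<exists>b. mu M x = cs b) \<and>
    (\<forall>x\<in>carrier M. \<forall>b. mu M x = cs b \<longrightarrow> lm M x x = b + eps * s b) \<and>
    (\<forall>x\<in>carrier M. \<forall>y\<in>carrier M. \<forall>b c. mu M x = cs b \<longrightarrow> mu M y = cs c \<longrightarrow>
      mu M (x \<oplus>\<^bsub>M\<^esub> y) = cs (b + c + lm M x y)) \<and>
    (\<forall>a. \<forall>x\<in>carrier M. \<forall>b. mu M x = cs b \<longrightarrow> mu M (act M a x) = cs (a * b * s a))"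

context
  fixes M :: "('a, 'm, 'y) qform_scheme"
  assumes M: "qf M"
begin

lemmas qf_module = M[unfolded qf_def, THEN conjunct1, rule_format]
lemmas lam_car = M[unfolded qf_def, THEN conjunct2, THEN conjunct1, rule_format]
lemmas lm_add_r = M[unfolded qf_def, THEN conjunct2, THEN conjunct2, THEN conjunct1, rule_format]
lemmas lm_act_r = M[unfolded qf_def, THEN conjunct2, THEN conjunct2, THEN conjunct2, THEN conjunct1, rule_format]
lemmas lm_sym = M[unfolded qf_def, THEN conjunct2, THEN conjunct2, THEN conjunct2, THEN conjunct2, THEN conjunct1, rule_format]
lemmas lm_repr = M[unfolded qf_def, THEN conjunct2, THEN conjunct2, THEN conjunct2, THEN conjunct2, THEN conjunct2, THEN conjunct1, rule_format]
lemmas lm_nondeg = M[unfolded qf_def, THEN conjunct2, THEN conjunct2, THEN conjunct2, THEN conjunct2, THEN conjunct2, THEN conjunct2, THEN conjunct1, rule_format]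
lemmas mu_ex = M[unfolded qf_def, THEN conjunct2, THEN conjunct2, THEN conjunct2, THEN conjunct2, THEN conjunct2, THEN conjunct2, THEN conjunct2, THEN conjunct1, rule_format]
lemmas mu_diag = M[unfolded qf_def, THEN conjunct2, THEN conjunct2, THEN conjunct2, THEN conjunct2, THEN conjunct2, THEN conjunct2, THEN conjunct2, THEN conjunct2, THEN conjunct1, rule_format]
lemmas mu_plus = M[unfolded qf_def, THEN conjunct2, THEN conjunct2, THEN conjunct2, THEN conjunct2, THEN conjunct2, THEN conjunct2, THEN conjunct2, THEN conjunct2, THEN conjunct2, THEN conjunct1, rule_format]
lemmas mu_act = M[unfolded qf_def, THEN conjunct2, THEN conjunct2, THEN conjunct2, THEN conjunct2, THEN conjunct2, THEN conjunct2, THEN conjunct2, THEN conjunct2, THEN conjunct2, THEN conjunct2, rule_format]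

lemma act_car [simp]: "x \<in> carrier M \<Longrightarrow> act M a x \<in> carrier M"
  unfolding act_def by (simp add: left_moduleD(3)[OF qf_module])

lemma add_car: "x \<in> carrier M \<Longrightarrow> y \<in> carrier M \<Longrightarrow> x \<oplus>\<^bsub>M\<^esub> y \<in> carrier M"
  using abelian_monoid.a_closed[OF abelian_group.axioms(1)[OF left_moduleD(2)[OF qf_module]]] .

lemma zero_car: "\<zero>\<^bsub>M\<^esub> \<in> carrier M"
  using abelian_monoid.zero_closed[OF abelian_group.axioms(1)[OF left_moduleD(2)[OF qf_module]]] .

lemma lm_add_l: "x \<in> carrier M \<Longrightarrow> y \<in> carrier M \<Longrightarrow> z \<in> carrier M \<Longrightarrow>
    lm M (x \<oplus>\<^bsub>M\<^esub> y) z = lm M x z + lm M y z"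
  by (simp add: lm_sym[of x z] lm_sym[of y z] lm_sym[of "x \<oplus>\<^bsub>M\<^esub> y" z] lm_add_r s_add distrib_left add_car)

lemma lm_act_l: "x \<in> carrier M \<Longrightarrow> y \<in> carrier M \<Longrightarrow> lm M (act M a x) y = s a * lm M x y"
  by (simp add: lm_sym[of x y] lm_sym[of "act M a x" y] lm_act_r s_mult mult.left_commute)

lemma act_zero: "x \<in> carrier M \<Longrightarrow> act M 0 x = \<zero>\<^bsub>M\<^esub>"
proof -
  assume x: "x \<in> carrier M"
  interpret M: abelian_group M using left_moduleD(2)[OF qf_module] .
  have "act M 0 x \<oplus>\<^bsub>M\<^esub> act M 0 x = act M 0 x \<oplus>\<^bsub>M\<^esub> \<zero>\<^bsub>M\<^esub>"
    using left_moduleD(4)[OF qf_module, of "\<rho> 0" "\<rho> 0" x] x act_car[OF x, of 0]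
    by (simp add: act_def rho_add[symmetric])
  then show ?thesis using act_car[OF x] by (simp del: M.r_zero)
qed

lemma mu_zero: "mu M \<zero>\<^bsub>M\<^esub> = cs 0"
  using mu_ex[OF zero_car] mu_act[OF zero_car, where a = 0] act_zero[OF zero_car] by auto

lemma lm_zero_r: "x \<in> carrier M \<Longrightarrow> lm M x \<zero>\<^bsub>M\<^esub> = 0"
  using lm_act_r[OF _ zero_car, of x 0] act_zero[OF zero_car] by simp

lemma lm_zero_l: "x \<in> carrier M \<Longrightarrow> lm M \<zero>\<^bsub>M\<^esub> x = 0"
  using lm_act_l[OF zero_car, of x 0] act_zero[OF zero_car] by simp

lemma act_add: "x \<in> carrier M \<Longrightarrow> act M (a + b) x = act M a x \<oplus>\<^bsub>M\<^esub> act M b x"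
  by (simp add: act_def rho_add left_moduleD(4)[OF qf_module])

lemma act_act: "x \<in> carrier M \<Longrightarrow> act M a (act M b x) = act M (a * b) x"
  by (simp add: act_def rho_mult left_moduleD(6)[OF qf_module])

lemma act_one: "x \<in> carrier M \<Longrightarrow> act M 1 x = x"
  by (simp add: act_def rho_one left_moduleD(7)[OF qf_module])

text \<open>Nondegeneracy turns equalities between elements into equalities between pairings; this
  is how linear combinations are compared below.\<close>

lemma lm_cancel:
  assumes x: "x \<in> carrier M" and y: "y \<in> carrier M"
    and eq: "\<And>z. z \<in> carrier M \<Longrightarrow> lm M x z = lm M y z"
  shows "x = y"
proof -
  interpret M: abelian_group M using left_moduleD(2)[OF qf_module] .
  have "x \<oplus>\<^bsub>M\<^esub> act M (- 1) y = \<zero>\<^bsub>M\<^esub>"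
  proof (rule lm_nondeg)
    fix z assume "z \<in> carrier M"
    then show "lm M (x \<oplus>\<^bsub>M\<^esub> act M (- 1) y) z = 0"
      using x y by (simp add: lm_add_l lm_act_l eq s_neg)
  qed (use x y in simp)
  moreover have "y \<oplus>\<^bsub>M\<^esub> act M (- 1) y = \<zero>\<^bsub>M\<^esub>"
    using act_add[OF y, of 1 "- 1"] y by (simp add: act_one act_zero)
  ultimately have "x \<oplus>\<^bsub>M\<^esub> act M (- 1) y = y \<oplus>\<^bsub>M\<^esub> act M (- 1) y" by simp
  then show ?thesis using x y by (simp add: M.add.right_cancel)
qed

lemma lm_cancel_r:
  assumes x: "x \<in> carrier M" and y: "y \<in> carrier M"
    and eq: "\<And>z. z \<in> carrier M \<Longrightarrow> lm M z x = lm M z y"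
  shows "x = y"
  by (rule lm_cancel[OF x y]) (simp add: lm_sym[OF x] lm_sym[OF y] eq)

end

lemma qf_form: "qf M \<Longrightarrow> fg_stably_free R M \<Longrightarrow> nonsingular_form k R \<sigma> M"
proof -
  assume M: "qf M" and sf: "fg_stably_free R M"
  have lamlm: "lam M x y = \<rho> (lm M x y)" if "x \<in> carrier M" "y \<in> carrier M" for x y
    using lam_car[OF M that] by (simp add: lm_def)
  have mub: "b \<in> mu M x \<Longrightarrow> x \<in> carrier M \<Longrightarrow> \<exists>c. b = \<rho> c \<and> mu M x = cs c" for b x
    using mu_ex[OF M, of x] by (metis cs_mem_eq mem_cs)
  note c = add_car[OF M] zero_car[OF M]
  show ?thesis
  proof (intro nonsingular_form.intro involution_ring nonsingular_form_axioms.intro sf lam_car[OF M])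
    fix x x' y assume "x \<in> carrier M" "x' \<in> carrier M" "y \<in> carrier M"
    then show "lam M (x \<oplus>\<^bsub>M\<^esub> x') y = lam M x y \<oplus> lam M x' y"
      by (simp add: lamlm c lm_add_l[OF M] rho_add)
  next
    fix x y y' assume "x \<in> carrier M" "y \<in> carrier M" "y' \<in> carrier M"
    then show "lam M x (y \<oplus>\<^bsub>M\<^esub> y') = lam M x y \<oplus> lam M x y'"
      by (simp add: lamlm c lm_add_r[OF M] rho_add)
  next
    fix x y assume "x \<in> carrier M" "y \<in> carrier M"
    then show "lam M x y = signed R k (\<sigma> (lam M y x))"
      by (simp add: lamlm sigma_rho signed_rho lm_sym[OF M, of x y])
  next
    fix r x y assume r: "r \<in> carrier R" and xy: "x \<in> carrier M" "y \<in> carrier M"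
    from rho_ex[OF r] obtain a where a: "r = \<rho> a" ..
    show "lam M x (r \<odot>\<^bsub>M\<^esub> y) = r \<otimes> lam M x y"
      using lm_act_r[OF M xy, of a] act_car[OF M xy(2), of a] xy
      by (simp add: lamlm a rho_mult act_def)
  next
    let ?F = "\<lambda>x. restrict (lam M x) (carrier M)"
    show "bij_betw ?F (carrier M) (linear_maps R M (regular_module R) \<inter> extensional (carrier M))"
    proof (rule bij_betwI')
      fix x y assume x: "x \<in> carrier M" and y: "y \<in> carrier M"
      show "(?F x = ?F y) = (x = y)"
      proof
        assume eq: "?F x = ?F y"
        show "x = y"
          by (rule lm_cancel[OF M x y]) (use fun_cong[OF eq] in \<open>simp add: lm_def restrict_def, metis\<close>)
      qed simp
    next
      fix x assume x: "x \<in> carrier M"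
      show "?F x \<in> linear_maps R M (regular_module R) \<inter> extensional (carrier M)"
      proof (intro IntI restrict_extensional semilinearI)
        fix y assume "y \<in> carrier M"
        then show "?F x y \<in> carrier (regular_module R)" using x by (simp add: regular_module_def lam_car[OF M])
      next
        fix y z assume "y \<in> carrier M" "z \<in> carrier M"
        then show "?F x (y \<oplus>\<^bsub>M\<^esub> z) = ?F x y \<oplus>\<^bsub>regular_module R\<^esub> ?F x z"
          using x by (simp add: regular_module_def c lamlm lm_add_r[OF M] rho_add)
      next
        fix r y assume r: "r \<in> carrier R" and y: "y \<in> carrier M"
        from rho_ex[OF r] obtain a where a: "r = \<rho> a" ..
        show "?F x (r \<odot>\<^bsub>M\<^esub> y) = r \<odot>\<^bsub>regular_module R\<^esub> ?F x y"
          using lm_act_r[OF M x y, of a] act_car[OF M y, of a] x y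
          by (simp add: regular_module_def lamlm a rho_mult act_def)
      qed
    next
      fix f assume f: "f \<in> linear_maps R M (regular_module R) \<inter> extensional (carrier M)"
      then have fl: "f \<in> linear_maps R M (regular_module R)" and fe: "f \<in> extensional (carrier M)" by auto
      note fD = semilinearD[OF fl, unfolded regular_module_def, simplified]
      have "\<exists>x\<in>carrier M. \<forall>y\<in>carrier M. lm M x y = un (f y)"
      proof (rule lm_repr[OF M])
        fix x y assume "x \<in> carrier M" "y \<in> carrier M"
        then show "un (f (x \<oplus>\<^bsub>M\<^esub> y)) = un (f x) + un (f y)" by (simp add: fD un_add)
      next
        fix a x assume "x \<in> carrier M"
        then show "un (f (act M a x)) = a * un (f x)" by (simp add: fD un_mult act_def)
      qed
      then obtain x where x: "x \<in> carrier M" "\<And>y. y \<in> carrier M \<Longrightarrow> lm M x y = un (f y)" by blast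
      have "f = ?F x"
      proof (rule extensionalityI[OF fe restrict_extensional])
        fix y assume "y \<in> carrier M"
        then show "f y = ?F x y" by (simp add: lamlm x fD)
      qed
      then show "\<exists>x\<in>carrier M. f = ?F x" using x by blast
    qed
  next
    fix x assume "x \<in> carrier M"
    then show "mu M x \<in> a_rcosets (indeterminacy R \<sigma> k)" using mu_ex[OF M, of x] by (auto simp: cs_cosets)
  next
    fix x b assume x: "x \<in> carrier M" and b: "b \<in> mu M x"
    from mub[OF b x] obtain c where c: "b = \<rho> c" "mu M x = cs c" by blast
    show "lam M x x = b \<oplus> signed R k (\<sigma> b)"
      using mu_diag[OF M x c(2)] x by (simp add: lamlm c(1) sigma_rho signed_rho rho_add)
  next
    fix x y assume x: "x \<in> carrier M" and y: "y \<in> carrier M"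
    from mu_ex[OF M x] mu_ex[OF M y] obtain b c where b: "mu M x = cs b" and c: "mu M y = cs c" by blast
    show "mu M (x \<oplus>\<^bsub>M\<^esub> y) = mu M x <+> mu M y <+> (indeterminacy R \<sigma> k +> lam M x y)"
      unfolding mu_plus[OF M x y b c] b c lamlm[OF x y] cs_def[symmetric] cs_add ..
  next
    fix r x b assume r: "r \<in> carrier R" and x: "x \<in> carrier M" and b: "b \<in> mu M x"
    from mub[OF b x] obtain c where c: "b = \<rho> c" "mu M x = cs c" by blast
    from rho_ex[OF r] obtain a where a: "r = \<rho> a" ..
    show "mu M (r \<odot>\<^bsub>M\<^esub> x) = indeterminacy R \<sigma> k +> (r \<otimes> b \<otimes> \<sigma> r)"
      using mu_act[OF M x c(2), of a] by (simp add: a c(1) act_def sigma_rho rho_mult cs_def)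
  qed
qed

lemma form_qf: "nonsingular_form k R \<sigma> M \<Longrightarrow> qf M"
proof -
  assume "nonsingular_form k R \<sigma> M"
  then interpret N: nonsingular_form k R \<sigma> M .
  have lmod: "left_module R M" using N.stably_free by (simp add: fg_stably_free_def)
  interpret M: abelian_group M using left_moduleD(2)[OF lmod] .
  have lamlm: "lam M x y = \<rho> (lm M x y)" if "x \<in> carrier M" "y \<in> carrier M" for x y
    using N.lam_closed[OF that] by (simp add: lm_def)
  have ac: "act M a x \<in> carrier M" if "x \<in> carrier M" for a x
    unfolding act_def using left_moduleD(3)[OF lmod] that by simp
  have mx: "\<exists>b. mu M x = cs b" if "x \<in> carrier M" for x
    using N.mu_closed[OF that] by (auto simp: cs_cosets)
  show ?thesis
    unfolding qf_def
  proof (intro conjI ballI allI impI lmod N.lam_closed mx)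
    fix x y z assume "x \<in> carrier M" "y \<in> carrier M" "z \<in> carrier M"
    then show "lm M x (y \<oplus>\<^bsub>M\<^esub> z) = lm M x y + lm M x z"
      by (simp add: lm_def N.lam_add_right un_add N.lam_closed)
  next
    fix a x y assume "x \<in> carrier M" "y \<in> carrier M"
    then show "lm M x (act M a y) = a * lm M x y"
      by (simp add: lm_def act_def N.lam_smult un_mult N.lam_closed)
  next
    fix x y assume xy: "x \<in> carrier M" "y \<in> carrier M"
    have "lam M x y = \<rho> (eps * s (lm M y x))"
      using N.lam_sym[OF xy] by (simp add: lamlm xy sigma_rho signed_rho)
    then show "lm M x y = eps * s (lm M y x)" by (simp add: lm_def)
  next
    fix f assume f: "\<forall>x\<in>carrier M. \<forall>y\<in>carrier M. f (x \<oplus>\<^bsub>M\<^esub> y) = f x + f y"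
      "\<forall>a. \<forall>x\<in>carrier M. f (act M a x) = a * f x"
    let ?f = "restrict (\<lambda>x. \<rho> (f x)) (carrier M)"
    have "?f \<in> linear_maps R M (regular_module R)"
    proof (rule semilinearI)
      fix r x assume r: "r \<in> carrier R" and x: "x \<in> carrier M"
      from rho_ex[OF r] obtain a where a: "r = \<rho> a" ..
      show "?f (r \<odot>\<^bsub>M\<^esub> x) = r \<odot>\<^bsub>regular_module R\<^esub> ?f x"
        using f(2) x ac[OF x, of a] by (simp add: regular_module_def a rho_mult act_def)
    qed (use f in \<open>auto simp: regular_module_def rho_add\<close>)
    then have "?f \<in> (\<lambda>x. restrict (lam M x) (carrier M)) ` carrier M"
      using N.nonsingular by (simp add: bij_betw_def)
    then obtain x where x: "x \<in> carrier M" "?f = restrict (lam M x) (carrier M)" by blast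
    have "lm M x y = f y" if "y \<in> carrier M" for y
      using fun_cong[OF x(2), of y] that by (simp add: lm_def) (metis un_rho)
    then show "\<exists>x\<in>carrier M. \<forall>y\<in>carrier M. lm M x y = f y" using x by blast
  next
    fix x assume x: "x \<in> carrier M" and 0: "\<forall>y\<in>carrier M. lm M x y = 0"
    have "lam M \<zero>\<^bsub>M\<^esub> y = \<rho> 0" if y: "y \<in> carrier M" for y
    proof -
      have "lm M (\<zero>\<^bsub>M\<^esub> \<oplus>\<^bsub>M\<^esub> \<zero>\<^bsub>M\<^esub>) y = lm M \<zero>\<^bsub>M\<^esub> y + lm M \<zero>\<^bsub>M\<^esub> y"
        using N.lam_add_left[of "\<zero>\<^bsub>M\<^esub>" "\<zero>\<^bsub>M\<^esub>" y] y
        by (simp add: lm_def un_add N.lam_closed del: M.l_zero M.r_zero)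
      then show ?thesis using lamlm[of "\<zero>\<^bsub>M\<^esub>" y] y by simp
    qed
    then have "restrict (lam M x) (carrier M) = restrict (lam M \<zero>\<^bsub>M\<^esub>) (carrier M)"
      using 0 x by (intro restrict_ext) (simp add: lamlm)
    then show "x = \<zero>\<^bsub>M\<^esub>" using N.nonsingular x by (auto simp: bij_betw_def inj_on_def)
  next
    fix x b assume x: "x \<in> carrier M" and b: "mu M x = cs b"
    have "lam M x x = \<rho> (b + eps * s b)"
      using N.mu_lam[OF x, of "\<rho> b"] b rho_cs by (simp add: sigma_rho signed_rho rho_add)
    then show "lm M x x = b + eps * s b" by (simp add: lm_def)
  next
    fix x y b c assume xy: "x \<in> carrier M" "y \<in> carrier M" and b: "mu M x = cs b" and c: "mu M y = cs c"
    show "mu M (x \<oplus>\<^bsub>M\<^esub> y) = cs (b + c + lm M x y)"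
      unfolding N.mu_add[OF xy] b c lamlm[OF xy] cs_def[symmetric] cs_add ..
  next
    fix a x b assume x: "x \<in> carrier M" and b: "mu M x = cs b"
    show "mu M (act M a x) = cs (a * b * s a)"
      using N.mu_smult[OF rho_car[of a] x, of "\<rho> b"] rho_cs[of b] b
      by (simp add: act_def sigma_rho rho_mult cs_def)
  qed
qed

end

text \<open>The Kronecker delta: \<open>dl\<close> is the identity matrix and \<open>dl i\<close>
  the i-th standard basis vector.\<close>

definition dl :: "nat \<Rightarrow> nat \<Rightarrow> 'b::comm_ring_1" where "dl i j = (if i = j then 1 else 0)"

lemma sum_dl [simp]:
  "j < n \<Longrightarrow> (\<Sum>k<n. f k * dl k j) = f j" "j < n \<Longrightarrow> (\<Sum>k<n. f k * dl j k) = f j"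
  "j < n \<Longrightarrow> (\<Sum>k<n. dl k j * f k) = f j" "j < n \<Longrightarrow> (\<Sum>k<n. dl j k * f k) = f j"
  by (simp_all add: dl_def if_distrib if_distribR cong: if_cong)

lemma sum_lessThan_add: "(\<Sum>i<n + m. f i) = (\<Sum>i<n. f i) + (\<Sum>i<m. f (n + i) :: 'c::comm_monoid_add)" for n m :: nat
  by (induction m) (auto simp: add.assoc)

lemma sum_lessThan_double: "(\<Sum>i<2 * m. f i) = (\<Sum>i<m. f (2 * i) + f (Suc (2 * i)) :: 'c::comm_monoid_add)"
  by (induction m) (auto simp: add.assoc)

context fmodel
begin

subsection \<open>Isometries and orthogonal sums\<close>

text \<open>Injectivity comes from nondegeneracy: elements with the same image have the same
  pairings with everything in \<open>M\<close>.\<close>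

lemma isoI:
  assumes M: "qf M" and N: "qf N" and h: "\<And>x. x \<in> carrier M \<Longrightarrow> h x \<in> carrier N"
    and add: "\<And>x y. x \<in> carrier M \<Longrightarrow> y \<in> carrier M \<Longrightarrow> h (x \<oplus>\<^bsub>M\<^esub> y) = h x \<oplus>\<^bsub>N\<^esub> h y"
    and act: "\<And>a x. x \<in> carrier M \<Longrightarrow> h (act M a x) = act N a (h x)"
    and onto: "\<And>y. y \<in> carrier N \<Longrightarrow> \<exists>x\<in>carrier M. y = h x"
    and lm: "\<And>x y. x \<in> carrier M \<Longrightarrow> y \<in> carrier M \<Longrightarrow> lm N (h x) (h y) = lm M x y"
    and mu: "\<And>x. x \<in> carrier M \<Longrightarrow> mu N (h x) = mu M x"
  shows "isometric R M N"
  unfolding isometric_def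
proof (intro bexI conjI ballI)
  show "h \<in> linear_maps R M N"
  proof (rule semilinearI)
    fix r x assume r: "r \<in> carrier R" and x: "x \<in> carrier M"
    from rho_ex[OF r] obtain a where "r = \<rho> a" ..
    then show "h (r \<odot>\<^bsub>M\<^esub> x) = r \<odot>\<^bsub>N\<^esub> h x" using act[OF x, of a] by (simp add: act_def)
  qed (use h add in auto)
  show "bij_betw h (carrier M) (carrier N)"
    unfolding bij_betw_def
  proof (intro conjI inj_onI equalityI subsetI)
    fix x y assume x: "x \<in> carrier M" and y: "y \<in> carrier M" and eq: "h x = h y"
    show "x = y"
    proof (rule lm_cancel[OF M x y])
      fix z assume z: "z \<in> carrier M"
      show "lm M x z = lm M y z" using lm[OF x z] lm[OF y z] eq by simp
    qed
  next
    fix y assume "y \<in> carrier N" then show "y \<in> h ` carrier M" using onto by blast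
  qed (use h in auto)
next
  fix x y assume xy: "x \<in> carrier M" "y \<in> carrier M"
  have "\<rho> (lm N (h x) (h y)) = \<rho> (lm M x y)" using lm[OF xy] by simp
  then show "lam N (h x) (h y) = lam M x y"
    using xy by (simp add: lm_def lam_car[OF M] lam_car[OF N] h del: rho_inj)
qed (rule mu)

lemma isoD:
  assumes "isometric R M N"
  obtains h where "h \<in> linear_maps R M N" "bij_betw h (carrier M) (carrier N)"
    "\<And>x. x \<in> carrier M \<Longrightarrow> h x \<in> carrier N"
    "\<And>x y. x \<in> carrier M \<Longrightarrow> y \<in> carrier M \<Longrightarrow> h (x \<oplus>\<^bsub>M\<^esub> y) = h x \<oplus>\<^bsub>N\<^esub> h y"
    "\<And>a x. x \<in> carrier M \<Longrightarrow> h (act M a x) = act N a (h x)"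
    "\<And>y. y \<in> carrier N \<Longrightarrow> \<exists>x\<in>carrier M. y = h x"
    "\<And>x y. x \<in> carrier M \<Longrightarrow> y \<in> carrier M \<Longrightarrow> lm N (h x) (h y) = lm M x y"
    "\<And>x. x \<in> carrier M \<Longrightarrow> mu N (h x) = mu M x"
proof -
  obtain h where h: "h \<in> linear_maps R M N" and bij: "bij_betw h (carrier M) (carrier N)"
    and lam: "\<forall>x\<in>carrier M. \<forall>y\<in>carrier M. lam N (h x) (h y) = lam M x y"
    and mu: "\<forall>x\<in>carrier M. mu N (h x) = mu M x"
    using assms unfolding isometric_def by blast
  show ?thesis
  proof (rule that[OF h bij semilinearD(1)[OF h] semilinearD(2)[OF h]])
    fix a x assume "x \<in> carrier M"
    then show "h (act M a x) = act N a (h x)" by (simp add: act_def semilinearD(3)[OF h])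
  next
    fix y assume "y \<in> carrier N"
    then show "\<exists>x\<in>carrier M. y = h x" using bij unfolding bij_betw_def by blast
  qed (use lam mu in \<open>auto simp: lm_def\<close>)
qed

lemma iso_refl: "isometric R M M"
  unfolding isometric_def by (intro bexI[of _ "\<lambda>x. x"] conjI) (auto intro: semilinearI simp: bij_betw_def)

lemma iso_sym:
  assumes M: "qf M" and iso: "isometric R M N"
  shows "isometric R N M"
proof -
  obtain h where h: "h \<in> linear_maps R M N" and bij: "bij_betw h (carrier M) (carrier N)"
    and lam: "\<forall>x\<in>carrier M. \<forall>y\<in>carrier M. lam N (h x) (h y) = lam M x y"
    and mu: "\<forall>x\<in>carrier M. mu N (h x) = mu M x"
    using iso unfolding isometric_def by blast
  let ?g = "inv_into (carrier M) h"
  note g = linear_inverse[OF qf_module[OF M] h bij]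
  have "?g y \<in> carrier M" "h (?g y) = y" if "y \<in> carrier N" for y
    using g(2) bij that by (auto simp: bij_betw_def f_inv_into_f)
  then show ?thesis
    unfolding isometric_def using g lam mu by (intro bexI[OF _ g(1)] conjI g(2)) metis+
qed

lemma iso_trans:
  assumes "isometric R M N" "isometric R N P"
  shows "isometric R M P"
proof -
  obtain h where h: "h \<in> linear_maps R M N" and bij: "bij_betw h (carrier M) (carrier N)"
    and lam: "\<forall>x\<in>carrier M. \<forall>y\<in>carrier M. lam N (h x) (h y) = lam M x y"
    and mu: "\<forall>x\<in>carrier M. mu N (h x) = mu M x"
    using assms(1) unfolding isometric_def by blast
  obtain g where g: "g \<in> linear_maps R N P" and bij': "bij_betw g (carrier N) (carrier P)"
    and lam': "\<forall>x\<in>carrier N. \<forall>y\<in>carrier N. lam P (g x) (g y) = lam N x y"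
    and mu': "\<forall>x\<in>carrier N. mu P (g x) = mu N x"
    using assms(2) unfolding isometric_def by blast
  show ?thesis
    unfolding isometric_def
    by (intro bexI[OF _ linear_comp[OF h g]] conjI bij_betw_trans[OF bij bij'])
      (use lam mu lam' mu' semilinearD(1)[OF h] in auto)
qed

lemma os_simps [simp]:
  "carrier (orthogonal_sum R M N) = carrier M \<times> carrier N"
  "zero (orthogonal_sum R M N) = (\<zero>\<^bsub>M\<^esub>, \<zero>\<^bsub>N\<^esub>)"
  "x \<oplus>\<^bsub>orthogonal_sum R M N\<^esub> y = (fst x \<oplus>\<^bsub>M\<^esub> fst y, snd x \<oplus>\<^bsub>N\<^esub> snd y)"
  "r \<odot>\<^bsub>orthogonal_sum R M N\<^esub> x = (r \<odot>\<^bsub>M\<^esub> fst x, r \<odot>\<^bsub>N\<^esub> snd x)"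
  "act (orthogonal_sum R M N) a x = (act M a (fst x), act N a (snd x))"
  "lam (orthogonal_sum R M N) x y = lam M (fst x) (fst y) \<oplus> lam N (snd x) (snd y)"
  "mu (orthogonal_sum R M N) x = mu M (fst x) <+> mu N (snd x)"
  by (simp_all add: orthogonal_sum_def direct_sum_def module.defs qform.defs act_def)

lemma ds_simps [simp]:
  "carrier (direct_sum M N) = carrier M \<times> carrier N"
  "zero (direct_sum M N) = (\<zero>\<^bsub>M\<^esub>, \<zero>\<^bsub>N\<^esub>)"
  "x \<oplus>\<^bsub>direct_sum M N\<^esub> y = (fst x \<oplus>\<^bsub>M\<^esub> fst y, snd x \<oplus>\<^bsub>N\<^esub> snd y)"
  "r \<odot>\<^bsub>direct_sum M N\<^esub> x = (r \<odot>\<^bsub>M\<^esub> fst x, r \<odot>\<^bsub>N\<^esub> snd x)"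
  "act (direct_sum M N) a x = (act M a (fst x), act N a (snd x))"
  by (simp_all add: direct_sum_def act_def)

lemma ds_module:
  assumes "left_module R M" "left_module R N"
  shows "left_module R (direct_sum M N)"
proof -
  interpret M: abelian_group M using left_moduleD(2)[OF assms(1)] .
  interpret N: abelian_group N using left_moduleD(2)[OF assms(2)] .
  have "abelian_group (direct_sum M N)"
  proof (rule abelian_groupI)
    fix x assume "x \<in> carrier (direct_sum M N)"
    then show "\<exists>y\<in>carrier (direct_sum M N). y \<oplus>\<^bsub>direct_sum M N\<^esub> x = \<zero>\<^bsub>direct_sum M N\<^esub>"
      by (intro bexI[of _ "(\<ominus>\<^bsub>M\<^esub> fst x, \<ominus>\<^bsub>N\<^esub> snd x)"]) (auto simp: M.l_neg N.l_neg)
  qed (auto simp: M.a_ac N.a_ac)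
  then show ?thesis
    unfolding left_module_def left_module_axioms_def
    using ring_R by (auto simp: left_moduleD[OF assms(1)] left_moduleD[OF assms(2)])
qed

lemma os_module:
  assumes "left_module R M" "left_module R N"
  shows "left_module R (orthogonal_sum R M N)"
  by (rule image_left_module[OF ds_module[OF assms], where h = "\<lambda>x. x"]) (auto intro!: semilinearI)

lemma lm_os: "qf M \<Longrightarrow> qf N \<Longrightarrow> fst x \<in> carrier M \<Longrightarrow> snd x \<in> carrier N \<Longrightarrow>
    fst y \<in> carrier M \<Longrightarrow> snd y \<in> carrier N \<Longrightarrow>
    lm (orthogonal_sum R M N) x y = lm M (fst x) (fst y) + lm N (snd x) (snd y)"
  by (simp add: lm_def un_add lam_car)

lemma mu_os: "mu M (fst x) = cs b \<Longrightarrow> mu N (snd x) = cs c \<Longrightarrow> mu (orthogonal_sum R M N) x = cs (b + c)"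
  by (simp add: cs_add)

lemma mu_os_ex:
  assumes "qf M" "qf N" "fst x \<in> carrier M" "snd x \<in> carrier N"
  obtains b c where "mu M (fst x) = cs b" "mu N (snd x) = cs c" "mu (orthogonal_sum R M N) x = cs (b + c)"
  using mu_ex[OF assms(1,3)] mu_ex[OF assms(2,4)] mu_os by blast

lemma qf_os:
  assumes M: "qf M" and N: "qf N"
  shows "qf (orthogonal_sum R M N)" (is "qf ?S")
proof -
  note cM = add_car[OF M] zero_car[OF M] act_car[OF M] lam_car[OF M]
  note cN = add_car[OF N] zero_car[OF N] act_car[OF N] lam_car[OF N]
  interpret R: ring R by (rule ring_R)
  interpret MM: abelian_group M using left_moduleD(2)[OF qf_module[OF M]] .
  interpret NN: abelian_group N using left_moduleD(2)[OF qf_module[OF N]] .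
  note lS = lm_os[OF M N]
  show ?thesis
    unfolding qf_def
  proof (intro conjI ballI allI impI os_module qf_module[OF M] qf_module[OF N])
    fix x y assume "x \<in> carrier ?S" "y \<in> carrier ?S"
    then show "lam ?S x y \<in> carrier R" by (auto simp: cM cN)
  next
    fix x y z assume "x \<in> carrier ?S" "y \<in> carrier ?S" "z \<in> carrier ?S"
    then show "lm ?S x (y \<oplus>\<^bsub>?S\<^esub> z) = lm ?S x y + lm ?S x z"
      by (auto simp: lS cM cN lm_add_r[OF M] lm_add_r[OF N] simp del: os_simps(6))
  next
    fix a x y assume "x \<in> carrier ?S" "y \<in> carrier ?S"
    then show "lm ?S x (act ?S a y) = a * lm ?S x y"
      by (auto simp: lS cM cN lm_act_r[OF M] lm_act_r[OF N] algebra_simps)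
  next
    fix x y assume "x \<in> carrier ?S" "y \<in> carrier ?S"
    then show "lm ?S x y = eps * s (lm ?S y x)"
      using lm_sym[OF M, of "fst x" "fst y"] lm_sym[OF N, of "snd x" "snd y"]
      by (auto simp: lS s_add distrib_left)
  next
    fix f assume f: "\<forall>x\<in>carrier ?S. \<forall>y\<in>carrier ?S. f (x \<oplus>\<^bsub>?S\<^esub> y) = f x + f y"
      "\<forall>a. \<forall>x\<in>carrier ?S. f (act ?S a x) = a * f x"
    have "\<exists>x\<in>carrier M. \<forall>y\<in>carrier M. lm M x y = f (y, \<zero>\<^bsub>N\<^esub>)"
    proof (rule lm_repr[OF M])
      fix x y assume "x \<in> carrier M" "y \<in> carrier M"
      then show "f (x \<oplus>\<^bsub>M\<^esub> y, \<zero>\<^bsub>N\<^esub>) = f (x, \<zero>\<^bsub>N\<^esub>) + f (y, \<zero>\<^bsub>N\<^esub>)"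
        using f(1)[rule_format, of "(x, \<zero>\<^bsub>N\<^esub>)" "(y, \<zero>\<^bsub>N\<^esub>)"] by simp
    next
      fix a x assume x: "x \<in> carrier M"
      have "act N a \<zero>\<^bsub>N\<^esub> = \<zero>\<^bsub>N\<^esub>"
        using act_act[OF N, of "\<zero>\<^bsub>N\<^esub>" a 0] act_zero[OF N, of "\<zero>\<^bsub>N\<^esub>"] by simp
      then show "f (act M a x, \<zero>\<^bsub>N\<^esub>) = a * f (x, \<zero>\<^bsub>N\<^esub>)"
        using f(2)[rule_format, of "(x, \<zero>\<^bsub>N\<^esub>)" a] x by simp
    qed
    then obtain u where u: "u \<in> carrier M" "\<And>y. y \<in> carrier M \<Longrightarrow> lm M u y = f (y, \<zero>\<^bsub>N\<^esub>)" by blast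
    have "\<exists>x\<in>carrier N. \<forall>y\<in>carrier N. lm N x y = f (\<zero>\<^bsub>M\<^esub>, y)"
    proof (rule lm_repr[OF N])
      fix x y assume "x \<in> carrier N" "y \<in> carrier N"
      then show "f (\<zero>\<^bsub>M\<^esub>, x \<oplus>\<^bsub>N\<^esub> y) = f (\<zero>\<^bsub>M\<^esub>, x) + f (\<zero>\<^bsub>M\<^esub>, y)"
        using f(1)[rule_format, of "(\<zero>\<^bsub>M\<^esub>, x)" "(\<zero>\<^bsub>M\<^esub>, y)"] by simp
    next
      fix a x assume x: "x \<in> carrier N"
      have "act M a \<zero>\<^bsub>M\<^esub> = \<zero>\<^bsub>M\<^esub>"
        using act_act[OF M, of "\<zero>\<^bsub>M\<^esub>" a 0] act_zero[OF M, of "\<zero>\<^bsub>M\<^esub>"] by simp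
      then show "f (\<zero>\<^bsub>M\<^esub>, act N a x) = a * f (\<zero>\<^bsub>M\<^esub>, x)"
        using f(2)[rule_format, of "(\<zero>\<^bsub>M\<^esub>, x)" a] x by simp
    qed
    then obtain v where v: "v \<in> carrier N" "\<And>y. y \<in> carrier N \<Longrightarrow> lm N v y = f (\<zero>\<^bsub>M\<^esub>, y)" by blast
    have "lm ?S (u, v) y = f y" if "y \<in> carrier ?S" for y
      using f(1)[rule_format, of "(fst y, \<zero>\<^bsub>N\<^esub>)" "(\<zero>\<^bsub>M\<^esub>, snd y)"] that u v by (auto simp: lS)
    then show "\<exists>x\<in>carrier ?S. \<forall>y\<in>carrier ?S. lm ?S x y = f y" using u v by (intro bexI[of _ "(u, v)"]) auto
  next
    fix x assume x: "x \<in> carrier ?S" and 0: "\<forall>y\<in>carrier ?S. lm ?S x y = 0"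
    have "fst x = \<zero>\<^bsub>M\<^esub>"
    proof (rule lm_nondeg[OF M])
      fix y assume "y \<in> carrier M"
      then show "lm M (fst x) y = 0" using 0[rule_format, of "(y, \<zero>\<^bsub>N\<^esub>)"] x by (auto simp: lS lm_zero_r[OF N])
    qed (use x in auto)
    moreover have "snd x = \<zero>\<^bsub>N\<^esub>"
    proof (rule lm_nondeg[OF N])
      fix y assume "y \<in> carrier N"
      then show "lm N (snd x) y = 0" using 0[rule_format, of "(\<zero>\<^bsub>M\<^esub>, y)"] x by (auto simp: lS lm_zero_r[OF M])
    qed (use x in auto)
    ultimately show "x = \<zero>\<^bsub>?S\<^esub>" by (simp add: prod_eq_iff)
  next
    fix x assume "x \<in> carrier ?S"
    then have fx: "fst x \<in> carrier M" "snd x \<in> carrier N" by auto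
    show "\<exists>b. mu ?S x = cs b" by (rule mu_os_ex[OF M N fx]) blast
  next
    fix x b assume x: "x \<in> carrier ?S" and b: "mu ?S x = cs b"
    then have fx: "fst x \<in> carrier M" "snd x \<in> carrier N" by auto
    obtain c d where cd: "mu M (fst x) = cs c" "mu N (snd x) = cs d" "mu ?S x = cs (c + d)"
      by (rule mu_os_ex[OF M N fx])
    have "b - (c + d) \<in> Lam" using b cd(3) cs_eq by metis
    then have "b - (c + d) + eps * s (b - (c + d)) = 0" by (rule Lam_herm)
    then have "b + eps * s b = (c + d) + eps * s (c + d)" by (simp add: s_simps algebra_simps)
    then show "lm ?S x x = b + eps * s b"
      using x mu_diag[OF M _ cd(1)] mu_diag[OF N _ cd(2)] by (auto simp: lS s_add algebra_simps)
  next
    fix x y b c assume x: "x \<in> carrier ?S" and y: "y \<in> carrier ?S" and b: "mu ?S x = cs b" and c: "mu ?S y = cs c"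
    then have fx: "fst x \<in> carrier M" "snd x \<in> carrier N" by auto
    obtain p q where p: "mu M (fst x) = cs p" "mu N (snd x) = cs q" "mu ?S x = cs (p + q)"
      by (rule mu_os_ex[OF M N fx])
    have fy: "fst y \<in> carrier M" "snd y \<in> carrier N" using y by auto
    obtain p' q' where p': "mu M (fst y) = cs p'" "mu N (snd y) = cs q'" "mu ?S y = cs (p' + q')"
      by (rule mu_os_ex[OF M N fy])
    have "mu ?S (x \<oplus>\<^bsub>?S\<^esub> y) = cs (p + p' + lm M (fst x) (fst y) + (q + q' + lm N (snd x) (snd y)))"
      using mu_plus[OF M fx(1) fy(1) p(1) p'(1)] mu_plus[OF N fx(2) fy(2) p(2) p'(2)]
      by (intro mu_os) simp_all
    moreover have "lm ?S x y = lm M (fst x) (fst y) + lm N (snd x) (snd y)" using x y by (auto simp: lS)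
    moreover have "b - (p + q) \<in> Lam" "c - (p' + q') \<in> Lam" using b c p(3) p'(3) cs_eq by metis+
    then have "- (b - (p + q)) - (c - (p' + q')) \<in> Lam" using Lam_diff Lam_neg by blast
    ultimately show "mu ?S (x \<oplus>\<^bsub>?S\<^esub> y) = cs (b + c + lm ?S x y)"
      by (simp only: cs_eq) (simp add: algebra_simps)
  next
    fix a x b assume x: "x \<in> carrier ?S" and b: "mu ?S x = cs b"
    then have fx: "fst x \<in> carrier M" "snd x \<in> carrier N" by auto
    obtain p q where p: "mu M (fst x) = cs p" "mu N (snd x) = cs q" "mu ?S x = cs (p + q)"
      by (rule mu_os_ex[OF M N fx])
    have "mu ?S (act ?S a x) = cs (a * p * s a + a * q * s a)"
      using mu_act[OF M fx(1) p(1), of a] mu_act[OF N fx(2) p(2), of a] by (intro mu_os) simp_all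
    moreover have "a * (p + q - b) * s a \<in> Lam"
      using b p(3) Lam_conj cs_eq by metis
    ultimately show "mu ?S (act ?S a x) = cs (a * b * s a)"
      by (simp only: cs_eq) (simp add: algebra_simps)
  qed
qed

lemma os_comm:
  assumes M: "qf M" and N: "qf N"
  shows "isometric R (orthogonal_sum R M N) (orthogonal_sum R N M)"
proof (rule isoI[where h = "\<lambda>x. (snd x, fst x)", OF qf_os[OF M N] qf_os[OF N M]])
  fix x y assume x: "x \<in> carrier (orthogonal_sum R M N)" and y: "y \<in> carrier (orthogonal_sum R M N)"
  then show "lm (orthogonal_sum R N M) (snd x, fst x) (snd y, fst y) = lm (orthogonal_sum R M N) x y"
    by (auto simp: lm_os[OF M N] lm_os[OF N M])
next
  fix x assume "x \<in> carrier (orthogonal_sum R M N)"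
  then have fx: "fst x \<in> carrier M" "snd x \<in> carrier N" by auto
  obtain b c where "mu M (fst x) = cs b" "mu N (snd x) = cs c"
    by (rule mu_os_ex[OF M N fx])
  then show "mu (orthogonal_sum R N M) (snd x, fst x) = mu (orthogonal_sum R M N) x"
    by (simp add: cs_add add.commute)
qed auto

lemma os_assoc:
  assumes M: "qf M" and N: "qf N" and P: "qf P"
  shows "isometric R (orthogonal_sum R (orthogonal_sum R M N) P) (orthogonal_sum R M (orthogonal_sum R N P))"
    (is "isometric R ?A ?B")
proof (rule isoI[where h = "\<lambda>x. (fst (fst x), snd (fst x), snd x)"])
  show A: "qf ?A" and B: "qf ?B" by (simp_all add: qf_os M N P)
  fix x y assume x: "x \<in> carrier ?A" and y: "y \<in> carrier ?A"
  then show "lm ?B (fst (fst x), snd (fst x), snd x) (fst (fst y), snd (fst y), snd y) = lm ?A x y"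
    by (auto simp: lm_os M N P qf_os simp del: os_simps(6))
next
  fix x assume "x \<in> carrier ?A"
  then have "fst (fst x) \<in> carrier M" "snd (fst x) \<in> carrier N" "snd x \<in> carrier P" by auto
  then obtain b c d where "mu M (fst (fst x)) = cs b" "mu N (snd (fst x)) = cs c" "mu P (snd x) = cs d"
    using mu_ex[OF M] mu_ex[OF N] mu_ex[OF P] by meson
  then show "mu ?B (fst (fst x), snd (fst x), snd x) = mu ?A x"
    by (simp add: cs_add add.assoc)
next
  fix y assume "y \<in> carrier ?B"
  then show "\<exists>x\<in>carrier ?A. y = (fst (fst x), snd (fst x), snd x)"
    by (intro bexI[of _ "((fst y, fst (snd y)), snd (snd y))"]) auto
qed auto

lemma os_cong:
  assumes M: "qf M" and N: "qf N" and M': "qf M'" and N': "qf N'"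
    and iM: "isometric R M M'" and iN: "isometric R N N'"
  shows "isometric R (orthogonal_sum R M N) (orthogonal_sum R M' N')"
proof -
  obtain h where h: "\<And>x. x \<in> carrier M \<Longrightarrow> h x \<in> carrier M'"
    "\<And>x y. x \<in> carrier M \<Longrightarrow> y \<in> carrier M \<Longrightarrow> h (x \<oplus>\<^bsub>M\<^esub> y) = h x \<oplus>\<^bsub>M'\<^esub> h y"
    "\<And>a x. x \<in> carrier M \<Longrightarrow> h (act M a x) = act M' a (h x)"
    "\<And>y. y \<in> carrier M' \<Longrightarrow> \<exists>x\<in>carrier M. y = h x"
    "\<And>x y. x \<in> carrier M \<Longrightarrow> y \<in> carrier M \<Longrightarrow> lm M' (h x) (h y) = lm M x y"
    "\<And>x. x \<in> carrier M \<Longrightarrow> mu M' (h x) = mu M x"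
    using iM by (rule isoD) blast
  obtain g where g: "\<And>x. x \<in> carrier N \<Longrightarrow> g x \<in> carrier N'"
    "\<And>x y. x \<in> carrier N \<Longrightarrow> y \<in> carrier N \<Longrightarrow> g (x \<oplus>\<^bsub>N\<^esub> y) = g x \<oplus>\<^bsub>N'\<^esub> g y"
    "\<And>a x. x \<in> carrier N \<Longrightarrow> g (act N a x) = act N' a (g x)"
    "\<And>y. y \<in> carrier N' \<Longrightarrow> \<exists>x\<in>carrier N. y = g x"
    "\<And>x y. x \<in> carrier N \<Longrightarrow> y \<in> carrier N \<Longrightarrow> lm N' (g x) (g y) = lm N x y"
    "\<And>x. x \<in> carrier N \<Longrightarrow> mu N' (g x) = mu N x"
    using iN by (rule isoD) blast
  show ?thesis
  proof (rule isoI[where h = "map_prod h g", OF qf_os[OF M N] qf_os[OF M' N']])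
    fix y assume "y \<in> carrier (orthogonal_sum R M' N')"
    then have "fst y \<in> carrier M'" "snd y \<in> carrier N'" by auto
    then obtain u v where "u \<in> carrier M" "v \<in> carrier N" "fst y = h u" "snd y = g v" using h(4) g(4) by meson
    then show "\<exists>x\<in>carrier (orthogonal_sum R M N). y = map_prod h g x"
      by (intro bexI[of _ "(u, v)"]) (auto simp: prod_eq_iff)
  qed (auto simp: h g lm_os M N M' N' simp del: os_simps(6))
qed

end

lemma sum_mult_assoc:
  "(\<Sum>k\<in>B. (\<Sum>i\<in>A. a i * g i k) * h k) = (\<Sum>i\<in>A. a i * (\<Sum>k\<in>B. g i k * h k :: 'b::comm_ring_1))"
  unfolding sum_distrib_left sum_distrib_right mult.assoc by (rule sum.swap)

context fmodel
begin

subsection \<open>Forms on free modules\<close>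

definition bl :: "nat \<Rightarrow> (nat \<Rightarrow> nat \<Rightarrow> 'b) \<Rightarrow> (nat \<Rightarrow> 'b) \<Rightarrow> (nat \<Rightarrow> 'b) \<Rightarrow> 'b" where
  "bl n A v w = (\<Sum>i<n. \<Sum>j<n. s (v i) * A i j * w j)"

text \<open>A matrix \<open>A\<close> describes a quadratic form on a free module:
  \<open>hm A\<close> is the matrix of \<lambda> and \<open>bl n A v v\<close> represents \<mu>(v).
  The matrix \<open>A\<close> is thus a refinement of its symmetrization, and \<open>hm A\<close>
  alone does not determine \<mu>.\<close>

definition hm :: "(nat \<Rightarrow> nat \<Rightarrow> 'b) \<Rightarrow> nat \<Rightarrow> nat \<Rightarrow> 'b" where
  "hm A i j = A i j + eps * s (A j i)"

definition nonsing :: "nat \<Rightarrow> (nat \<Rightarrow> nat \<Rightarrow> 'b) \<Rightarrow> bool" where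
  "nonsing n A \<longleftrightarrow> (\<exists>g. \<forall>i<n. \<forall>j<n.
     (\<Sum>k<n. g i k * hm A k j) = dl i j \<and> (\<Sum>k<n. hm A i k * g k j) = dl i j)"

definition vec :: "nat \<Rightarrow> (nat \<Rightarrow> 'b) \<Rightarrow> nat \<Rightarrow> 'a" where
  "vec n v = (\<lambda>i. if i < n then \<rho> (v i) else \<zero>)"

definition fm :: "nat \<Rightarrow> (nat \<Rightarrow> nat \<Rightarrow> 'b) \<Rightarrow> ('a, nat \<Rightarrow> 'a) qform" where
  "fm n A = module.extend (free_module R n) (qform.fields
     (\<lambda>x y. \<rho> (bl n A (un \<circ> x) (un \<circ> y) + eps * s (bl n A (un \<circ> y) (un \<circ> x))))
     (\<lambda>x. cs (bl n A (un \<circ> x) (un \<circ> x))))"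

primrec lc :: "('a, 'm, 'y) module_scheme \<Rightarrow> (nat \<Rightarrow> 'm) \<Rightarrow> (nat \<Rightarrow> 'b) \<Rightarrow> nat \<Rightarrow> 'm" where
  "lc M b v 0 = \<zero>\<^bsub>M\<^esub>"
| "lc M b v (Suc n) = lc M b v n \<oplus>\<^bsub>M\<^esub> act M (v n) (b n)"

lemma hm_sym: "hm A i j = eps * s (hm A j i)"
  by (simp add: hm_def s_add s_mult distrib_left add.commute)

lemma bl_cong: "(\<And>i. i < n \<Longrightarrow> v i = v' i) \<Longrightarrow> (\<And>i. i < n \<Longrightarrow> w i = w' i) \<Longrightarrow>
    (\<And>i j. i < n \<Longrightarrow> j < n \<Longrightarrow> A i j = A' i j) \<Longrightarrow> bl n A v w = bl n A' v' w'"
  unfolding bl_def by (intro sum.cong) auto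

lemma bl_left: "bl n A v w = (\<Sum>j<n. (\<Sum>i<n. s (v i) * A i j) * w j)"
  unfolding bl_def sum_distrib_right by (rule sum.swap)

lemma bl_right: "bl n A v w = (\<Sum>i<n. s (v i) * (\<Sum>j<n. A i j * w j))"
  unfolding bl_def sum_distrib_left by (simp add: mult.assoc)

lemma bl_hm: "bl n (hm A) v w = bl n A v w + eps * s (bl n A w v)"
proof -
  have "eps * s (bl n A w v) = (\<Sum>j<n. \<Sum>i<n. s (v i) * (eps * s (A j i)) * w j)"
    unfolding bl_def by (simp add: s_sum s_mult sum_distrib_left ac_simps)
  also have "\<dots> = (\<Sum>i<n. \<Sum>j<n. s (v i) * (eps * s (A j i)) * w j)" by (rule sum.swap)
  finally show ?thesis by (simp add: bl_def hm_def sum.distrib algebra_simps)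
qed

lemma bl_add_l: "bl n A (\<lambda>i. v i + v' i) w = bl n A v w + bl n A v' w"
  by (simp add: bl_def s_add sum.distrib algebra_simps)

lemma bl_add_r: "bl n A v (\<lambda>i. w i + w' i) = bl n A v w + bl n A v w'"
  by (simp add: bl_def sum.distrib algebra_simps)

lemma bl_act_l: "bl n A (\<lambda>i. a * v i) w = s a * bl n A v w"
  by (simp add: bl_def s_mult sum_distrib_left ac_simps)

lemma bl_act_r: "bl n A v (\<lambda>i. a * w i) = a * bl n A v w"
  by (simp add: bl_def sum_distrib_left ac_simps)

lemma s_dl [simp]: "s (dl i j) = dl i j"
  by (simp add: dl_def)

lemma bl_dl_l: "i < n \<Longrightarrow> bl n A (dl i) w = (\<Sum>j<n. A i j * w j)"
proof -
  assume i: "i < n"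
  have "bl n A (dl i) w = (\<Sum>k<n. dl i k * (\<Sum>j<n. A k j * w j))"
    by (simp add: bl_def sum_distrib_left mult.assoc)
  then show ?thesis using i by simp
qed

lemma bl_dl_r: "j < n \<Longrightarrow> bl n A v (dl j) = (\<Sum>i<n. s (v i) * A i j)"
  by (simp add: bl_def)

lemma bl_dl: "i < n \<Longrightarrow> j < n \<Longrightarrow> bl n A (dl i) (dl j) = A i j"
  by (simp add: bl_dl_l)

text \<open>Since \<open>hm A\<close> is hermitian up to \<open>eps\<close>, multiplying the
  conjugate transpose of a left inverse by \<open>eps\<close> gives a right inverse, and the two
  inverses then coincide.\<close>

lemma nonsingI:
  assumes g: "\<And>i j. i < n \<Longrightarrow> j < n \<Longrightarrow> (\<Sum>k<n. g i k * hm A k j) = dl i j"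
  shows "nonsing n A"
proof -
  define g' where "g' k j = eps * s (g j k)" for k j
  have g': "(\<Sum>k<n. hm A i k * g' k j) = dl i j" if "i < n" "j < n" for i j
  proof -
    have "(\<Sum>k<n. hm A i k * g' k j) = s (\<Sum>k<n. g j k * hm A k i)"
      unfolding s_sum g'_def by (intro sum.cong refl, subst hm_sym) (simp add: s_mult ac_simps)
    also have "\<dots> = dl i j" unfolding g[OF that(2,1)] by (simp add: dl_def)
    finally show ?thesis .
  qed
  have "g i j = g' i j" if ij: "i < n" "j < n" for i j
  proof -
    have "g i j = (\<Sum>k<n. g i k * (\<Sum>l<n. hm A k l * g' l j))"
      using ij g' by (simp cong: sum.cong_simp)
    also have "\<dots> = (\<Sum>l<n. (\<Sum>k<n. g i k * hm A k l) * g' l j)"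
      by (rule sum_mult_assoc[symmetric])
    also have "\<dots> = g' i j" using ij g by (simp cong: sum.cong_simp)
    finally show ?thesis .
  qed
  then have "(\<Sum>k<n. hm A i k * g k j) = dl i j" if "i < n" "j < n" for i j
    using g'[OF that] that by (simp cong: sum.cong_simp)
  then show ?thesis unfolding nonsing_def using g by blast
qed

lemma nonsing_cong:
  assumes "nonsing n A" "\<And>i j. i < n \<Longrightarrow> j < n \<Longrightarrow> hm A i j = hm A' i j"
  shows "nonsing n A'"
proof -
  obtain g where "\<And>i j. i < n \<Longrightarrow> j < n \<Longrightarrow> (\<Sum>k<n. g i k * hm A k j) = dl i j"
    using assms(1) unfolding nonsing_def by blast
  then show ?thesis by (intro nonsingI[where g = g]) (simp add: assms(2)[symmetric] cong: sum.cong_simp)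
qed

lemma vec_car: "vec n v \<in> carrier (free_module R n)"
  by (simp add: vec_def free_module_def)

lemma vec_ex: "x \<in> carrier (free_module R n) \<Longrightarrow> x = vec n (un \<circ> x)"
  by (auto simp: vec_def free_module_def fun_eq_iff)

lemma vec_eq: "vec n v = vec n w \<longleftrightarrow> (\<forall>i<n. v i = w i)"
  by (auto simp: vec_def fun_eq_iff)

lemma un_vec: "i < n \<Longrightarrow> un (vec n v i) = v i"
  by (simp add: vec_def)

lemma free_simps:
  "zero (free_module R n) = vec n (\<lambda>_. 0)"
  "vec n v \<oplus>\<^bsub>free_module R n\<^esub> vec n w = vec n (\<lambda>i. v i + w i)"
  "\<rho> a \<odot>\<^bsub>free_module R n\<^esub> vec n v = vec n (\<lambda>i. a * v i)"
proof -
  interpret ring R by (rule ring_R)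
  show "zero (free_module R n) = vec n (\<lambda>_. 0)"
    "vec n v \<oplus>\<^bsub>free_module R n\<^esub> vec n w = vec n (\<lambda>i. v i + w i)"
    "\<rho> a \<odot>\<^bsub>free_module R n\<^esub> vec n v = vec n (\<lambda>i. a * v i)"
    by (auto simp: vec_def free_module_def fun_eq_iff rho_zero rho_add rho_mult)
qed

lemma fm_simps [simp]:
  "carrier (fm n A) = carrier (free_module R n)"
  "zero (fm n A) = vec n (\<lambda>_. 0)"
  "vec n v \<oplus>\<^bsub>fm n A\<^esub> vec n w = vec n (\<lambda>i. v i + w i)"
  "act (fm n A) a (vec n v) = vec n (\<lambda>i. a * v i)"
  by (simp_all add: free_simps[symmetric] act_def) (simp_all add: fm_def free_module_def module.defs qform.defs)

lemma lam_fm: "lam (fm n A) (vec n v) (vec n w) = \<rho> (bl n (hm A) v w)"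
proof -
  have "bl n A (un \<circ> vec n x) (un \<circ> vec n y) = bl n A x y" for x y
    by (rule bl_cong) (simp_all add: un_vec)
  then show ?thesis by (simp add: fm_def module.defs qform.defs bl_hm)
qed

lemma lm_fm [simp]: "lm (fm n A) (vec n v) (vec n w) = bl n (hm A) v w"
  by (simp add: lm_def lam_fm)

lemma mu_fm [simp]: "mu (fm n A) (vec n v) = cs (bl n A v v)"
proof -
  have "bl n A (un \<circ> vec n x) (un \<circ> vec n y) = bl n A x y" for x y
    by (rule bl_cong) (simp_all add: un_vec)
  then show ?thesis by (simp add: fm_def module.defs qform.defs)
qed

lemma free_all: "(\<forall>x\<in>carrier (free_module R n). P x) \<longleftrightarrow> (\<forall>v. P (vec n v))"
  using vec_car vec_ex by metis

lemma free_left_module: "left_module R (free_module R n)"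
proof -
  interpret R: ring R by (rule ring_R)
  let ?F = "free_module R n"
  have [simp]: "vec n v \<in> carrier ?F" for v by (rule vec_car)
  have "abelian_group ?F"
  proof (rule abelian_groupI)
    fix x y assume "x \<in> carrier ?F" "y \<in> carrier ?F"
    then obtain v w where [simp]: "x = vec n v" "y = vec n w" using vec_ex by metis
    show "x \<oplus>\<^bsub>?F\<^esub> y \<in> carrier ?F" by (simp add: free_simps)
    show "x \<oplus>\<^bsub>?F\<^esub> y = y \<oplus>\<^bsub>?F\<^esub> x" by (simp add: free_simps add.commute)
  next
    fix x y z assume "x \<in> carrier ?F" "y \<in> carrier ?F" "z \<in> carrier ?F"
    then obtain u v w where [simp]: "x = vec n u" "y = vec n v" "z = vec n w" using vec_ex by metis
    show "x \<oplus>\<^bsub>?F\<^esub> y \<oplus>\<^bsub>?F\<^esub> z = x \<oplus>\<^bsub>?F\<^esub> (y \<oplus>\<^bsub>?F\<^esub> z)" by (simp add: free_simps add.assoc)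
  next
    fix x assume "x \<in> carrier ?F"
    then obtain v where [simp]: "x = vec n v" using vec_ex by metis
    show "\<zero>\<^bsub>?F\<^esub> \<oplus>\<^bsub>?F\<^esub> x = x" by (simp add: free_simps)
    show "\<exists>y\<in>carrier ?F. y \<oplus>\<^bsub>?F\<^esub> x = \<zero>\<^bsub>?F\<^esub>"
      by (intro bexI[of _ "vec n (\<lambda>i. - v i)"]) (simp_all add: free_simps)
  qed (simp add: free_simps)
  moreover have "left_module_axioms R ?F"
  proof
    fix a x assume "a \<in> carrier R" "x \<in> carrier ?F"
    then obtain a' v where [simp]: "a = \<rho> a'" "x = vec n v" using vec_ex rho_ex by metis
    show "a \<odot>\<^bsub>?F\<^esub> x \<in> carrier ?F" by (simp add: free_simps)
  next
    fix a b x assume "a \<in> carrier R" "b \<in> carrier R" "x \<in> carrier ?F"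
    then obtain a' b' v where [simp]: "a = \<rho> a'" "b = \<rho> b'" "x = vec n v" using vec_ex rho_ex by metis
    show "(a \<oplus> b) \<odot>\<^bsub>?F\<^esub> x = a \<odot>\<^bsub>?F\<^esub> x \<oplus>\<^bsub>?F\<^esub> b \<odot>\<^bsub>?F\<^esub> x"
      by (simp add: rho_add[symmetric] free_simps distrib_right)
    show "(a \<otimes> b) \<odot>\<^bsub>?F\<^esub> x = a \<odot>\<^bsub>?F\<^esub> (b \<odot>\<^bsub>?F\<^esub> x)"
      by (simp add: rho_mult[symmetric] free_simps mult.assoc)
  next
    fix a x y assume "a \<in> carrier R" "x \<in> carrier ?F" "y \<in> carrier ?F"
    then obtain a' v w where [simp]: "a = \<rho> a'" "x = vec n v" "y = vec n w" using vec_ex rho_ex by metis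
    show "a \<odot>\<^bsub>?F\<^esub> (x \<oplus>\<^bsub>?F\<^esub> y) = a \<odot>\<^bsub>?F\<^esub> x \<oplus>\<^bsub>?F\<^esub> a \<odot>\<^bsub>?F\<^esub> y"
      by (simp add: free_simps distrib_left)
  next
    fix x assume "x \<in> carrier ?F"
    then obtain v where [simp]: "x = vec n v" using vec_ex by metis
    show "\<one> \<odot>\<^bsub>?F\<^esub> x = x" by (simp add: rho_one[symmetric] free_simps)
  qed
  ultimately show ?thesis using ring_R by (simp add: left_module_def)
qed

lemma fm_left_module: "left_module R (fm n A)"
  by (rule image_left_module[OF free_left_module, where h = "\<lambda>x. x"])
    (auto intro!: semilinearI simp: free_simps, auto simp: fm_def module.defs free_module_def)

lemma vec_expand:
  assumes add: "\<And>v w. f (vec n (\<lambda>i. v i + w i)) = f (vec n v) + (f (vec n w) :: 'b)"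
    and act: "\<And>a v. f (vec n (\<lambda>i. a * v i)) = a * f (vec n v)"
  shows "f (vec n v) = (\<Sum>i<n. v i * f (vec n (dl i)))"
proof -
  have zero: "f (vec n (\<lambda>_. 0)) = 0" using act[of 0 "\<lambda>_. 0"] by simp
  have "f (vec n (\<lambda>i. if i < m then v i else 0)) = (\<Sum>i<m. v i * f (vec n (dl i)))" for m
  proof (induction m)
    case (Suc m)
    have eq: "(\<lambda>i. if i < Suc m then v i else 0) = (\<lambda>i. (if i < m then v i else 0) + v m * dl m i)"
      by (auto simp: dl_def fun_eq_iff less_Suc_eq)
    show ?case unfolding eq add act Suc sum.lessThan_Suc ..
  qed (simp add: zero)
  moreover have "vec n (\<lambda>i. if i < n then v i else 0) = vec n v" by (simp add: vec_eq)
  ultimately show ?thesis by metis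
qed

lemma qf_fm:
  assumes "nonsing n A"
  shows "qf (fm n A)"
proof -
  obtain g where g1: "\<And>i j. i < n \<Longrightarrow> j < n \<Longrightarrow> (\<Sum>k<n. g i k * hm A k j) = dl i j"
    and g2: "\<And>i j. i < n \<Longrightarrow> j < n \<Longrightarrow> (\<Sum>k<n. hm A i k * g k j) = dl i j"
    using assms unfolding nonsing_def by blast
  show ?thesis
    unfolding qf_def fm_simps(1) free_all
  proof (intro conjI allI impI fm_left_module)
    fix v w show "lam (fm n A) (vec n v) (vec n w) \<in> carrier R" by (simp add: lam_fm)
  next
    fix v w show "lm (fm n A) (vec n v) (vec n w) = eps * s (lm (fm n A) (vec n w) (vec n v))"
      by (simp add: bl_hm s_add s_mult distrib_left add.commute)
  next
    fix f assume f: "\<forall>v w. f (vec n v \<oplus>\<^bsub>fm n A\<^esub> vec n w) = f (vec n v) + f (vec n w)"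
      "\<forall>a v. f (act (fm n A) a (vec n v)) = a * f (vec n v)"
    \<comment> \<open>The row of values of \<open>f\<close> on the basis times the inverse matrix,
      conjugated because \<lambda> is conjugate linear in its left argument.\<close>
    define x where "x k = s (\<Sum>i<n. f (vec n (dl i)) * g i k)" for k
    have "lm (fm n A) (vec n x) (vec n w) = f (vec n w)" for w
    proof -
      have "(\<Sum>k<n. s (x k) * hm A k j) = f (vec n (dl j))" if "j < n" for j
        using that by (simp add: x_def sum_mult_assoc g1 cong: sum.cong_simp)
      then have "bl n (hm A) x w = (\<Sum>j<n. f (vec n (dl j)) * w j)"
        by (simp add: bl_left cong: sum.cong_simp)
      also have "\<dots> = f (vec n w)"
        using vec_expand[of f n w] f by (simp add: mult.commute)
      finally show ?thesis by simp
    qed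
    then show "\<exists>x\<in>carrier (free_module R n). \<forall>w. lm (fm n A) x (vec n w) = f (vec n w)"
      by (intro bexI[OF _ vec_car[of n x]] allI)
  next
    fix v assume v: "\<forall>w. lm (fm n A) (vec n v) (vec n w) = 0"
    have "v i = 0" if i: "i < n" for i
    proof -
      have "(\<Sum>k<n. s (v k) * hm A k j) = 0" if "j < n" for j
        using v[rule_format, of "dl j"] that by (simp add: bl_dl_r)
      then have "0 = (\<Sum>j<n. (\<Sum>k<n. s (v k) * hm A k j) * g j i)" by (simp cong: sum.cong_simp)
      also have "\<dots> = (\<Sum>k<n. s (v k) * (\<Sum>j<n. hm A k j * g j i))"
        by (rule sum_mult_assoc)
      also have "\<dots> = s (v i)" using i by (simp add: g2 cong: sum.cong_simp)
      finally show ?thesis using s_s[of "v i"] by simp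
    qed
    then show "vec n v = \<zero>\<^bsub>fm n A\<^esub>" by (simp add: vec_eq)
  next
    fix v show "\<exists>b. mu (fm n A) (vec n v) = cs b" by auto
  next
    fix v b assume "mu (fm n A) (vec n v) = cs b"
    then have "bl n A v v - b \<in> Lam" by (simp add: cs_eq)
    from Lam_herm[OF this] show "lm (fm n A) (vec n v) (vec n v) = b + eps * s b"
      by (simp add: bl_hm s_simps algebra_simps)
  next
    fix v w b c assume "mu (fm n A) (vec n v) = cs b" "mu (fm n A) (vec n w) = cs c"
    then have "bl n A v v - b \<in> Lam" "bl n A w w - c \<in> Lam" by (simp_all add: cs_eq)
    \<comment> \<open>Expanding \<mu>(v + w) gives the cross terms \<open>bl n A v w\<close> and
      \<open>bl n A w v\<close>, whereas \<lambda>(v, w) contains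
      \<open>eps * s (bl n A w v)\<close> in place of the latter. The discrepancy is an element of
      \<open>Lam\<close>.\<close>
    moreover have "bl n A w v - eps * s (bl n A w v) \<in> Lam" by (rule LamI)
    ultimately have "(bl n A v v - b) + (bl n A w w - c) + (bl n A w v - eps * s (bl n A w v)) \<in> Lam"
      by (intro Lam_add)
    then show "mu (fm n A) (vec n v \<oplus>\<^bsub>fm n A\<^esub> vec n w) = cs (b + c + lm (fm n A) (vec n v) (vec n w))"
      by (simp add: cs_eq bl_add_l bl_add_r bl_hm) (simp add: algebra_simps)
  next
    fix a v b assume "mu (fm n A) (vec n v) = cs b"
    then have "a * (bl n A v v - b) * s a \<in> Lam" by (simp add: cs_eq Lam_conj)
    then show "mu (fm n A) (act (fm n A) a (vec n v)) = cs (a * b * s a)"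
      by (simp add: cs_eq bl_act_l bl_act_r) (simp add: algebra_simps)
  qed (simp_all add: bl_add_r bl_act_r)
qed

lemma free_stably_free:
  assumes iso: "module_iso R Q (free_module R q)"
  shows "fg_stably_free R Q"
proof -
  let ?D = "direct_sum Q (free_module R 0)"
  obtain h where h: "h \<in> linear_maps R Q (free_module R q)"
    and bij: "bij_betw h (carrier Q) (carrier (free_module R q))" and Q: "left_module R Q"
    using iso unfolding module_iso_def by blast
  have c0: "x = vec 0 (\<lambda>_. 0)" if "x \<in> carrier (free_module R 0)" for x
    using that by (auto simp: free_module_def vec_def)
  have lin: "h \<circ> fst \<in> linear_maps R ?D (free_module R q)"
    by (rule semilinearI) (auto simp: semilinearD[OF h])
  moreover have "bij_betw (h \<circ> fst) (carrier ?D) (carrier (free_module R q))"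
    unfolding bij_betw_def
  proof
    show "inj_on (h \<circ> fst) (carrier ?D)"
    proof (rule inj_onI)
      fix x y assume x: "x \<in> carrier ?D" and y: "y \<in> carrier ?D" and eq: "(h \<circ> fst) x = (h \<circ> fst) y"
      have "fst x = fst y" using bij x y eq by (auto simp: bij_betw_def dest: inj_onD)
      moreover have "snd x = snd y" using x y c0[of "snd x"] c0[of "snd y"] by auto
      ultimately show "x = y" by (rule prod_eqI)
    qed
    have "carrier (free_module R 0) \<noteq> {}" using vec_car[of 0] by (metis empty_iff)
    then have "fst ` carrier ?D = carrier Q" by (simp add: fst_image_times)
    then show "(h \<circ> fst) ` carrier ?D = carrier (free_module R q)"
      using bij unfolding bij_betw_def by (metis image_comp)
  qed
  moreover have "left_module R ?D" by (rule ds_module[OF Q free_left_module])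
  ultimately have "module_iso R ?D (free_module R q)"
    unfolding module_iso_def using free_left_module by blast
  then show ?thesis unfolding fg_stably_free_def using Q by blast
qed

lemma fm_stably_free: "fg_stably_free R (fm n A)"
proof (rule free_stably_free)
  have "(\<lambda>x. x) \<in> linear_maps R (fm n A) (free_module R n)"
    by (rule semilinearI) (simp_all add: fm_def free_module_def module.defs)
  then show "module_iso R (fm n A) (free_module R n)"
    unfolding module_iso_def using fm_left_module free_left_module
    by (auto intro!: bexI[of _ "\<lambda>x. x"] simp: bij_betw_def)
qed

lemma fm_form: "nonsing n A \<Longrightarrow> nonsingular_form k R \<sigma> (fm n A)"
  by (intro qf_form qf_fm fm_stably_free)

subsection \<open>Recognition of free forms by Gram matrices\<close>

context
  fixes M :: "('a, 'm, 'y) qform_scheme" and b :: "nat \<Rightarrow> 'm" and n :: nat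
  assumes M: "qf M" and b: "\<And>i. i < n \<Longrightarrow> b i \<in> carrier M"
begin

lemma lc_car: "m \<le> n \<Longrightarrow> lc M b v m \<in> carrier M"
  by (induction m) (simp_all add: zero_car[OF M] add_car[OF M] act_car[OF M] b)

lemma lc_fun:
  assumes add: "\<And>x y. x \<in> carrier M \<Longrightarrow> y \<in> carrier M \<Longrightarrow> f (x \<oplus>\<^bsub>M\<^esub> y) = f x + (f y :: 'b)"
    and act: "\<And>a x. x \<in> carrier M \<Longrightarrow> f (act M a x) = a * f x"
  shows "m \<le> n \<Longrightarrow> f (lc M b v m) = (\<Sum>i<m. v i * f (b i))"
proof (induction m)
  case 0
  have "f \<zero>\<^bsub>M\<^esub> = 0" using act[OF zero_car[OF M], of 0] act_zero[OF M zero_car[OF M]] by simp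
  then show ?case by simp
qed (simp add: add act b lc_car act_car[OF M])

lemma lm_lc_r: "z \<in> carrier M \<Longrightarrow> lm M z (lc M b v n) = (\<Sum>i<n. v i * lm M z (b i))"
  by (rule lc_fun) (simp_all add: lm_add_r[OF M] lm_act_r[OF M])

lemma lm_lc_l: "z \<in> carrier M \<Longrightarrow> lm M (lc M b v n) z = (\<Sum>i<n. s (v i) * lm M (b i) z)"
proof -
  assume z: "z \<in> carrier M"
  have "lm M (lc M b v n) z = eps * s (\<Sum>i<n. v i * lm M z (b i))"
    by (subst lm_sym[OF M]) (simp_all add: z lc_car lm_lc_r)
  also have "\<dots> = (\<Sum>i<n. s (v i) * (eps * s (lm M z (b i))))"
    by (simp add: s_simps sum_distrib_left ac_simps)
  also have "\<dots> = (\<Sum>i<n. s (v i) * lm M (b i) z)"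
    by (intro sum.cong refl) (simp add: lm_sym[OF M, of _ z] z b)
  finally show ?thesis .
qed

context
  fixes A :: "nat \<Rightarrow> nat \<Rightarrow> 'b"
  assumes diag: "\<And>i. i < n \<Longrightarrow> mu M (b i) = cs (A i i)"
    and off: "\<And>i j. i < j \<Longrightarrow> j < n \<Longrightarrow> lm M (b i) (b j) = hm A i j"
begin

text \<open>The diagonal of a Gram matrix is dictated by \<mu> and the lower triangle by symmetry,
  so only the entries above the diagonal have to be checked.\<close>

lemma gram: "i < n \<Longrightarrow> j < n \<Longrightarrow> lm M (b i) (b j) = hm A i j"
proof -
  assume ij: "i < n" "j < n"
  consider "i < j" | "i = j" | "j < i" by linarith
  then show ?thesis
  proof cases
    case 2 then show ?thesis using mu_diag[OF M b[OF ij(1)] diag[OF ij(1)]] by (simp add: hm_def)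
  next
    case 3
    then have "lm M (b i) (b j) = eps * s (hm A j i)"
      using off[OF 3 ij(1)] lm_sym[OF M b[OF ij(1)] b[OF ij(2)]] by simp
    then show ?thesis by (simp add: hm_sym[of A i j])
  qed (use off ij in auto)
qed

text \<open>Adding a multiple of \<open>b m\<close> contributes the pairing with the previous sum.
  This pairing contains the conjugate of the row \<open>A m j\<close> times \<open>eps\<close>,
  while \<open>bl\<close> contains the row itself, and the difference lies in
  \<open>Lam\<close>.\<close>

lemma mu_lc: "m \<le> n \<Longrightarrow> mu M (lc M b v m) = cs (bl m A v v)"
proof (induction m)
  case 0
  then show ?case by (simp add: mu_zero[OF M] bl_def)
next
  case (Suc m)
  have m: "m < n" using Suc.prems by simp
  have "lm M (lc M b v m) (act M (v m) (b m)) = v m * (\<Sum>i<m. s (v i) * hm A i m)"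
  proof -
    have "lm M (lc M b v m) (b m) = eps * s (\<Sum>i<m. v i * lm M (b m) (b i))"
      using lc_fun[of "lm M (b m)" m v] m
      by (subst lm_sym[OF M]) (simp_all add: lc_car b lm_add_r[OF M] lm_act_r[OF M])
    also have "\<dots> = (\<Sum>i<m. s (v i) * hm A i m)"
      using m by (simp add: gram s_simps sum_distrib_left hm_sym[of A _ m] ac_simps)
    finally show ?thesis using m by (simp add: lm_act_r[OF M] lc_car b)
  qed
  then have "mu M (lc M b v (Suc m)) =
      cs (bl m A v v + v m * A m m * s (v m) + v m * (\<Sum>i<m. s (v i) * hm A i m))"
    using mu_plus[OF M lc_car act_car[OF M b[OF m]] Suc.IH mu_act[OF M b[OF m] diag[OF m]], of "v m"] m
    by simp
  also have "\<dots> = cs (bl (Suc m) A v v)"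
  proof -
    have "bl (Suc m) A v v = bl m A v v + (\<Sum>i<m. s (v i) * A i m * v m)
        + ((\<Sum>j<m. s (v m) * A m j * v j) + s (v m) * A m m * v m)"
      by (simp add: bl_def sum.distrib)
    moreover have "v m * (\<Sum>i<m. s (v i) * hm A i m)
        = (\<Sum>i<m. s (v i) * A i m * v m) + eps * s (\<Sum>j<m. s (v m) * A m j * v j)"
      by (simp add: hm_def sum_distrib_left s_simps algebra_simps sum.distrib)
    ultimately have "bl (Suc m) A v v - (bl m A v v + v m * A m m * s (v m) + v m * (\<Sum>i<m. s (v i) * hm A i m))
        = (\<Sum>j<m. s (v m) * A m j * v j) - eps * s (\<Sum>j<m. s (v m) * A m j * v j)"
      by (simp add: algebra_simps)
    then show ?thesis unfolding cs_eq using LamI Lam_neg by (metis minus_diff_eq)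
  qed
  finally show ?case .
qed

text \<open>Vectors with an invertible Gram matrix and zero orthogonal complement form a basis. The
  coefficients \<open>v\<close> of a given \<open>z\<close> are its pairings with the
  \<open>b i\<close>, multiplied by the inverse Gram matrix; the remainder is orthogonal to every
  \<open>b i\<close>.\<close>

lemma gram_iso:
  assumes ns: "nonsing n A"
    and nondeg: "\<And>z. z \<in> carrier M \<Longrightarrow> (\<And>i. i < n \<Longrightarrow> lm M (b i) z = 0) \<Longrightarrow> z = \<zero>\<^bsub>M\<^esub>"
  shows "isometric R (fm n A) M"
proof (rule isoI[OF qf_fm[OF ns] M, where h = "\<lambda>x. lc M b (un \<circ> x) n"])
  have [simp]: "lc M b v n \<in> carrier M" for v by (rule lc_car) simp
  have lcv: "lc M b (un \<circ> vec n v) n = lc M b v n" for v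
    by (rule lm_cancel[OF M]) (simp_all add: lm_lc_l un_vec)
  {
    fix x assume "x \<in> carrier (fm n A)"
    then obtain v where [simp]: "x = vec n v" using vec_ex by auto
    show "lc M b (un \<circ> x) n \<in> carrier M" by simp
    show "mu M (lc M b (un \<circ> x) n) = mu (fm n A) x" by (simp add: lcv mu_lc)
    fix a show "lc M b (un \<circ> act (fm n A) a x) n = act M a (lc M b (un \<circ> x) n)"
      by (rule lm_cancel[OF M])
        (simp_all add: lcv lm_lc_l lm_act_l[OF M] act_car[OF M] s_mult sum_distrib_left mult.assoc)
  next
    fix x y assume "x \<in> carrier (fm n A)" "y \<in> carrier (fm n A)"
    then obtain v w where [simp]: "x = vec n v" "y = vec n w" using vec_ex by (metis fm_simps(1))
    show "lc M b (un \<circ> (x \<oplus>\<^bsub>fm n A\<^esub> y)) n = lc M b (un \<circ> x) n \<oplus>\<^bsub>M\<^esub> lc M b (un \<circ> y) n"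
      by (rule lm_cancel[OF M])
        (simp_all add: lcv lm_lc_l lm_add_l[OF M] add_car[OF M] s_add distrib_right sum.distrib)
    have "lm M (lc M b v n) (lc M b w n) = bl n (hm A) v w"
      by (simp add: lm_lc_l lm_lc_r b gram bl_left mult.commute cong: sum.cong_simp)
    then show "lm M (lc M b (un \<circ> x) n) (lc M b (un \<circ> y) n) = lm (fm n A) x y" by (simp add: lcv)
  }
  fix z assume z: "z \<in> carrier M"
  obtain g where g2: "\<And>i j. i < n \<Longrightarrow> j < n \<Longrightarrow> (\<Sum>k<n. hm A i k * g k j) = dl i j"
    using ns unfolding nonsing_def by blast
  define v where "v j = (\<Sum>k<n. g j k * lm M (b k) z)" for j
  let ?d = "z \<oplus>\<^bsub>M\<^esub> act M (- 1) (lc M b v n)"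
  have "?d = \<zero>\<^bsub>M\<^esub>"
  proof (rule nondeg)
    show "?d \<in> carrier M" by (simp add: z add_car[OF M] act_car[OF M])
    fix i assume i: "i < n"
    have "(\<Sum>j<n. v j * lm M (b i) (b j)) = (\<Sum>j<n. hm A i j * (\<Sum>k<n. g j k * lm M (b k) z))"
      using i by (simp add: gram v_def mult.commute cong: sum.cong_simp)
    also have "\<dots> = (\<Sum>k<n. (\<Sum>j<n. hm A i j * g j k) * lm M (b k) z)"
      by (rule sum_mult_assoc[symmetric])
    also have "\<dots> = lm M (b i) z" using i by (simp add: g2 cong: sum.cong_simp)
    finally show "lm M (b i) ?d = 0" using i
      by (simp add: lm_add_r[OF M] lm_act_r[OF M] act_car[OF M] b z lm_lc_r)
  qed
  then have "lm M y ?d = 0" if "y \<in> carrier M" for y using that by (simp add: lm_zero_r[OF M])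
  then have "lm M y z = lm M y (lc M b v n)" if "y \<in> carrier M" for y
    using that z by (simp add: lm_add_r[OF M] lm_act_r[OF M] act_car[OF M])
  then have "z = lc M b v n" by (intro lm_cancel_r[OF M z]) simp_all
  then show "\<exists>x\<in>carrier (fm n A). z = lc M b (un \<circ> x) n"
    by (intro bexI[of _ "vec n v"]) (simp_all add: lcv vec_car)
qed

end
end

end

context fmodel
begin

definition eqv :: "('a, 'm, 'y) qform_scheme \<Rightarrow> ('a, 'n, 'z) qform_scheme \<Rightarrow> bool"  (infix "\<doteq>" 50) where
  "M \<doteq> N \<longleftrightarrow> qf M \<and> qf N \<and> isometric R M N"

abbreviation os (infixr "\<bottom>" 65) where "M \<bottom> N \<equiv> orthogonal_sum R M N"

lemma eqv_refl: "qf M \<Longrightarrow> M \<doteq> M" by (simp add: eqv_def iso_refl)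
lemma eqv_sym: "M \<doteq> N \<Longrightarrow> N \<doteq> M" unfolding eqv_def using iso_sym by blast
lemma eqv_trans [trans]: "M \<doteq> N \<Longrightarrow> N \<doteq> P \<Longrightarrow> M \<doteq> P" unfolding eqv_def using iso_trans by blast
lemma eqv_cong: "M \<doteq> M' \<Longrightarrow> N \<doteq> N' \<Longrightarrow> M \<bottom> N \<doteq> M' \<bottom> N'"
  unfolding eqv_def by (simp add: qf_os os_cong)
lemma eqv_comm: "qf M \<Longrightarrow> qf N \<Longrightarrow> M \<bottom> N \<doteq> N \<bottom> M"
  unfolding eqv_def by (simp add: qf_os os_comm)
lemma eqv_assoc: "qf M \<Longrightarrow> qf N \<Longrightarrow> qf P \<Longrightarrow> (M \<bottom> N) \<bottom> P \<doteq> M \<bottom> (N \<bottom> P)"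
  unfolding eqv_def by (simp add: qf_os os_assoc)
lemma eqv_qf: "M \<doteq> N \<Longrightarrow> qf M" "M \<doteq> N \<Longrightarrow> qf N" by (simp_all add: eqv_def)

subsection \<open>Coordinates\<close>

context
  fixes M :: "('a, 'm, 'y) qform_scheme" and c :: "'m \<Rightarrow> nat \<Rightarrow> 'b" and n :: nat
  assumes M: "qf M"
    and c_add: "\<And>x y i. x \<in> carrier M \<Longrightarrow> y \<in> carrier M \<Longrightarrow> i < n \<Longrightarrow> c (x \<oplus>\<^bsub>M\<^esub> y) i = c x i + c y i"
    and c_act: "\<And>a x i. x \<in> carrier M \<Longrightarrow> i < n \<Longrightarrow> c (act M a x) i = a * c x i"
    and c_surj: "\<And>v. \<exists>x\<in>carrier M. \<forall>i<n. c x i = v i"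
begin

lemma c_basis: "\<exists>b. (\<forall>i. b i \<in> carrier M) \<and> (\<forall>i. \<forall>j<n. c (b i) j = dl i j)"
  using c_surj[of "dl _"] by metis

lemma c_lc: "(\<And>i. i < m \<Longrightarrow> b i \<in> carrier M) \<Longrightarrow> i < n \<Longrightarrow> c (lc M b v m) i = (\<Sum>j<m. v j * c (b j) i)"
  by (rule lc_fun[OF M, where n = m and m = m and f = "\<lambda>x. c x i"]) (auto simp: c_add c_act)

lemma c_dual: "\<exists>e. (\<forall>i<n. e i \<in> carrier M \<and> (\<forall>y\<in>carrier M. lm M (e i) y = c y i))"
proof -
  have "\<exists>x\<in>carrier M. \<forall>y\<in>carrier M. lm M x y = c y i" if "i < n" for i
    by (rule lm_repr[OF M]) (simp_all add: that c_add c_act)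
  then show ?thesis by metis
qed

text \<open>Preimages \<open>b i\<close> of the unit vectors form a basis. Its Gram matrix is
  invertible because the vectors \<open>e i\<close> that represent the coordinate functionals are
  dual to it: their coordinates, conjugated, are the rows of the inverse.\<close>

lemma coord_iso:
  assumes inj: "\<And>x. x \<in> carrier M \<Longrightarrow> \<forall>i<n. c x i = 0 \<Longrightarrow> x = \<zero>\<^bsub>M\<^esub>"
  shows "\<exists>A. nonsing n A \<and> fm n A \<doteq> M"
proof -
  obtain b where b: "\<And>i. b i \<in> carrier M" and cb: "\<And>i j. j < n \<Longrightarrow> c (b i) j = dl i j"
    using c_basis by blast
  obtain e where e: "\<And>i. i < n \<Longrightarrow> e i \<in> carrier M"
    and le: "\<And>i y. i < n \<Longrightarrow> y \<in> carrier M \<Longrightarrow> lm M (e i) y = c y i"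
    using c_dual by blast
  have lcc: "lc M b v n \<in> carrier M" for v by (rule lc_car[OF M b order_refl])
  have exp: "z = lc M b (c z) n" if z: "z \<in> carrier M" for z
  proof -
    let ?d = "z \<oplus>\<^bsub>M\<^esub> act M (- 1) (lc M b (c z) n)"
    have "?d = \<zero>\<^bsub>M\<^esub>"
      by (rule inj) (simp_all add: add_car[OF M] act_car[OF M] z lcc c_add c_act c_lc b cb)
    then have "lm M y ?d = 0" if "y \<in> carrier M" for y using that by (simp add: lm_zero_r[OF M])
    then have "lm M y z = lm M y (lc M b (c z) n)" if "y \<in> carrier M" for y
      using that z lcc by (simp add: lm_add_r[OF M] lm_act_r[OF M] act_car[OF M])
    then show ?thesis by (intro lm_cancel_r[OF M z lcc]) simp_all
  qed
  \<comment> \<open>Upper triangular: representatives of \<mu> on the diagonal and \<lambda> above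
    it, so that the symmetrization restores the full Gram matrix.\<close>
  define A where "A i j = (if i = j then SOME a. mu M (b i) = cs a else if i < j then lm M (b i) (b j) else 0)" for i j
  have diag: "mu M (b i) = cs (A i i)" for i
    unfolding A_def using someI_ex[OF mu_ex[OF M b[of i]]] by simp
  have off: "lm M (b i) (b j) = hm A i j" if "i < j" for i j using that by (simp add: hm_def A_def)
  have gr: "lm M (b i) (b j) = hm A i j" if "i < n" "j < n" for i j
    by (rule gram[OF M b diag off that])
  have ns: "nonsing n A"
  proof (rule nonsingI[where g = "\<lambda>i k. s (c (e i) k)"])
    fix i j assume ij: "i < n" "j < n"
    have "lm M (e i) (b j) = lm M (lc M b (c (e i)) n) (b j)"
      by (rule arg_cong[OF exp[OF e[OF ij(1)]], of "\<lambda>x. lm M x (b j)"])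
    also have "\<dots> = (\<Sum>k<n. s (c (e i) k) * lm M (b k) (b j))" by (rule lm_lc_l[OF M b b])
    finally have "lm M (e i) (b j) = (\<Sum>k<n. s (c (e i) k) * lm M (b k) (b j))" .
    moreover have "lm M (e i) (b j) = dl i j" using ij by (simp add: le b cb) (simp add: dl_def)
    ultimately show "(\<Sum>k<n. s (c (e i) k) * hm A k j) = dl i j"
      using ij by (simp add: gr[symmetric] cong: sum.cong_simp)
  qed
  have "isometric R (fm n A) M"
  proof (rule gram_iso[OF M b diag off ns])
    fix z assume z: "z \<in> carrier M" and 0: "\<And>i. i < n \<Longrightarrow> lm M (b i) z = 0"
    show "z = \<zero>\<^bsub>M\<^esub>"
    proof (rule lm_cancel_r[OF M z zero_car[OF M]])
      fix y assume y: "y \<in> carrier M"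
      have "lm M y z = lm M (lc M b (c y) n) z" by (rule arg_cong[OF exp[OF y], of "\<lambda>x. lm M x z"])
      also have "\<dots> = 0" using 0 by (simp add: lm_lc_l[OF M b z])
      finally show "lm M y z = lm M y \<zero>\<^bsub>M\<^esub>" using y by (simp add: lm_zero_r[OF M])
    qed
  qed
  then show ?thesis using ns M qf_fm[OF ns] unfolding eqv_def by blast
qed

end

subsection \<open>Hyperbolic forms\<close>

text \<open>The partners of a hyperbolic pair sit at the adjacent positions 2i and 2i + 1 rather
  than in two separate halves, so that the block sum of two such matrices is again
  \<open>hy\<close>.\<close>

definition hy :: "nat \<Rightarrow> nat \<Rightarrow> 'b" where "hy i j = (if even i \<and> j = Suc i then 1 else 0)"
definition hyp :: "nat \<Rightarrow> ('a, nat \<Rightarrow> 'a) qform" where "hyp m = fm (2 * m) hy"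

lemma hm_hy: "hm hy i j = (if even i \<and> j = Suc i then 1 else if even j \<and> i = Suc j then eps else 0)"
  by (auto simp: hm_def hy_def)

lemma nonsing_hy: "nonsing (2 * m) hy"
proof (rule nonsingI[where g = "\<lambda>i k. if even i \<and> k = Suc i then eps else if even k \<and> i = Suc k then 1 else 0"])
  fix i j assume ij: "i < 2 * m" "j < 2 * m"
  let ?p = "if even i then Suc i else i - 1"
  have p: "?p < 2 * m" using ij by (auto elim!: evenE)
  have "(\<Sum>k<2 * m. (if even i \<and> k = Suc i then eps else if even k \<and> i = Suc k then 1 else 0) * hm hy k j)
      = (\<Sum>k<2 * m. if k = ?p then (if even i then eps else 1) * hm hy ?p j else 0)"
    by (intro sum.cong refl) (auto elim!: oddE)
  also have "\<dots> = (if even i then eps else 1) * hm hy ?p j" using p by simp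
  also have "\<dots> = dl i j" by (cases "even i") (auto simp: hm_hy dl_def elim!: oddE, presburger+)
  finally show "(\<Sum>k<2 * m. (if even i \<and> k = Suc i then eps else if even k \<and> i = Suc k then 1 else 0) * hm hy k j) = dl i j" .
qed

lemma qf_hyp [simp]: "qf (hyp m)" by (simp add: hyp_def qf_fm nonsing_hy)

lemma hyp_form: "nonsingular_form k R \<sigma> (hyp m)" by (simp add: hyp_def fm_form nonsing_hy)

text \<open>Here \<open>c\<close> maps onto the free module of rank \<open>q\<close> with a
  Lagrangian as kernel. The vectors \<open>e i\<close> representing the coordinate functionals are
  orthogonal to this kernel, hence lie in it; lifts \<open>f i\<close> of the unit vectors are dual
  to them and are corrected by elements of the kernel until they span a second Lagrangian.\<close>

lemma metabolic_iso:
  assumes N: "qf N"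
    and c_add: "\<And>x y i. x \<in> carrier N \<Longrightarrow> y \<in> carrier N \<Longrightarrow> i < q \<Longrightarrow> c (x \<oplus>\<^bsub>N\<^esub> y) i = c x i + c y i"
    and c_act: "\<And>a x i. x \<in> carrier N \<Longrightarrow> i < q \<Longrightarrow> c (act N a x) i = a * c x i"
    and c_surj: "\<And>v. \<exists>x\<in>carrier N. \<forall>i<q. c x i = v i"
    and iso0: "\<And>x. x \<in> carrier N \<Longrightarrow> \<forall>i<q. c x i = 0 \<Longrightarrow> mu N x = cs 0"
    and iso1: "\<And>x y. x \<in> carrier N \<Longrightarrow> \<forall>i<q. c x i = 0 \<Longrightarrow> y \<in> carrier N \<Longrightarrow> \<forall>i<q. c y i = 0 \<Longrightarrow> lm N x y = 0"
    and max: "\<And>x. x \<in> carrier N \<Longrightarrow> (\<And>y. y \<in> carrier N \<Longrightarrow> \<forall>i<q. c y i = 0 \<Longrightarrow> lm N x y = 0) \<Longrightarrow> \<forall>i<q. c x i = 0"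
  shows "hyp q \<doteq> N"
proof -
  note cc = c_add c_act c_surj
  obtain f where f: "\<And>i. f i \<in> carrier N" and cf: "\<And>i j. j < q \<Longrightarrow> c (f i) j = dl i j"
    using c_basis[OF N cc] by blast
  obtain e' where e': "\<And>i. i < q \<Longrightarrow> e' i \<in> carrier N"
    and le': "\<And>i y. i < q \<Longrightarrow> y \<in> carrier N \<Longrightarrow> lm N (e' i) y = c y i"
    using c_dual[OF N cc] by blast
  \<comment> \<open>Extended by zero beyond \<open>q\<close>, so that membership in the carrier
    holds for every index.\<close>
  define e where "e i = (if i < q then e' i else \<zero>\<^bsub>N\<^esub>)" for i
  have e: "e i \<in> carrier N" for i by (simp add: e_def e' zero_car[OF N])
  have le: "lm N (e i) y = c y i" if "i < q" "y \<in> carrier N" for i y using that by (simp add: e_def le')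
  have ce: "\<forall>j<q. c (e i) j = 0" if "i < q" for i
    by (rule max[OF e]) (simp add: le that)
  define \<phi> where "\<phi> i j = (if i = j then SOME a. mu N (f i) = cs a else if i < j then lm N (f i) (f j) else 0)" for i j
  have diag: "mu N (f i) = cs (\<phi> i i)" for i
    unfolding \<phi>_def using someI_ex[OF mu_ex[OF N f[of i]]] by simp
  have off: "lm N (f i) (f j) = hm \<phi> i j" if "i < j" for i j using that by (simp add: hm_def \<phi>_def)
  have gr: "lm N (f i) (f j) = hm \<phi> i j" if "i < q" "j < q" for i j
    by (rule gram[OF N f diag off that])
  define L where "L j = lc N e (\<lambda>i. s (\<phi> j i)) q" for j
  have L: "L j \<in> carrier N" for j unfolding L_def by (rule lc_car[OF N e order_refl])
  have cL: "c (L j) i = 0" if "i < q" for i j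
    unfolding L_def using that ce by (subst c_lc[OF N cc e that]) simp_all
  define f' where "f' j = f j \<oplus>\<^bsub>N\<^esub> act N (- 1) (L j)" for j
  have aL: "act N (- 1) (L j) \<in> carrier N" for j by (simp add: act_car[OF N] L)
  have f': "f' j \<in> carrier N" for j by (simp add: f'_def add_car[OF N] f aL)
  have cf': "c (f' i) j = dl i j" if "j < q" for i j
    using that by (simp add: f'_def c_add f aL c_act L cL cf)
  have lff': "lm N (f' j) (f' i) = 0" if ij: "i < q" "j < q" for i j
  proof -
    have lLz: "lm N (L j) (f' i) = \<phi> j i"
      unfolding L_def using ij by (simp add: lm_lc_l[OF N e f'] le f' cf')
    have "lm N (f j) (e l) = eps * dl j l" if "l < q" for l
      using lm_sym[OF N f e, of j l] that by (simp add: le f cf)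
    then have "lm N (f j) (L i) = eps * s (\<phi> i j)"
      unfolding L_def using ij
      by (simp add: lm_lc_r[OF N e f] mult.left_commute[of _ eps] sum_distrib_left[symmetric] cong: sum.cong_simp)
    then have "lm N (f j) (f' i) = \<phi> j i"
      using ij by (simp add: f'_def lm_add_r[OF N] lm_act_r[OF N] f aL L gr hm_def)
    then show ?thesis unfolding f'_def[of j] using lLz
      by (simp add: lm_add_l[OF N] lm_act_l[OF N] f aL L f' s_neg)
  qed
  have muf': "mu N (f' j) = cs 0" if j: "j < q" for j
  proof -
    have "mu N (act N (- 1) (L j)) = cs 0" by (rule iso0[OF aL]) (simp add: c_act L cL)
    then have "mu N (f' j) = cs (\<phi> j j + 0 + lm N (f j) (act N (- 1) (L j)))"
      unfolding f'_def by (intro mu_plus[OF N f aL diag])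
    also have "lm N (f j) (act N (- 1) (L j)) = - (eps * s (\<phi> j j))"
    proof -
      have "lm N (f j) (e l) = eps * dl j l" if "l < q" for l
        using lm_sym[OF N f e, of j l] that by (simp add: le f cf)
      then have "lm N (f j) (L j) = eps * s (\<phi> j j)"
        unfolding L_def using j
        by (simp add: lm_lc_r[OF N e f] mult.left_commute[of _ eps] sum_distrib_left[symmetric] cong: sum.cong_simp)
      then show ?thesis by (simp add: lm_act_r[OF N f L])
    qed
    finally show ?thesis using LamI[of "\<phi> j j"] by (simp add: cs_eq)
  qed
  define b where "b i = (if even i then e (i div 2) else f' (i div 2))" for i
  have b: "b i \<in> carrier N" for i by (simp add: b_def e f')
  have "isometric R (fm (2 * q) hy) N"
  proof (rule gram_iso[OF N b _ _ nonsing_hy])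
    fix i assume "i < 2 * q"
    then show "mu N (b i) = cs (hy i i)" using muf'[of "i div 2"] iso0[OF e ce, of "i div 2"]
      by (auto simp: b_def hy_def)
  next
    fix i j assume ij: "i < j" "j < 2 * q"
    have h: "i div 2 < q" "j div 2 < q" using ij by auto
    have fe: "lm N (f' (i div 2)) (e (j div 2)) = eps * dl (i div 2) (j div 2)"
      using lm_sym[OF N f' e, of "i div 2" "j div 2"] h by (simp add: le f' cf')
    show "lm N (b i) (b j) = hm hy i j"
    proof (cases "even i")
      case True
      then show ?thesis using h ij le[OF h(1) e, of "j div 2"] ce[OF h(2)] le[OF h(1) f', of "j div 2"] cf'[OF h(1), of "j div 2"]
        by (auto simp: b_def hm_hy dl_def elim!: evenE oddE)
    next
      case False
      then show ?thesis using h ij fe lff'[OF h(2,1)]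
        by (auto simp: b_def hm_hy dl_def elim!: evenE oddE)
    qed
  next
    fix z assume z: "z \<in> carrier N" and 0: "\<And>i. i < 2 * q \<Longrightarrow> lm N (b i) z = 0"
    have ez: "c z i = 0" if "i < q" for i using 0[of "2 * i"] that le[OF that z] by (simp add: b_def)
    have fz: "lm N z (f' i) = 0" if "i < q" for i
      using 0[of "Suc (2 * i)"] that lm_sym[OF N z f', of i] by (simp add: b_def)
    show "z = \<zero>\<^bsub>N\<^esub>"
    proof (rule lm_nondeg[OF N z])
      fix y assume y: "y \<in> carrier N"
      let ?l = "lc N f' (c y) q"
      have l: "?l \<in> carrier N" by (rule lc_car[OF N f' order_refl])
      have cl: "c ?l i = c y i" if "i < q" for i using that by (simp add: c_lc[OF N cc f'] cf')
      have "lm N z (y \<oplus>\<^bsub>N\<^esub> act N (- 1) ?l) = 0"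
        by (rule iso1[OF z]) (use ez in \<open>simp_all add: add_car[OF N] act_car[OF N] y l c_add c_act cl\<close>)
      moreover have "lm N z ?l = 0" using fz by (simp add: lm_lc_r[OF N f' z])
      ultimately show "lm N z y = 0" using z y l by (simp add: lm_add_r[OF N] lm_act_r[OF N] act_car[OF N])
    qed
  qed
  then show ?thesis using N unfolding eqv_def hyp_def by (simp add: qf_fm nonsing_hy)
qed

definition bs :: "nat \<Rightarrow> (nat \<Rightarrow> nat \<Rightarrow> 'b) \<Rightarrow> (nat \<Rightarrow> nat \<Rightarrow> 'b) \<Rightarrow> nat \<Rightarrow> nat \<Rightarrow> 'b" where
  "bs n A B i j = (if i < n \<and> j < n then A i j else if n \<le> i \<and> n \<le> j then B (i - n) (j - n) else 0)"

lemma hm_bs: "hm (bs n A B) = bs n (hm A) (hm B)"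
  by (auto simp: hm_def bs_def fun_eq_iff)

lemma fm_cong: "(\<And>i j. i < n \<Longrightarrow> j < n \<Longrightarrow> A i j = B i j) \<Longrightarrow> fm n A = fm n B"
  unfolding fm_def by (simp cong: bl_cong)

lemma bl_zero [simp]: "bl n A (\<lambda>_. 0) w = 0" "bl n A v (\<lambda>_. 0) = 0"
  by (simp_all add: bl_def)

lemma nonsing_bs:
  assumes "nonsing n A" "nonsing m B"
  shows "nonsing (n + m) (bs n A B)"
proof -
  obtain g where g: "\<And>i j. i < n \<Longrightarrow> j < n \<Longrightarrow> (\<Sum>k<n. g i k * hm A k j) = dl i j"
    using assms(1) unfolding nonsing_def by blast
  obtain g' where g': "\<And>i j. i < m \<Longrightarrow> j < m \<Longrightarrow> (\<Sum>k<m. g' i k * hm B k j) = dl i j"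
    using assms(2) unfolding nonsing_def by blast
  show ?thesis
  proof (rule nonsingI[where g = "bs n g g'"])
    fix i j assume "i < n + m" "j < n + m"
    then have "\<not> i < n \<Longrightarrow> i - n < m" "\<not> j < n \<Longrightarrow> j - n < m" by linarith+
    then show "(\<Sum>k<n + m. bs n g g' i k * hm (bs n A B) k j) = dl i j"
      using g[of i j] g'[of "i - n" "j - n"]
      by (cases "i < n"; cases "j < n")
        (simp_all add: sum_lessThan_add hm_bs bs_def dl_def eq_diff_iff cong: sum.cong_simp)
  qed
qed

lemma fm_os:
  assumes A: "nonsing n A" and B: "nonsing m B"
  shows "fm (n + m) (bs n A B) \<doteq> fm n A \<bottom> fm m B"
proof -
  note qA = qf_fm[OF A] and qB = qf_fm[OF B] and ns = nonsing_bs[OF A B]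
  let ?z = "\<lambda>_::nat. 0 :: 'b"
  define b where "b i = (if i < n then (vec n (dl i), vec m ?z) else (vec n ?z, vec m (dl (i - n))))" for i
  have "isometric R (fm (n + m) (bs n A B)) (fm n A \<bottom> fm m B)"
  proof (rule gram_iso[OF qf_os[OF qA qB] _ _ _ ns])
    fix i assume "i < n + m"
    then have "mu (fm n A \<bottom> fm m B) (b i) = cs ((if i < n then A i i else 0) + (if i < n then 0 else B (i - n) (i - n)))"
      by (intro mu_os) (auto simp: b_def bl_dl)
    then show "mu (fm n A \<bottom> fm m B) (b i) = cs (bs n A B i i)" by (simp add: bs_def)
  next
    fix i j assume "i < j" "j < n + m"
    then show "lm (fm n A \<bottom> fm m B) (b i) (b j) = hm (bs n A B) i j"
      by (subst lm_os[OF qA qB]) (auto simp: b_def vec_car bl_dl hm_bs bs_def)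
  next
    fix z assume z: "z \<in> carrier (fm n A \<bottom> fm m B)" and 0: "\<And>i. i < n + m \<Longrightarrow> lm (fm n A \<bottom> fm m B) (b i) z = 0"
    then obtain v w where zz: "z = (vec n v, vec m w)" using vec_ex by (cases z) (auto, metis)
    have zv: "lm (fm n A) (vec n v) (vec n u) = 0" for u
    proof -
      have "lm (fm n A) (vec n (dl i)) (vec n v) = 0" if "i < n" for i
        using 0[of i] that lm_os[OF qA qB, of "b i" z] by (simp add: b_def zz vec_car)
      then have "lm (fm n A) (vec n u) (vec n v) = 0"
        by (simp add: bl_dl_l bl_right)
      then show ?thesis using lm_sym[OF qA, of "vec n v" "vec n u"] vec_car[of n] by (simp del: lm_fm)
    qed
    have zw: "lm (fm m B) (vec m w) (vec m u) = 0" for u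
    proof -
      have "lm (fm m B) (vec m (dl i)) (vec m w) = 0" if "i < m" for i
        using 0[of "n + i"] that lm_os[OF qA qB, of "b (n + i)" z] by (simp add: b_def zz vec_car)
      then have "lm (fm m B) (vec m u) (vec m w) = 0"
        by (simp add: bl_dl_l bl_right)
      then show ?thesis using lm_sym[OF qB, of "vec m w" "vec m u"] vec_car[of m] by (simp del: lm_fm)
    qed
    have "vec n v = \<zero>\<^bsub>fm n A\<^esub>"
    proof (rule lm_nondeg[OF qA])
      fix y assume "y \<in> carrier (fm n A)"
      then obtain u where "y = vec n u" using vec_ex by auto
      then show "lm (fm n A) (vec n v) y = 0" using zv by simp
    qed (simp add: vec_car)
    moreover have "vec m w = \<zero>\<^bsub>fm m B\<^esub>"
    proof (rule lm_nondeg[OF qB])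
      fix y assume "y \<in> carrier (fm m B)"
      then obtain u where "y = vec m u" using vec_ex by auto
      then show "lm (fm m B) (vec m w) y = 0" using zw by simp
    qed (simp add: vec_car)
    ultimately show "z = \<zero>\<^bsub>fm n A \<bottom> fm m B\<^esub>" by (simp add: zz)
  qed (auto simp: b_def vec_car)
  then show ?thesis unfolding eqv_def using qf_os[OF qA qB] qf_fm[OF ns] by blast
qed

lemma hyp_os: "hyp (p + q) \<doteq> hyp p \<bottom> hyp q"
proof -
  have "bs (2 * p) hy hy i j = hy i j" for i j
    by (auto simp: bs_def hy_def)
  then have "fm (2 * p + 2 * q) (bs (2 * p) hy hy) = hyp (p + q)"
    unfolding hyp_def distrib_left by (intro fm_cong)
  then show ?thesis using fm_os[OF nonsing_hy nonsing_hy, of p q] by (simp add: hyp_def)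
qed

end

context fmodel
begin

lemma hm_hy_even: "hm hy j (2 * i) = (if j = Suc (2 * i) then eps else 0)"
proof -
  have "\<not> (even j \<and> 2 * i = Suc j)" by presburger
  then show ?thesis by (auto simp: hm_hy)
qed

lemma dl_odd [simp]: "dl (2 * i) (Suc (2 * j)) = 0" "dl (Suc (2 * j)) (2 * i) = 0"
proof -
  have "2 * i \<noteq> Suc (2 * j)" by presburger
  then show "dl (2 * i) (Suc (2 * j)) = 0" "dl (Suc (2 * j)) (2 * i) = 0" unfolding dl_def by auto
qed

lemma os_fm_ex:
  assumes "x \<in> carrier (M \<bottom> fm n A)"
  shows "\<exists>u v. u \<in> carrier M \<and> x = (u, vec n v)"
proof -
  have "snd x = vec n (un \<circ> snd x)" by (rule vec_ex) (use assms in auto)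
  then have "fst x \<in> carrier M \<and> x = (fst x, vec n (un \<circ> snd x))" using assms by (auto intro: prod_eqI)
  then show ?thesis by blast
qed

subsection \<open>Lagrangians\<close>

text \<open>The even basis vectors span a Lagrangian \<open>L\<close>. It is the kernel of the
  projection \<open>h\<close> to the odd coordinates, so the quotient is free.\<close>

lemma hyp_lagrangian: "\<exists>L. lagrangian k R \<sigma> (hyp q) L"
proof -
  let ?H = "hyp q"
  have H: "qf ?H" by simp
  interpret H: abelian_group ?H using left_moduleD(2)[OF qf_module[OF H]] .
  have carH: "carrier ?H = carrier (free_module R (2 * q))" by (simp add: hyp_def)
  define h where "h x = vec q (\<lambda>i. un (x (Suc (2 * i))))" for x
  have hv: "h (vec (2 * q) v) = vec q (\<lambda>i. v (Suc (2 * i)))" for v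
    by (simp add: h_def vec_eq un_vec)
  have lin: "h \<in> linear_maps R ?H (free_module R q)"
  proof (rule semilinearI)
    fix x y assume "x \<in> carrier ?H" "y \<in> carrier ?H"
    then obtain v w where [simp]: "x = vec (2 * q) v" "y = vec (2 * q) w" using vec_ex by (metis carH)
    show "h x \<in> carrier (free_module R q)" by (simp add: h_def vec_car)
    show "h (x \<oplus>\<^bsub>?H\<^esub> y) = h x \<oplus>\<^bsub>free_module R q\<^esub> h y" by (simp add: hyp_def hv free_simps)
  next
    fix r x assume "r \<in> carrier R" "x \<in> carrier ?H"
    then obtain a v where [simp]: "r = \<rho> a" "x = vec (2 * q) v" using vec_ex rho_ex by (metis carH)
    show "h (r \<odot>\<^bsub>?H\<^esub> x) = r \<odot>\<^bsub>free_module R q\<^esub> h x"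
      using fm_simps(4)[of "2 * q" hy a v] by (simp add: hyp_def hv free_simps act_def)
  qed
  define L where "L = {x \<in> carrier ?H. h x = \<zero>\<^bsub>free_module R q\<^esub>}"
  have memL: "vec (2 * q) v \<in> L \<longleftrightarrow> (\<forall>i<q. v (Suc (2 * i)) = 0)" for v
    by (simp add: L_def carH vec_car hv free_simps vec_eq)
  have onto: "h ` carrier ?H = carrier (free_module R q)"
  proof (intro equalityI subsetI)
    fix y assume "y \<in> carrier (free_module R q)"
    then obtain v where "y = vec q v" using vec_ex by auto
    then have "y = h (vec (2 * q) (\<lambda>i. v (i div 2)))" by (simp add: hv)
    then show "y \<in> h ` carrier ?H" by (simp add: carH vec_car)
  qed (use semilinearD(1)[OF lin] in auto)
  have "module_iso R (quotient_module ?H L) (free_module R q)"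
    by (rule quotient_module_iso[OF qf_module[OF H] free_left_module lin onto L_def])
  then have sf: "fg_stably_free R (quotient_module ?H L)" by (rule free_stably_free)
  have nz: "hm hy i j = 0" if "even i" "even j" for i j using that by (auto simp: hm_hy)
  have odd0: "v i = 0" if "vec (2 * q) v \<in> L" "odd i" "i < 2 * q" for v i
    using that by (auto simp: memL elim!: oddE)
  have perp: "L = {x \<in> carrier ?H. \<forall>y\<in>L. lam ?H x y = \<zero>}"
  proof (intro equalityI subsetI CollectI conjI ballI)
    fix x assume "x \<in> L" then show "x \<in> carrier ?H" by (simp add: L_def)
  next
    fix x y assume x: "x \<in> L" and y: "y \<in> L"
    then obtain v w where [simp]: "x = vec (2 * q) v" "y = vec (2 * q) w" using vec_ex unfolding L_def carH by (metis (no_types, lifting) mem_Collect_eq)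
    have "s (v i) * hm hy i j * w j = 0" if "i < 2 * q" "j < 2 * q" for i j
      using odd0[of v i] odd0[of w j] nz[of i j] x y that by (cases "even i"; cases "even j") simp_all
    then have "bl (2 * q) (hm hy) v w = 0" by (simp add: bl_def)
    then show "lam ?H x y = \<zero>" by (simp add: hyp_def lam_fm rho_zero)
  next
    fix x assume "x \<in> {x \<in> carrier ?H. \<forall>y\<in>L. lam ?H x y = \<zero>}"
    then have x: "x \<in> carrier ?H" "\<And>y. y \<in> L \<Longrightarrow> lam ?H x y = \<zero>" by auto
    then obtain v where [simp]: "x = vec (2 * q) v" using vec_ex carH by metis
    have "v (Suc (2 * i)) = 0" if i: "i < q" for i
    proof -
      have "vec (2 * q) (dl (2 * i)) \<in> L" by (simp add: memL)
      then have "\<rho> (bl (2 * q) (hm hy) v (dl (2 * i))) = \<rho> 0"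
        using x(2)[of "vec (2 * q) (dl (2 * i))"] by (simp add: hyp_def lam_fm rho_zero del: rho_inj)
      then have "(\<Sum>j<2 * q. s (v j) * hm hy j (2 * i)) = 0" using i by (simp add: bl_dl_r)
      moreover have "(\<Sum>j<2 * q. s (v j) * hm hy j (2 * i)) = (\<Sum>j<2 * q. if j = Suc (2 * i) then s (v j) * eps else 0)"
        by (intro sum.cong refl) (simp add: hm_hy_even)
      ultimately have "s (v (Suc (2 * i))) * eps = 0" using i by simp
      then have "s (s (v (Suc (2 * i))) * eps * eps) = 0" by simp
      then show ?thesis by (simp add: mult.assoc)
    qed
    then show "x \<in> L" by (simp add: memL)
  qed
  have muL: "mu ?H x = indeterminacy R \<sigma> k" if x: "x \<in> L" for x
  proof -
    obtain v where [simp]: "x = vec (2 * q) v" using vec_ex x unfolding L_def carH by (metis (no_types, lifting) mem_Collect_eq)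
    have "s (v i) * hy i j * v j = 0" if "i < 2 * q" "j < 2 * q" for i j
      using odd0[of v j] x that by (auto simp: hy_def)
    then have "bl (2 * q) hy v v = 0" by (simp add: bl_def)
    then show ?thesis by (simp add: hyp_def cs_zero)
  qed
  have sub: "submodule L R ?H"
  proof (intro submodule.intro submodule_axioms.intro subgroup.intro)
    show "L \<subseteq> carrier (add_monoid ?H)" by (auto simp: L_def)
    show "\<one>\<^bsub>add_monoid ?H\<^esub> \<in> L" by (simp add: hyp_def memL)
    fix x y assume "x \<in> L" "y \<in> L"
    then obtain v w where "x = vec (2 * q) v" "y = vec (2 * q) w" "x \<in> L" "y \<in> L"
      using vec_ex unfolding L_def carH by (metis (no_types, lifting) mem_Collect_eq)
    then show "x \<otimes>\<^bsub>add_monoid ?H\<^esub> y \<in> L" by (simp add: hyp_def memL)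
  next
    fix x assume x: "x \<in> L"
    then have xc: "x \<in> carrier ?H" by (simp add: L_def)
    have "h (\<ominus>\<^bsub>?H\<^esub> x) \<oplus>\<^bsub>free_module R q\<^esub> \<zero>\<^bsub>free_module R q\<^esub> = \<zero>\<^bsub>free_module R q\<^esub>"
      using semilinearD(2)[OF lin, of "\<ominus>\<^bsub>?H\<^esub> x" x] x xc linear_zero[OF qf_module[OF H] free_left_module lin]
      by (simp add: L_def H.l_neg)
    then have "h (\<ominus>\<^bsub>?H\<^esub> x) = \<zero>\<^bsub>free_module R q\<^esub>"
      using semilinearD(1)[OF lin, of "\<ominus>\<^bsub>?H\<^esub> x"] xc
      by (simp add: abelian_monoid.r_zero[OF abelian_group.axioms(1)[OF left_moduleD(2)[OF free_left_module]]])
    then show "inv\<^bsub>add_monoid ?H\<^esub> x \<in> L" using xc by (simp add: L_def a_inv_def[symmetric])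
  next
    fix a x assume "a \<in> carrier R" "x \<in> L"
    then obtain v r where "x = vec (2 * q) v" "x \<in> L" "a = \<rho> r"
      using vec_ex rho_ex unfolding L_def carH by (metis (no_types, lifting) mem_Collect_eq)
    then show "a \<odot>\<^bsub>?H\<^esub> x \<in> L" using fm_simps(4)[of "2 * q" hy r v] by (simp add: hyp_def memL act_def)
  qed
  show ?thesis unfolding lagrangian_def using sub sf muL perp by blast
qed

text \<open>Stable freeness gives an isomorphism from \<open>M\<close> plus a free module of rank
  \<open>m\<close> to one of rank \<open>n\<close>. Adding \<open>hyp m\<close> provides 2m further
  coordinates: the even ones enter this isomorphism and yield \<open>n\<close> coordinates, and the
  odd ones are kept as the other \<open>m\<close>.\<close>

lemma stabilize:
  assumes "nonsingular_form k R \<sigma> M"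
  shows "\<exists>m n A. nonsing n A \<and> fm n A \<doteq> M \<bottom> hyp m"
proof -
  have M: "qf M" by (rule form_qf[OF assms])
  have "fg_stably_free R M" using assms unfolding nonsingular_form_def nonsingular_form_axioms_def by blast
  then obtain m n h where h: "h \<in> linear_maps R (direct_sum M (free_module R m)) (free_module R n)"
    and bij: "bij_betw h (carrier (direct_sum M (free_module R m))) (carrier (free_module R n))"
    and lm: "left_module R (direct_sum M (free_module R m))"
    unfolding fg_stably_free_def module_iso_def by blast
  note hD = semilinearD[OF h, simplified]
  have hadd: "h (x \<oplus>\<^bsub>M\<^esub> y, vec m (\<lambda>i. v i + w i)) = h (x, vec m v) \<oplus>\<^bsub>free_module R n\<^esub> h (y, vec m w)"
    if "x \<in> carrier M" "y \<in> carrier M" for x y v w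
    using hD(2)[of "(x, vec m v)" "(y, vec m w)"] that by (simp add: vec_car free_simps)
  have hact: "h (act M a x, vec m (\<lambda>i. a * v i)) = \<rho> a \<odot>\<^bsub>free_module R n\<^esub> h (x, vec m v)"
    if "x \<in> carrier M" for x a v
    using hD(3)[of "\<rho> a" "(x, vec m v)"] that by (simp add: vec_car free_simps act_def)
  have hex: "\<exists>u. h (x, vec m v) = vec n u" if "x \<in> carrier M" for x v
    proof -
    have "h (x, vec m v) \<in> carrier (free_module R n)" using hD(1)[of "(x, vec m v)"] that vec_car by simp
    from vec_ex[OF this] show ?thesis by blast
  qed
  let ?S = "M \<bottom> hyp m"
  have S: "qf ?S" by (simp add: qf_os M)
  have carS: "\<exists>u v. u \<in> carrier M \<and> x = (u, vec (2 * m) v)" if "x \<in> carrier ?S" for x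
    using os_fm_ex that by (simp add: hyp_def)
  define c where "c x i = (if i < n then un (h (fst x, vec m (\<lambda>j. un (snd x (2 * j)))) i)
      else un (snd x (Suc (2 * (i - n)))))" for x i
  have cv: "c (x, vec (2 * m) v) i = (if i < n then un (h (x, vec m (\<lambda>j. v (2 * j))) i) else v (Suc (2 * (i - n))))"
    if "i < n + m" for x v i
  proof -
    have "vec m (\<lambda>j. un (vec (2 * m) v (2 * j))) = vec m (\<lambda>j. v (2 * j))" by (simp add: vec_eq un_vec)
    moreover have "\<not> i < n \<Longrightarrow> Suc (2 * (i - n)) < 2 * m" using that by linarith
    ultimately show ?thesis unfolding c_def by (simp add: un_vec)
  qed
  have "\<exists>A. nonsing (n + m) A \<and> fm (n + m) A \<doteq> ?S"
  proof (rule coord_iso[OF S, where c = c])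
    fix x y i assume "x \<in> carrier ?S" "y \<in> carrier ?S" and i: "i < n + m"
    then obtain u v u' v' where u: "u \<in> carrier M" "u' \<in> carrier M"
      and [simp]: "x = (u, vec (2 * m) v)" "y = (u', vec (2 * m) v')" using carS by meson
    obtain z z' where "h (u, vec m (\<lambda>j. v (2 * j))) = vec n z" "h (u', vec m (\<lambda>j. v' (2 * j))) = vec n z'"
      using hex u by meson
    then show "c (x \<oplus>\<^bsub>?S\<^esub> y) i = c x i + c y i"
      using i u by (simp add: hyp_def cv hadd free_simps un_vec)
  next
    fix a x i assume "x \<in> carrier ?S" and i: "i < n + m"
    then obtain u v where u: "u \<in> carrier M" and [simp]: "x = (u, vec (2 * m) v)" using carS by meson
    obtain z where "h (u, vec m (\<lambda>j. v (2 * j))) = vec n z" using hex u by meson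
    then show "c (act ?S a x) i = a * c x i"
      using i u by (simp add: hyp_def cv hact free_simps un_vec)
  next
    fix v :: "nat \<Rightarrow> 'b"
    have "vec n v \<in> h ` carrier (direct_sum M (free_module R m))" using bij vec_car[of n v] unfolding bij_betw_def by blast
    then obtain u x where u: "u \<in> carrier M" "x \<in> carrier (free_module R m)" "h (u, x) = vec n v" by auto
    then obtain w where w: "x = vec m w" using vec_ex by blast
    let ?w = "\<lambda>i. if even i then w (i div 2) else v (n + i div 2)"
    show "\<exists>x\<in>carrier ?S. \<forall>i<n + m. c x i = v i"
      by (rule bexI[of _ "(u, vec (2 * m) ?w)"]) (use u in \<open>simp_all add: cv w un_vec hyp_def vec_car\<close>)
  next
    fix x assume "x \<in> carrier ?S" and 0: "\<forall>i<n + m. c x i = 0"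
    then obtain u v where u: "u \<in> carrier M" and [simp]: "x = (u, vec (2 * m) v)" using carS by meson
    obtain z where z: "h (u, vec m (\<lambda>j. v (2 * j))) = vec n z" using hex u by meson
    have zi: "z i = 0" if "i < n" for i using 0[rule_format, of i] that by (simp add: cv z un_vec)
    have "h (u, vec m (\<lambda>j. v (2 * j))) = h (\<zero>\<^bsub>M\<^esub>, vec m (\<lambda>_. 0))"
      using linear_zero[OF lm free_left_module h] zi by (simp add: z free_simps vec_eq)
    then have "(u, vec m (\<lambda>j. v (2 * j))) = (\<zero>\<^bsub>M\<^esub>, vec m (\<lambda>_. 0))"
      by (rule inj_onD[OF bij_betw_imp_inj_on[OF bij]]) (simp_all add: u zero_car[OF M] vec_car)
    then have u0: "u = \<zero>\<^bsub>M\<^esub>" and ev: "\<And>j. j < m \<Longrightarrow> v (2 * j) = 0" by (auto simp: vec_eq)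
    have od: "v (Suc (2 * j)) = 0" if "j < m" for j using 0[rule_format, of "n + j"] that by (simp add: cv)
    have "v i = 0" if "i < 2 * m" for i
      using that ev[of "i div 2"] od[of "i div 2"] by (cases "even i") (auto elim!: evenE oddE)
    then show "x = \<zero>\<^bsub>?S\<^esub>" by (simp add: u0 hyp_def vec_eq)
  qed
  then show ?thesis by blast
qed

text \<open>The quotient by \<open>L\<close> is only stably free. In \<open>M\<close> plus
  \<open>hyp p\<close>, the sum of \<open>L\<close> and the span of the even basis vectors is a
  Lagrangian whose quotient is that by \<open>L\<close> plus a free module of rank \<open>p\<close>,
  hence free, and \<open>metabolic_iso\<close> applies.\<close>

lemma metabolic_stable:
  assumes M: "nonsingular_form k R \<sigma> M" and L: "lagrangian k R \<sigma> M L"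
  shows "\<exists>p q. hyp q \<doteq> M \<bottom> hyp p"
proof -
  have qM: "qf M" by (rule form_qf[OF M])
  have sub: "submodule L R M" and perp: "L = {x \<in> carrier M. \<forall>y\<in>L. lam M x y = \<zero>}"
    and muL: "\<forall>x\<in>L. mu M x = indeterminacy R \<sigma> k" and sf: "fg_stably_free R (quotient_module M L)"
    using L unfolding lagrangian_def by blast+
  note MD = left_moduleD[OF qf_module[OF qM]]
  interpret A: abelian_group M by (rule MD(2))
  interpret S: abelian_subgroup L M
    by (rule abelian_subgroupI3) (auto intro!: additive_subgroup.intro submodule.axioms(1)[OF sub] A.abelian_group_axioms)
  let ?Q = "quotient_module M L"
  obtain p q h where h: "h \<in> linear_maps R (direct_sum ?Q (free_module R p)) (free_module R q)"
    and bij: "bij_betw h (carrier (direct_sum ?Q (free_module R p))) (carrier (free_module R q))"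
    and lm: "left_module R (direct_sum ?Q (free_module R p))"
    using sf unfolding fg_stably_free_def module_iso_def by blast
  have Qc: "carrier ?Q = {L +>\<^bsub>M\<^esub> x |x. x \<in> carrier M}" by (auto simp: quotient_module_def A_RCOSETS_def')
  have Qadd: "(L +>\<^bsub>M\<^esub> x) \<oplus>\<^bsub>?Q\<^esub> (L +>\<^bsub>M\<^esub> y) = L +>\<^bsub>M\<^esub> (x \<oplus>\<^bsub>M\<^esub> y)" if "x \<in> carrier M" "y \<in> carrier M" for x y
    using that by (simp add: quotient_module_def S.a_rcos_sum)
  have Qact: "\<rho> a \<odot>\<^bsub>?Q\<^esub> (L +>\<^bsub>M\<^esub> x) = L +>\<^bsub>M\<^esub> (act M a x)" if x: "x \<in> carrier M" for a x
  proof -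
    have "L +>\<^bsub>M\<^esub> (\<rho> a \<odot>\<^bsub>M\<^esub> y) = L +>\<^bsub>M\<^esub> (act M a x)" if y: "y \<in> L +>\<^bsub>M\<^esub> x" for y
    proof -
      obtain l where l: "l \<in> L" "y = l \<oplus>\<^bsub>M\<^esub> x" using y by (auto simp: a_r_coset_def')
      have "\<rho> a \<odot>\<^bsub>M\<^esub> y = \<rho> a \<odot>\<^bsub>M\<^esub> l \<oplus>\<^bsub>M\<^esub> act M a x" using l x by (simp add: MD(5) act_def)
      then have "\<rho> a \<odot>\<^bsub>M\<^esub> y \<in> L +>\<^bsub>M\<^esub> (act M a x)"
        using submodule.smult_closed[OF sub rho_car l(1), of a] unfolding a_r_coset_def' by blast
      then show ?thesis using S.a_repr_independence'[of _ "act M a x"] act_car[OF qM x] by metis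
    qed
    moreover have "x \<in> L +>\<^bsub>M\<^esub> x" using x by (rule S.a_rcos_self)
    ultimately show ?thesis unfolding quotient_module_def by auto
  qed
  have Q0: "\<zero>\<^bsub>?Q\<^esub> = L" by (simp add: quotient_module_def)
  have Lx: "L +>\<^bsub>M\<^esub> x = L \<longleftrightarrow> x \<in> L" if "x \<in> carrier M" for x
    using that S.a_rcos_self[of x] S.a_rcos_const[of x] by auto
  note hD = semilinearD[OF h, simplified]
  have hadd: "h (L +>\<^bsub>M\<^esub> (x \<oplus>\<^bsub>M\<^esub> y), vec p (\<lambda>i. v i + w i)) = h (L +>\<^bsub>M\<^esub> x, vec p v) \<oplus>\<^bsub>free_module R q\<^esub> h (L +>\<^bsub>M\<^esub> y, vec p w)"
    if "x \<in> carrier M" "y \<in> carrier M" for x y v w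
    using hD(2)[of "(L +>\<^bsub>M\<^esub> x, vec p v)" "(L +>\<^bsub>M\<^esub> y, vec p w)"] that by (auto simp add: vec_car free_simps Qadd Qc)
  have hact: "h (L +>\<^bsub>M\<^esub> (act M a x), vec p (\<lambda>i. a * v i)) = \<rho> a \<odot>\<^bsub>free_module R q\<^esub> h (L +>\<^bsub>M\<^esub> x, vec p v)"
    if "x \<in> carrier M" for x a v
    using hD(3)[of "\<rho> a" "(L +>\<^bsub>M\<^esub> x, vec p v)"] that by (auto simp add: vec_car free_simps Qact Qc)
  have hex: "\<exists>u. h (L +>\<^bsub>M\<^esub> x, vec p v) = vec q u" if "x \<in> carrier M" for x v
    proof -
    have "h (L +>\<^bsub>M\<^esub> x, vec p v) \<in> carrier (free_module R q)"
      using hD(1)[of "(L +>\<^bsub>M\<^esub> x, vec p v)"] that vec_car Qc by auto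
    from vec_ex[OF this] show ?thesis by blast
  qed
  let ?S = "M \<bottom> hyp p"
  have qS: "qf ?S" by (simp add: qf_os qM)
  have carS: "\<exists>u v. u \<in> carrier M \<and> x = (u, vec (2 * p) v)" if "x \<in> carrier ?S" for x
    using os_fm_ex that by (simp add: hyp_def)
  define c where "c x i = un (h (L +>\<^bsub>M\<^esub> fst x, vec p (\<lambda>j. un (snd x (Suc (2 * j))))) i)" for x i
  have cv: "c (x, vec (2 * p) v) i = un (h (L +>\<^bsub>M\<^esub> x, vec p (\<lambda>j. v (Suc (2 * j)))) i)" for x v i
  proof -
    have "vec p (\<lambda>j. un (vec (2 * p) v (Suc (2 * j)))) = vec p (\<lambda>j. v (Suc (2 * j)))" by (simp add: vec_eq un_vec)
    then show ?thesis unfolding c_def by simp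
  qed
  have K: "(\<forall>i<q. c (u, vec (2 * p) v) i = 0) \<longleftrightarrow> u \<in> L \<and> (\<forall>j<p. v (Suc (2 * j)) = 0)" if u: "u \<in> carrier M" for u v
  proof -
    obtain z where z: "h (L +>\<^bsub>M\<^esub> u, vec p (\<lambda>j. v (Suc (2 * j)))) = vec q z" using hex[OF u] by blast
    have "(\<forall>i<q. c (u, vec (2 * p) v) i = 0) \<longleftrightarrow> vec q z = vec q (\<lambda>_. 0)" by (simp add: cv z un_vec vec_eq)
    also have "\<dots> \<longleftrightarrow> h (L +>\<^bsub>M\<^esub> u, vec p (\<lambda>j. v (Suc (2 * j)))) = h (L, vec p (\<lambda>_. 0))"
      using linear_zero[OF lm free_left_module h] by (simp add: z free_simps Q0)
    also have "\<dots> \<longleftrightarrow> (L +>\<^bsub>M\<^esub> u, vec p (\<lambda>j. v (Suc (2 * j)))) = (L, vec p (\<lambda>_. 0))"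
    proof (rule inj_on_eq_iff[OF bij_betw_imp_inj_on[OF bij]])
      show "(L, vec p (\<lambda>_. 0)) \<in> carrier (direct_sum ?Q (free_module R p))"
        using Lx[of "\<zero>\<^bsub>M\<^esub>"] S.zero_closed Qc by (auto simp: vec_car)
    qed (use u Qc in \<open>auto simp: vec_car\<close>)
    also have "\<dots> \<longleftrightarrow> u \<in> L \<and> (\<forall>j<p. v (Suc (2 * j)) = 0)" by (simp add: Lx[OF u] vec_eq)
    finally show ?thesis .
  qed
  have odd0: "v i = 0" if "\<forall>j<p. v (Suc (2 * j)) = 0" "odd i" "i < 2 * p" for v :: "nat \<Rightarrow> 'b" and i
    using that by (auto elim!: oddE)
  have "hyp q \<doteq> ?S"
  proof (rule metabolic_iso[OF qS, where c = c])
    fix x y i assume "x \<in> carrier ?S" "y \<in> carrier ?S" and i: "i < q"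
    then obtain u v u' v' where u: "u \<in> carrier M" "u' \<in> carrier M"
      and [simp]: "x = (u, vec (2 * p) v)" "y = (u', vec (2 * p) v')" using carS by meson
    obtain z z' where "h (L +>\<^bsub>M\<^esub> u, vec p (\<lambda>j. v (Suc (2 * j)))) = vec q z" "h (L +>\<^bsub>M\<^esub> u', vec p (\<lambda>j. v' (Suc (2 * j)))) = vec q z'"
      using hex u by meson
    then show "c (x \<oplus>\<^bsub>?S\<^esub> y) i = c x i + c y i"
      using i u by (simp add: hyp_def cv hadd free_simps un_vec)
  next
    fix a x i assume "x \<in> carrier ?S" and i: "i < q"
    then obtain u v where u: "u \<in> carrier M" and [simp]: "x = (u, vec (2 * p) v)" using carS by meson
    obtain z where "h (L +>\<^bsub>M\<^esub> u, vec p (\<lambda>j. v (Suc (2 * j)))) = vec q z" using hex u by meson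
    then show "c (act ?S a x) i = a * c x i"
      using i u by (simp add: hyp_def cv hact free_simps un_vec)
  next
    fix v :: "nat \<Rightarrow> 'b"
    have "vec q v \<in> h ` carrier (direct_sum ?Q (free_module R p))" using bij vec_car[of q v] unfolding bij_betw_def by blast
    then obtain u x where u: "u \<in> carrier M" "x \<in> carrier (free_module R p)" "h (L +>\<^bsub>M\<^esub> u, x) = vec q v" by (auto simp: Qc)
    then obtain w where w: "x = vec p w" using vec_ex by blast
    show "\<exists>x\<in>carrier ?S. \<forall>i<q. c x i = v i"
      by (rule bexI[of _ "(u, vec (2 * p) (\<lambda>i. w (i div 2)))"]) (use u in \<open>simp_all add: cv w un_vec hyp_def vec_car\<close>)
  next
    fix x assume "x \<in> carrier ?S" and 0: "\<forall>i<q. c x i = 0"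
    then obtain u v where u: "u \<in> carrier M" and [simp]: "x = (u, vec (2 * p) v)" using carS by meson
    have uL: "u \<in> L" and v: "\<forall>j<p. v (Suc (2 * j)) = 0" using 0 K[OF u] by auto
    have "s (v i) * hy i j * v j = 0" if "i < 2 * p" "j < 2 * p" for i j
      using odd0[OF v, of j] that by (auto simp: hy_def)
    then have "bl (2 * p) hy v v = 0" by (simp add: bl_def)
    then show "mu ?S x = cs 0" using muL uL mu_os[of M x 0 "hyp p" 0] by (simp add: cs_zero hyp_def)
  next
    fix x y assume "x \<in> carrier ?S" and 0: "\<forall>i<q. c x i = 0" and "y \<in> carrier ?S" and nz: "\<forall>i<q. c y i = 0"
    then obtain u v u' v' where u: "u \<in> carrier M" "u' \<in> carrier M"
      and [simp]: "x = (u, vec (2 * p) v)" "y = (u', vec (2 * p) v')" using carS by meson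
    have uL: "u \<in> L" and v: "\<forall>j<p. v (Suc (2 * j)) = 0" using 0 K[OF u(1)] by auto
    have uL': "u' \<in> L" and v': "\<forall>j<p. v' (Suc (2 * j)) = 0" using nz K[OF u(2)] by auto
    have "s (v i) * hm hy i j * v' j = 0" if "i < 2 * p" "j < 2 * p" for i j
      using odd0[OF v, of i] odd0[OF v', of j] that by (auto simp: hm_hy)
    then have "bl (2 * p) (hm hy) v v' = 0" by (simp add: bl_def)
    moreover have "lam M u u' = \<rho> 0" using uL uL' perp by (simp add: rho_zero) blast
    ultimately show "lm ?S x y = 0" using u
      by (subst lm_os[OF qM qf_hyp]) (simp_all add: hyp_def vec_car lm_def[of M])
  next
    fix x assume "x \<in> carrier ?S"
      and 0: "\<And>y. y \<in> carrier ?S \<Longrightarrow> \<forall>i<q. c y i = 0 \<Longrightarrow> lm ?S x y = 0"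
    then obtain u v where u: "u \<in> carrier M" and [simp]: "x = (u, vec (2 * p) v)" using carS by meson
    have "lam M u l = \<zero>" if l: "l \<in> L" for l
    proof -
      have lc: "l \<in> carrier M" using l S.a_Hcarr by blast
      have "lm ?S x (l, vec (2 * p) (\<lambda>_. 0)) = 0"
        by (rule 0) (use l lc K[OF lc] in \<open>auto simp: hyp_def vec_car\<close>)
      then have "lm M u l = 0" using u lc by (subst (asm) lm_os[OF qM qf_hyp]) (simp_all add: hyp_def vec_car)
      then have "\<rho> (lm M u l) = \<rho> 0" by simp
      then show ?thesis using u lc by (simp add: lm_def lam_car[OF qM] rho_zero del: rho_inj)
    qed
    then have "u \<in> L" using perp u by blast
    moreover have "v (Suc (2 * i)) = 0" if i: "i < p" for i
    proof -
      have "lm ?S x (\<zero>\<^bsub>M\<^esub>, vec (2 * p) (dl (2 * i))) = 0"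
        by (rule 0) (use K[of "\<zero>\<^bsub>M\<^esub>"] S.zero_closed in \<open>auto simp: hyp_def vec_car zero_car[OF qM]\<close>)
      then have "bl (2 * p) (hm hy) v (dl (2 * i)) = 0"
        using u by (subst (asm) lm_os[OF qM qf_hyp]) (simp_all add: hyp_def vec_car zero_car[OF qM] lm_zero_r[OF qM])
      then have "(\<Sum>j<2 * p. s (v j) * hm hy j (2 * i)) = 0" using i by (simp add: bl_dl_r)
      moreover have "(\<Sum>j<2 * p. s (v j) * hm hy j (2 * i)) = (\<Sum>j<2 * p. if j = Suc (2 * i) then s (v j) * eps else 0)"
        by (intro sum.cong refl) (simp add: hm_hy_even)
      ultimately have "s (v (Suc (2 * i))) * eps = 0" using i by simp
      then have "s (s (v (Suc (2 * i))) * eps * eps) = 0" by simp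
      then show ?thesis by (simp add: mult.assoc)
    qed
    ultimately show "\<forall>i<q. c x i = 0" using K[OF u] by simp
  qed
  then show ?thesis by blast
qed

subsection \<open>Stable isometry\<close>

definition steq :: "('a, 'm, 'y) qform_scheme \<Rightarrow> ('a, 'n, 'z) qform_scheme \<Rightarrow> bool" where
  "steq M N \<longleftrightarrow> (\<exists>a b. M \<bottom> hyp a \<doteq> N \<bottom> hyp b)"

lemma hyp_shift: "qf M \<Longrightarrow> M \<bottom> hyp (a + b) \<doteq> (M \<bottom> hyp a) \<bottom> hyp b"
  by (rule eqv_trans[OF eqv_cong[OF eqv_refl hyp_os] eqv_sym[OF eqv_assoc]]) simp_all

lemma steq_sym: "steq M N \<Longrightarrow> steq N M"
  unfolding steq_def using eqv_sym by blast

lemma steq_trans: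
  assumes M: "qf M" and N: "qf N" and P: "qf P" and "steq M N" "steq N P"
  shows "steq M P"
proof -
  obtain a b a' b' where 1: "M \<bottom> hyp a \<doteq> N \<bottom> hyp b" and 2: "N \<bottom> hyp a' \<doteq> P \<bottom> hyp b'"
    using assms(4,5) unfolding steq_def by blast
  have "M \<bottom> hyp (a + a') \<doteq> (M \<bottom> hyp a) \<bottom> hyp a'" by (rule hyp_shift[OF M])
  also have "\<dots> \<doteq> (N \<bottom> hyp b) \<bottom> hyp a'" by (rule eqv_cong[OF 1 eqv_refl[OF qf_hyp]])
  also have "\<dots> \<doteq> N \<bottom> hyp (b + a')" by (rule eqv_sym[OF hyp_shift[OF N]])
  also have "\<dots> \<doteq> (N \<bottom> hyp a') \<bottom> hyp b" using hyp_shift[OF N, of a' b] by (simp add: add.commute)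
  also have "\<dots> \<doteq> (P \<bottom> hyp b') \<bottom> hyp b" by (rule eqv_cong[OF 2 eqv_refl[OF qf_hyp]])
  also have "\<dots> \<doteq> P \<bottom> hyp (b' + b)" by (rule eqv_sym[OF hyp_shift[OF P]])
  finally show ?thesis unfolding steq_def by blast
qed

lemma eqv_steq: "M \<doteq> N \<Longrightarrow> steq M N"
  unfolding steq_def by (intro exI[of _ 0] eqv_cong eqv_refl) simp_all

lemma steq_hyp: "qf M \<Longrightarrow> steq (M \<bottom> hyp m) M"
  unfolding steq_def by (intro exI[of _ 0] exI[of _ m] eqv_trans[OF eqv_sym[OF hyp_shift]]) (simp_all add: eqv_refl qf_os)

lemma os_hyp_swap:
  assumes A: "qf A" and B: "qf B"
  shows "(A \<bottom> B) \<bottom> (hyp a \<bottom> hyp b) \<doteq> (A \<bottom> hyp a) \<bottom> (B \<bottom> hyp b)"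
proof -
  note q = A B qf_os qf_hyp
  have "(A \<bottom> B) \<bottom> (hyp a \<bottom> hyp b) \<doteq> A \<bottom> (B \<bottom> (hyp a \<bottom> hyp b))" by (intro eqv_assoc q)
  also have "\<dots> \<doteq> A \<bottom> ((B \<bottom> hyp a) \<bottom> hyp b)" by (intro eqv_cong eqv_refl eqv_sym[OF eqv_assoc] q)
  also have "\<dots> \<doteq> A \<bottom> ((hyp a \<bottom> B) \<bottom> hyp b)" by (intro eqv_cong eqv_refl eqv_comm q)
  also have "\<dots> \<doteq> A \<bottom> (hyp a \<bottom> (B \<bottom> hyp b))" by (intro eqv_cong eqv_refl eqv_assoc q)
  also have "\<dots> \<doteq> (A \<bottom> hyp a) \<bottom> (B \<bottom> hyp b)" by (intro eqv_sym[OF eqv_assoc] q)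
  finally show ?thesis .
qed

lemma steq_cong:
  assumes M: "qf M" and N: "qf N" and M': "qf M'" and N': "qf N'" and "steq M M'" "steq N N'"
  shows "steq (M \<bottom> N) (M' \<bottom> N')"
proof -
  obtain a b a' b' where 1: "M \<bottom> hyp a \<doteq> M' \<bottom> hyp b" and 2: "N \<bottom> hyp a' \<doteq> N' \<bottom> hyp b'"
    using assms(5,6) unfolding steq_def by blast
  have "(M \<bottom> N) \<bottom> hyp (a + a') \<doteq> (M \<bottom> N) \<bottom> (hyp a \<bottom> hyp a')"
    by (intro eqv_cong eqv_refl hyp_os qf_os M N)
  also have "\<dots> \<doteq> (M \<bottom> hyp a) \<bottom> (N \<bottom> hyp a')" by (rule os_hyp_swap[OF M N])
  also have "\<dots> \<doteq> (M' \<bottom> hyp b) \<bottom> (N' \<bottom> hyp b')" by (rule eqv_cong[OF 1 2])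
  also have "\<dots> \<doteq> (M' \<bottom> N') \<bottom> (hyp b \<bottom> hyp b')" by (rule eqv_sym[OF os_hyp_swap[OF M' N']])
  also have "\<dots> \<doteq> (M' \<bottom> N') \<bottom> hyp (b + b')"
    by (intro eqv_cong eqv_refl eqv_sym[OF hyp_os] qf_os M' N')
  finally show ?thesis unfolding steq_def by blast
qed

lemma metabolic_steq:
  assumes "nonsingular_form k R \<sigma> M" "lagrangian k R \<sigma> M L"
  shows "steq M (hyp 0)"
proof -
  obtain p q where "hyp q \<doteq> M \<bottom> hyp p" using metabolic_stable[OF assms] by blast
  then have "M \<bottom> hyp p \<doteq> hyp (0 + q)" using eqv_sym by simp
  from eqv_trans[OF this hyp_os] show ?thesis unfolding steq_def by blast
qed

lemma steq_os_metabolic: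
  assumes M: "qf M" and M0: "qf M0" and 0: "steq M0 (hyp 0)"
  shows "steq M (M \<bottom> M0)"
proof -
  have "steq M (M \<bottom> hyp 0)" by (rule steq_sym[OF steq_hyp[OF M]])
  moreover have "steq (M \<bottom> hyp 0) (M \<bottom> M0)"
    by (rule steq_cong[OF M qf_hyp M M0 eqv_steq[OF eqv_refl[OF M]] steq_sym[OF 0]])
  ultimately show ?thesis by (rule steq_trans[OF M qf_os[OF M qf_hyp] qf_os[OF M M0]])
qed

text \<open>Forms with a Lagrangian become hyperbolic after adding a hyperbolic form, and hyperbolic
  forms have Lagrangians. So the arbitrary metabolic summands in \<open>witt_equivalent\<close> can
  be replaced by forms given by explicit matrices.\<close>

lemma witt_steq:
  assumes M: "qf M" and N: "qf N"
  shows "witt_equivalent k R \<sigma> M N \<longleftrightarrow> steq M N"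
proof
  assume "witt_equivalent k R \<sigma> M N"
  then obtain M0 N0 :: "('a, nat \<Rightarrow> 'a) qform" where
    fM: "nonsingular_form k R \<sigma> M0" and fN: "nonsingular_form k R \<sigma> N0"
    and L: "\<exists>L. lagrangian k R \<sigma> M0 L" "\<exists>L. lagrangian k R \<sigma> N0 L"
    and iso: "isometric R (M \<bottom> M0) (N \<bottom> N0)"
    unfolding witt_equivalent_def by blast
  note qM0 = form_qf[OF fM] and qN0 = form_qf[OF fN]
  have M0: "steq M0 (hyp 0)" and N0: "steq N0 (hyp 0)" using metabolic_steq fM fN L by blast+
  have "M \<bottom> M0 \<doteq> N \<bottom> N0" using iso unfolding eqv_def by (simp add: qf_os M N qM0 qN0)
  then have "steq (M \<bottom> M0) (N \<bottom> N0)" by (rule eqv_steq)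
  from steq_trans[OF M qf_os[OF M qM0] qf_os[OF N qN0] steq_os_metabolic[OF M qM0 M0] this]
  have "steq M (N \<bottom> N0)" .
  from steq_trans[OF M qf_os[OF N qN0] N this steq_sym[OF steq_os_metabolic[OF N qN0 N0]]]
  show "steq M N" .
next
  assume "steq M N"
  then obtain a b where "M \<bottom> hyp a \<doteq> N \<bottom> hyp b" unfolding steq_def by blast
  then show "witt_equivalent k R \<sigma> M N"
    unfolding witt_equivalent_def eqv_def
    by (intro exI[of _ "hyp a"] exI[of _ "hyp b"] conjI hyp_form hyp_lagrangian) blast
qed

end

context fmodel
begin

subsection \<open>The Witt group\<close>

definition cl :: "nat \<Rightarrow> (nat \<Rightarrow> nat \<Rightarrow> 'b) \<Rightarrow> ('a, nat \<Rightarrow> 'a) qform set" where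
  "cl n A = witt_class k R \<sigma> (fm n A)"

abbreviation LG where "LG \<equiv> L_group k R \<sigma>"

lemma witt_class_eqI:
  assumes "qf M" "qf N" "steq M N"
  shows "witt_class k R \<sigma> M = witt_class k R \<sigma> N"
proof -
  have "steq M P \<longleftrightarrow> steq N P" if "qf P" for P :: "('a, nat \<Rightarrow> 'a) qform"
    using steq_trans[OF assms(2,1) that steq_sym[OF assms(3)]] steq_trans[OF assms(1,2) that assms(3)] by blast
  then show ?thesis unfolding witt_class_def using witt_steq[OF assms(1)] witt_steq[OF assms(2)] form_qf by blast
qed

lemma mem_cl: "nonsing n A \<Longrightarrow> M \<in> cl n A \<longleftrightarrow> nonsingular_form k R \<sigma> M \<and> steq (fm n A) M"
  unfolding cl_def witt_class_def using witt_steq[OF qf_fm] form_qf by blast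

lemma fm_mem_cl: "nonsing n A \<Longrightarrow> fm n A \<in> cl n A"
  by (simp add: mem_cl fm_form eqv_steq eqv_refl qf_fm)

lemma cl_eq:
  assumes "nonsing n A" "nonsing p C"
  shows "cl n A = cl p C \<longleftrightarrow> steq (fm n A) (fm p C)"
proof
  assume "cl n A = cl p C"
  then have "fm p C \<in> cl n A" using fm_mem_cl[OF assms(2)] by simp
  then show "steq (fm n A) (fm p C)" by (simp add: mem_cl assms)
next
  assume "steq (fm n A) (fm p C)"
  then show "cl n A = cl p C" unfolding cl_def by (intro witt_class_eqI qf_fm assms)
qed

lemma cl_eqI: "fm n A \<doteq> fm p C \<Longrightarrow> cl n A = cl p C"
  unfolding cl_def using witt_class_eqI eqv_steq eqv_qf by blast

lemma form_class:
  assumes "nonsingular_form k R \<sigma> M"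
  shows "\<exists>n A. nonsing n A \<and> witt_class k R \<sigma> M = cl n A \<and> steq (fm n A) M"
proof -
  have M: "qf M" by (rule form_qf[OF assms])
  obtain m n A where A: "nonsing n A" and "fm n A \<doteq> M \<bottom> hyp m" using stabilize[OF assms] by blast
  then have "steq (fm n A) M"
    using steq_trans[OF qf_fm qf_os[OF M qf_hyp] M eqv_steq steq_hyp[OF M]] by blast
  then show ?thesis using A unfolding cl_def by (metis witt_class_eqI M qf_fm)
qed

lemma LG_carrier: "carrier LG = {cl n A |n A. nonsing n A}"
proof (intro equalityI subsetI)
  fix U assume "U \<in> carrier LG"
  then obtain M :: "('a, nat \<Rightarrow> 'a) qform" where "U = witt_class k R \<sigma> M" "nonsingular_form k R \<sigma> M"
    unfolding L_group_def by auto
  then show "U \<in> {cl n A |n A. nonsing n A}" using form_class by blast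
next
  fix U assume "U \<in> {cl n A |n A. nonsing n A}"
  then show "U \<in> carrier LG" unfolding L_group_def cl_def using fm_form by auto
qed

lemma cl_car: "nonsing n A \<Longrightarrow> cl n A \<in> carrier LG"
  unfolding LG_carrier by blast

lemma LG_add_forms:
  assumes A: "nonsing n A" and B: "nonsing m B"
  shows "cl n A \<oplus>\<^bsub>LG\<^esub> cl m B = witt_class k R \<sigma> (fm n A \<bottom> fm m B)"
proof -
  have "witt_class k R \<sigma> (M \<bottom> N) = witt_class k R \<sigma> (fm n A \<bottom> fm m B)" if "M \<in> cl n A" "N \<in> cl m B" for M N
  proof (rule witt_class_eqI)
    have M: "qf M" "steq (fm n A) M" and N: "qf N" "steq (fm m B) N"
      using that by (auto simp: mem_cl A B intro: form_qf)
    show "qf (M \<bottom> N)" "qf (fm n A \<bottom> fm m B)" by (simp_all add: qf_os M N qf_fm A B)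
    show "steq (M \<bottom> N) (fm n A \<bottom> fm m B)"
      by (intro steq_cong M N qf_fm A B steq_sym[OF M(2)] steq_sym[OF N(2)])
  qed
  then have "(\<Union>M\<in>cl n A. \<Union>N\<in>cl m B. witt_class k R \<sigma> (M \<bottom> N)) = witt_class k R \<sigma> (fm n A \<bottom> fm m B)"
    using fm_mem_cl[OF A] fm_mem_cl[OF B] by blast
  then show ?thesis unfolding L_group_def by simp
qed

lemma LG_add:
  assumes A: "nonsing n A" and B: "nonsing m B"
  shows "cl n A \<oplus>\<^bsub>LG\<^esub> cl m B = cl (n + m) (bs n A B)"
  unfolding LG_add_forms[OF A B] unfolding cl_def
  using fm_os[OF A B] by (intro witt_class_eqI) (auto dest: eqv_sym eqv_steq eqv_qf)

lemma LG_zero: "\<zero>\<^bsub>LG\<^esub> = cl 0 A"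
proof -
  have "zero_form k R \<sigma> = fm 0 A" unfolding zero_form_def fm_def by (simp add: bl_def rho_zero cs_zero)
  then show ?thesis by (simp add: L_group_def cl_def)
qed

lemma nonsing_0: "nonsing 0 A" by (simp add: nonsing_def)

lemma cl_hyp: "cl (2 * m) hy = \<zero>\<^bsub>LG\<^esub>"
proof -
  have "steq (hyp m) (hyp 0)"
  proof -
    have "hyp m \<bottom> hyp 0 \<doteq> hyp 0 \<bottom> hyp m" by (rule eqv_comm) simp_all
    then show ?thesis unfolding steq_def by blast
  qed
  then show ?thesis unfolding LG_zero[of hy] cl_eq[OF nonsing_hy nonsing_0] by (simp add: hyp_def)
qed

lemma hm_neg: "hm (\<lambda>i j. - A i j) i j = - hm A i j"
  by (simp add: hm_def s_neg)

lemma nonsing_neg: "nonsing n A \<Longrightarrow> nonsing n (\<lambda>i j. - A i j)"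
proof -
  assume "nonsing n A"
  then obtain g where "\<And>i j. i < n \<Longrightarrow> j < n \<Longrightarrow> (\<Sum>k<n. g i k * hm A k j) = dl i j"
    unfolding nonsing_def by blast
  then show ?thesis by (intro nonsingI[where g = "\<lambda>i j. - g i j"]) (simp add: hm_neg)
qed

lemma bl_neg: "bl n (\<lambda>i j. - A i j) v w = - bl n A v w"
  by (simp add: bl_def sum_negf)

text \<open>The diagonal is a Lagrangian in a form plus its negative; it is the kernel of the
  difference \<open>c\<close> of the two coordinate vectors.\<close>

lemma fm_neg_hyp:
  assumes A: "nonsing n A"
  shows "hyp n \<doteq> fm n A \<bottom> fm n (\<lambda>i j. - A i j)"
proof -
  let ?B = "\<lambda>i j. - A i j"
  note qA = qf_fm[OF A] and qB = qf_fm[OF nonsing_neg[OF A]]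
  let ?N = "fm n A \<bottom> fm n ?B"
  have hmB: "bl n (hm ?B) v w = - bl n (hm A) v w" for v w by (simp add: bl_def hm_neg sum_negf)
  have ex: "\<exists>v w. x = (vec n v, vec n w)" if "x \<in> carrier ?N" for x
    using os_fm_ex[OF that] vec_ex by (metis fm_simps(1))
  define c where "c x i = un (fst x i) - un (snd x i)" for x :: "(nat \<Rightarrow> 'a) \<times> (nat \<Rightarrow> 'a)" and i :: nat
  have cv: "c (vec n v, vec n w) i = v i - w i" if "i < n" for v w i using that by (simp add: c_def un_vec)
  have K: "x = (vec n v, vec n v)" if "x = (vec n v, vec n w)" "\<forall>i<n. c x i = 0" for x v w
    using that by (simp add: cv vec_eq)
  have lmN: "lm ?N (vec n v, vec n w) (vec n v', vec n w') = bl n (hm A) v v' - bl n (hm A) w w'" for v w v' w'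
    by (subst lm_os[OF qA qB]) (simp_all add: vec_car hmB)
  show ?thesis
  proof (rule metabolic_iso[OF qf_os[OF qA qB], where c = c])
    fix x y i assume "x \<in> carrier ?N" "y \<in> carrier ?N" and i: "i < n"
    then obtain v w v' w' where [simp]: "x = (vec n v, vec n w)" "y = (vec n v', vec n w')" using ex by meson
    show "c (x \<oplus>\<^bsub>?N\<^esub> y) i = c x i + c y i" using i by (simp add: cv)
  next
    fix a x i assume "x \<in> carrier ?N" and i: "i < n"
    then obtain v w where [simp]: "x = (vec n v, vec n w)" using ex by meson
    show "c (act ?N a x) i = a * c x i" using i by (simp add: cv algebra_simps)
  next
    fix v show "\<exists>x\<in>carrier ?N. \<forall>i<n. c x i = v i"
      by (rule bexI[of _ "(vec n v, vec n (\<lambda>_. 0))"]) (simp_all add: cv vec_car)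
  next
    fix x assume "x \<in> carrier ?N" and 0: "\<forall>i<n. c x i = 0"
    then obtain v where "x = (vec n v, vec n v)" using ex K by meson
    then show "mu ?N x = cs 0" using mu_os[of "fm n A" x "bl n A v v" "fm n ?B" "- bl n A v v"] by (simp add: bl_neg)
  next
    fix x y assume "x \<in> carrier ?N" and 0: "\<forall>i<n. c x i = 0" and "y \<in> carrier ?N" and 1: "\<forall>i<n. c y i = 0"
    then obtain v w where "x = (vec n v, vec n v)" "y = (vec n w, vec n w)" using ex K by meson
    then show "lm ?N x y = 0" by (simp add: lmN)
  next
    fix x assume x: "x \<in> carrier ?N" and 0: "\<And>y. y \<in> carrier ?N \<Longrightarrow> \<forall>i<n. c y i = 0 \<Longrightarrow> lm ?N x y = 0"
    obtain v w where xx: "x = (vec n v, vec n w)" using ex[OF x] by blast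
    have "vec n v = vec n w"
    proof (rule lm_cancel[OF qA])
      fix z assume "z \<in> carrier (fm n A)"
      then obtain u where z: "z = vec n u" using vec_ex by auto
      have "lm ?N x (vec n u, vec n u) = 0" by (rule 0) (simp_all add: vec_car cv)
      then show "lm (fm n A) (vec n v) z = lm (fm n A) (vec n w) z" by (simp add: xx z lmN)
    qed (simp_all add: vec_car)
    then show "\<forall>i<n. c x i = 0" by (simp add: xx cv vec_eq)
  qed
qed

lemma LG_neg: "nonsing n A \<Longrightarrow> cl n (\<lambda>i j. - A i j) \<oplus>\<^bsub>LG\<^esub> cl n A = \<zero>\<^bsub>LG\<^esub>"
proof -
  assume A: "nonsing n A"
  note B = nonsing_neg[OF A]
  have "fm n (\<lambda>i j. - A i j) \<bottom> fm n A \<doteq> hyp n"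
    by (rule eqv_trans[OF eqv_comm[OF qf_fm[OF B] qf_fm[OF A]] eqv_sym[OF fm_neg_hyp[OF A]]])
  then have "cl n (\<lambda>i j. - A i j) \<oplus>\<^bsub>LG\<^esub> cl n A = witt_class k R \<sigma> (hyp n)"
    unfolding LG_add_forms[OF B A] using witt_class_eqI eqv_steq eqv_qf by blast
  then show ?thesis using cl_hyp[of n] by (simp add: cl_def hyp_def)
qed

lemma LG_group: "abelian_group LG"
proof (rule abelian_groupI)
  fix x y assume "x \<in> carrier LG" "y \<in> carrier LG"
  then obtain n A m B where A: "nonsing n A" and B: "nonsing m B" and [simp]: "x = cl n A" "y = cl m B"
    unfolding LG_carrier by blast
  show "x \<oplus>\<^bsub>LG\<^esub> y \<in> carrier LG" by (simp add: LG_add A B cl_car nonsing_bs)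
  show "x \<oplus>\<^bsub>LG\<^esub> y = y \<oplus>\<^bsub>LG\<^esub> x"
    unfolding \<open>x = _\<close> \<open>y = _\<close> LG_add_forms[OF A B] LG_add_forms[OF B A]
    by (intro witt_class_eqI eqv_steq eqv_comm qf_os qf_fm A B)
next
  fix x y z assume "x \<in> carrier LG" "y \<in> carrier LG" "z \<in> carrier LG"
  then obtain n A m B p C where A: "nonsing n A" and B: "nonsing m B" and C: "nonsing p C"
    and xyz: "x = cl n A" "y = cl m B" "z = cl p C"
    unfolding LG_carrier by blast
  note q = qf_fm[OF A] qf_fm[OF B] qf_fm[OF C]
  note AB = nonsing_bs[OF A B] and BC = nonsing_bs[OF B C]
  have "fm (n + m) (bs n A B) \<bottom> fm p C \<doteq> (fm n A \<bottom> fm m B) \<bottom> fm p C"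
    by (rule eqv_cong[OF fm_os[OF A B] eqv_refl[OF q(3)]])
  also have "\<dots> \<doteq> fm n A \<bottom> (fm m B \<bottom> fm p C)" by (rule eqv_assoc[OF q])
  also have "\<dots> \<doteq> fm n A \<bottom> fm (m + p) (bs m B C)"
    by (rule eqv_cong[OF eqv_refl[OF q(1)] eqv_sym[OF fm_os[OF B C]]])
  finally have "witt_class k R \<sigma> (fm (n + m) (bs n A B) \<bottom> fm p C) = witt_class k R \<sigma> (fm n A \<bottom> fm (m + p) (bs m B C))"
    using witt_class_eqI eqv_steq eqv_qf by blast
  then show "x \<oplus>\<^bsub>LG\<^esub> y \<oplus>\<^bsub>LG\<^esub> z = x \<oplus>\<^bsub>LG\<^esub> (y \<oplus>\<^bsub>LG\<^esub> z)"
    by (simp only: xyz LG_add[OF A B] LG_add[OF B C] LG_add_forms[OF AB C] LG_add_forms[OF A BC])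
next
  show "\<zero>\<^bsub>LG\<^esub> \<in> carrier LG" by (simp add: LG_zero[of hy] cl_car nonsing_0)
next
  fix x assume "x \<in> carrier LG"
  then obtain n A where A: "nonsing n A" and [simp]: "x = cl n A" unfolding LG_carrier by blast
  have "bs 0 hy A = A" by (simp add: bs_def fun_eq_iff)
  then show "\<zero>\<^bsub>LG\<^esub> \<oplus>\<^bsub>LG\<^esub> x = x" by (simp add: LG_zero[of hy] LG_add[OF nonsing_0 A])
  show "\<exists>y\<in>carrier LG. y \<oplus>\<^bsub>LG\<^esub> x = \<zero>\<^bsub>LG\<^esub>"
    using LG_neg[OF A] cl_car[OF nonsing_neg[OF A]] by auto
qed

subsection \<open>Matrix description of isometries\<close>

text \<open>An isometry in terms of matrices: the rows of \<open>U\<close> are the images of the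
  basis vectors, and \<open>V\<close> expresses the target basis through them. All conditions are
  equations in the ring or memberships in \<open>Lam\<close>, so ring homomorphisms preserve
  them.\<close>

definition miso :: "nat \<Rightarrow> (nat \<Rightarrow> nat \<Rightarrow> 'b) \<Rightarrow> nat \<Rightarrow> (nat \<Rightarrow> nat \<Rightarrow> 'b) \<Rightarrow> bool" where
  "miso n A p C \<longleftrightarrow> (\<exists>U V. (\<forall>i<n. bl p C (U i) (U i) - A i i \<in> Lam) \<and>
     (\<forall>i<n. \<forall>j<n. bl p (hm C) (U i) (U j) = hm A i j) \<and>
     (\<forall>l<p. \<forall>m<p. (\<Sum>i<n. V l i * U i m) = dl l m))"

lemma bl_sum_l: "bl p C (\<lambda>m. \<Sum>i\<in>I. V i * U i m) w = (\<Sum>i\<in>I. s (V i) * bl p C (U i) w)"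
proof (induction I rule: infinite_finite_induct)
  case (insert x F)
  then show ?case by (simp add: bl_add_l[of p C "\<lambda>m. V x * U x m"] bl_act_l)
qed simp_all

lemma lc_vec:
  assumes "zero M = vec n (\<lambda>_. 0)" "\<And>v w. vec n v \<oplus>\<^bsub>M\<^esub> vec n w = vec n (\<lambda>i. v i + w i)"
    "\<And>a v. act M a (vec n v) = vec n (\<lambda>i. a * v i)"
  shows "lc M (\<lambda>i. vec n (U i)) v m = vec n (\<lambda>j. \<Sum>i<m. v i * U i j)"
  by (induction m) (simp_all add: assms)

lemma lc_dl:
  assumes "zero M = vec n (\<lambda>_. 0)" "\<And>v w. vec n v \<oplus>\<^bsub>M\<^esub> vec n w = vec n (\<lambda>i. v i + w i)"
    "\<And>a v. act M a (vec n v) = vec n (\<lambda>i. a * v i)"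
  shows "lc M (\<lambda>i. vec n (dl i)) v n = vec n v"
  by (simp add: lc_vec[OF assms] vec_eq)

lemma miso_eqv:
  assumes A: "nonsing n A" and C: "nonsing p C" and iso: "miso n A p C"
  shows "fm n A \<doteq> fm p C"
proof -
  obtain U V where UD: "\<And>i. i < n \<Longrightarrow> bl p C (U i) (U i) - A i i \<in> Lam"
    and U: "\<And>i j. i < n \<Longrightarrow> j < n \<Longrightarrow> bl p (hm C) (U i) (U j) = hm A i j"
    and V: "\<And>l m. l < p \<Longrightarrow> m < p \<Longrightarrow> (\<Sum>i<n. V l i * U i m) = dl l m"
    using iso unfolding miso_def by blast
  have "isometric R (fm n A) (fm p C)"
  proof (rule gram_iso[OF qf_fm[OF C] _ _ _ A, where b = "\<lambda>i. vec p (U i)"])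
    fix z assume z: "z \<in> carrier (fm p C)" and 0: "\<And>i. i < n \<Longrightarrow> lm (fm p C) (vec p (U i)) z = 0"
    obtain w where zw: "z = vec p w" using z vec_ex by auto
    have dl0: "(\<Sum>j<p. hm C l j * w j) = 0" if l: "l < p" for l
    proof -
      have "bl p (hm C) (dl l) w = bl p (hm C) (\<lambda>m. \<Sum>i<n. V l i * U i m) w"
        by (rule bl_cong) (simp_all add: V l)
      also have "\<dots> = 0" unfolding bl_sum_l using 0 by (simp add: zw)
      finally show ?thesis by (simp add: bl_dl_l l)
    qed
    show "z = \<zero>\<^bsub>fm p C\<^esub>"
    proof (rule lm_cancel_r[OF qf_fm[OF C] z])
      fix y assume "y \<in> carrier (fm p C)"
      then obtain u where "y = vec p u" using vec_ex by auto
      then show "lm (fm p C) y z = lm (fm p C) y \<zero>\<^bsub>fm p C\<^esub>"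
        using dl0 by (simp add: zw) (simp add: bl_right)
    qed (simp add: vec_car)
  qed (use UD U in \<open>simp_all add: vec_car cs_eq\<close>)
  then show ?thesis unfolding eqv_def using qf_fm[OF A] qf_fm[OF C] by blast
qed

lemma eqv_miso:
  assumes "fm n A \<doteq> fm p C"
  shows "miso n A p C"
proof -
  have qA: "qf (fm n A)" and qC: "qf (fm p C)" and iso: "isometric R (fm n A) (fm p C)"
    using assms unfolding eqv_def by blast+
  obtain h where hc: "\<And>x. x \<in> carrier (fm n A) \<Longrightarrow> h x \<in> carrier (fm p C)"
    and hadd: "\<And>x y. x \<in> carrier (fm n A) \<Longrightarrow> y \<in> carrier (fm n A) \<Longrightarrow> h (x \<oplus>\<^bsub>fm n A\<^esub> y) = h x \<oplus>\<^bsub>fm p C\<^esub> h y"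
    and hact: "\<And>a x. x \<in> carrier (fm n A) \<Longrightarrow> h (act (fm n A) a x) = act (fm p C) a (h x)"
    and onto: "\<And>y. y \<in> carrier (fm p C) \<Longrightarrow> \<exists>x\<in>carrier (fm n A). y = h x"
    and hlm: "\<And>x y. x \<in> carrier (fm n A) \<Longrightarrow> y \<in> carrier (fm n A) \<Longrightarrow> lm (fm p C) (h x) (h y) = lm (fm n A) x y"
    and hmu: "\<And>x. x \<in> carrier (fm n A) \<Longrightarrow> mu (fm p C) (h x) = mu (fm n A) x"
    using iso by (rule isoD) blast
  define U where "U i = un \<circ> h (vec n (dl i))" for i
  have hU: "h (vec n (dl i)) = vec p (U i)" for i
    unfolding U_def by (rule vec_ex) (use hc[of "vec n (dl i)"] in \<open>simp add: vec_car\<close>)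
  have hlc: "h (lc (fm n A) (\<lambda>i. vec n (dl i)) v m) = lc (fm p C) (\<lambda>i. vec p (U i)) v m" for v m
  proof (induction m)
    case 0
    have "h (act (fm n A) 0 (vec n (\<lambda>_. 0))) = act (fm p C) 0 (h (vec n (\<lambda>_. 0)))"
      by (rule hact) (simp add: vec_car)
    also have "\<dots> = \<zero>\<^bsub>fm p C\<^esub>" using act_zero[OF qC hc[of "vec n (\<lambda>_. 0)"]] by (simp add: vec_car)
    finally show ?case by simp
  next
    case (Suc m)
    have "lc (fm n A) (\<lambda>i. vec n (dl i)) v m \<in> carrier (fm n A)"
      by (rule lc_car[OF qA _ order_refl]) (simp add: vec_car)
    then have "h (lc (fm n A) (\<lambda>i. vec n (dl i)) v (Suc m)) =
       h (lc (fm n A) (\<lambda>i. vec n (dl i)) v m) \<oplus>\<^bsub>fm p C\<^esub> h (act (fm n A) (v m) (vec n (dl m)))"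
      unfolding lc.simps by (intro hadd) (simp_all add: vec_car)
    also have "h (act (fm n A) (v m) (vec n (dl m))) = act (fm p C) (v m) (vec p (U m))"
      by (subst hact) (simp_all add: vec_car hU)
    finally show ?case by (simp only: Suc lc.simps)
  qed
  have hv: "h (vec n v) = vec p (\<lambda>j. \<Sum>i<n. v i * U i j)" for v
  proof -
    have "lc (fm n A) (\<lambda>i. vec n (dl i)) v n = vec n v" by (rule lc_dl) simp_all
    then show ?thesis using hlc[of v n] by (simp add: lc_vec[where M = "fm p C"])
  qed
  have "\<exists>v. vec p (dl l) = h (vec n v)" for l
    using onto[of "vec p (dl l)"] vec_ex vec_car by (metis fm_simps(1))
  then obtain V where V: "\<And>l. vec p (dl l) = h (vec n (V l))" by metis
  have 1: "bl p C (U i) (U i) - A i i \<in> Lam" if "i < n" for i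
    using hmu[of "vec n (dl i)"] that by (simp add: hU vec_car bl_dl cs_eq)
  have 2: "bl p (hm C) (U i) (U j) = hm A i j" if "i < n" "j < n" for i j
    using hlm[of "vec n (dl i)" "vec n (dl j)"] that by (simp add: hU vec_car bl_dl)
  have 3: "(\<Sum>i<n. V l i * U i m) = dl l m" if "l < p" "m < p" for l m
    using V[of l] that by (simp add: hv vec_eq)
  show ?thesis
    unfolding miso_def by (intro exI[of _ U] exI[of _ V] conjI allI impI 1 2 3)
qed

text \<open>Equality of classes becomes a system of matrix equations. This gives functoriality in
  the ring and is the starting point of the Arf invariant.\<close>

lemma steq_miso:
  assumes A: "nonsing n A" and C: "nonsing p C"
  shows "steq (fm n A) (fm p C) \<longleftrightarrow> (\<exists>a b. miso (n + 2 * a) (bs n A hy) (p + 2 * b) (bs p C hy))"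
proof -
  have "fm n A \<bottom> hyp a \<doteq> fm p C \<bottom> hyp b \<longleftrightarrow> miso (n + 2 * a) (bs n A hy) (p + 2 * b) (bs p C hy)" for a b
  proof -
    have eA: "fm (n + 2 * a) (bs n A hy) \<doteq> fm n A \<bottom> hyp a" unfolding hyp_def by (rule fm_os[OF A nonsing_hy])
    have eC: "fm (p + 2 * b) (bs p C hy) \<doteq> fm p C \<bottom> hyp b" unfolding hyp_def by (rule fm_os[OF C nonsing_hy])
    show ?thesis
    proof
      assume "fm n A \<bottom> hyp a \<doteq> fm p C \<bottom> hyp b"
      from eqv_miso[OF eqv_trans[OF eqv_trans[OF eA this] eqv_sym[OF eC]]]
      show "miso (n + 2 * a) (bs n A hy) (p + 2 * b) (bs p C hy)" .
    next
      assume "miso (n + 2 * a) (bs n A hy) (p + 2 * b) (bs p C hy)"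
      from miso_eqv[OF nonsing_bs[OF A nonsing_hy] nonsing_bs[OF C nonsing_hy] this]
      have "fm (n + 2 * a) (bs n A hy) \<doteq> fm (p + 2 * b) (bs p C hy)" .
      from eqv_trans[OF eqv_trans[OF eqv_sym[OF eA] this] eC]
      show "fm n A \<bottom> hyp a \<doteq> fm p C \<bottom> hyp b" .
    qed
  qed
  then show ?thesis unfolding steq_def by simp
qed

end

section \<open>Base change\<close>

lemma ex1_unique: "\<exists>!x. P x \<Longrightarrow> P a \<Longrightarrow> P b \<Longrightarrow> a = b"
  by blast

context fmodel
begin

lemma lc_closed:
  assumes P: "left_module R P" and b: "\<And>i. b i \<in> carrier P"
  shows "lc P b v m \<in> carrier P"
proof (induction m)
  case 0
  show ?case using abelian_monoid.zero_closed[OF abelian_group.axioms(1)[OF left_moduleD(2)[OF P]]] by simp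
next
  case (Suc m)
  then show ?case
    using abelian_monoid.a_closed[OF abelian_group.axioms(1)[OF left_moduleD(2)[OF P]]] left_moduleD(3)[OF P] b
    by (simp add: act_def)
qed

lemma lc_add:
  assumes P: "left_module R P" and b: "\<And>i. b i \<in> carrier P"
  shows "lc P b (\<lambda>i. v i + w i) m = lc P b v m \<oplus>\<^bsub>P\<^esub> lc P b w m"
proof -
  interpret P: abelian_group P using left_moduleD(2)[OF P] .
  show ?thesis
  proof (induction m)
    case (Suc m)
    have "act P x (b m) \<in> carrier P" for x using left_moduleD(3)[OF P] b by (simp add: act_def)
    moreover have "act P (v m + w m) (b m) = act P (v m) (b m) \<oplus>\<^bsub>P\<^esub> act P (w m) (b m)"
      using left_moduleD(4)[OF P] b by (simp add: act_def rho_add)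
    ultimately show ?case by (simp add: Suc lc_closed[OF P] b P.a_ac)
  qed simp
qed

lemma lc_act:
  assumes P: "left_module R P" and b: "\<And>i. b i \<in> carrier P"
  shows "lc P b (\<lambda>i. a * v i) m = act P a (lc P b v m)"
proof -
  interpret P: abelian_group P using left_moduleD(2)[OF P] .
  note PD = left_moduleD[OF P]
  show ?thesis
  proof (induction m)
    case 0
    have "act P a \<zero>\<^bsub>P\<^esub> \<in> carrier P" unfolding act_def by (simp add: PD(3))
    moreover have "act P a \<zero>\<^bsub>P\<^esub> \<oplus>\<^bsub>P\<^esub> act P a \<zero>\<^bsub>P\<^esub> = act P a \<zero>\<^bsub>P\<^esub> \<oplus>\<^bsub>P\<^esub> \<zero>\<^bsub>P\<^esub>"
      using PD(5)[of "\<rho> a" "\<zero>\<^bsub>P\<^esub>" "\<zero>\<^bsub>P\<^esub>"] PD(3)[of "\<rho> a" "\<zero>\<^bsub>P\<^esub>"] by (simp add: act_def)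
    ultimately show ?case by (simp del: P.r_zero)
  next
    case (Suc m)
    have "act P x (b m) \<in> carrier P" for x using PD(3) b by (simp add: act_def)
    moreover have "act P (a * v m) (b m) = act P a (act P (v m) (b m))"
      using PD(6) b by (simp add: act_def rho_mult)
    ultimately show ?case by (simp add: Suc) (simp add: act_def PD(5) lc_closed[OF P] b)
  qed
qed

lemma fm_ex: "x \<in> carrier (fm n A) \<Longrightarrow> \<exists>v. x = vec n v"
  using vec_ex[of x n] by auto

lemma free_lc_dl_fm: "lc (fm n A) (\<lambda>i. vec n (dl i)) v n = vec n v"
  by (rule lc_dl) simp_all

lemma linear_lc:
  assumes M: "left_module R M" and P: "left_module R P" and h: "h \<in> linear_maps R M P" and b: "\<And>i. b i \<in> carrier M"
  shows "h (lc M b v m) = lc P (\<lambda>i. h (b i)) v m"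
proof (induction m)
  case 0
  then show ?case by (simp add: linear_zero[OF M P h])
next
  case (Suc m)
  have "act M (v m) (b m) \<in> carrier M" using left_moduleD(3)[OF M] b by (simp add: act_def)
  then show ?case
    using Suc semilinearD(2)[OF h lc_closed[OF M b]] semilinearD(3)[OF h] b by (simp add: act_def)
qed

end

locale fmodel_hom = A: fmodel R \<sigma> \<rho> s k + B: fmodel S \<tau> \<rho>' s' k
  for R :: "('a, 'x) ring_scheme" and \<sigma> and \<rho> :: "'b::comm_ring_1 \<Rightarrow> 'a" and s k
    and S :: "('c, 'w) ring_scheme" and \<tau> and \<rho>' :: "'d::comm_ring_1 \<Rightarrow> 'c" and s' +
  fixes f :: "'a \<Rightarrow> 'c" and g :: "'b \<Rightarrow> 'd"
  assumes f_rho: "f (\<rho> a) = \<rho>' (g a)" and g_add: "g (a + b) = g a + g b"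
    and g_mult: "g (a * b) = g a * g b" and g_one [simp]: "g 1 = 1" and g_s: "g (s a) = s' (g a)"
begin

definition gm :: "(nat \<Rightarrow> nat \<Rightarrow> 'b) \<Rightarrow> nat \<Rightarrow> nat \<Rightarrow> 'd" where "gm A i j = g (A i j)"

lemma g_zero [simp]: "g 0 = 0" using g_add[of 0 0] by simp
lemma g_neg: "g (- a) = - g a" using g_add[of a "- a"] by (simp add: minus_unique)
lemma g_diff: "g (a - b) = g a - g b" using g_add[of a "- b"] by (simp add: g_neg)
lemma g_sum: "g (\<Sum>i\<in>I. F i) = (\<Sum>i\<in>I. g (F i))"
  by (induction I rule: infinite_finite_induct) (auto simp: g_add)
lemma g_eps [simp]: "g A.eps = B.eps" by (simp add: A.eps_def B.eps_def g_neg)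
lemma g_dl [simp]: "g (dl i j) = dl i j" by (simp add: dl_def)

lemma g_Lam: "u \<in> A.Lam \<Longrightarrow> g u \<in> B.Lam"
  unfolding A.Lam_def B.Lam_def by (auto simp: g_diff g_mult g_s)

lemma g_cs: "A.cs a = A.cs b \<Longrightarrow> B.cs (g a) = B.cs (g b)"
  unfolding A.cs_eq B.cs_eq using g_Lam by (metis g_diff)

lemma hm_gm: "B.hm (gm A) = gm (A.hm A)"
  by (simp add: A.hm_def B.hm_def gm_def g_add g_mult g_s fun_eq_iff)

lemma g_bl: "g (A.bl n A v w) = B.bl n (gm A) (\<lambda>i. g (v i)) (\<lambda>i. g (w i))"
  by (simp add: A.bl_def B.bl_def g_sum g_mult g_s gm_def)

lemma gm_hy: "gm A.hy = B.hy"
  by (simp add: gm_def A.hy_def B.hy_def fun_eq_iff)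

lemma gm_bs: "gm (A.bs n A C) = B.bs n (gm A) (gm C)"
  by (simp add: gm_def A.bs_def B.bs_def fun_eq_iff)

lemma nonsing_gm: "A.nonsing n A \<Longrightarrow> B.nonsing n (gm A)"
proof -
  assume "A.nonsing n A"
  then obtain h where h: "\<And>i j. i < n \<Longrightarrow> j < n \<Longrightarrow> (\<Sum>k<n. h i k * A.hm A k j) = dl i j"
    unfolding A.nonsing_def by blast
  show ?thesis
  proof (rule B.nonsingI[where g = "\<lambda>i k. g (h i k)"])
    fix i j assume "i < n" "j < n"
    then have "g (\<Sum>k<n. h i k * A.hm A k j) = g (dl i j)" using h by simp
    then show "(\<Sum>k<n. g (h i k) * B.hm (gm A) k j) = dl i j" by (simp add: g_sum g_mult hm_gm gm_def)
  qed
qed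

lemma miso_gm:
  assumes "A.miso n A p C"
  shows "B.miso n (gm A) p (gm C)"
proof -
  obtain U V where UD: "\<And>i. i < n \<Longrightarrow> A.bl p C (U i) (U i) - A i i \<in> A.Lam"
    and U: "\<And>i j. i < n \<Longrightarrow> j < n \<Longrightarrow> A.bl p (A.hm C) (U i) (U j) = A.hm A i j"
    and V: "\<And>l m. l < p \<Longrightarrow> m < p \<Longrightarrow> (\<Sum>i<n. V l i * U i m) = dl l m"
    using assms unfolding A.miso_def by blast
  show ?thesis
    unfolding B.miso_def
  proof (rule exI[of _ "\<lambda>i m. g (U i m)"], rule exI[of _ "\<lambda>l i. g (V l i)"], intro conjI allI impI)
    fix i assume "i < n"
    from g_Lam[OF UD[OF this]]
    show "B.bl p (gm C) (\<lambda>m. g (U i m)) (\<lambda>m. g (U i m)) - gm A i i \<in> B.Lam"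
      by (simp add: g_diff g_bl gm_def)
  next
    fix i j assume "i < n" "j < n"
    then show "B.bl p (B.hm (gm C)) (\<lambda>m. g (U i m)) (\<lambda>m. g (U j m)) = B.hm (gm A) i j"
      using arg_cong[OF U, of i j g] by (simp add: g_bl hm_gm) (simp add: gm_def)
  next
    fix l m assume "l < p" "m < p"
    then show "(\<Sum>i<n. g (V l i) * g (U i m)) = dl l m"
      using arg_cong[OF V, of l m g] by (simp add: g_sum g_mult)
  qed
qed

lemma steq_gm:
  assumes A: "A.nonsing n A" and C: "A.nonsing p C" and "A.steq (A.fm n A) (A.fm p C)"
  shows "B.steq (B.fm n (gm A)) (B.fm p (gm C))"
proof -
  obtain a b where "A.miso (n + 2 * a) (A.bs n A A.hy) (p + 2 * b) (A.bs p C A.hy)"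
    using assms(3) unfolding A.steq_miso[OF A C] by blast
  from miso_gm[OF this] show ?thesis
    unfolding B.steq_miso[OF nonsing_gm[OF A] nonsing_gm[OF C]] gm_bs gm_hy by blast
qed

lemma semilinear_act:
  "h \<in> semilinear_maps R f M N \<Longrightarrow> x \<in> carrier M \<Longrightarrow> h (A.act M a x) = B.act N (g a) (h x)"
  by (simp add: A.act_def B.act_def semilinearD(3) f_rho)

lemma semilinear_zero:
  assumes M: "left_module R M" and N: "left_module S N" and h: "h \<in> semilinear_maps R f M N"
  shows "h \<zero>\<^bsub>M\<^esub> = \<zero>\<^bsub>N\<^esub>"
proof -
  interpret M: abelian_group M using left_moduleD(2)[OF M] .
  interpret N: abelian_group N using left_moduleD(2)[OF N] .
  note hD = semilinearD[OF h]
  have "h \<zero>\<^bsub>M\<^esub> \<oplus>\<^bsub>N\<^esub> h \<zero>\<^bsub>M\<^esub> = h \<zero>\<^bsub>M\<^esub> \<oplus>\<^bsub>N\<^esub> \<zero>\<^bsub>N\<^esub>" using hD(1) hD(2)[of "\<zero>\<^bsub>M\<^esub>" "\<zero>\<^bsub>M\<^esub>"] by simp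
  then show ?thesis using hD(1)[of "\<zero>\<^bsub>M\<^esub>"] by (simp del: N.r_zero)
qed

lemma semilinear_lc:
  assumes M: "left_module R M" and N: "left_module S N" and h: "h \<in> semilinear_maps R f M N"
    and b: "\<And>i. b i \<in> carrier M"
  shows "h (A.lc M b v m) = B.lc N (\<lambda>i. h (b i)) (\<lambda>i. g (v i)) m"
proof (induction m)
  case 0
  then show ?case by (simp add: semilinear_zero[OF M N h])
next
  case (Suc m)
  have "A.act M (v m) (b m) \<in> carrier M" using left_moduleD(3)[OF M] b by (simp add: A.act_def)
  then show ?case
    using Suc semilinearD(2)[OF h A.lc_closed[OF M b]] semilinear_act[OF h b] by simp
qed

text \<open>Applying \<open>g\<close> to the entries of the matrix gives the extended form. The
  universal property holds because a semilinear map out of a free module is determined by its values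
  on the basis, and these can be prescribed on the new basis.\<close>

lemma base_change_fm:
  assumes C: "A.nonsing n C"
  shows "base_change_form k R S \<tau> f (A.fm n C) (B.fm n (gm C))"
  unfolding base_change_form_def
proof (intro conjI exI[of _ "\<lambda>x i. f (x i)"] ballI)
  let ?\<phi> = "\<lambda>x (i :: nat). f (x i)"
  have \<phi>v: "?\<phi> (A.vec n v) = B.vec n (\<lambda>i. g (v i))" for v
    unfolding A.vec_def B.vec_def fun_eq_iff using f_rho[of 0] by (simp add: f_rho A.rho_zero B.rho_zero)
  have hmC: "g (A.bl n (A.hm C) v w) = B.bl n (B.hm (gm C)) (\<lambda>i. g (v i)) (\<lambda>i. g (w i))" for v w
    by (simp add: g_bl hm_gm)
  show "nonsingular_form k S \<tau> (B.fm n (gm C))" by (rule B.fm_form[OF nonsing_gm[OF C]])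
  show "extension_of_scalars R S f (A.fm n C) (B.fm n (gm C)) ?\<phi>"
    unfolding extension_of_scalars_def
  proof (intro conjI allI impI ballI)
    show "left_module S (B.fm n (gm C))" by (rule B.fm_left_module)
    show \<phi>: "?\<phi> \<in> semilinear_maps R f (A.fm n C) (B.fm n (gm C))"
    proof (rule semilinearI)
      fix x y assume "x \<in> carrier (A.fm n C)" "y \<in> carrier (A.fm n C)"
      then obtain v w where [simp]: "x = A.vec n v" "y = A.vec n w" using A.fm_ex by meson
      show "?\<phi> x \<in> carrier (B.fm n (gm C))" by (simp add: \<phi>v B.vec_car)
      have "?\<phi> (A.vec n (\<lambda>i. v i + w i)) = ?\<phi> x \<oplus>\<^bsub>B.fm n (gm C)\<^esub> ?\<phi> y" by (simp only: \<phi>v \<open>x = _\<close> \<open>y = _\<close>) (simp add: g_add)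
      then show "?\<phi> (x \<oplus>\<^bsub>A.fm n C\<^esub> y) = ?\<phi> x \<oplus>\<^bsub>B.fm n (gm C)\<^esub> ?\<phi> y" by simp
    next
      fix r x assume "r \<in> carrier R" "x \<in> carrier (A.fm n C)"
      then obtain a v where [simp]: "r = \<rho> a" "x = A.vec n v" using A.fm_ex A.rho_ex by meson
      have "?\<phi> (A.vec n (\<lambda>i. a * v i)) = B.act (B.fm n (gm C)) (g a) (?\<phi> x)" by (simp only: \<phi>v \<open>x = _\<close>) (simp add: g_mult)
      then show "?\<phi> (r \<odot>\<^bsub>A.fm n C\<^esub> x) = f r \<odot>\<^bsub>B.fm n (gm C)\<^esub> ?\<phi> x"
        using A.fm_simps(4)[of n C a v] by (simp add: A.act_def B.act_def f_rho)
    qed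
    fix P :: "('c, nat \<Rightarrow> 'c) module" and \<psi>
    assume P: "left_module S P" and \<psi>: "\<psi> \<in> semilinear_maps R f (A.fm n C) P"
    let ?b = "\<lambda>i. \<psi> (A.vec n (dl i))"
    have b: "?b i \<in> carrier P" for i by (rule semilinearD(1)[OF \<psi>]) (simp add: A.vec_car)
    define h where "h = restrict (\<lambda>x. B.lc P ?b (B.un \<circ> x) n) (carrier (B.fm n (gm C)))"
    have lcun: "B.lc P ?b (B.un \<circ> B.vec n w) m = B.lc P ?b w m" if "m \<le> n" for m w
      using that by (induction m) (simp_all add: B.un_vec)
    have hv: "h (B.vec n w) = B.lc P ?b w n" for w
      by (simp add: h_def B.vec_car lcun)
    have e: "?\<phi> (A.vec n (dl i)) = B.vec n (dl i)" for i by (simp add: \<phi>v)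
    show "\<exists>!h. h \<in> linear_maps S (B.fm n (gm C)) P \<inter> extensional (carrier (B.fm n (gm C))) \<and>
             (\<forall>x\<in>carrier (A.fm n C). h (?\<phi> x) = \<psi> x)"
    proof (rule ex1I)
      have hl: "h \<in> linear_maps S (B.fm n (gm C)) P"
      proof (rule semilinearI)
        fix x y assume "x \<in> carrier (B.fm n (gm C))" "y \<in> carrier (B.fm n (gm C))"
        then obtain v w where [simp]: "x = B.vec n v" "y = B.vec n w" using B.fm_ex by meson
        show "h x \<in> carrier P" by (simp add: hv B.lc_closed[OF P b])
        show "h (x \<oplus>\<^bsub>B.fm n (gm C)\<^esub> y) = h x \<oplus>\<^bsub>P\<^esub> h y" by (simp add: hv B.lc_add[OF P b])
      next
        fix r x assume "r \<in> carrier S" "x \<in> carrier (B.fm n (gm C))"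
        then obtain a v where [simp]: "r = \<rho>' a" "x = B.vec n v" using B.fm_ex B.rho_ex by meson
        show "h (r \<odot>\<^bsub>B.fm n (gm C)\<^esub> x) = r \<odot>\<^bsub>P\<^esub> h x"
          using B.fm_simps(4)[of n "gm C" a v] B.lc_act[OF P b, where a = a and v = v and m = n] by (simp add: hv B.act_def)
      qed
      have "h (?\<phi> x) = \<psi> x" if xc: "x \<in> carrier (A.fm n C)" for x
      proof -
        obtain v where x: "x = A.vec n v" using A.fm_ex[OF xc] by blast
        have "\<psi> (A.lc (A.fm n C) (\<lambda>i. A.vec n (dl i)) v n) = B.lc P ?b (\<lambda>i. g (v i)) n"
          by (rule semilinear_lc[OF A.fm_left_module P \<psi>]) (simp add: A.vec_car)
        then show ?thesis by (simp add: A.free_lc_dl_fm x \<phi>v hv)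
      qed
      then show "h \<in> linear_maps S (B.fm n (gm C)) P \<inter> extensional (carrier (B.fm n (gm C))) \<and>
             (\<forall>x\<in>carrier (A.fm n C). h (?\<phi> x) = \<psi> x)" using hl by (auto simp: h_def)
    next
      fix h' assume h': "h' \<in> linear_maps S (B.fm n (gm C)) P \<inter> extensional (carrier (B.fm n (gm C))) \<and>
             (\<forall>x\<in>carrier (A.fm n C). h' (?\<phi> x) = \<psi> x)"
      then have hl: "h' \<in> linear_maps S (B.fm n (gm C)) P" and he: "h' \<in> extensional (carrier (B.fm n (gm C)))"
        and hp: "\<And>x. x \<in> carrier (A.fm n C) \<Longrightarrow> h' (?\<phi> x) = \<psi> x" by auto
      show "h' = h"
      proof (rule extensionalityI[OF he])
        show "h \<in> extensional (carrier (B.fm n (gm C)))" by (simp add: h_def)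
        fix x assume "x \<in> carrier (B.fm n (gm C))"
        then obtain v where [simp]: "x = B.vec n v" using B.fm_ex by meson
        have "h' (B.vec n (dl i)) = ?b i" for i using hp[of "A.vec n (dl i)"] by (simp add: e A.vec_car)
        moreover have "h' (B.lc (B.fm n (gm C)) (\<lambda>i. B.vec n (dl i)) v n) = B.lc P (\<lambda>i. h' (B.vec n (dl i))) v n"
          by (rule B.linear_lc[OF B.fm_left_module P hl]) (simp add: B.vec_car)
        ultimately show "h' x = h x" by (simp add: B.free_lc_dl_fm hv)
      qed
    qed
  qed
  fix x assume "x \<in> carrier (A.fm n C)"
  then obtain v where x: "x = A.vec n v" using A.fm_ex by meson
  {
    fix y assume "y \<in> carrier (A.fm n C)"
    then obtain w where y: "y = A.vec n w" using A.fm_ex by meson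
    show "lam (B.fm n (gm C)) (?\<phi> x) (?\<phi> y) = f (lam (A.fm n C) x y)"
      unfolding x y \<phi>v A.lam_fm B.lam_fm f_rho hmC ..
  }
  fix b assume "b \<in> mu (A.fm n C) x"
  then obtain c where c: "b = \<rho> c" "A.cs c = A.cs (A.bl n C v v)"
    by (auto simp: x) (metis A.cs_mem_eq A.mem_cs)
  show "mu (B.fm n (gm C)) (?\<phi> x) = indeterminacy S \<tau> k +>\<^bsub>S\<^esub> f b"
    using g_cs[OF c(2)] unfolding x \<phi>v B.mu_fm c(1) f_rho B.cs_def[symmetric] g_bl by simp
qed

text \<open>After stabilization \<open>M\<close> has a basis with matrix \<open>D\<close>. The
  images of this basis have Gram matrix \<open>gm D\<close> in the correspondingly stabilized
  \<open>N\<close>, and only elements orthogonal to all of them need attention. Uniqueness in the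
  universal property shows that these vanish.\<close>

lemma base_change_class:
  fixes M :: "('a, 'm, 'y) qform_scheme" and N :: "('c, nat \<Rightarrow> 'c) qform"
  assumes M: "nonsingular_form k R \<sigma> M" and bc: "base_change_form k R S \<tau> f M N"
    and C: "A.nonsing n C" and MC: "A.steq (A.fm n C) M"
  shows "B.steq (B.fm n (gm C)) N"
proof -
  have qM: "A.qf M" by (rule A.form_qf[OF M])
  obtain \<phi> where N: "nonsingular_form k S \<tau> N" and ext: "extension_of_scalars R S f M N \<phi>"
    and plam: "\<And>x y. x \<in> carrier M \<Longrightarrow> y \<in> carrier M \<Longrightarrow> lam N (\<phi> x) (\<phi> y) = f (lam M x y)"
    and pmu: "\<And>x b. x \<in> carrier M \<Longrightarrow> b \<in> mu M x \<Longrightarrow> mu N (\<phi> x) = indeterminacy S \<tau> k +>\<^bsub>S\<^esub> f b"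
    using bc unfolding base_change_form_def by blast
  have qN: "B.qf N" by (rule B.form_qf[OF N])
  have \<phi>: "\<phi> \<in> semilinear_maps R f M N" using ext unfolding extension_of_scalars_def by blast
  note \<phi>c = semilinearD(1)[OF \<phi>]
  have plm: "B.lm N (\<phi> x) (\<phi> y) = g (A.lm M x y)" if "x \<in> carrier M" "y \<in> carrier M" for x y
  proof -
    have "lam M x y = \<rho> (A.lm M x y)" using that by (simp add: A.lm_def A.lam_car[OF qM])
    then show ?thesis by (simp add: B.lm_def plam that f_rho)
  qed
  have pmu': "mu N (\<phi> x) = B.cs (g c)" if "x \<in> carrier M" "mu M x = A.cs c" for x c
    using pmu[OF that(1), of "\<rho> c"] that A.rho_cs by (simp add: f_rho B.cs_def)
  \<comment> \<open>The functional \<lambda>(y, -) and the zero functional agree on the image of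
    \<open>\<phi>\<close>, so they are equal by uniqueness, and nondegeneracy gives y = 0.\<close>
  have gen: "y = \<zero>\<^bsub>N\<^esub>" if y: "y \<in> carrier N" and 0: "\<And>x. x \<in> carrier M \<Longrightarrow> B.lm N (\<phi> x) y = 0" for y
  proof -
    \<comment> \<open>The universal property speaks of target modules with elements of type
      \<open>nat \<Rightarrow> 'c\<close>, so functionals take values in the free module of rank one
      instead of \<open>S\<close> itself.\<close>
    let ?P = "free_module S (1::nat)"
    have P: "left_module S ?P" by (rule B.free_left_module)
    have y0: "B.lm N y (\<phi> x) = 0" if "x \<in> carrier M" for x
      using B.lm_sym[OF qN y \<phi>c[OF that]] 0[OF that] by simp
    let ?z = "\<lambda>_::'m. B.vec 1 (\<lambda>_. 0)"
    let ?h1 = "restrict (\<lambda>x. B.vec 1 (\<lambda>_. B.lm N y x)) (carrier N)"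
    let ?h2 = "restrict (\<lambda>x. B.vec 1 (\<lambda>_. 0)) (carrier N)"
    have z: "?z \<in> semilinear_maps R f M ?P"
    proof (rule semilinearI)
      fix r x assume "r \<in> carrier R"
      then obtain a where "r = \<rho> a" using A.rho_ex by blast
      then show "?z (r \<odot>\<^bsub>M\<^esub> x) = f r \<odot>\<^bsub>?P\<^esub> ?z x" by (simp add: f_rho B.free_simps)
    qed (simp_all add: B.vec_car B.free_simps)
    have ex1: "\<exists>!h. h \<in> linear_maps S N ?P \<inter> extensional (carrier N) \<and> (\<forall>x\<in>carrier M. h (\<phi> x) = ?z x)"
      by (rule ext[unfolded extension_of_scalars_def, THEN conjunct2, THEN conjunct2, rule_format, OF P z])
    have h1: "?h1 \<in> linear_maps S N ?P"
    proof (rule semilinearI)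
      fix r x assume "r \<in> carrier S" "x \<in> carrier N"
      moreover obtain a where "r = \<rho>' a" using B.rho_ex calculation(1) by blast
      ultimately show "?h1 (r \<odot>\<^bsub>N\<^esub> x) = r \<odot>\<^bsub>?P\<^esub> ?h1 x"
        using B.lm_act_r[OF qN y, of x a] B.act_car[OF qN, of x a] by (simp add: B.free_simps B.act_def)
    qed (simp_all add: B.vec_car B.free_simps B.add_car[OF qN] B.lm_add_r[OF qN y])
    have h2: "?h2 \<in> linear_maps S N ?P"
    proof (rule semilinearI)
      fix r x assume "r \<in> carrier S" "x \<in> carrier N"
      moreover obtain a where "r = \<rho>' a" using B.rho_ex calculation(1) by blast
      ultimately show "?h2 (r \<odot>\<^bsub>N\<^esub> x) = r \<odot>\<^bsub>?P\<^esub> ?h2 x"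
        using B.act_car[OF qN, of x a] by (simp add: B.free_simps B.act_def)
    qed (simp_all add: B.vec_car B.free_simps B.add_car[OF qN])
    have "?h1 \<in> linear_maps S N ?P \<inter> extensional (carrier N) \<and> (\<forall>x\<in>carrier M. ?h1 (\<phi> x) = ?z x)"
      using h1 by (simp add: \<phi>c y0)
    moreover have "?h2 \<in> linear_maps S N ?P \<inter> extensional (carrier N) \<and> (\<forall>x\<in>carrier M. ?h2 (\<phi> x) = ?z x)"
      using h2 by (simp add: \<phi>c)
    ultimately have eq: "?h1 = ?h2" by (rule ex1_unique[OF ex1])
    show ?thesis
    proof (rule B.lm_nondeg[OF qN y])
      fix x assume "x \<in> carrier N"
      then show "B.lm N y x = 0" using fun_cong[OF eq, of x] by (simp add: B.vec_eq)
    qed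
  qed
  obtain m p D where D: "A.nonsing p D" and iso: "A.eqv (A.fm p D) (orthogonal_sum R M (A.hyp m))"
    using A.stabilize[OF M] by blast
  let ?S = "orthogonal_sum R M (A.hyp m)" and ?T = "orthogonal_sum S N (B.hyp m)"
  have qS: "A.qf ?S" and qT: "B.qf ?T" by (simp_all add: A.qf_os B.qf_os qM qN)
  have qD: "A.qf (A.fm p D)" by (rule A.qf_fm[OF D])
  obtain h where h: "h \<in> linear_maps R (A.fm p D) ?S"
    and hc: "\<And>x. x \<in> carrier (A.fm p D) \<Longrightarrow> h x \<in> carrier ?S"
    and onto: "\<And>y. y \<in> carrier ?S \<Longrightarrow> \<exists>x\<in>carrier (A.fm p D). y = h x"
    and hlm: "\<And>x y. x \<in> carrier (A.fm p D) \<Longrightarrow> y \<in> carrier (A.fm p D) \<Longrightarrow> A.lm ?S (h x) (h y) = A.lm (A.fm p D) x y"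
    and hmu: "\<And>x. x \<in> carrier (A.fm p D) \<Longrightarrow> mu ?S (h x) = mu (A.fm p D) x"
    using iso unfolding A.eqv_def by (elim conjE A.isoD) blast
  define \<Phi> where "\<Phi> x = (\<phi> (fst x), \<lambda>i :: nat. f (snd x i))" for x
  have fv: "(\<lambda>i. f (A.vec q v i)) = B.vec q (\<lambda>i. g (v i))" for v q
    unfolding A.vec_def B.vec_def fun_eq_iff using f_rho[of 0] by (simp add: f_rho A.rho_zero B.rho_zero)
  have \<Phi>v: "\<Phi> (x, A.vec (2 * m) v) = (\<phi> x, B.vec (2 * m) (\<lambda>i. g (v i)))" for x v
    by (simp add: \<Phi>_def fv)
  have ex: "\<exists>u v. u \<in> carrier M \<and> x = (u, A.vec (2 * m) v)" if "x \<in> carrier ?S" for x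
    using A.os_fm_ex that by (simp add: A.hyp_def)
  have \<Phi>: "\<Phi> \<in> semilinear_maps R f ?S ?T"
  proof (rule semilinearI)
    fix x y assume "x \<in> carrier ?S" "y \<in> carrier ?S"
    then obtain u v u' v' where [simp]: "u \<in> carrier M" "x = (u, A.vec (2 * m) v)" "u' \<in> carrier M" "y = (u', A.vec (2 * m) v')"
      using ex by meson
    show "\<Phi> x \<in> carrier ?T" by (simp add: \<Phi>v \<phi>c B.hyp_def B.vec_car)
    show "\<Phi> (x \<oplus>\<^bsub>?S\<^esub> y) = \<Phi> x \<oplus>\<^bsub>?T\<^esub> \<Phi> y"
      by (simp add: A.hyp_def B.hyp_def \<Phi>v semilinearD(2)[OF \<phi>] g_add)
  next
    fix r x assume r: "r \<in> carrier R" and "x \<in> carrier ?S"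
    then obtain u v where [simp]: "u \<in> carrier M" "x = (u, A.vec (2 * m) v)" using ex by meson
    obtain a where a: "r = \<rho> a" using A.rho_ex r by blast
    have "r \<odot>\<^bsub>?S\<^esub> x = (A.act M a u, A.vec (2 * m) (\<lambda>i. a * v i))"
      using A.fm_simps(4)[of "2 * m" A.hy a v] by (simp add: a A.act_def A.hyp_def)
    moreover have "f r \<odot>\<^bsub>?T\<^esub> \<Phi> x = (B.act N (g a) (\<phi> u), B.vec (2 * m) (\<lambda>i. g (a * v i)))"
      using B.fm_simps(4)[of "2 * m" B.hy "g a" "\<lambda>i. g (v i)"] by (simp add: a f_rho B.act_def B.hyp_def \<Phi>v g_mult)
    ultimately show "\<Phi> (r \<odot>\<^bsub>?S\<^esub> x) = f r \<odot>\<^bsub>?T\<^esub> \<Phi> x" by (simp add: \<Phi>v semilinear_act[OF \<phi>])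
  qed
  have \<Phi>lm: "B.lm ?T (\<Phi> x) (\<Phi> y) = g (A.lm ?S x y)" if x: "x \<in> carrier ?S" and y: "y \<in> carrier ?S" for x y
  proof -
    obtain u v u' v' where [simp]: "u \<in> carrier M" "x = (u, A.vec (2 * m) v)" "u' \<in> carrier M" "y = (u', A.vec (2 * m) v')"
      using ex[OF x] ex[OF y] by blast
    have "A.lm ?S x y = A.lm M u u' + A.bl (2 * m) (A.hm A.hy) v v'"
      by (subst A.lm_os[OF qM A.qf_hyp]) (simp_all add: A.hyp_def A.vec_car)
    moreover have "B.lm ?T (\<Phi> x) (\<Phi> y) = B.lm N (\<phi> u) (\<phi> u') + B.bl (2 * m) (B.hm B.hy) (\<lambda>i. g (v i)) (\<lambda>i. g (v' i))"
      by (subst B.lm_os[OF qN B.qf_hyp]) (simp_all add: \<Phi>v B.hyp_def B.vec_car \<phi>c)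
    ultimately show ?thesis by (simp add: g_add plm g_bl hm_gm[symmetric] gm_hy)
  qed
  have \<Phi>mu: "mu ?T (\<Phi> x) = B.cs (g c)" if x: "x \<in> carrier ?S" and c: "mu ?S x = A.cs c" for x c
  proof -
    obtain u v where uv [simp]: "u \<in> carrier M" "x = (u, A.vec (2 * m) v)" using ex[OF x] by blast
    obtain d where d: "mu M u = A.cs d" using A.mu_ex[OF qM uv(1)] by blast
    have "mu ?S x = A.cs (d + A.bl (2 * m) A.hy v v)" by (rule A.mu_os) (simp_all add: d A.hyp_def)
    then have "B.cs (g c) = B.cs (g (d + A.bl (2 * m) A.hy v v))" using c g_cs by metis
    also have "\<dots> = mu ?T (\<Phi> x)"
    proof -
      have "mu ?T (\<Phi> x) = B.cs (g d + g (A.bl (2 * m) A.hy v v))"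
        by (rule B.mu_os) (simp_all add: \<Phi>v pmu'[OF uv(1) d] B.hyp_def g_bl gm_hy)
      then show ?thesis by (simp add: g_add)
    qed
    finally show ?thesis by simp
  qed
  have "isometric S (B.fm p (gm D)) ?T"
  proof (rule B.gram_iso[OF qT _ _ _ nonsing_gm[OF D], where b = "\<lambda>i. \<Phi> (h (A.vec p (dl i)))"])
    fix i assume "i < p"
    then have "mu ?S (h (A.vec p (dl i))) = A.cs (D i i)"
      by (simp add: hmu A.vec_car A.bl_dl del: A.os_simps)
    then show "mu ?T (\<Phi> (h (A.vec p (dl i)))) = B.cs (gm D i i)"
      unfolding gm_def by (intro \<Phi>mu hc) (simp_all add: A.vec_car)
  next
    fix i j assume "i < j" "j < p"
    then show "B.lm ?T (\<Phi> (h (A.vec p (dl i)))) (\<Phi> (h (A.vec p (dl j)))) = B.hm (gm D) i j"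
      by (subst \<Phi>lm) (simp_all add: hc hlm A.vec_car A.bl_dl hm_gm gm_def del: A.os_simps)
  next
    fix z assume z: "z \<in> carrier ?T" and 0: "\<And>i. i < p \<Longrightarrow> B.lm ?T (\<Phi> (h (A.vec p (dl i)))) z = 0"
    have all0: "B.lm ?T (\<Phi> x) z = 0" if x: "x \<in> carrier ?S" for x
    proof -
      obtain x' where x': "x' \<in> carrier (A.fm p D)" "x = h x'" using onto[OF x] by blast
      obtain v where v: "x = h (A.vec p v)" using A.fm_ex[OF x'(1)] x'(2) by blast
      have "h (A.lc (A.fm p D) (\<lambda>i. A.vec p (dl i)) v p) = A.lc ?S (\<lambda>i. h (A.vec p (dl i))) v p"
        by (rule A.linear_lc[OF A.qf_module[OF qD] A.qf_module[OF qS] h]) (simp add: A.vec_car)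
      then have "x = A.lc ?S (\<lambda>i. h (A.vec p (dl i))) v p" by (simp add: v A.free_lc_dl_fm)
      then have "\<Phi> x = B.lc ?T (\<lambda>i. \<Phi> (h (A.vec p (dl i)))) (\<lambda>i. g (v i)) p"
        using semilinear_lc[OF A.qf_module[OF qS] B.qf_module[OF qT] \<Phi>, of "\<lambda>i. h (A.vec p (dl i))" v p] hc
        by (simp add: A.vec_car del: A.os_simps)
      then show ?thesis
        using B.lm_lc_l[OF qT _ z, of p "\<lambda>i. \<Phi> (h (A.vec p (dl i)))" "\<lambda>i. g (v i)"] 0 semilinearD(1)[OF \<Phi> hc]
        by (simp add: A.vec_car del: A.os_simps B.os_simps)
    qed
    obtain y w where zz: "z = (y, B.vec (2 * m) w)" and y: "y \<in> carrier N"
      using B.os_fm_ex[of z N "2 * m" B.hy] z by (auto simp: B.hyp_def)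
    have \<phi>0: "\<phi> \<zero>\<^bsub>M\<^esub> = \<zero>\<^bsub>N\<^esub>" by (rule semilinear_zero[OF A.qf_module[OF qM] B.qf_module[OF qN] \<phi>])
    have "y = \<zero>\<^bsub>N\<^esub>"
    proof (rule gen[OF y])
      fix x assume x: "x \<in> carrier M"
      have "B.lm ?T (\<Phi> (x, A.vec (2 * m) (\<lambda>_. 0))) z = 0" by (rule all0) (simp add: x A.hyp_def A.vec_car)
      then show "B.lm N (\<phi> x) y = 0"
        using x y by (subst (asm) B.lm_os[OF qN B.qf_hyp]) (simp_all add: \<Phi>v zz \<phi>c B.hyp_def B.vec_car)
    qed
    moreover have "B.vec (2 * m) w = \<zero>\<^bsub>B.hyp m\<^esub>"
    proof (rule B.lm_cancel_r[OF B.qf_hyp])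
      fix v assume "v \<in> carrier (B.hyp m)"
      then obtain v' where v': "v = B.vec (2 * m) v'" using B.fm_ex unfolding B.hyp_def by blast
      have "B.bl (2 * m) (B.hm B.hy) (dl i) w = 0" if "i < 2 * m" for i
      proof -
        have "B.lm ?T (\<Phi> (\<zero>\<^bsub>M\<^esub>, A.vec (2 * m) (dl i))) z = 0"
          by (rule all0) (simp add: A.zero_car[OF qM] A.hyp_def A.vec_car)
        then show ?thesis
          using y by (subst (asm) B.lm_os[OF qN B.qf_hyp])
            (simp_all add: \<Phi>v zz \<phi>0 B.hyp_def B.vec_car B.zero_car[OF qN] B.lm_zero_l[OF qN])
      qed
      then have "B.bl (2 * m) (B.hm B.hy) v' w = 0" by (simp add: B.bl_dl_l) (simp add: B.bl_right)
      then show "B.lm (B.hyp m) v (B.vec (2 * m) w) = B.lm (B.hyp m) v \<zero>\<^bsub>B.hyp m\<^esub>"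
        by (simp add: v' B.hyp_def)
    qed (simp_all add: B.hyp_def B.vec_car)
    ultimately show "z = \<zero>\<^bsub>?T\<^esub>" by (simp add: zz)
  qed (use semilinearD(1)[OF \<Phi> hc] in \<open>simp add: A.vec_car del: B.os_simps A.os_simps\<close>)
  then have "B.steq (B.fm p (gm D)) ?T"
    by (intro B.eqv_steq) (simp add: B.eqv_def qT B.qf_fm nonsing_gm D)
  then have "B.steq (B.fm p (gm D)) N"
    using B.steq_trans[OF B.qf_fm[OF nonsing_gm[OF D]] qT qN _ B.steq_hyp[OF qN]] by blast
  moreover have "A.steq (A.fm p D) (A.fm n C)"
    using A.steq_trans[OF qD qS qM A.eqv_steq[OF iso] A.steq_hyp[OF qM]]
      A.steq_trans[OF qD qM A.qf_fm[OF C] _ A.steq_sym[OF MC]] by blast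
  then have "B.steq (B.fm n (gm C)) (B.fm p (gm D))"
    using steq_gm[OF D C] B.steq_sym by blast
  ultimately show ?thesis
    using B.steq_trans[OF B.qf_fm[OF nonsing_gm[OF C]] B.qf_fm[OF nonsing_gm[OF D]] qN] by blast
qed

text \<open>\<open>base_change_class\<close> shows that all choices in the union give the same
  class, and \<open>base_change_fm\<close> that the union is not empty.\<close>

lemma L_map_cl:
  assumes C: "A.nonsing n C"
  shows "L_map k R S \<tau> f (A.cl n C) = B.cl n (gm C)"
proof -
  have 1: "witt_class k S \<tau> N = B.cl n (gm C)"
    if M: "M \<in> A.cl n C" and N: "base_change_form k R S \<tau> f M N"
    for M :: "('a, nat \<Rightarrow> 'a) qform" and N :: "('c, nat \<Rightarrow> 'c) qform"
  proof -
    have "nonsingular_form k R \<sigma> M" "A.steq (A.fm n C) M" using M by (simp_all add: A.mem_cl C)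
    from base_change_class[OF this(1) N C this(2)] have st: "B.steq (B.fm n (gm C)) N" .
    have "B.qf N" using N B.form_qf unfolding base_change_form_def by blast
    from B.witt_class_eqI[OF B.qf_fm[OF nonsing_gm[OF C]] this st] show ?thesis by (simp add: B.cl_def)
  qed
  have 2: "A.fm n C \<in> A.cl n C" by (rule A.fm_mem_cl[OF C])
  show ?thesis
    unfolding L_map_def using 1 2 base_change_fm[OF C] by blast
qed

end

section \<open>Planes and their classes\<close>

lemma sum2: "(\<Sum>i<2. f i) = f 0 + (f (Suc 0) :: 'a::comm_monoid_add)"
  by (simp add: eval_nat_numeral)

lemma sum4: "(\<Sum>i<4. f i) = f 0 + f (Suc 0) + f 2 + (f 3 :: 'a::comm_monoid_add)"
  by (simp add: eval_nat_numeral)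

lemma less2: "i < (2::nat) \<longleftrightarrow> i = 0 \<or> i = Suc 0" by auto
lemma less4: "i < (4::nat) \<longleftrightarrow> i = 0 \<or> i = Suc 0 \<or> i = 2 \<or> i = 3" by auto

context fmodel
begin

text \<open>Change of basis by \<open>U\<close> with inverse \<open>V\<close>. Invertibility of the
  new Gram matrix is part of the conclusion: \<open>E i\<close> represents the i-th coordinate with
  respect to the new basis, and its own coordinates in that basis, conjugated, form the i-th row of
  the inverse.\<close>

lemma cl_change:
  assumes A: "nonsing p A"
    and VU: "\<And>l m. l < p \<Longrightarrow> m < p \<Longrightarrow> (\<Sum>i<p. V l i * U i m) = dl l m"
    and UV: "\<And>i j. i < p \<Longrightarrow> j < p \<Longrightarrow> (\<Sum>l<p. U i l * V l j) = dl i j"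
    and diag: "\<And>i. i < p \<Longrightarrow> bl p A (U i) (U i) - C i i \<in> Lam"
    and herm: "\<And>i j. i < p \<Longrightarrow> j < p \<Longrightarrow> bl p (hm A) (U i) (U j) = hm C i j"
  shows "nonsing p C" "cl p C = cl p A"
proof -
  have qA: "qf (fm p A)" by (rule qf_fm[OF A])
  have "\<exists>E. \<forall>w. bl p (hm A) E w = (\<Sum>l<p. w l * V l i)" for i
  proof -
    have "\<exists>x\<in>carrier (fm p A). \<forall>y\<in>carrier (fm p A). lm (fm p A) x y = (\<Sum>l<p. un (y l) * V l i)"
    proof (rule lm_repr[OF qA])
      fix x y assume "x \<in> carrier (fm p A)" "y \<in> carrier (fm p A)"
      then obtain v w where [simp]: "x = vec p v" "y = vec p w" using fm_ex by meson
      show "(\<Sum>l<p. un ((x \<oplus>\<^bsub>fm p A\<^esub> y) l) * V l i) = (\<Sum>l<p. un (x l) * V l i) + (\<Sum>l<p. un (y l) * V l i)"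
        by (simp add: un_vec algebra_simps sum.distrib cong: sum.cong_simp)
    next
      fix a x assume "x \<in> carrier (fm p A)"
      then obtain v where [simp]: "x = vec p v" using fm_ex by meson
      show "(\<Sum>l<p. un (act (fm p A) a x l) * V l i) = a * (\<Sum>l<p. un (x l) * V l i)"
        by (simp add: un_vec sum_distrib_left mult.assoc cong: sum.cong_simp)
    qed
    then obtain x where x: "x \<in> carrier (fm p A)"
      and xl: "\<And>y. y \<in> carrier (fm p A) \<Longrightarrow> lm (fm p A) x y = (\<Sum>l<p. un (y l) * V l i)" by blast
    obtain e where e: "x = vec p e" using fm_ex[OF x] by blast
    have "bl p (hm A) e w = (\<Sum>l<p. w l * V l i)" for w
      using xl[of "vec p w"] by (simp add: e vec_car un_vec cong: sum.cong_simp)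
    then show ?thesis by blast
  qed
  then obtain E where E: "\<And>i w. bl p (hm A) (E i) w = (\<Sum>l<p. w l * V l i)" by metis
  show ns: "nonsing p C"
  proof (rule nonsingI[where g = "\<lambda>i k. s (\<Sum>l<p. E i l * V l k)"])
    fix i j assume ij: "i < p" "j < p"
    have "(\<Sum>k<p. s (\<Sum>l<p. E i l * V l k) * hm C k j) = (\<Sum>k<p. s (\<Sum>l<p. E i l * V l k) * bl p (hm A) (U k) (U j))"
      using ij by (simp add: herm cong: sum.cong_simp)
    also have "\<dots> = bl p (hm A) (\<lambda>m. \<Sum>k<p. (\<Sum>l<p. E i l * V l k) * U k m) (U j)" by (simp only: bl_sum_l)
    also have "\<dots> = bl p (hm A) (E i) (U j)"
      by (rule bl_cong) (simp_all add: sum_mult_assoc VU cong: sum.cong_simp)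
    also have "\<dots> = dl i j" using UV[OF ij(2,1)] by (simp add: E) (simp add: dl_def)
    finally show "(\<Sum>k<p. s (\<Sum>l<p. E i l * V l k) * hm C k j) = dl i j" .
  qed
  have "miso p C p A"
    unfolding miso_def by (rule exI[of _ U], rule exI[of _ V]) (simp add: diag herm VU)
  from cl_eqI[OF miso_eqv[OF ns A this]] show "cl p C = cl p A" .
qed

lemma cl_cong:
  assumes "nonsing p A" "\<And>i j. i < p \<Longrightarrow> j < p \<Longrightarrow> hm A i j = hm C i j" "\<And>i. i < p \<Longrightarrow> A i i - C i i \<in> Lam"
  shows "nonsing p C" "cl p C = cl p A"
  using cl_change[OF assms(1), of dl dl C] assms(2,3) by (simp_all add: bl_dl)

text \<open>The admissible \<mu>-values of vectors with \<lambda>(x, x) = 0. Since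
  \<open>Lam\<close> acts as zero on plane classes, what counts is the quotient of \<open>Hh\<close>
  by \<open>Lam\<close>, a Tate cohomology group of the involution.\<close>

definition Hh :: "'b set" where "Hh = {a. a + eps * s a = 0}"

definition pl :: "'b \<Rightarrow> 'b \<Rightarrow> nat \<Rightarrow> nat \<Rightarrow> 'b" where
  "pl a b i j = (if i = 0 \<and> j = 0 then a else if i = 0 \<and> j = Suc 0 then 1 else if i = Suc 0 \<and> j = Suc 0 then b else 0)"

definition sy :: "'b \<Rightarrow> 'b \<Rightarrow> ('a, nat \<Rightarrow> 'a) qform set" where "sy a b = cl 2 (pl a b)"

lemma hm_pl: "a \<in> Hh \<Longrightarrow> b \<in> Hh \<Longrightarrow> i < 2 \<Longrightarrow> j < 2 \<Longrightarrow> hm (pl a b) i j = hm hy i j"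
  by (auto simp: hm_hy hm_def[of "pl a b"] pl_def Hh_def less2)

lemma nonsing_pl: "a \<in> Hh \<Longrightarrow> b \<in> Hh \<Longrightarrow> nonsing 2 (pl a b)"
  by (rule nonsing_cong[OF nonsing_hy[of 1, simplified]]) (simp add: hm_pl)

lemma sy_car: "a \<in> Hh \<Longrightarrow> b \<in> Hh \<Longrightarrow> sy a b \<in> carrier LG"
  by (simp add: sy_def cl_car nonsing_pl)

lemma Hh_zero [simp]: "0 \<in> Hh" by (simp add: Hh_def)
lemma Hh_add: "a \<in> Hh \<Longrightarrow> b \<in> Hh \<Longrightarrow> a + b \<in> Hh"
proof -
  assume "a \<in> Hh" "b \<in> Hh"
  then have "(a + eps * s a) + (b + eps * s b) = 0" by (simp add: Hh_def)
  then show ?thesis by (simp add: Hh_def s_add algebra_simps)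
qed
lemma Hh_neg: "a \<in> Hh \<Longrightarrow> - a \<in> Hh" by (simp add: Hh_def s_neg add_eq_0_iff)
lemma Lam_Hh: "a \<in> Lam \<Longrightarrow> a \<in> Hh" by (simp add: Hh_def Lam_herm)
lemma Hh_conj: "a \<in> Hh \<Longrightarrow> r * a * s r \<in> Hh"
proof -
  assume "a \<in> Hh"
  then have "r * s r * (a + eps * s a) = 0" by (simp add: Hh_def)
  then show ?thesis by (simp add: Hh_def s_mult algebra_simps)
qed

lemma sy_cong:
  assumes "a \<in> Hh" "b \<in> Hh" "a - a' \<in> Lam" "b - b' \<in> Lam"
  shows "sy a b = sy a' b'"
proof -
  have H: "a' \<in> Hh" "b' \<in> Hh"
    using Hh_add[OF assms(1) Hh_neg[OF Lam_Hh[OF assms(3)]]] Hh_add[OF assms(2) Hh_neg[OF Lam_Hh[OF assms(4)]]] by simp_all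
  show ?thesis
    unfolding sy_def
  proof (rule sym, rule cl_cong(2)[OF nonsing_pl[OF assms(1,2)]])
    fix i j assume "i < (2::nat)" "j < (2::nat)"
    then show "hm (pl a b) i j = hm (pl a' b') i j" by (simp add: hm_pl H assms(1,2))
  next
    fix i assume "i < (2::nat)"
    then have "i = 0 \<or> i = Suc 0" by (simp only: less2)
    then show "pl a b i i - pl a' b' i i \<in> Lam" using assms(3,4) by (elim disjE) (simp_all add: pl_def)
  qed
qed

text \<open>If (x, y) is the basis of the plane, then (y, eps x) is used; the factor
  \<open>eps\<close> restores the pairing 1 and does not affect \<mu>.\<close>

lemma sy_swap:
  assumes "a \<in> Hh" "b \<in> Hh"
  shows "sy b a = sy a b"
  unfolding sy_def
  by (rule cl_change(2)[OF nonsing_pl[OF assms], where U = "\<lambda>i m. if i = 0 then dl (Suc 0) m else eps * dl 0 m"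
        and V = "\<lambda>l i. if l = 0 then eps * dl (Suc 0) i else dl 0 i"])
    (use assms in \<open>auto simp: less2 sum2 bl_def pl_def hm_def dl_def Hh_def algebra_simps\<close>)

text \<open>Replaces y by y + c x. The summand \<open>eps * c\<close> is \<lambda>(y, c x), and
  \<open>c \<in> Hh\<close> is what keeps \<lambda>(y + c x, y + c x) = 0.\<close>

lemma sy_shear:
  assumes a: "a \<in> Hh" and b: "b \<in> Hh" and c: "c \<in> Hh"
  shows "sy a (b + c * a * s c + eps * c) = sy a b"
proof -
  have sc: "s c = - (eps * c)"
  proof -
    have "eps * (c + eps * s c) = 0" using c by (simp add: Hh_def)
    then show ?thesis by (simp add: distrib_left add_eq_0_iff2)
  qed
  have "c * a * s c \<in> Hh" by (rule Hh_conj[OF a])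
  moreover have "eps * c \<in> Hh" using c by (simp add: Hh_def s_mult sc)
  ultimately have b': "b + c * a * s c + eps * c \<in> Hh" using b by (intro Hh_add)
  let ?U = "\<lambda>i m. if i = 0 then dl 0 m else dl (Suc 0) m + c * dl 0 m"
  let ?V = "\<lambda>l i. if l = 0 then dl 0 i else dl (Suc 0) i - c * dl 0 i"
  show ?thesis
    unfolding sy_def
  proof (rule cl_change(2)[OF nonsing_pl[OF a b], where U = ?U and V = ?V])
    fix i assume "i < (2::nat)"
    then show "bl 2 (pl a b) (?U i) (?U i) - pl a (b + c * a * s c + eps * c) i i \<in> Lam"
      using LamI[of "s c"] by (auto simp: less2 sum2 bl_def pl_def dl_def algebra_simps)
  next
    fix i j assume ij: "i < (2::nat)" "j < (2::nat)"
    have "bl 2 (hm (pl a b)) (?U i) (?U j) = bl 2 (hm hy) (?U i) (?U j)" by (rule bl_cong) (simp_all add: hm_pl a b)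
    also have "\<dots> = hm hy i j"
      using ij by (auto simp: bl_def sum2 less2 dl_def hm_hy sc algebra_simps)
    finally show "bl 2 (hm (pl a b)) (?U i) (?U j) = hm (pl a (b + c * a * s c + eps * c)) i j"
      by (simp only: hm_pl[OF a b' ij])
  qed (auto simp: less2 sum2 dl_def)
qed

text \<open>With a = 0 a shear changes the second value by \<open>eps * c\<close> alone; c = -eps b
  removes it, and the plane is hyperbolic.\<close>

lemma sy_zero: "b \<in> Hh \<Longrightarrow> sy 0 b = \<zero>\<^bsub>LG\<^esub>"
proof -
  assume b: "b \<in> Hh"
  have "eps * (b + eps * s b) = 0" using b by (simp add: Hh_def)
  then have "eps * b \<in> Hh" by (simp add: Hh_def s_mult distrib_left)
  from sy_shear[OF Hh_zero b Hh_neg[OF this]] have "sy 0 0 = sy 0 b" by simp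
  moreover have "sy 0 0 = cl (2 * 1) hy"
    unfolding sy_def using cl_cong(2)[OF nonsing_hy[of 1], of "pl 0 0"] hm_pl[OF Hh_zero Hh_zero] 
    by (auto simp: less2 pl_def hy_def)
  ultimately show ?thesis using cl_hyp[of 1] by simp
qed

lemma bs2_hy: "bs 2 hy hy = hy"
  by (auto simp: bs_def hy_def fun_eq_iff)

lemma hm_bs_pl:
  assumes "a \<in> Hh" "b \<in> Hh" "a' \<in> Hh" "b' \<in> Hh" "i < 4" "j < 4"
  shows "hm (bs 2 (pl a b) (pl a' b')) i j = hm hy i j"
proof -
  have "\<not> i < 2 \<Longrightarrow> i - 2 < 2" "\<not> j < 2 \<Longrightarrow> j - 2 < 2" using assms(5,6) by linarith+
  then have "hm (bs 2 (pl a b) (pl a' b')) i j = hm (bs 2 hy hy) i j"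
    by (simp add: hm_bs bs_def hm_pl assms(1-4))
  then show ?thesis by (simp only: bs2_hy)
qed

text \<open>In a sum of planes with bases (x, y) and (x', y') the vectors x and y' are replaced by x
  + r x' and y' - s(r) y; the second change restores orthogonality of the two planes. Additivity of
  the symbol, its order two and the transfer of squares between its arguments are all special
  cases.\<close>

lemma sy_star:
  assumes H: "a \<in> Hh" "b \<in> Hh" "a' \<in> Hh" "b' \<in> Hh"
  shows "sy (a + r * a' * s r) b \<oplus>\<^bsub>LG\<^esub> sy a' (b' + s r * b * r) = sy a b \<oplus>\<^bsub>LG\<^esub> sy a' b'"
proof -
  have H': "a + r * a' * s r \<in> Hh" "b' + s r * b * r \<in> Hh"
    using Hh_add[OF H(1) Hh_conj[OF H(3)]] Hh_add[OF H(4) Hh_conj[OF H(2), of "s r"]] by simp_all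
  let ?A = "bs 2 (pl a b) (pl a' b')" and ?C = "bs 2 (pl (a + r * a' * s r) b) (pl a' (b' + s r * b * r))"
  note nA = nonsing_bs[OF nonsing_pl[OF H(1,2)] nonsing_pl[OF H(3,4)]]
  let ?U = "\<lambda>i m. dl i m + (if i = 0 then r * dl 2 m else if i = 3 then - s r * dl (Suc 0) m else 0)"
  let ?V = "\<lambda>i m. dl i m - (if i = 0 then r * dl 2 m else if i = 3 then - s r * dl (Suc 0) m else 0)"
  have hA: "hm ?A i j = hm hy i j" if "i < 4" "j < 4" for i j
    using hm_bs_pl[OF H that] .
  have hC: "hm ?C i j = hm hy i j" if "i < 4" "j < 4" for i j
    using hm_bs_pl[OF H'(1) H(2,3) H'(2) that] .
  have "cl 4 ?C = cl 4 ?A"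
  proof (rule cl_change(2)[where U = ?U and V = ?V])
    show "nonsing 4 ?A" using nA by simp
    fix i assume "i < (4::nat)"
    then show "bl 4 ?A (?U i) (?U i) - ?C i i \<in> Lam"
      by (auto simp: less4 sum4 bl_def dl_def bs_def pl_def s_neg algebra_simps)
  next
    fix i j assume ij: "i < (4::nat)" "j < (4::nat)"
    have "bl 4 (hm ?A) (?U i) (?U j) = bl 4 (hm hy) (?U i) (?U j)" by (rule bl_cong) (simp_all add: hA)
    also have "\<dots> = hm hy i j" using ij by (auto simp: less4 sum4 bl_def dl_def hm_hy s_neg mult.commute[of _ eps])
    finally show "bl 4 (hm ?A) (?U i) (?U j) = hm ?C i j" using hC[OF ij] by simp
  qed (auto simp: less4 sum4 dl_def)
  then show ?thesis
    unfolding sy_def LG_add[OF nonsing_pl[OF H(1,2)] nonsing_pl[OF H(3,4)]] LG_add[OF nonsing_pl[OF H'(1) H(2)] nonsing_pl[OF H(3) H'(2)]]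
    by simp
qed

section \<open>Splitting planes off a matrix, and Higman's trick\<close>

lemma nonsing_bs_snd:
  assumes "nonsing (m + n) (bs m A B)"
  shows "nonsing n B"
proof -
  obtain g where g: "\<And>i j. i < m + n \<Longrightarrow> j < m + n \<Longrightarrow> (\<Sum>k<m + n. g i k * hm (bs m A B) k j) = dl i j"
    using assms unfolding nonsing_def by blast
  show ?thesis
  proof (rule nonsingI[where g = "\<lambda>i k. g (m + i) (m + k)"])
    fix i j assume "i < n" "j < n"
    then show "(\<Sum>k<n. g (m + i) (m + k) * hm B k j) = dl i j"
      using g[of "m + i" "m + j"] by (simp add: sum_lessThan_add hm_bs bs_def dl_def cong: sum.cong_simp)
  qed
qed

text \<open>The shear adds \<open>z i\<close> times the basis vector 0 to the i-th one. As
  \<open>z 0 = 0\<close>, the added matrix squares to zero, and changing its sign gives the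
  inverse.\<close>

lemma shear_inverse:
  assumes "z 0 = (0::'b)" "l < p" "m < p"
  shows "(\<Sum>i<p. (dl l i - z l * dl 0 i) * (dl i m + z i * dl 0 m)) = dl l m"
    "(\<Sum>i<p. (dl l i + z l * dl 0 i) * (dl i m - z i * dl 0 m)) = dl l m"
proof -
  have "0 < p" using assms by simp
  then show "(\<Sum>i<p. (dl l i - z l * dl 0 i) * (dl i m + z i * dl 0 m)) = dl l m"
    "(\<Sum>i<p. (dl l i + z l * dl 0 i) * (dl i m - z i * dl 0 m)) = dl l m"
    using assms by (simp_all add: left_diff_distrib distrib_right sum_subtractf sum.distrib mult.assoc sum_distrib_left[symmetric])
qed

text \<open>Basis vector 0 is isotropic, pairs to 1 with its successor and to 0 with the rest.
  Adding multiples of it makes basis vector 1 isotropic for \<lambda> and orthogonal to the rest,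
  without changing the pairings among the rest.\<close>

lemma split_plane:
  assumes A: "nonsing (2 + n) A" and h00: "hm A 0 0 = 0" and h01: "hm A 0 (Suc 0) = 1"
    and h0: "\<And>j. 2 \<le> j \<Longrightarrow> j < 2 + n \<Longrightarrow> hm A 0 j = 0"
  shows "\<exists>a\<in>Hh. \<exists>b\<in>Hh. \<exists>B. nonsing n B \<and> (\<forall>i<n. \<forall>j<n. hm B i j = hm A (2 + i) (2 + j)) \<and>
    cl (2 + n) A = sy a b \<oplus>\<^bsub>LG\<^esub> cl n B"
proof -
  \<comment> \<open>At index 1 the coefficient uses \<open>A 1 1\<close>, a half of \<lambda>(e_1,
    e_1) in the sense that the latter is \<open>A 1 1 + eps * s (A 1 1)\<close>; at larger indices
    it cancels the full pairing with e_1.\<close>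
  define z where "z i = (if i = 0 then 0 else if i = Suc 0 then - (eps * A 1 1) else - (eps * hm A 1 i))" for i
  define U where "U i m = dl i m + z i * dl 0 m" for i m
  define q where "q i j = hm A i j + z j * hm A i 0 + s (z i) * hm A 0 j" for i j
  have blU: "bl (2 + n) (hm A) (U i) (U j) = q i j" if "i < 2 + n" "j < 2 + n" for i j
    using that unfolding U_def by (simp add: bl_add_l bl_add_r bl_act_l bl_act_r bl_dl h00 q_def algebra_simps)
  have h10: "hm A (Suc 0) 0 = eps" using hm_sym[of A "Suc 0" 0] h01 by simp
  have hi0: "hm A i 0 = 0" if "2 \<le> i" "i < 2 + n" for i using hm_sym[of A i 0] h0[OF that] by simp
  have q0: "q 0 0 = 0" "q 0 (Suc 0) = 1" "q (Suc 0) 0 = eps" by (simp_all add: q_def z_def h00 h01 h10)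
  have q11: "q (Suc 0) (Suc 0) = 0"
    by (simp add: q_def z_def h01 h10 hm_def[of A "Suc 0" "Suc 0"] s_simps mult.commute[of _ eps])
  have qj: "q 0 j = 0" "q j 0 = 0" "q (Suc 0) j = 0" "q j (Suc 0) = 0" if "2 \<le> j" "j < 2 + n" for j
    using that h0[OF that] hi0[OF that] h01 h10 hm_sym[of A j "Suc 0"]
    by (simp_all add: q_def z_def s_simps mult.commute[of _ eps] h00)
  have qij: "q i j = hm A i j" if "2 \<le> i" "i < 2 + n" "2 \<le> j" "j < 2 + n" for i j
    using that by (simp add: q_def h0 hi0)
  define a where "a = bl (2 + n) A (U 0) (U 0)"
  define b where "b = bl (2 + n) A (U (Suc 0)) (U (Suc 0))"
  have a: "a \<in> Hh" and b: "b \<in> Hh"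
    using blU[of 0 0] blU[of "Suc 0" "Suc 0"] by (simp_all add: Hh_def a_def b_def bl_hm q0 q11)
  define B where "B i j = (if i = j then bl (2 + n) A (U (2 + i)) (U (2 + i)) else if i < j then hm A (2 + i) (2 + j) else 0)" for i j
  have hB: "hm B i j = hm A (2 + i) (2 + j)" if "i < n" "j < n" for i j
  proof -
    consider "i = j" | "i < j" | "j < i" by linarith
    then show ?thesis
    proof cases
      case 1
      then show ?thesis using blU[of "2 + i" "2 + i"] qij[of "2 + i" "2 + i"] that by (simp add: hm_def[of B] B_def bl_hm)
    next
      case 2 then show ?thesis by (simp add: hm_def[of B] B_def)
    next
      case 3 then show ?thesis using hm_sym[of A "2 + i" "2 + j"] by (simp add: hm_def[of B] B_def)
    qed
  qed
  let ?C = "bs 2 (pl a b) B"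
  have split: "i = 0 \<or> i = Suc 0 \<or> (2 \<le> i \<and> i - 2 < n \<and> i = 2 + (i - 2))" if "i < 2 + n" for i using that by auto
  have z0: "z 0 = 0" by (simp add: z_def)
  have VU: "(\<Sum>i<2 + n. (dl l i - z l * dl 0 i) * U i m) = dl l m" if "l < 2 + n" "m < 2 + n" for l m
    unfolding U_def by (rule shear_inverse(1)[where z = z, OF z0 that])
  have UV: "(\<Sum>i<2 + n. U l i * (dl i m - z i * dl 0 m)) = dl l m" if "l < 2 + n" "m < 2 + n" for l m
    unfolding U_def by (rule shear_inverse(2)[where z = z, OF z0 that])
  have dg: "bl (2 + n) A (U i) (U i) - ?C i i \<in> Lam" if i: "i < 2 + n" for i
  proof -
    from split[OF i] have "bl (2 + n) A (U i) (U i) - ?C i i = 0"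
      by (elim disjE conjE) (simp_all add: bs_def pl_def a_def b_def B_def)
    then show ?thesis by simp
  qed
  have hr: "bl (2 + n) (hm A) (U i) (U j) = hm ?C i j" if ij: "i < 2 + n" "j < 2 + n" for i j
    using split[OF ij(1)] split[OF ij(2)] unfolding blU[OF ij] hm_bs
    by (elim disjE conjE) (use ij in \<open>simp_all add: bs_def q0 q11 qj qij hm_pl a b hm_hy hB\<close>)
  have C: "nonsing (2 + n) ?C" "cl (2 + n) ?C = cl (2 + n) A"
    using cl_change[OF A, where U = U and V = "\<lambda>l m. dl l m - z l * dl 0 m" and C = ?C, OF VU UV dg hr] by blast+
  have nB: "nonsing n B" by (rule nonsing_bs_snd[OF C(1)])
  have "cl (2 + n) A = sy a b \<oplus>\<^bsub>LG\<^esub> cl n B"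
    unfolding sy_def LG_add[OF nonsing_pl[OF a b] nB] using C(2) by simp
  then show ?thesis using a b nB hB by blast
qed

text \<open>A form whose \<lambda> is standard hyperbolic can differ from a hyperbolic form only in
  \<mu>, so it is a sum of planes. \<open>split_plane\<close> removes them one at a time and leaves
  the remaining \<lambda> standard.\<close>

lemma hyperbolic_planes:
  assumes "\<And>i j. i < 2 * m \<Longrightarrow> j < 2 * m \<Longrightarrow> hm C i j = hm hy i j"
    and zero: "\<zero>\<^bsub>LG\<^esub> \<in> P" and step: "\<And>a b x. a \<in> Hh \<Longrightarrow> b \<in> Hh \<Longrightarrow> x \<in> P \<Longrightarrow> sy a b \<oplus>\<^bsub>LG\<^esub> x \<in> P"
  shows "cl (2 * m) C \<in> P"
  using assms(1)
proof (induction m arbitrary: C)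
  case 0
  then show ?case using zero LG_zero[of C] by simp
next
  case (Suc m)
  have 2: "2 * Suc m = 2 + 2 * m" by simp
  have "nonsing (2 * Suc m) C" by (rule nonsing_cong[OF nonsing_hy]) (simp add: Suc.prems)
  then have ns: "nonsing (2 + 2 * m) C" by simp
  have "\<exists>a\<in>Hh. \<exists>b\<in>Hh. \<exists>B. nonsing (2 * m) B \<and> (\<forall>i<2 * m. \<forall>j<2 * m. hm B i j = hm C (2 + i) (2 + j)) \<and>
    cl (2 + 2 * m) C = sy a b \<oplus>\<^bsub>LG\<^esub> cl (2 * m) B"
    by (rule split_plane[OF ns]) (simp_all add: Suc.prems hm_hy)
  then obtain a b B where ab: "a \<in> Hh" "b \<in> Hh" and hB: "\<And>i j. i < 2 * m \<Longrightarrow> j < 2 * m \<Longrightarrow> hm B i j = hm C (2 + i) (2 + j)"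
    and eq: "cl (2 + 2 * m) C = sy a b \<oplus>\<^bsub>LG\<^esub> cl (2 * m) B" by blast
  have "cl (2 * m) B \<in> P" by (rule Suc.IH) (simp add: hB Suc.prems hm_hy)
  then show ?case using step[OF ab] by (simp only: 2 eq)
qed

lemma bl_bs: "bl (n + m) (bs n A B) v w = bl n A v w + bl m B (\<lambda>i. v (n + i)) (\<lambda>i. w (n + i))"
  by (simp add: bl_def sum_lessThan_add bs_def cong: sum.cong_simp)

lemma bl_hy: "bl (2 * m) hy v w = (\<Sum>i<m. s (v (2 * i)) * w (Suc (2 * i)))"
proof -
  have "bl (2 * m) hy v w = (\<Sum>i<2 * m. if even i then s (v i) * w (Suc i) else 0)"
    unfolding bl_right
  proof (rule sum.cong[OF refl])
    fix i assume i: "i \<in> {..<2 * m}"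
    have "(\<Sum>j<2 * m. hy i j * w j) = (\<Sum>j<2 * m. if j = Suc i then (if even i then w j else 0) else 0)"
      by (rule sum.cong) (auto simp: hy_def)
    also have "\<dots> = (if even i then w (Suc i) else 0)" using i by (auto elim!: evenE)
    finally show "s (v i) * (\<Sum>j<2 * m. hy i j * w j) = (if even i then s (v i) * w (Suc i) else 0)" by simp
  qed
  then show ?thesis by (simp add: sum_lessThan_double)
qed

text \<open>Higman's trick: the term \<open>s u * Q\<close> is traded for the entries \<open>u\<close> and \<open>Q\<close>
  of a larger matrix.\<close>

definition hig :: "nat \<Rightarrow> (nat \<Rightarrow> nat \<Rightarrow> 'b) \<Rightarrow> 'b \<Rightarrow> (nat \<Rightarrow> nat \<Rightarrow> 'b) \<Rightarrow> nat \<Rightarrow> nat \<Rightarrow> 'b" where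
  "hig n A u Q i j = (if i < n then if j < n then A i j + s u * Q i j else if j = n + Suc (2 * i) then s u else 0
     else if j < n then if even (i - n) then Q ((i - n) div 2) j else 0 else hy (i - n) (j - n))"

text \<open>\<open>hig\<close> is the matrix of \<open>A\<close> plus \<open>n\<close> hyperbolic
  planes after the change of basis 1 + X: the i-th vector of \<open>A\<close> receives
  \<open>u\<close> times the even vector of the i-th plane and \<open>Q m i\<close> times the odd
  vector of the m-th plane, for every m. Since X maps old vectors to combinations of new ones, X^2 =
  0 and the inverse is 1 - X. The pairing of the added parts is \<open>s u * Q i j\<close>.\<close>

lemma higman:
  assumes A: "nonsing n A"
  shows "nonsing (n + 2 * n) (hig n A u Q)" "cl (n + 2 * n) (hig n A u Q) = cl n A"
proof -
  define X where "X i m = (if i < n \<and> n \<le> m then if even (m - n) then u * dl i ((m - n) div 2) else Q ((m - n) div 2) i else 0)" for i m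
  have X0: "X i m = 0" if "m < n \<or> n \<le> i" for i m using that by (auto simp: X_def)
  have XX: "X l i * X i m = 0" for l i m by (cases "i < n") (simp_all add: X0)
  have Xe: "X i (n + 2 * m) = u * dl i m" "X i (Suc (n + 2 * m)) = Q m i" if "i < n" for i m
    using that by (simp_all add: X_def Suc_diff_le)
  let ?U = "\<lambda>i m. dl i m + X i m" and ?V = "\<lambda>i m. dl i m - X i m"
  note nA = nonsing_bs[OF A nonsing_hy[of n]]
  let ?A = "bs n A hy"
  have blU: "bl (n + 2 * n) ?A (?U i) (?U j) = hig n A u Q i j" if ij: "i < n + 2 * n" "j < n + 2 * n" for i j
  proof -
    have "bl (n + 2 * n) ?A (?U i) (?U j) = bl n A (dl i) (dl j)
       + (\<Sum>m<n. s (dl i (n + 2 * m) + X i (n + 2 * m)) * (dl j (n + Suc (2 * m)) + X j (n + Suc (2 * m))))"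
      unfolding bl_bs bl_hy by (intro arg_cong2[where f = "(+)"] bl_cong) (simp_all add: X0)
    also have "\<dots> = hig n A u Q i j"
    proof (cases "i < n"; cases "j < n")
      assume i: "i < n" and j: "j < n"
      have "(\<Sum>m<n. s (dl i (n + 2 * m) + X i (n + 2 * m)) * (dl j (n + Suc (2 * m)) + X j (n + Suc (2 * m))))
        = (\<Sum>m<n. s u * (dl i m * Q m j))"
        using i j by (intro sum.cong refl) (simp add: Xe dl_def s_mult)
      then show ?thesis using i j by (simp add: bl_dl hig_def sum_distrib_left[symmetric])
    next
      assume i: "i < n" and j: "\<not> j < n"
      have "bl n A (dl i) (dl j) = 0" using i j by (simp add: bl_dl_l dl_def)
      moreover have "(\<Sum>m<n. s (dl i (n + 2 * m) + X i (n + 2 * m)) * (dl j (n + Suc (2 * m)) + X j (n + Suc (2 * m))))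
        = (\<Sum>m<n. dl i m * (s u * dl j (n + Suc (2 * m))))"
        using i j by (intro sum.cong refl) (simp add: Xe X0, simp add: dl_def s_mult)
      moreover have "\<dots> = s u * dl j (n + Suc (2 * i))" using i by (simp only: sum_dl)
      ultimately have "bl n A (dl i) (dl j) + (\<Sum>m<n. s (dl i (n + 2 * m) + X i (n + 2 * m)) * (dl j (n + Suc (2 * m)) + X j (n + Suc (2 * m))))
        = s u * dl j (n + Suc (2 * i))" by (simp only: add_0_left)
      then show ?thesis using i j by (simp only: hig_def dl_def if_True if_False) auto
    next
      assume i: "\<not> i < n" and j: "j < n"
      have "bl n A (dl i) (dl j) = 0" using i j by (simp add: bl_dl_r dl_def)
      moreover have "(\<Sum>m<n. s (dl i (n + 2 * m) + X i (n + 2 * m)) * (dl j (n + Suc (2 * m)) + X j (n + Suc (2 * m))))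
        = (\<Sum>m<n. if i = n + 2 * m then Q m j else 0)"
        using i j by (intro sum.cong refl) (simp add: Xe X0, simp add: dl_def)
      moreover have "\<dots> = (\<Sum>m<n. if m = (i - n) div 2 then if even (i - n) then Q m j else 0 else 0)"
        using i by (intro sum.cong refl) auto
      moreover have "(i - n) div 2 < n" using ij(1) i by auto
      then have "(\<Sum>m<n. if m = (i - n) div 2 then if even (i - n) then Q m j else 0 else 0) = (if even (i - n) then Q ((i - n) div 2) j else 0)"
        by simp
      ultimately have "bl n A (dl i) (dl j) + (\<Sum>m<n. s (dl i (n + 2 * m) + X i (n + 2 * m)) * (dl j (n + Suc (2 * m)) + X j (n + Suc (2 * m))))
        = (if even (i - n) then Q ((i - n) div 2) j else 0)" by (simp only: add_0_left)
      then show ?thesis using i j by (simp only: hig_def if_True if_False)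
    next
      assume i: "\<not> i < n" and j: "\<not> j < n"
      have "bl n A (dl i) (dl j) = 0" using i j by (simp add: bl_def dl_def)
      moreover have "(\<Sum>m<n. s (dl i (n + 2 * m) + X i (n + 2 * m)) * (dl j (n + Suc (2 * m)) + X j (n + Suc (2 * m))))
        = bl (2 * n) hy (dl (i - n)) (dl (j - n))"
        unfolding bl_hy using i j by (intro sum.cong refl) (auto simp add: X0 dl_def)
      moreover have "bl (2 * n) hy (dl (i - n)) (dl (j - n)) = hy (i - n) (j - n)"
        using i j ij by (intro bl_dl) auto
      ultimately have "bl n A (dl i) (dl j) + (\<Sum>m<n. s (dl i (n + 2 * m) + X i (n + 2 * m)) * (dl j (n + Suc (2 * m)) + X j (n + Suc (2 * m))))
        = hy (i - n) (j - n)" by (simp only: add_0_left)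
      then show ?thesis using i j by (simp only: hig_def if_True if_False)
    qed
    finally show ?thesis .
  qed
  have "bl (n + 2 * n) (hm ?A) (?U i) (?U j) = hm (hig n A u Q) i j" if "i < n + 2 * n" "j < n + 2 * n" for i j
    using blU[OF that] blU[OF that(2,1)] by (simp add: bl_hm hm_def[of "hig n A u Q"])
  note herm = this
  have XX': "X i m * X l i = 0" for l i m using XX[of l i m] by (simp add: mult.commute)
  have VU: "(\<Sum>i<n + 2 * n. ?V l i * ?U i m) = dl l m" and UV: "(\<Sum>i<n + 2 * n. ?U l i * ?V i m) = dl l m"
    if "l < n + 2 * n" "m < n + 2 * n" for l m
    using that by (simp_all add: algebra_simps XX XX' sum.distrib sum_subtractf)
  have dg: "bl (n + 2 * n) ?A (?U i) (?U i) - hig n A u Q i i \<in> Lam" if "i < n + 2 * n" for i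
    unfolding blU[OF that that] by simp
  note change = cl_change[OF nA, where U = ?U and V = ?V and C = "hig n A u Q", OF VU UV dg herm]
  show "nonsing (n + 2 * n) (hig n A u Q)" by (rule change(1))
  have "cl (n + 2 * n) (hig n A u Q) = cl (n + 2 * n) ?A" by (rule change(2))
  also have "\<dots> = cl n A \<oplus>\<^bsub>LG\<^esub> cl (2 * n) hy" by (rule LG_add[OF A nonsing_hy, symmetric])
  also have "\<dots> = cl n A"
    using abelian_monoid.r_zero[OF abelian_group.axioms(1)[OF LG_group] cl_car[OF A]] by (simp only: cl_hyp)
  finally show "cl (n + 2 * n) (hig n A u Q) = cl n A" .
qed

end

section \<open>Completion of unimodular vectors\<close>

definition mm :: "nat \<Rightarrow> (nat \<Rightarrow> nat \<Rightarrow> 'e::comm_ring_1) \<Rightarrow> (nat \<Rightarrow> nat \<Rightarrow> 'e) \<Rightarrow> nat \<Rightarrow> nat \<Rightarrow> 'e" where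
  "mm n A B i j = (\<Sum>k<n. A i k * B k j)"

definition inv2 :: "nat \<Rightarrow> (nat \<Rightarrow> nat \<Rightarrow> 'e::comm_ring_1) \<Rightarrow> (nat \<Rightarrow> nat \<Rightarrow> 'e) \<Rightarrow> bool" where
  "inv2 n A B \<longleftrightarrow> (\<forall>i<n. \<forall>j<n. mm n A B i j = dl i j \<and> mm n B A i j = dl i j)"

lemma mm_assoc: "mm n (mm n A B) C i j = mm n A (mm n B C) i j"
  unfolding mm_def by (rule sum_mult_assoc)

lemma mm_cong: "(\<And>k. k < n \<Longrightarrow> A i k = A' i k) \<Longrightarrow> (\<And>k. k < n \<Longrightarrow> B k j = B' k j) \<Longrightarrow> mm n A B i j = mm n A' B' i j"
  unfolding mm_def by (intro sum.cong) auto

lemma mm_dl: "i < n \<Longrightarrow> mm n dl A i j = A i j"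
  by (simp add: mm_def)

lemma inv2_mm:
  assumes A: "inv2 n A A'" and B: "inv2 n B B'"
  shows "inv2 n (mm n A B) (mm n B' A')"
proof -
  have "mm n (mm n A B) (mm n B' A') i j = dl i j" if "inv2 n A A'" "inv2 n B B'" "i < n" "j < n" for A A' B B' i j
  proof -
    have "mm n (mm n A B) (mm n B' A') i j = mm n A (mm n (mm n B B') A') i j"
      unfolding mm_assoc by (rule mm_cong) (simp_all add: mm_assoc)
    also have "\<dots> = mm n A A' i j"
    proof (rule mm_cong)
      fix k assume k: "k < n"
      have "mm n (mm n B B') A' k j = mm n dl A' k j" by (rule mm_cong) (use that k in \<open>simp_all add: inv2_def\<close>)
      then show "mm n (mm n B B') A' k j = A' k j" using k by (simp add: mm_dl)
    qed simp
    finally show ?thesis using that by (simp add: inv2_def)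
  qed
  moreover have "inv2 n A' A" "inv2 n B' B" using A B by (simp_all add: inv2_def)
  ultimately show ?thesis using A B unfolding inv2_def[of n "mm n A B"] by blast
qed

text \<open>The Euclidean algorithm, formulated through the cofactors: (c, d) is unimodular also
  when a = b = 0, where dividing by the common divisor would not produce it.\<close>

lemma bezout_ex:
  fixes a b :: "'e::euclidean_ring"
  shows "\<exists>g c d x y. a = g * c \<and> b = g * d \<and> x * c + y * d = 1"
proof (induction "euclidean_size b" arbitrary: a b rule: less_induct)
  case less
  show ?case
  proof (cases "b = 0")
    case True
    then show ?thesis by (intro exI[of _ a] exI[of _ 1] exI[of _ 0] exI[of _ 1] exI[of _ 0]) simp
  next
    case False
    then have "euclidean_size (a mod b) < euclidean_size b" by (rule mod_size_less)
    from less[OF this, of b] obtain g c d x y where gcd: "b = g * c" "a mod b = g * d" "x * c + y * d = 1" by blast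
    have a: "a = (a div b) * b + a mod b" by simp
    have "a = g * ((a div b) * c + d)" by (subst a, subst (2) gcd(1), subst gcd(2)) (simp add: algebra_simps)
    moreover have "y * ((a div b) * c + d) + (x - y * (a div b)) * c = 1" using gcd(3) by (simp add: algebra_simps)
    ultimately show ?thesis using gcd(1) by blast
  qed
qed

text \<open>Unimodular row operations collect a common divisor in position 0. Each new entry is
  merged with it by a 2 x 2 Bezout matrix.\<close>

lemma reduce_vector:
  fixes r :: "nat \<Rightarrow> 'e::euclidean_ring"
  shows "\<exists>W W' g. inv2 (Suc n) W W' \<and> (\<forall>i<Suc n. (\<Sum>j<Suc n. W i j * r j) = g * dl i 0)"
proof (induction n)
  case 0
  show ?case by (intro exI[of _ dl] exI[of _ "r 0"]) (simp add: inv2_def mm_def dl_def)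
next
  case (Suc n)
  then obtain W W' g where W: "inv2 (Suc n) W W'" and Wr: "\<And>i. i < Suc n \<Longrightarrow> (\<Sum>j<Suc n. W i j * r j) = g * dl i 0"
    by blast
  define N where "N = Suc n"
  define W1 where "W1 i j = (if i < N \<and> j < N then W i j else dl i j)" for i j
  define W1' where "W1' i j = (if i < N \<and> j < N then W' i j else dl i j)" for i j
  have i1: "inv2 (Suc N) W1 W1'"
    unfolding inv2_def mm_def
  proof (intro allI impI)
    fix i j assume "i < Suc N" "j < Suc N"
    then show "(\<Sum>k<Suc N. W1 i k * W1' k j) = dl i j \<and> (\<Sum>k<Suc N. W1' i k * W1 k j) = dl i j"
      using W[unfolded inv2_def mm_def, folded N_def, rule_format, of i j]
      by (cases "i = N"; cases "j = N") (simp_all add: W1_def W1'_def dl_def cong: sum.cong_simp)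
  qed
  obtain h c d x y where hcd: "g = h * c" "r N = h * d" "x * c + y * d = 1" using bezout_ex[of g "r N"] by blast
  have N0: "N \<noteq> 0" by (simp add: N_def)
  \<comment> \<open>The block with rows (x, y) and (d, c) placed in positions 0 and N, the identity
    elsewhere. With -d for d its determinant is x c + y d = 1, so the inverse has the same
    shape.\<close>
  define P where "P x y d c i j = (if i = 0 then if j = 0 then x else if j = N then y else 0
      else if i = N then if j = 0 then d else if j = N then c else 0 else dl i j)" for x y d c :: 'e and i j
  have Pf: "(\<Sum>k<Suc N. P x y d c i k * f k) = (if i = 0 then x * f 0 + y * f N else if i = N then d * f 0 + c * f N else f i)"
    if "i < Suc N" for x y d c i and f :: "nat \<Rightarrow> 'e"
  proof -
    have two: "(\<Sum>k<Suc N. (if k = 0 then u else if k = N then w else 0) * f k) = u * f 0 + w * f N" for u w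
    proof -
      have "(\<Sum>k<Suc N. (if k = 0 then u else if k = N then w else 0) * f k)
        = (\<Sum>k<Suc N. dl k 0 * (u * f k)) + (\<Sum>k<Suc N. dl k N * (w * f k))"
        unfolding sum.distrib[symmetric] using N0 by (intro sum.cong) (auto simp: dl_def)
      then show ?thesis using N0 by (simp del: sum.lessThan_Suc)
    qed
    show ?thesis using that N0 by (auto simp: P_def two simp del: sum.lessThan_Suc)
  qed
  let ?P = "P x y (- d) c" and ?P' = "P c (- y) d x"
  have iP: "inv2 (Suc N) ?P ?P'"
    unfolding inv2_def mm_def
  proof (intro allI impI)
    fix i j assume "i < Suc N" "j < Suc N"
    then show "(\<Sum>k<Suc N. ?P i k * ?P' k j) = dl i j \<and> (\<Sum>k<Suc N. ?P' i k * ?P k j) = dl i j"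
      using hcd(3) N0 by (simp only: Pf) (auto simp: P_def dl_def algebra_simps)
  qed
  have W1r: "(\<Sum>j<Suc N. W1 i j * r j) = (if i = N then h * d else g * dl i 0)" if "i < Suc N" for i
    using that Wr[of i] N0 hcd(2) by (cases "i = N") (simp_all add: W1_def N_def[symmetric] dl_def cong: sum.cong_simp)
  have "(\<Sum>j<Suc N. mm (Suc N) ?P W1 i j * r j) = h * dl i 0" if i: "i < Suc N" for i
  proof -
    have "(\<Sum>j<Suc N. mm (Suc N) ?P W1 i j * r j) = (\<Sum>k<Suc N. ?P i k * (\<Sum>j<Suc N. W1 k j * r j))"
      unfolding mm_def by (rule sum_mult_assoc)
    also have "\<dots> = (\<Sum>k<Suc N. ?P i k * (if k = N then h * d else g * dl k 0))"
      by (intro sum.cong refl) (simp only: W1r lessThan_iff)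
    also have "\<dots> = h * dl i 0"
    proof -
      have "x * (h * c) + y * (h * d) = h * (x * c + y * d)" by (simp add: algebra_simps)
      then have e: "x * (h * c) + y * (h * d) = h" by (simp only: hcd(3) mult_1_right)
      have e2: "- d * (h * c) + c * (h * d) = 0" by (simp add: algebra_simps)
      show ?thesis unfolding Pf[OF i] hcd(1) using N0 e e2 by (simp add: dl_def)
    qed
    finally show ?thesis .
  qed
  then show ?case using inv2_mm[OF iP i1] unfolding N_def by blast
qed

text \<open>If \<open>r\<close> is unimodular, the scalar \<open>g\<close> to which it is reduced
  divides every entry of \<open>r\<close> and hence is a unit; a diagonal matrix with its inverse in
  position 0 turns it into 1.\<close>

lemma complete_vector:
  fixes r :: "nat \<Rightarrow> 'e::euclidean_ring"
  assumes r: "(\<Sum>i<Suc n. r i * c i) = 1"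
  shows "\<exists>W W'. inv2 (Suc n) W W' \<and> (\<forall>i<Suc n. (\<Sum>j<Suc n. W i j * r j) = dl i 0)"
proof -
  define N where "N = Suc n"
  obtain W W' g where W: "inv2 N W W'" and Wr: "\<And>i. i < N \<Longrightarrow> (\<Sum>j<N. W i j * r j) = g * dl i 0"
    using reduce_vector[of n r] unfolding N_def by blast
  define u where "u = (\<Sum>l<N. W' l 0 * c l)"
  have rl: "r l = g * W' l 0" if l: "l < N" for l
  proof -
    have "r l = (\<Sum>j<N. mm N W' W l j * r j)" using W l by (simp add: inv2_def)
    also have "\<dots> = (\<Sum>i<N. W' l i * (\<Sum>j<N. W i j * r j))" unfolding mm_def by (rule sum_mult_assoc)
    also have "\<dots> = (\<Sum>i<N. (W' l i * g) * dl i 0)" by (intro sum.cong refl) (simp add: Wr mult.assoc)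
    also have "\<dots> = g * W' l 0" by (simp add: N_def mult.commute del: sum.lessThan_Suc)
    finally show ?thesis .
  qed
  have gu: "g * u = 1"
    using r unfolding N_def[symmetric] u_def sum_distrib_left by (simp add: rl mult.assoc cong: sum.cong_simp)
  define D where "D v i j = (if i = 0 then v * dl 0 j else dl i j)" for v :: 'e and i j
  have Df: "(\<Sum>k<N. D v i k * f k) = (if i = 0 then v * f 0 else f i)" if "i < N" for v i f
    using that by (simp add: D_def mult.assoc sum_distrib_left[symmetric])
  have iD: "inv2 N (D u) (D g)"
    unfolding inv2_def mm_def using gu
    by (intro allI impI) (simp only: Df, auto simp: D_def dl_def mult.commute)
  have "(\<Sum>j<N. mm N (D u) W i j * r j) = dl i 0" if i: "i < N" for i
  proof -
    have "(\<Sum>j<N. mm N (D u) W i j * r j) = (\<Sum>k<N. D u i k * (\<Sum>j<N. W k j * r j))"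
      unfolding mm_def by (rule sum_mult_assoc)
    also have "\<dots> = (\<Sum>k<N. D u i k * (g * dl k 0))" by (intro sum.cong refl) (simp add: Wr)
    also have "\<dots> = dl i 0" unfolding Df[OF i] using gu by (auto simp: dl_def mult.commute)
    finally show ?thesis .
  qed
  then show ?thesis using inv2_mm[OF iD W] unfolding N_def by blast
qed

text \<open>A Euclidean ring of constants, fixed by the involution, with a retraction
  \<open>\<pi>\<close>. Vectors are completed to bases over the constants, since Z[t] is not
  Euclidean. For Z[t] the retraction is evaluation at 0; for F_2[t] both maps are the
  identity.\<close>

locale fmodel_const = fmodel R \<sigma> \<rho> s k
  for R :: "('a, 'x) ring_scheme" (structure) and \<sigma> and \<rho> :: "'b::comm_ring_1 \<Rightarrow> 'a" and s k +
  fixes \<kappa> :: "'e::euclidean_ring \<Rightarrow> 'b" and \<pi> :: "'b \<Rightarrow> 'e"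
  assumes k_add: "\<kappa> (x + y) = \<kappa> x + \<kappa> y" and k_mult: "\<kappa> (x * y) = \<kappa> x * \<kappa> y" and k_one: "\<kappa> 1 = 1"
    and s_k: "s (\<kappa> x) = \<kappa> x"
    and p_add: "\<pi> (a + b) = \<pi> a + \<pi> b" and p_mult: "\<pi> (a * b) = \<pi> a * \<pi> b" and p_one: "\<pi> 1 = 1"
    and p_k: "\<pi> (\<kappa> x) = x"
begin

lemma k_zero: "\<kappa> 0 = 0" using k_add[of 0 0] by simp
lemma p_zero: "\<pi> 0 = 0" using p_add[of 0 0] by (metis add_0_right add_left_cancel)
lemma k_sum: "\<kappa> (\<Sum>i\<in>I. f i) = (\<Sum>i\<in>I. \<kappa> (f i))"
  by (induction I rule: infinite_finite_induct) (auto simp: k_add k_zero)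
lemma p_sum: "\<pi> (\<Sum>i\<in>I. f i) = (\<Sum>i\<in>I. \<pi> (f i))"
  by (induction I rule: infinite_finite_induct) (auto simp: p_add p_zero)
lemma k_dl: "\<kappa> (dl i j) = dl i j" by (simp add: dl_def k_one k_zero)

text \<open>Sets in which matrix entries remain under constant changes of basis. The relevant
  examples are the constants and the polynomials of degree at most 1.\<close>

definition kclosed :: "'b set \<Rightarrow> bool" where
  "kclosed X \<longleftrightarrow> 0 \<in> X \<and> (\<forall>x\<in>X. \<forall>y\<in>X. x + y \<in> X) \<and> (\<forall>c. \<forall>x\<in>X. \<kappa> c * x \<in> X)"

lemma kclosed_sum: "kclosed X \<Longrightarrow> (\<And>i. i \<in> I \<Longrightarrow> f i \<in> X) \<Longrightarrow> (\<Sum>i\<in>I. f i) \<in> X"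
  by (induction I rule: infinite_finite_induct) (auto simp: kclosed_def)

lemma kclosed_bl:
  assumes X: "kclosed X" and A: "\<And>i j. i < n \<Longrightarrow> j < n \<Longrightarrow> A i j \<in> X"
  shows "bl n A (\<lambda>i. \<kappa> (v i)) (\<lambda>i. \<kappa> (w i)) \<in> X"
  unfolding bl_def
proof (intro kclosed_sum[OF X])
  fix i j assume "i \<in> {..<n}" "j \<in> {..<n}"
  then have "\<kappa> (w j) * (\<kappa> (v i) * A i j) \<in> X" using A X unfolding kclosed_def by simp
  then show "s (\<kappa> (v i)) * A i j * \<kappa> (w j) \<in> X" by (simp add: s_k ac_simps)
qed

lemma change_const:
  assumes A: "nonsing p A" and W: "inv2 p W W'"
  defines "C \<equiv> \<lambda>i j. bl p A (\<lambda>m. \<kappa> (W i m)) (\<lambda>m. \<kappa> (W j m))"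
  shows "nonsing p C" "cl p C = cl p A" "hm C i j = bl p (hm A) (\<lambda>m. \<kappa> (W i m)) (\<lambda>m. \<kappa> (W j m))"
proof -
  have h: "hm C i j = bl p (hm A) (\<lambda>m. \<kappa> (W i m)) (\<lambda>m. \<kappa> (W j m))" for i j
    unfolding bl_hm by (simp only: hm_def C_def)
  then show "hm C i j = bl p (hm A) (\<lambda>m. \<kappa> (W i m)) (\<lambda>m. \<kappa> (W j m))" .
  have W1: "(\<Sum>m<p. \<kappa> (W' i m) * \<kappa> (W m j)) = dl i j" and W2: "(\<Sum>m<p. \<kappa> (W i m) * \<kappa> (W' m j)) = dl i j"
    if "i < p" "j < p" for i j
    using W that unfolding inv2_def mm_def by (simp_all add: k_mult[symmetric] k_sum[symmetric] k_dl)
  note ch = cl_change[OF A, where U = "\<lambda>i m. \<kappa> (W i m)" and V = "\<lambda>i m. \<kappa> (W' i m)" and C = C, OF W1 W2 _ h[symmetric]]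
  show "nonsing p C" by (rule ch(1)) (simp_all add: C_def)
  show "cl p C = cl p A" by (rule ch(2)) (simp_all add: C_def)
qed

text \<open>Two completions over the constants. One makes \<open>v\<close> the leading basis vector.
  The pairings of \<open>v\<close> with the basis are constant and unimodular by nonsingularity, so
  another completion makes \<open>v\<close> pair to 1 with a single further basis vector and to 0
  with the rest. Then \<open>split_plane\<close> applies, and all entries have stayed in every
  \<open>kclosed\<close> set.\<close>

lemma split_isotropic:
  assumes A: "nonsing n A" and v: "(\<Sum>i<n. v i * c i) = 1"
    and iso: "bl n (hm A) (\<lambda>i. \<kappa> (v i)) (\<lambda>i. \<kappa> (v i)) = 0"
    and const: "\<And>j. j < n \<Longrightarrow> (\<Sum>i<n. \<kappa> (v i) * hm A i j) = \<kappa> (r j)"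
  shows "\<exists>n' a b B. n = 2 + n' \<and> a \<in> Hh \<and> b \<in> Hh \<and> nonsing n' B \<and> cl n A = sy a b \<oplus>\<^bsub>LG\<^esub> cl n' B \<and>
    (\<forall>X. kclosed X \<longrightarrow> (\<forall>i<n. \<forall>j<n. hm A i j \<in> X) \<longrightarrow> (\<forall>i<n'. \<forall>j<n'. hm B i j \<in> X))"
proof -
  have "n \<noteq> 0" using v by (cases n) simp_all
  then obtain m where n: "n = Suc m" using not0_implies_Suc by blast
  obtain W W' where W: "inv2 n W W'" and Wv: "\<And>i. i < n \<Longrightarrow> (\<Sum>j<n. W i j * v j) = dl i 0"
    using complete_vector[of v c m] v unfolding n by blast
  have W'0: "W' l 0 = v l" if l: "l < n" for l
  proof -
    have "v l = (\<Sum>j<n. mm n W' W l j * v j)" using W l by (simp add: inv2_def)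
    also have "\<dots> = (\<Sum>i<n. W' l i * (\<Sum>j<n. W i j * v j))" unfolding mm_def by (rule sum_mult_assoc)
    also have "\<dots> = (\<Sum>i<n. W' l i * dl i 0)" by (intro sum.cong refl) (simp add: Wv)
    also have "\<dots> = W' l 0" by (simp add: n del: sum.lessThan_Suc)
    finally show ?thesis by simp
  qed
  define U where "U i j = W' j i" for i j
  have U: "inv2 n U (\<lambda>i j. W j i)"
    unfolding inv2_def mm_def U_def
  proof (intro allI impI)
    fix i j assume "i < n" "j < n"
    then have "(\<Sum>k<n. W j k * W' k i) = dl j i" "(\<Sum>k<n. W' j k * W k i) = dl j i"
      using W unfolding inv2_def mm_def by blast+
    then show "(\<Sum>k<n. W' k i * W j k) = dl i j \<and> (\<Sum>k<n. W k i * W' j k) = dl i j"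
      by (simp add: mult.commute) (simp add: dl_def)
  qed
  define C where "C i j = bl n A (\<lambda>m. \<kappa> (U i m)) (\<lambda>m. \<kappa> (U j m))" for i j
  note C = change_const[OF A U, folded C_def]
  have U0: "bl n (hm A) (\<lambda>m. \<kappa> (U 0 m)) w = bl n (hm A) (\<lambda>m. \<kappa> (v m)) w" for w
    by (rule bl_cong) (simp_all add: U_def W'0)
  have U0': "bl n (hm A) w (\<lambda>m. \<kappa> (U 0 m)) = bl n (hm A) w (\<lambda>m. \<kappa> (v m))" for w
    by (rule bl_cong) (simp_all add: U_def W'0)
  have C00: "hm C 0 0 = 0" unfolding C(3) U0 U0' by (rule iso)
  define q where "q j = (\<Sum>m<n. r m * U j m)" for j
  have C0: "hm C 0 j = \<kappa> (q j)" for j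
  proof -
    have "hm C 0 j = bl n (hm A) (\<lambda>m. \<kappa> (v m)) (\<lambda>m. \<kappa> (U j m))" by (simp only: C(3) U0)
    also have "\<dots> = (\<Sum>m<n. (\<Sum>l<n. \<kappa> (v l) * hm A l m) * \<kappa> (U j m))" by (simp only: bl_left s_k)
    also have "\<dots> = (\<Sum>m<n. \<kappa> (r m) * \<kappa> (U j m))" by (intro sum.cong refl) (simp add: const)
    finally show ?thesis by (simp add: q_def k_sum k_mult)
  qed
  \<comment> \<open>The leading pairing is \<lambda>(v, v), so unimodularity of the row of pairings
    comes from the remaining entries.\<close>
  have q0: "q 0 = 0" using C00 C0[of 0] p_k p_zero by metis
  obtain g where "\<And>i j. i < n \<Longrightarrow> j < n \<Longrightarrow> (\<Sum>k<n. hm C i k * g k j) = dl i j"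
    using C(1) unfolding nonsing_def by blast
  then have g: "(\<Sum>k<n. hm C 0 k * g k 0) = dl 0 0" using n by blast
  \<comment> \<open>The cofactors come from a column of the inverse Gram matrix;
    \<open>\<pi>\<close> makes them constant.\<close>
  have "(\<Sum>k<n. q k * \<pi> (g k 0)) = 1"
    using arg_cong[OF g, of \<pi>] by (simp add: C0 p_sum p_mult p_k dl_def p_one)
  then have q1: "(\<Sum>k<m. q (Suc k) * \<pi> (g (Suc k) 0)) = 1"
    unfolding n sum.lessThan_Suc_shift by (simp add: q0)
  then have "m \<noteq> 0" by (cases m) simp_all
  then obtain n' where m: "m = Suc n'" using not0_implies_Suc by blast
  obtain T T' where T: "inv2 m T T'" and Tq: "\<And>i. i < m \<Longrightarrow> (\<Sum>j<m. T i j * q (Suc j)) = dl i 0"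
    using complete_vector[of "\<lambda>j. q (Suc j)" "\<lambda>j. \<pi> (g (Suc j) 0)" n'] q1 unfolding m by blast
  \<comment> \<open>Acts on the basis vectors after the leading one and keeps \<open>v\<close> in
    place.\<close>
  define ex :: "(nat \<Rightarrow> nat \<Rightarrow> 'e) \<Rightarrow> nat \<Rightarrow> nat \<Rightarrow> 'e" where
    "ex T i j = (if i = 0 \<or> j = 0 then dl i j else T (i - 1) (j - 1))" for T i j
  have mmex: "mm n (ex T) (ex T') i j = dl i j" if "\<And>i j. i < m \<Longrightarrow> j < m \<Longrightarrow> mm m T T' i j = dl i j" "i < n" "j < n" for T T' i j
    using that(1)[of "i - 1" "j - 1"] that(2,3)
    unfolding n mm_def sum.lessThan_Suc_shift
    by (cases i; cases j) (auto simp: ex_def dl_def)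
  have eT: "inv2 n (ex T) (ex T')"
    using T mmex[of T T'] mmex[of T' T] unfolding inv2_def by blast
  define D where "D i j = bl n C (\<lambda>m. \<kappa> (ex T i m)) (\<lambda>m. \<kappa> (ex T j m))" for i j
  note D = change_const[OF C(1) eT, folded D_def]
  have nn: "n = 2 + n'" using n m by simp
  have e0: "\<kappa> (ex T 0 j) = dl 0 j" for j by (simp add: ex_def k_dl)
  have D0: "hm D 0 j = (\<Sum>l<n. \<kappa> (q l) * \<kappa> (ex T j l))" for j
    unfolding D(3) e0 using n by (simp add: bl_dl_l C0 eta_contract_eq)
  have D00: "hm D 0 0 = 0" using n by (simp add: D0 ex_def k_dl q0 k_zero del: sum.lessThan_Suc)
  have DS: "hm D 0 (Suc j) = dl j 0" if j: "j < m" for j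
  proof -
    have "hm D 0 (Suc j) = \<kappa> (\<Sum>l<m. T j l * q (Suc l))"
      unfolding D0 n sum.lessThan_Suc_shift by (simp add: q0 k_zero ex_def k_sum k_mult mult.commute)
    then show ?thesis by (simp add: Tq j k_dl)
  qed
  have "\<exists>a\<in>Hh. \<exists>b\<in>Hh. \<exists>B. nonsing n' B \<and> (\<forall>i<n'. \<forall>j<n'. hm B i j = hm D (2 + i) (2 + j)) \<and>
    cl (2 + n') D = sy a b \<oplus>\<^bsub>LG\<^esub> cl n' B"
  proof (rule split_plane)
    show "nonsing (2 + n') D" using D(1) nn by simp
    show "hm D 0 (Suc 0) = 1" using DS[of 0] m by (simp add: dl_def)
    fix j :: nat assume "2 \<le> j" "j < 2 + n'"
    then show "hm D 0 j = 0" using DS[of "j - 1"] m by (simp add: dl_def)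
  qed (rule D00)
  then obtain a b B where ab: "a \<in> Hh" "b \<in> Hh" and B: "nonsing n' B"
    and hB: "\<And>i j. i < n' \<Longrightarrow> j < n' \<Longrightarrow> hm B i j = hm D (2 + i) (2 + j)"
    and eq: "cl (2 + n') D = sy a b \<oplus>\<^bsub>LG\<^esub> cl n' B" by blast
  have "cl n A = sy a b \<oplus>\<^bsub>LG\<^esub> cl n' B" using eq D(2) C(2) nn by simp
  moreover have "hm B i j \<in> X" if X: "kclosed X" and hA: "\<forall>i<n. \<forall>j<n. hm A i j \<in> X" and ij: "i < n'" "j < n'" for X i j
  proof -
    have "hm C i j \<in> X" for i j unfolding C(3) by (rule kclosed_bl[OF X]) (use hA in blast)
    then have "hm D i j \<in> X" for i j unfolding D(3) by (intro kclosed_bl[OF X])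
    then show ?thesis using hB[OF ij] by simp
  qed
  ultimately show ?thesis using nn ab B by blast
qed

end

section \<open>The classes that are sums of planes\<close>

context fmodel
begin

inductive_set span :: "('a, nat \<Rightarrow> 'a) qform set set" where
  span_zero: "\<zero>\<^bsub>LG\<^esub> \<in> span"
| span_add: "a \<in> Hh \<Longrightarrow> b \<in> Hh \<Longrightarrow> x \<in> span \<Longrightarrow> sy a b \<oplus>\<^bsub>LG\<^esub> x \<in> span"

lemma span_car: "x \<in> span \<Longrightarrow> x \<in> carrier LG"
proof (induction rule: span.induct)
  case span_zero
  show ?case using LG_zero[of hy] cl_car[OF nonsing_0] by simp
next
  case (span_add a b x)
  then show ?case using abelian_monoid.a_closed[OF abelian_group.axioms(1)[OF LG_group]] sy_car by blast
qed

lemma span_shift: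
  assumes "a \<in> Hh" "b \<in> Hh" "x \<in> span" "y \<in> carrier LG"
  shows "sy a b \<oplus>\<^bsub>LG\<^esub> (x \<oplus>\<^bsub>LG\<^esub> y) = (sy a b \<oplus>\<^bsub>LG\<^esub> x) \<oplus>\<^bsub>LG\<^esub> y"
  by (rule abelian_monoid.a_assoc[OF abelian_group.axioms(1)[OF LG_group] sy_car[OF assms(1,2)] span_car[OF assms(3)] assms(4), symmetric])

end

section \<open>The Arf invariant\<close>

lemma sum_swap4:
  "(\<Sum>i\<in>I. \<Sum>k\<in>I. \<Sum>j\<in>J. \<Sum>l\<in>J. t i k j l) = (\<Sum>j\<in>J. \<Sum>l\<in>J. \<Sum>i\<in>I. \<Sum>k\<in>I. t i k j l :: 'r::comm_monoid_add)"
proof -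
  have "(\<Sum>i\<in>I. \<Sum>k\<in>I. \<Sum>j\<in>J. \<Sum>l\<in>J. t i k j l) = (\<Sum>i\<in>I. \<Sum>j\<in>J. \<Sum>k\<in>I. \<Sum>l\<in>J. t i k j l)"
    by (rule sum.cong[OF refl], rule sum.swap)
  also have "\<dots> = (\<Sum>j\<in>J. \<Sum>i\<in>I. \<Sum>k\<in>I. \<Sum>l\<in>J. t i k j l)" by (rule sum.swap)
  also have "\<dots> = (\<Sum>j\<in>J. \<Sum>i\<in>I. \<Sum>l\<in>J. \<Sum>k\<in>I. t i k j l)"
    by (rule sum.cong[OF refl], rule sum.cong[OF refl], rule sum.swap)
  also have "\<dots> = (\<Sum>j\<in>J. \<Sum>l\<in>J. \<Sum>i\<in>I. \<Sum>k\<in>I. t i k j l)"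
    by (rule sum.cong[OF refl], rule sum.swap)
  finally show ?thesis .
qed

context
  assumes char2: "(1::'r::comm_ring_1) + 1 = 0"
begin

lemma char2_double: "x + x = (0::'r)"
  using char2 by (metis mult_2 mult_zero_left one_add_one)

text \<open>The off-diagonal terms occur in equal pairs and cancel in characteristic 2, so the trace
  of M^2 is the square of the trace of M.\<close>

lemma trace_square: "(\<Sum>i<n. \<Sum>j<n. M i j * M j i) = (\<Sum>i<n. M i i) * (\<Sum>i<n. M i i :: 'r)" for n :: nat
proof (induction n)
  case (Suc n)
  have "(\<Sum>i<Suc n. \<Sum>j<Suc n. M i j * M j i) = (\<Sum>i<n. \<Sum>j<n. M i j * M j i) + ((\<Sum>i<n. M i n * M n i) + (\<Sum>i<n. M n i * M i n)) + M n n * M n n"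
    by (simp add: sum.distrib add_ac)
  also have "(\<Sum>i<n. M n i * M i n) = (\<Sum>i<n. M i n * M n i)" by (simp add: mult.commute)
  also have "(\<Sum>i<n. M i n * M n i) + (\<Sum>i<n. M i n * M n i) = 0" by (rule char2_double)
  finally show ?case using char2_double[of "M n n * (\<Sum>i<n. M i i)"] by (simp add: Suc algebra_simps)
qed simp

text \<open>By symmetry of both matrices the terms at (i, k) and (k, i) agree and cancel, so the
  trace of the product only involves the diagonals.\<close>

lemma trace_symmetric:
  fixes n :: nat
  assumes "\<And>i k. i < n \<Longrightarrow> k < n \<Longrightarrow> F i k = F k i" "\<And>i k. i < n \<Longrightarrow> k < n \<Longrightarrow> G i k = G k i"
  shows "(\<Sum>i<n. \<Sum>k<n. F i k * G k i) = (\<Sum>i<n. F i i * G i i :: 'r)"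
  using assms
proof (induction n)
  case (Suc n)
  have "(\<Sum>i<Suc n. \<Sum>k<Suc n. F i k * G k i) = (\<Sum>i<n. \<Sum>k<n. F i k * G k i) + ((\<Sum>i<n. F i n * G n i) + (\<Sum>i<n. F n i * G i n)) + F n n * G n n"
    by (simp add: sum.distrib add_ac)
  also have "(\<Sum>i<n. F n i * G i n) = (\<Sum>i<n. F i n * G n i)"
    by (intro sum.cong refl) (simp add: Suc.prems(1)[of n] Suc.prems(2)[of n])
  also have "(\<Sum>i<n. F i n * G n i) + (\<Sum>i<n. F i n * G n i) = 0" by (rule char2_double)
  finally show ?case using Suc by simp
qed simp

text \<open>By \<open>trace_symmetric\<close> the left side is the trace of X Y^t Z W^t, that is of
  P Q with P = W^t X and Q = Y^t Z. The last assumption says P = 1 + Q, so the trace is tr Q + tr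
  (Q^2) = tr Q + (tr Q)^2, and w = tr Q.\<close>

lemma arf_relation:
  fixes X Y Z W :: "nat \<Rightarrow> nat \<Rightarrow> 'r"
  assumes F: "\<And>i k. i < p \<Longrightarrow> k < p \<Longrightarrow> (\<Sum>j<y. X i j * Y k j) = (\<Sum>j<y. X k j * Y i j)"
    and G: "\<And>i k. i < p \<Longrightarrow> k < p \<Longrightarrow> (\<Sum>j<y. Z i j * W k j) = (\<Sum>j<y. Z k j * W i j)"
    and PQ: "\<And>l j. l < y \<Longrightarrow> j < y \<Longrightarrow> (\<Sum>i<p. W i l * X i j) + (\<Sum>i<p. Y i l * Z i j) = dl l j"
  shows "\<exists>w. (\<Sum>i<p. (\<Sum>j<y. X i j * Y i j) * (\<Sum>j<y. Z i j * W i j)) = w + w * w"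
proof -
  define Q where "Q l j = (\<Sum>i<p. Y i l * Z i j)" for l j
  have P: "(\<Sum>i<p. W i l * X i j) = dl l j + Q l j" if "l < y" "j < y" for l j
    using PQ[OF that] char2_double[of "Q l j"] unfolding Q_def[symmetric] by (metis add.assoc add.right_neutral)
  have "(\<Sum>i<p. (\<Sum>j<y. X i j * Y i j) * (\<Sum>j<y. Z i j * W i j))
      = (\<Sum>i<p. \<Sum>k<p. (\<Sum>j<y. X i j * Y k j) * (\<Sum>j<y. Z k j * W i j))"
    by (rule trace_symmetric[symmetric]) (simp_all add: F G)
  also have "\<dots> = (\<Sum>i<p. \<Sum>k<p. \<Sum>j<y. \<Sum>l<y. (X i j * Y k j) * (Z k l * W i l))"
    by (simp only: sum_product)
  also have "\<dots> = (\<Sum>j<y. \<Sum>l<y. \<Sum>i<p. \<Sum>k<p. (X i j * Y k j) * (Z k l * W i l))" by (rule sum_swap4)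
  also have "\<dots> = (\<Sum>j<y. \<Sum>l<y. (\<Sum>i<p. W i l * X i j) * Q j l)"
    by (simp add: Q_def sum_product ac_simps)
  also have "\<dots> = (\<Sum>j<y. \<Sum>l<y. dl l j * Q j l + Q j l * Q l j)"
    by (intro sum.cong refl) (simp add: P algebra_simps)
  also have "\<dots> = (\<Sum>j<y. Q j j) + (\<Sum>j<y. \<Sum>l<y. Q j l * Q l j)"
    by (simp add: sum.distrib)
  finally show ?thesis unfolding trace_square by blast
qed

end

lemma bit_poly_double [simp]: "p + p = (0 :: bit poly)"
proof (rule poly_eqI)
  fix n
  have "b + b = 0" for b :: bit by (cases b) simp_all
  then show "coeff (p + p) n = coeff 0 n" by (simp only: coeff_add coeff_0)
qed

lemma bit_poly_numeral_2 [simp]: "(2 :: bit poly) = 0"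
  by (metis bit_poly_double one_add_one)

lemma bit_poly_neg: "- p = (p :: bit poly)"
  using bit_poly_double[of p] by (metis add_eq_0_iff2 minus_minus)

lemma bit_poly_add_left [simp]: "p + (p + q) = (q :: bit poly)"
  by (simp add: add.assoc[symmetric])

locale fmodel_F2 = fmodel R \<sigma> \<rho> id k
  for R :: "('a, 'x) ring_scheme" (structure) and \<sigma> and \<rho> :: "bit poly \<Rightarrow> 'a" and k
begin

lemma eps_1 [simp]: "eps = 1" by (simp only: eps_def bit_poly_neg if_cancel)
lemma Lam_0: "Lam = {0}" by (simp add: Lam_def)
lemma Hh_UNIV: "a \<in> Hh" by (simp add: Hh_def)

text \<open>If the symbol vanishes, the plane plus a hyperbolic form is isometric to a hyperbolic
  form. The images of its hyperbolic pairs are the rows of \<open>U\<close>, whose even and odd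
  coordinates form the blocks X, Y and Z, W. Their \<mu>-values are a, b for the first pair and 0
  for the others, so the sum in \<open>arf_relation\<close> is a b.\<close>

lemma arf_zero:
  assumes "sy a b = \<zero>\<^bsub>LG\<^esub>"
  shows "\<exists>w. a * b = w + w * w"
proof -
  have "steq (fm 2 (pl a b)) (fm 0 hy)"
    using assms unfolding sy_def LG_zero[of hy] by (simp add: cl_eq nonsing_pl Hh_UNIV nonsing_0)
  then obtain x y where "miso (2 + 2 * x) (bs 2 (pl a b) hy) (0 + 2 * y) (bs 0 hy hy)"
    unfolding steq_miso[OF nonsing_pl[OF Hh_UNIV Hh_UNIV] nonsing_0] by blast
  moreover have "bs 0 hy hy = hy" by (simp add: bs_def fun_eq_iff)
  ultimately have "miso (2 + 2 * x) (bs 2 (pl a b) hy) (2 * y) hy" by simp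
  then obtain U V where UD: "\<And>i. i < 2 + 2 * x \<Longrightarrow> bl (2 * y) hy (U i) (U i) - bs 2 (pl a b) hy i i \<in> Lam"
    and U: "\<And>i j. i < 2 + 2 * x \<Longrightarrow> j < 2 + 2 * x \<Longrightarrow> bl (2 * y) (hm hy) (U i) (U j) = hm (bs 2 (pl a b) hy) i j"
    and V: "\<And>l m. l < 2 * y \<Longrightarrow> m < 2 * y \<Longrightarrow> (\<Sum>i<2 + 2 * x. V l i * U i m) = dl l m"
    unfolding miso_def by blast
  define p where "p = Suc x"
  have pp: "2 + 2 * x = 2 * p" by (simp add: p_def)
  note UD = UD[unfolded pp] and U = U[unfolded pp] and V = V[unfolded pp]
  have hmA: "hm (bs 2 (pl a b) hy) i j = hm hy i j" for i j
  proof -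
    have "hm (bs 2 (pl a b) hy) i j = hm (bs 2 hy hy) i j"
      by (simp add: hm_bs bs_def hm_pl Hh_UNIV)
    then show ?thesis by (simp only: bs2_hy)
  qed
  have Uhh: "bl (2 * y) (hm hy) (U i) (U j) = hm hy i j" if "i < 2 * p" "j < 2 * p" for i j
    using U[OF that] hmA by simp
  have blhh: "bl (2 * y) (hm hy) v w = (\<Sum>j<y. v (2 * j) * w (Suc (2 * j))) + (\<Sum>j<y. w (2 * j) * v (Suc (2 * j)))" for v w
    by (simp add: bl_hm bl_hy)
  define X where "X i j = U (2 * i) (2 * j)" for i j
  define Y where "Y i j = U (2 * i) (Suc (2 * j))" for i j
  define Z where "Z i j = U (Suc (2 * i)) (2 * j)" for i j
  define W where "W i j = U (Suc (2 * i)) (Suc (2 * j))" for i j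
  have e0: "hm hy (2 * i) (2 * j) = 0" "hm hy (Suc (2 * i)) (Suc (2 * j)) = 0" for i j
    by (simp_all add: hm_hy hm_hy_even, presburger+)
  have bitadd0: "u = v" if "u + v = 0" for u v :: "bit poly" using that by (metis add_eq_0_iff bit_poly_neg)
  have F: "(\<Sum>j<y. X i j * Y k j) = (\<Sum>j<y. X k j * Y i j)" if "i < p" "k < p" for i k
    using Uhh[of "2 * i" "2 * k"] that unfolding blhh by - (rule bitadd0, simp add: e0 X_def Y_def)
  have G: "(\<Sum>j<y. Z i j * W k j) = (\<Sum>j<y. Z k j * W i j)" if "i < p" "k < p" for i k
    using Uhh[of "Suc (2 * i)" "Suc (2 * k)"] that unfolding blhh by - (rule bitadd0, simp add: e0 Z_def W_def)
  have PQ: "(\<Sum>i<p. W i l * X i j) + (\<Sum>i<p. Y i l * Z i j) = dl l j" if l: "l < y" and j: "j < y" for l j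
  proof -
    \<comment> \<open>Exchanges the partners of each hyperbolic pair; \<open>hm hy\<close> is the
      permutation matrix J of \<open>\<tau>\<close>.\<close>
    define \<tau> where "\<tau> i = (if even i then Suc i else i - 1)" for i :: nat
    have \<tau>2 [simp]: "\<tau> (2 * i) = Suc (2 * i)" "\<tau> (Suc (2 * i)) = 2 * i" for i by (simp_all add: \<tau>_def)
    define C where "C l m = (\<Sum>i<2 * p. U (\<tau> i) l * U i m)" for l m
    have tau_lt: "\<tau> i < 2 * p" if "i < 2 * p" for i using that by (auto simp: \<tau>_def elim!: evenE)
    have hm_tau: "hm hy i (\<tau> j) = dl i j" for i j
    proof (cases "even j")
      case True
      then obtain m where "j = 2 * m" by (elim evenE)
      then show ?thesis by (auto simp: hm_hy dl_def)
    next
      case False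
      then obtain m where "j = Suc (2 * m)" by (metis oddE Suc_eq_plus1)
      then show ?thesis by (simp add: hm_hy_even dl_def)
    qed
    have blt: "bl (2 * y) (hm hy) v w = (\<Sum>l<2 * y. v (\<tau> l) * w l)" for v w
      unfolding blhh sum_lessThan_double \<tau>2 sum.distrib by (simp only: mult.commute add.commute)
    \<comment> \<open>Since \<open>U\<close> preserves the form, U J U^t = J. Multiplication by J U
      on the right gives U J C = U with C = U^t J U, and the left inverse \<open>V\<close> of
      \<open>U\<close> cancels \<open>U\<close>, which leaves C = J. The entry of C at an odd row
      and an even column is the asserted sum.\<close>
    have UC: "(\<Sum>l<2 * y. U i (\<tau> l) * C l m) = U i m" if i: "i < 2 * p" for i m
    proof -
      have "(\<Sum>l<2 * y. U i (\<tau> l) * C l m) = (\<Sum>j<2 * p. (\<Sum>l<2 * y. U i (\<tau> l) * U (\<tau> j) l) * U j m)"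
        unfolding C_def by (rule sum_mult_assoc[symmetric])
      also have "\<dots> = (\<Sum>j<2 * p. dl i j * U j m)"
        by (intro sum.cong refl) (simp add: blt[symmetric] Uhh i tau_lt hm_tau)
      finally show ?thesis using i by simp
    qed
    have "dl (2 * l) (2 * j) = (\<Sum>i<2 * p. V (2 * l) i * U i (2 * j))" using V[of "2 * l" "2 * j"] l j by simp
    also have "\<dots> = (\<Sum>i<2 * p. V (2 * l) i * (\<Sum>m<2 * y. U i (\<tau> m) * C m (2 * j)))" by (intro sum.cong refl) (simp add: UC)
    also have "\<dots> = (\<Sum>m<2 * y. (\<Sum>i<2 * p. V (2 * l) i * U i (\<tau> m)) * C m (2 * j))" by (rule sum_mult_assoc[symmetric])
    also have "\<dots> = (\<Sum>m<2 * y. if m = Suc (2 * l) then C m (2 * j) else 0)"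
    proof (intro sum.cong refl)
      fix m assume m: "m \<in> {..<2 * y}"
      then have "\<tau> m < 2 * y" by (auto simp: \<tau>_def elim!: evenE)
      then have "(\<Sum>i<2 * p. V (2 * l) i * U i (\<tau> m)) = dl (2 * l) (\<tau> m)" using V l by simp
      moreover have "dl (2 * l) (\<tau> m) = (if m = Suc (2 * l) then 1 else 0 :: bit poly)"
      proof -
        have "2 * l = (if even m then Suc m else m - 1) \<longleftrightarrow> m = Suc (2 * l)" by presburger
        then show ?thesis by (simp only: dl_def \<tau>_def)
      qed
      ultimately show "(\<Sum>i<2 * p. V (2 * l) i * U i (\<tau> m)) * C m (2 * j) = (if m = Suc (2 * l) then C m (2 * j) else 0)" by simp
    qed
    also have "\<dots> = C (Suc (2 * l)) (2 * j)" using l by simp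
    also have "\<dots> = (\<Sum>i<p. W i l * X i j + Y i l * Z i j)"
      unfolding C_def sum_lessThan_double by (simp add: X_def Y_def Z_def W_def)
    finally show ?thesis by (simp add: sum.distrib dl_def)
  qed
  have D: "bl (2 * y) hy (U i) (U i) = bs 2 (pl a b) hy i i" if "i < 2 * p" for i
    using UD[OF that] by (simp add: Lam_0)
  have A: "(\<Sum>j<y. X i j * Y i j) = (if i = 0 then a else 0)" if "i < p" for i
    using D[of "2 * i"] that unfolding bl_hy by (simp add: X_def Y_def bs_def pl_def hy_def)
  have B: "(\<Sum>j<y. Z i j * W i j) = (if i = 0 then b else 0)" if "i < p" for i
    using D[of "Suc (2 * i)"] that unfolding bl_hy by (simp add: Z_def W_def bs_def pl_def hy_def)
  have "(\<Sum>i<p. (\<Sum>j<y. X i j * Y i j) * (\<Sum>j<y. Z i j * W i j)) = (\<Sum>i<p. if i = 0 then a * b else 0)"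
    by (intro sum.cong refl) (simp add: A B)
  also have "\<dots> = a * b" by (simp add: p_def)
  finally have eq: "(\<Sum>i<p. (\<Sum>j<y. X i j * Y i j) * (\<Sum>j<y. Z i j * W i j)) = a * b" .
  have "(1::bit poly) + 1 = 0" by simp
  from arf_relation[where p = p and y = y and X = X and Y = Y and Z = Z and W = W, OF this F G PQ] show ?thesis unfolding eq by blast
qed

end

section \<open>Symbols over \<open>\<FF>\<^sub>2[t]\<close>\<close>

text \<open>Separates even and odd powers: over F_2 a polynomial in t^2 is a square. The degree
  bounds drive the induction in \<open>S_prod\<close>.\<close>

lemma bit_poly_sqrt:
  fixes c :: "bit poly"
  shows "\<exists>p q. c = p * p + [:0, 1:] * (q * q) \<and> 2 * degree p \<le> degree c \<and> (q = 0 \<or> 2 * degree q < degree c)"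
proof (induction c)
  case 0
  show ?case by (intro exI[of _ 0]) simp
next
  case (pCons a c)
  then obtain p q where c: "c = p * p + [:0, 1:] * (q * q)" and p: "2 * degree p \<le> degree c"
    and q: "q = 0 \<or> 2 * degree q < degree c" by blast
  have aa: "a * a = a" by (cases a) simp_all
  have "[:a:] * [:a:] = [:a:]" by (simp add: aa)
  then have "([:a:] + [:0, 1:] * q) * ([:a:] + [:0, 1:] * q) = [:a:] + [:0, 1:] * [:0, 1:] * (q * q)"
    using bit_poly_double[of "[:a:] * ([:0, 1:] * q)"] by (simp add: algebra_simps)
  moreover have "pCons a c = [:a:] + [:0, 1:] * c" by simp
  ultimately have eq: "pCons a c = ([:a:] + [:0, 1:] * q) * ([:a:] + [:0, 1:] * q) + [:0, 1:] * (p * p)"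
    unfolding c by (simp only: distrib_left mult.assoc add.commute add.left_commute)
  show ?case
  proof (cases "c = 0")
    case True
    then have "a \<noteq> 0" using pCons(1) by simp
    show ?thesis by (intro exI[of _ "[:a:]"] exI[of _ 0]) (simp add: True aa)
  next
    case False
    have "degree ([:a:] + [:0, 1:] * q) \<le> (if q = 0 then 0 else Suc (degree q))"
      by (auto simp: degree_pCons_le)
    then have "2 * degree ([:a:] + [:0, 1:] * q) \<le> degree (pCons a c)" using q False by (auto split: if_splits)
    moreover have "2 * degree p < degree (pCons a c)" using p False by simp
    ultimately show ?thesis using eq by blast
  qed
qed

text \<open>Describes \<open>Hh\<close> modulo \<open>Lam\<close> by a set \<open>H\<close> of
  polynomials over F_2, with representatives chosen by \<open>lift\<close>. All compatibilities hold
  only modulo \<open>Lam\<close>; the twisted product r a s(r) corresponds to r^2 a.\<close>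

locale symbols = fmodel R \<sigma> \<rho> s k
  for R :: "('a, 'x) ring_scheme" (structure) and \<sigma> and \<rho> :: "'b::comm_ring_1 \<Rightarrow> 'a" and s k +
  fixes lift :: "bit poly \<Rightarrow> 'b" and H :: "bit poly set"
  assumes lift_Hh: "c \<in> H \<Longrightarrow> lift c \<in> Hh"
    and lift_onto: "a \<in> Hh \<Longrightarrow> \<exists>c\<in>H. a - lift c \<in> Lam"
    and H_add: "c \<in> H \<Longrightarrow> d \<in> H \<Longrightarrow> c + d \<in> H" and H_sq: "c \<in> H \<Longrightarrow> r * r * c \<in> H"
    and lift_add: "c \<in> H \<Longrightarrow> d \<in> H \<Longrightarrow> lift c + lift d - lift (c + d) \<in> Lam"
    and lift_sq: "c \<in> H \<Longrightarrow> lift r * lift c * s (lift r) - lift (r * r * c) \<in> Lam"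
    and lift_eps: "c \<in> H \<Longrightarrow> eps * lift c - lift c \<in> Lam"
    and lift_0: "lift 0 = 0"
begin

interpretation G: abelian_group LG by (rule LG_group)

definition S where "S a b = sy (lift a) (lift b)"

lemma S_car [simp]: "a \<in> H \<Longrightarrow> b \<in> H \<Longrightarrow> S a b \<in> carrier LG"
  by (simp add: S_def sy_car lift_Hh)

lemma sy_lift: "a \<in> Hh \<Longrightarrow> b \<in> Hh \<Longrightarrow> \<exists>c\<in>H. \<exists>d\<in>H. sy a b = S c d"
  unfolding S_def using lift_onto sy_cong by meson

lemma H_zero: "0 \<in> H"
  using lift_onto[OF Hh_zero] H_add by (metis bit_poly_double)

lemma S_zero: "b \<in> H \<Longrightarrow> S 0 b = \<zero>\<^bsub>LG\<^esub>"
  by (simp add: S_def lift_0 sy_zero lift_Hh)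

lemma S_swap: "a \<in> H \<Longrightarrow> b \<in> H \<Longrightarrow> S b a = S a b"
  by (simp add: S_def sy_swap lift_Hh)

lemma S_star:
  assumes "a \<in> H" "b \<in> H" "a' \<in> H" "b' \<in> H"
  shows "S (a + r * r * a') b \<oplus>\<^bsub>LG\<^esub> S a' (b' + r * r * b) = S a b \<oplus>\<^bsub>LG\<^esub> S a' b'"
proof -
  have c: "lift u + lift r * lift v * s (lift r) - lift (u + r * r * v) \<in> Lam" if "u \<in> H" "v \<in> H" for u v
    using Lam_add[OF lift_sq[OF that(2), of r] lift_add[OF that(1) H_sq[OF that(2)], of r]] by (simp add: algebra_simps)
  have in_H: "lift u + lift r * lift v * s (lift r) \<in> Hh" if "u \<in> H" "v \<in> H" for u v
    by (intro Hh_add Hh_conj lift_Hh that)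
  have "S (a + r * r * a') b = sy (lift a + lift r * lift a' * s (lift r)) (lift b)"
    unfolding S_def by (rule sy_cong[symmetric]) (simp_all add: in_H c lift_Hh assms)
  moreover have "S a' (b' + r * r * b) = sy (lift a') (lift b' + s (lift r) * lift b * lift r)"
    unfolding S_def using in_H[OF assms(4,2)] c[OF assms(4,2)]
    by (intro sy_cong[symmetric]) (simp_all add: lift_Hh assms mult.commute mult.left_commute)
  ultimately show ?thesis using sy_star[of "lift a" "lift b" "lift a'" "lift b'" "lift r"] by (simp add: lift_Hh assms S_def)
qed

text \<open>In \<open>S_star\<close> the first argument of one plane and the last argument of the
  other are taken to be 0, so both planes on the right are hyperbolic.\<close>

lemma S_move_neg:
  assumes "a \<in> H" "b \<in> H"
  shows "S (r * r * a) b \<oplus>\<^bsub>LG\<^esub> S a (r * r * b) = \<zero>\<^bsub>LG\<^esub>"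
proof -
  have "S a 0 = \<zero>\<^bsub>LG\<^esub>" using S_swap[OF assms(1) H_zero] S_zero[OF assms(1)] by simp
  then show ?thesis using S_star[OF H_zero assms(2,1) H_zero, of r] S_zero[OF assms(2)] by simp
qed

lemma S_double: "a \<in> H \<Longrightarrow> b \<in> H \<Longrightarrow> S a b \<oplus>\<^bsub>LG\<^esub> S a b = \<zero>\<^bsub>LG\<^esub>"
  using S_move_neg[of a b 1] by simp

lemma eq_of_sum_zero: "x \<in> carrier LG \<Longrightarrow> y \<in> carrier LG \<Longrightarrow> x \<oplus>\<^bsub>LG\<^esub> y = \<zero>\<^bsub>LG\<^esub> \<Longrightarrow> y \<oplus>\<^bsub>LG\<^esub> y = \<zero>\<^bsub>LG\<^esub> \<Longrightarrow> x = y"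
  by (metis G.add.right_cancel)

lemma S_move: "a \<in> H \<Longrightarrow> b \<in> H \<Longrightarrow> S (r * r * a) b = S a (r * r * b)"
  by (rule eq_of_sum_zero) (simp_all add: S_move_neg S_double H_sq)

text \<open>In \<open>S_star\<close> take r = 1 and the same second argument b for both planes: one
  plane on the left becomes S a' (b + b) = S a' 0 and disappears.\<close>

lemma S_add: "a \<in> H \<Longrightarrow> a' \<in> H \<Longrightarrow> b \<in> H \<Longrightarrow> S (a + a') b = S a b \<oplus>\<^bsub>LG\<^esub> S a' b"
proof -
  assume H: "a \<in> H" "a' \<in> H" "b \<in> H"
  have "S a' 0 = \<zero>\<^bsub>LG\<^esub>" using S_swap[OF H(2) H_zero] S_zero[OF H(2)] by simp
  then show ?thesis using S_star[OF H(1,3,2,3), of 1] H by (simp add: H_add)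
qed

lemma S_add_right: "a \<in> H \<Longrightarrow> b \<in> H \<Longrightarrow> b' \<in> H \<Longrightarrow> S a (b + b') = S a b \<oplus>\<^bsub>LG\<^esub> S a b'"
  using S_add[of b b' a] S_swap H_add by metis

lemma S_frob: "a \<in> H \<Longrightarrow> c \<in> H \<Longrightarrow> S a (c * c * a) = S a c"
proof -
  assume H: "a \<in> H" "c \<in> H"
  have cca: "c * c * a \<in> H" by (rule H_sq[OF H(1)])
  have "lift c * lift a * s (lift c) + eps * lift c - lift (c * c * a + c) \<in> Lam"
    using Lam_add[OF Lam_add[OF lift_sq[OF H(1), of c] lift_add[OF cca H(2)]] lift_eps[OF H(2)]]
    by (simp add: algebra_simps)
  moreover have "eps * lift c \<in> Hh" using Hh_add[OF Lam_Hh[OF lift_eps[OF H(2)]] lift_Hh[OF H(2)]] by simp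
  then have "lift c * lift a * s (lift c) + eps * lift c \<in> Hh" by (intro Hh_add Hh_conj lift_Hh H)
  ultimately have "sy (lift a) (lift c * lift a * s (lift c) + eps * lift c) = S a (c * c * a + c)"
    unfolding S_def by (intro sy_cong) (simp_all add: lift_Hh H)
  moreover have "sy (lift a) (lift c * lift a * s (lift c) + eps * lift c) = sy (lift a) 0"
    using sy_shear[OF lift_Hh[OF H(1)] Hh_zero lift_Hh[OF H(2)]] by simp
  moreover have "sy (lift a) 0 = \<zero>\<^bsub>LG\<^esub>" using sy_swap[OF lift_Hh[OF H(1)] Hh_zero] sy_zero[OF lift_Hh[OF H(1)]] by simp
  ultimately have "S a (c * c * a) \<oplus>\<^bsub>LG\<^esub> S a c = \<zero>\<^bsub>LG\<^esub>" using S_add_right[OF H(1) cca H(2)] by simp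
  then show ?thesis by (rule eq_of_sum_zero[rotated 2]) (simp_all add: H cca S_double)
qed

text \<open>Squares can be moved to the other argument, and both arguments are sums p^2 + t q^2. The
  critical case is S t (t q^2) = S t q by \<open>S_frob\<close>; by induction on the degree this is
  S 1 (t q), and \<open>S_frob\<close> once more gives S 1 (t^2 q^2).\<close>

lemma S_prod:
  assumes "H = UNIV"
  shows "S a b = S 1 (a * b)"
proof -
  have H [simp]: "x \<in> H" for x by (simp add: assms)
  let ?t = "[:0, 1:] :: bit poly"
  have sq: "S (u * u) b = S 1 (u * u * b)" for u b using S_move[of 1 b u] by simp
  have t: "S ?t b = S 1 (?t * b)" for b
  proof (induction "degree b" arbitrary: b rule: less_induct)
    case less
    obtain p q where b: "b = p * p + ?t * (q * q)" and q: "q = 0 \<or> 2 * degree q < degree b"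
      using bit_poly_sqrt[of b] by blast
    have 1: "S ?t (p * p) = S 1 (?t * (p * p))"
      using sq[of p ?t] S_swap[of ?t "p * p"] by (simp add: mult.commute)
    have "S ?t (?t * (q * q)) = S ?t q" using S_frob[of ?t q] by (simp add: mult.commute)
    also have "\<dots> = S 1 (?t * q)"
    proof (cases "q = 0")
      case True
      then show ?thesis using S_swap[of 0] S_zero by simp
    next
      case False
      then show ?thesis using q by (intro less) linarith
    qed
    also have "\<dots> = S 1 ((?t * q) * (?t * q) * 1)" by (rule S_frob[symmetric]) simp_all
    also have "(?t * q) * (?t * q) * 1 = ?t * (?t * (q * q))" by (simp only: ac_simps mult_1_right mult_1_left)
    finally show ?case unfolding b distrib_left using 1 by (simp only: S_add_right H)
  qed
  obtain p q where a: "a = p * p + ?t * (q * q)" using bit_poly_sqrt[of a] by blast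
  have "S (?t * (q * q)) b = S 1 (?t * (q * q) * b)"
    using S_move[of ?t b q] t[of "q * q * b"] by (simp only: H ac_simps simp_thms)
  then show ?thesis unfolding a distrib_right using sq by (simp only: S_add S_add_right H)
qed

end

section \<open>Functoriality of plane classes and a normal form for them\<close>

abbreviation stretch :: "nat \<Rightarrow> 'r::comm_ring_1 poly \<Rightarrow> 'r poly" where
  "stretch j p \<equiv> pcompose p (monom 1 j)"

abbreviation TT :: "'r::comm_ring_1 poly" where "TT \<equiv> [:0, 1:]"

lemma bit_poly_square_add: "(a + b) * (a + b) = a * a + b * (b :: bit poly)"
proof -
  have "(a + b) * (a + b) = a * a + b * b + (a * b + a * b)" by (simp only: algebra_simps)
  then show ?thesis by (simp only: bit_poly_double add_0_right)
qed

lemma coeff_0_dvd: "coeff c 0 = 0 \<Longrightarrow> \<exists>d. c = TT * (d :: 'r::comm_ring_1 poly)"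
  by (cases c) auto

context fmodel_hom
begin

lemma L_map_car: "x \<in> carrier A.LG \<Longrightarrow> L_map k R S \<tau> f x \<in> carrier B.LG"
  unfolding A.LG_carrier using L_map_cl nonsing_gm B.cl_car by auto

lemma L_map_zero: "L_map k R S \<tau> f \<zero>\<^bsub>A.LG\<^esub> = \<zero>\<^bsub>B.LG\<^esub>"
  using L_map_cl[OF A.nonsing_0[of A.hy]] A.LG_zero[of A.hy] B.LG_zero by metis

lemma L_map_add:
  assumes "x \<in> carrier A.LG" "y \<in> carrier A.LG"
  shows "L_map k R S \<tau> f (x \<oplus>\<^bsub>A.LG\<^esub> y) = L_map k R S \<tau> f x \<oplus>\<^bsub>B.LG\<^esub> L_map k R S \<tau> f y"
proof -
  obtain n A m C where A: "A.nonsing n A" and C: "A.nonsing m C" and [simp]: "x = A.cl n A" "y = A.cl m C"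
    using assms unfolding A.LG_carrier by blast
  show ?thesis
    by (simp add: A.LG_add[OF A C] L_map_cl[OF A.nonsing_bs[OF A C]] L_map_cl[OF A] L_map_cl[OF C] gm_bs
        B.LG_add[OF nonsing_gm[OF A] nonsing_gm[OF C]])
qed

lemma g_Hh: "a \<in> A.Hh \<Longrightarrow> g a \<in> B.Hh"
proof -
  assume "a \<in> A.Hh"
  then have "g (a + A.eps * s a) = 0" by (simp add: A.Hh_def)
  then show ?thesis by (simp add: B.Hh_def g_add g_mult g_s)
qed

lemma L_map_sy: "a \<in> A.Hh \<Longrightarrow> b \<in> A.Hh \<Longrightarrow> L_map k R S \<tau> f (A.sy a b) = B.sy (g a) (g b)"
proof -
  assume "a \<in> A.Hh" "b \<in> A.Hh"
  moreover have "gm (A.pl a b) = B.pl (g a) (g b)" by (intro ext) (simp add: gm_def A.pl_def B.pl_def)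
  ultimately show ?thesis unfolding A.sy_def B.sy_def using L_map_cl[OF A.nonsing_pl, of a b] by simp
qed

end

text \<open>A normal form for planes: every symbol is \<open>S h (\<theta> c)\<close> with
  \<open>c\<close> in \<open>C\<close>. The set \<open>C\<close> contains all c with c(0) = 0, and
  constant terms occur only if \<open>h = 1\<close>. \<open>C_h\<close> makes normal forms with c(0)
  = 0 vanish at t = 0, and \<open>th_detect\<close> recovers \<open>c\<close> modulo the elements w
  + w^2 from the product of the two \<mu>-values.\<close>

locale symbol_map = symbols R \<sigma> \<rho> s k lift H
  for R :: "('a, 'x) ring_scheme" (structure) and \<sigma> and \<rho> :: "'b::comm_ring_1 \<Rightarrow> 'a" and s k lift H +
  fixes h :: "bit poly" and \<theta> :: "bit poly \<Rightarrow> bit poly" and C :: "bit poly set"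
  assumes h_H: "h \<in> H" and th_H: "c \<in> C \<Longrightarrow> \<theta> c \<in> H"
    and C_0: "coeff c 0 = 0 \<Longrightarrow> c \<in> C" and C_add: "c \<in> C \<Longrightarrow> d \<in> C \<Longrightarrow> c + d \<in> C"
    and C_sq: "c \<in> C \<Longrightarrow> c * c \<in> C" and C_1: "c \<in> C \<Longrightarrow> coeff c 0 \<noteq> 0 \<Longrightarrow> 1 \<in> C \<and> h = 1 \<and> \<theta> 1 = 1"
    and C_h: "c \<in> C \<Longrightarrow> coeff c 0 = 0 \<Longrightarrow> coeff h 0 = 0 \<or> coeff (\<theta> c) 0 = 0"
    and th_add: "c \<in> C \<Longrightarrow> d \<in> C \<Longrightarrow> \<theta> (c + d) = \<theta> c + \<theta> d"
    and th_sq: "c \<in> C \<Longrightarrow> \<theta> (c * c) = \<theta> c * \<theta> c * h"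
    and th_prod: "a \<in> H \<Longrightarrow> b \<in> H \<Longrightarrow> \<exists>c\<in>C. S a b = S h (\<theta> c)"
    and th_detect: "c \<in> C \<Longrightarrow> h * \<theta> c = w + w * w \<Longrightarrow> \<exists>w. c = w + w * w"
begin

interpretation G: abelian_group LG by (rule LG_group)

definition E where "E c = S h (\<theta> c)"

lemma E_car: "c \<in> C \<Longrightarrow> E c \<in> carrier LG"
  by (simp add: E_def S_car h_H th_H)

lemma E_add: "c \<in> C \<Longrightarrow> d \<in> C \<Longrightarrow> E (c + d) = E c \<oplus>\<^bsub>LG\<^esub> E d"
  by (simp add: E_def th_add S_add_right h_H th_H)

lemma E_artin: "w \<in> C \<Longrightarrow> E (w + w * w) = \<zero>\<^bsub>LG\<^esub>"
  by (simp add: E_add C_sq) (simp add: E_def th_sq S_frob S_double h_H th_H)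

lemma E_zero: "E 0 = \<zero>\<^bsub>LG\<^esub>"
  using E_artin[OF C_0, of 0] by simp

lemma span_E: "x \<in> span \<Longrightarrow> \<exists>c\<in>C. x = E c"
proof (induction rule: span.induct)
  case span_zero
  then show ?case using E_zero C_0[of 0] by force
next
  case (span_add a b x)
  obtain c' where c': "c' \<in> C" "x = E c'" using span_add by blast
  obtain u v where "u \<in> H" "v \<in> H" "sy a b = S u v" using sy_lift[OF span_add(1,2)] by blast
  then obtain c where "c \<in> C" "sy a b = E c" using th_prod unfolding E_def by metis
  then show ?case using c' E_add C_add by metis
qed

end

section \<open>Normal forms for the three sets of admissible values\<close>

context symbols
begin

lemma S_self: "a \<in> H \<Longrightarrow> b \<in> H \<Longrightarrow> S (r * r * a) (q * q * b) = S a (r * q * (r * q) * b)"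
  using S_move[of a "q * q * b" r] H_sq[of b q] by (simp only: ac_simps)

lemma symbol_map_all:
  assumes "H = UNIV"
  shows "symbol_map R \<sigma> \<rho> s k lift H 1 (\<lambda>c. c) UNIV"
  using S_prod[OF assms] by unfold_locales (auto simp: assms)

text \<open>Moving a square across gives S u^2 v^2 = S 1 (u v)^2, so \<open>c = u v\<close> serves
  as coordinate. The Arf product is c^2, which differs from c by c + c^2.\<close>

lemma symbol_map_squares:
  assumes H: "H = {c. \<exists>d. c = d * d}"
  shows "symbol_map R \<sigma> \<rho> s k lift H 1 (\<lambda>c. c * c) UNIV"
proof unfold_locales
  have 1: "1 \<in> H" unfolding H by (intro CollectI exI[of _ 1]) simp
  then show "1 \<in> H" .
  fix a b assume "a \<in> H" "b \<in> H"
  then obtain u v where "a = u * u" "b = v * v" unfolding H by blast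
  then show "\<exists>c\<in>UNIV. S a b = S 1 (c * c)" using S_self[OF 1 1, of u v] by auto
next
  fix c w :: "bit poly" assume *: "1 * (c * c) = w + w * w"
  have "c = (c * c) + (c + c * c)" by (simp add: add.left_commute[of "c * c"])
  also have "\<dots> = (w + c) + (w + c) * (w + c)" unfolding bit_poly_square_add using * by (simp add: ac_simps)
  finally show "\<exists>w. c = w + w * w" by blast
qed (auto simp: H bit_poly_square_add coeff_mult)

text \<open>Every value is t times a square, and moving squares across leaves the symbols S t (t
  d^2). Their Arf product is (t d)^2, so the coordinate is c = t d and \<open>\<theta>\<close>
  writes t d^2 in terms of c.\<close>

lemma symbol_map_odd:
  assumes H: "H = {c. \<exists>d. c = TT * (d * d)}"
  shows "symbol_map R \<sigma> \<rho> s k lift H TT (\<lambda>c. TT * ((c div TT) * (c div TT))) {c. coeff c 0 = 0}"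
proof unfold_locales
  have div: "TT * d div TT = d" for d :: "bit poly" by (rule nonzero_mult_div_cancel_left) simp
  have t: "TT \<in> H" unfolding H by (intro CollectI exI[of _ 1]) simp
  then show "TT \<in> H" .
  {
    fix a b assume "a \<in> H" "b \<in> H"
    then obtain u v where "a = u * u * TT" "b = v * v * TT" unfolding H by (auto simp only: ac_simps)
    then have "S a b = S TT (TT * (u * v * (u * v)))" using S_self[OF t t, of u v] by (simp only: ac_simps)
    then show "\<exists>c\<in>{c. coeff c 0 = 0}. S a b = S TT (TT * ((c div TT) * (c div TT)))"
      by (intro bexI[of _ "TT * (u * v)"]) (simp_all only: div mem_Collect_eq coeff_mult, simp)
  next
    fix c w :: "bit poly" assume c: "c \<in> {c. coeff c 0 = 0}" and *: "TT * (TT * ((c div TT) * (c div TT))) = w + w * w"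
    obtain d where d: "c = TT * d" using c coeff_0_dvd by blast
    have "c * c = w + w * w" using * unfolding d div by (simp only: ac_simps)
    have "c = (c * c) + (c + c * c)" by (simp add: add.left_commute[of "c * c"])
    also have "\<dots> = (w + c) + (w + c) * (w + c)" unfolding bit_poly_square_add using \<open>c * c = w + w * w\<close> by (simp add: ac_simps)
    finally show "\<exists>w. c = w + w * w" by blast
  next
    fix c d :: "bit poly" assume "c \<in> {c. coeff c 0 = 0}" "d \<in> {c. coeff c 0 = 0}"
    then obtain u v where "c = TT * u" "d = TT * v" using coeff_0_dvd by blast
    then show "TT * ((c + d) div TT * ((c + d) div TT)) = TT * (c div TT * (c div TT)) + TT * (d div TT * (d div TT))"
      by (simp only: distrib_left[symmetric] div bit_poly_square_add)
  next
    fix c :: "bit poly" assume "c \<in> {c. coeff c 0 = 0}"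
    then obtain u where c: "c = TT * u" using coeff_0_dvd by blast
    have "TT * u * (TT * u) = TT * (TT * (u * u))" by (simp only: ac_simps)
    then have "c * c div TT = TT * (u * u)" "c div TT = u" unfolding c by (simp_all only: div)
    then show "TT * (c * c div TT * (c * c div TT)) = TT * (c div TT * (c div TT)) * (TT * (c div TT * (c div TT))) * TT"
      by (simp only: ac_simps)
  }
qed (auto simp: H coeff_mult)

text \<open>Substituting t^j turns both arguments into multiples of t^j = u^2 t with u = t^m and j =
  2m + 1. The square u^2 is moved to the second argument, which restores the normal form; for even j
  no factor t would remain.\<close>

lemma stretch_odd:
  assumes H: "H = {c. \<exists>d. c = TT * (d * d)}" and j: "odd j" and c: "coeff c 0 = 0"
  shows "S (stretch j TT) (stretch j (TT * ((c div TT) * (c div TT))))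
    = S TT (TT * ((stretch j c div TT) * (stretch j c div TT)))"
proof -
  obtain d where d: "c = TT * d" using c coeff_0_dvd by blast
  obtain m where m: "j = Suc (2 * m)" using j by (metis oddE Suc_eq_plus1)
  let ?u = "monom 1 m :: bit poly"
  have tj: "stretch j TT = ?u * ?u * TT"
    by (simp add: m mult_monom mult_2 monom_Suc pcompose_pCons)
  have div: "TT * d div TT = d" for d :: "bit poly" by (rule nonzero_mult_div_cancel_left) simp
  have t: "TT \<in> H" unfolding H by (intro CollectI exI[of _ 1]) simp
  have sc: "stretch j c = TT * (?u * (?u * stretch j d))" unfolding d pcompose_mult tj by (simp only: ac_simps)
  have "stretch j (TT * ((c div TT) * (c div TT))) = (?u * stretch j d) * (?u * stretch j d) * TT"
    unfolding d div pcompose_mult tj by (simp only: ac_simps)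
  then show ?thesis unfolding sc div tj using S_self[OF t t, of ?u "?u * stretch j d"] by (simp only: ac_simps)
qed

end

section \<open>Polynomial rings\<close>

text \<open>The substitution of e t for t. As the coefficients have trivial involution, this is the
  involution of the polynomial ring.\<close>

definition twist :: "int \<Rightarrow> 'r::comm_ring_1 poly \<Rightarrow> 'r poly" where
  "twist e p = pcompose p [:0, of_int e:]"

lemma coeff_twist: "coeff (twist e p) i = of_int e ^ i * coeff p i"
  by (simp add: twist_def coeff_pcompose_linear)

lemma twist_1: "twist 1 = id"
  by (simp add: twist_def fun_eq_iff)

lemma coeff_stretch:
  "0 < j \<Longrightarrow> coeff (stretch j p) n = (if j dvd n then coeff p (n div j) else (0 :: 'r::comm_ring_1))"
proof (induction p arbitrary: n)
  case (pCons a p)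
  have "coeff (stretch j (pCons a p)) n = (if n = 0 then a else 0) + (if j \<le> n then coeff (stretch j p) (n - j) else 0)"
    by (simp add: pcompose_pCons coeff_monom_mult coeff_pCons split: nat.split)
  also have "\<dots> = (if j dvd n then coeff (pCons a p) (n div j) else 0)"
  proof (cases "j \<le> n")
    case True
    then obtain m where m: "n = m + j" by (metis add.commute le_Suc_ex)
    then show ?thesis using pCons by (simp add: div_add_self2)
  next
    case False
    then show ?thesis using pCons(3) by (auto simp: dvd_imp_le)
  qed
  finally show ?case .
qed simp

lemma stretch_power: "stretch j (p ^ n) = stretch j p ^ n"
  by (induction n) (simp_all add: pcompose_1 pcompose_mult)

lemma stretch_twist:
  fixes p :: "'r::comm_ring_1 poly"
  assumes "e = 1 \<or> e = -1" "e = 1 \<or> odd j"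
  shows "stretch j (twist e p) = twist e (stretch j p)"
proof -
  have "pcompose [:0, of_int e:] (monom 1 j) = pcompose (monom 1 j) [:0, of_int e :: 'r:]"
  proof (rule poly_eqI)
    fix n
    have "pcompose [:0, of_int e :: 'r:] (monom 1 j) = smult (of_int e) (monom 1 j)"
      by (simp add: pcompose_pCons mult.commute[of "monom 1 j"])
    then show "coeff (pcompose [:0, of_int e:] (monom 1 j)) n = coeff (pcompose (monom 1 j) [:0, of_int e :: 'r:]) n"
      using assms by (auto simp: coeff_pcompose_linear)
  qed
  then show ?thesis by (simp add: twist_def pcompose_assoc[symmetric])
qed

context fmodel
begin

lemma finsum_rho: "(\<Oplus>i\<in>I. \<rho> (F i)) = \<rho> (\<Sum>i\<in>I. F i)"
proof -
  interpret ring R by (rule ring_R)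
  show ?thesis
    by (induction I rule: infinite_finite_induct) (simp_all add: finsum_infinite rho_zero rho_add Pi_def)
qed

lemma add_pow_rho: "add_pow R (z :: int) (\<rho> a) = \<rho> (of_int z * a)"
proof -
  interpret ring R by (rule ring_R)
  have n: "add_pow R n (\<rho> a) = \<rho> (of_nat n * a)" for n :: nat
    by (induction n) (simp_all add: rho_zero rho_add[symmetric] algebra_simps)
  show ?thesis
  proof (cases "0 \<le> z")
    case True
    then show ?thesis by (simp add: add_pow_int_ge n)
  next
    case False
    then have "of_int z * a = - (of_nat (nat (- z)) * a)" by simp
    then show ?thesis using False by (simp add: add_pow_int_lt n rho_neg)
  qed
qed

lemma pow_rho: "\<rho> a [^] (n::nat) = \<rho> (a ^ n)"
proof -
  interpret ring R by (rule ring_R)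
  show ?thesis by (induction n) (simp_all add: rho_one rho_mult[symmetric] mult.commute)
qed

definition prho :: "'b poly \<Rightarrow> nat \<Rightarrow> 'a" where "prho p = (\<lambda>i. \<rho> (coeff p i))"

lemma prho_up: "prho p \<in> up R"
proof -
  have "bound \<zero> (degree p) (prho p)" by (auto simp: prho_def rho_zero coeff_eq_0)
  then show ?thesis unfolding up_def prho_def by auto
qed

lemma bij_prho: "bij_betw prho UNIV (up R)"
proof (rule bij_betwI[where g = "\<lambda>f. Abs_poly (\<lambda>i. un (f i))"])
  show "prho \<in> UNIV \<rightarrow> up R" using prho_up by blast
  show "Abs_poly (\<lambda>i. un (prho p i)) = p" for p by (simp add: prho_def coeff_inverse)
  fix f assume f: "f \<in> up R"
  then obtain n where "bound \<zero> n f" unfolding up_def by blast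
  then have "un (f i) = 0" if "i > n" for i using that un_rho[of 0] by (simp add: bound_def rho_zero)
  then have "coeff (Abs_poly (\<lambda>i. un (f i))) i = un (f i)" for i by (simp add: coeff_Abs_poly[of n])
  moreover have "f i \<in> carrier R" for i using f unfolding up_def by blast
  ultimately show "prho (Abs_poly (\<lambda>i. un (f i))) = f" by (simp add: prho_def)
qed simp

lemma poly_model:
  assumes \<sigma>: "\<sigma> = id" and e: "e = 1 \<or> e = -1"
  shows "fmodel (UP R) (poly_inv e R \<sigma>) prho (twist e)"
proof (intro fmodel.intro)
  interpret ring R by (rule ring_R)
  interpret UP_ring R "UP R" by unfold_locales
  show "ring (UP R)" by (rule UP_ring)
  show "bij_betw prho UNIV (carrier (UP R))" using bij_prho by (simp add: UP_def)
  fix p q :: "'b poly"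
  note up [simp] = prho_up[of p] prho_up[of q]
  show "prho (p + q) = prho p \<oplus>\<^bsub>UP R\<^esub> prho q"
    using up by (simp add: UP_def) (simp add: prho_def rho_add)
  show "prho (p * q) = prho p \<otimes>\<^bsub>UP R\<^esub> prho q"
    using up by (simp add: UP_def) (simp add: prho_def Polynomial.coeff_mult rho_mult[symmetric] finsum_rho)
  show "poly_inv e R \<sigma> (prho p) = prho (twist e p)"
    using up by (simp add: poly_inv_def UP_def \<sigma>) (simp add: prho_def add_pow_rho coeff_twist)
  show "prho 1 = \<one>\<^bsub>UP R\<^esub>" by (simp add: UP_def) (auto simp: prho_def rho_one rho_zero fun_eq_iff)
  show "twist e (p + q) = twist e p + twist e q" "twist e (p * q) = twist e p * twist e q" "twist e (1::'b poly) = 1"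
    by (simp_all add: twist_def pcompose_add pcompose_mult pcompose_1)
  have "(of_int e * of_int e :: 'b) = 1" using e by auto
  then show "twist e (twist e p) = p"
    by (intro poly_eqI) (simp add: coeff_twist mult.assoc[symmetric] power_mult_distrib[symmetric])
qed

lemma eval_zero_prho: "eval_zero R (prho p) = \<rho> (coeff p 0)"
proof -
  interpret ring R by (rule ring_R)
  have "eval_zero R (prho p) = (\<Oplus>i\<in>{..deg R (prho p)}. \<rho> (coeff p i * 0 ^ i))"
    unfolding eval_zero_def eval_def
    by (simp add: UP_def prho_up rho_zero[symmetric] pow_rho rho_mult) (simp add: prho_def)
  also have "\<dots> = \<rho> (coeff p 0)" unfolding finsum_rho by (simp add: power_0_left if_distrib cong: if_cong)
  finally show ?thesis .
qed

lemma prho_const: "up_ring.monom (UP R) (\<rho> a) j = prho (Polynomial.monom a j)"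
  by (simp add: UP_def prho_def fun_eq_iff rho_zero)

lemma V_map_prho:
  assumes \<sigma>: "\<sigma> = id"
  shows "V_map R j (prho p) = prho (stretch j p)"
proof -
  interpret ring R by (rule ring_R)
  interpret P: UP_ring R "UP R" by unfold_locales
  interpret U: fmodel "UP R" "poly_inv 1 R \<sigma>" prho "twist 1" k by (rule poly_model[OF \<sigma>]) simp
  let ?d = "deg R (prho p)"
  have car: "prho p \<in> carrier (UP R)" by (rule U.rho_car)
  have c: "up_ring.coeff (UP R) (prho p) i = \<rho> (coeff p i)" for i
    using car by (simp add: UP_def) (simp add: prho_def)
  have zero: "coeff p i = 0" if "i > ?d" for i
  proof -
    have "\<rho> (coeff p i) = \<rho> 0" using P.deg_aboveD[OF that car] by (simp add: c rho_zero)
    then show ?thesis by simp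
  qed
  have "V_map R j (prho p) = (\<Oplus>\<^bsub>UP R\<^esub>i\<in>{..?d}. prho ([:coeff p i:] * Polynomial.monom 1 j ^ i))"
    unfolding V_map_def eval_def using car
    by (simp add: c rho_one[symmetric] prho_const U.pow_rho U.rho_mult[symmetric] monom_0 del: mult_pCons_left)
  also have "\<dots> = prho (\<Sum>i\<le>?d. [:coeff p i:] * Polynomial.monom 1 j ^ i)" by (rule U.finsum_rho)
  also have "(\<Sum>i\<le>?d. [:coeff p i:] * Polynomial.monom 1 j ^ i) = stretch j p"
  proof -
    have "p = (\<Sum>i\<le>?d. [:coeff p i:] * [:0, 1:] ^ i)"
      using poly_as_sum_of_monoms'[of p ?d] zero by (simp add: degree_le monom_altdef)
    then have "stretch j p = stretch j (\<Sum>i\<le>?d. [:coeff p i:] * [:0, 1:] ^ i)" by simp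
    also have "\<dots> = (\<Sum>i\<le>?d. [:coeff p i:] * Polynomial.monom 1 j ^ i)"
      by (simp add: pcompose_sum pcompose_mult stretch_power pcompose_smult pcompose_pCons)
    finally show ?thesis by simp
  qed
  finally show ?thesis .
qed

end

lemma int_model: "fmodel \<Z> id id id"
  by unfold_locales (auto intro!: abelian_groupI simp: algebra_simps)

definition bit_int :: "bit \<Rightarrow> int" where "bit_int b = (if b = 0 then 0 else 1)"

lemma bit_int_of_int: "of_int (bit_int b) = b"
  by (cases b) (simp_all add: bit_int_def)

lemma bit_model: "fmodel (residue_ring 2) id bit_int id"
proof (intro fmodel.intro)
  interpret residues 2 "residue_ring 2" by unfold_locales simp_all
  show "ring (residue_ring 2)" by (rule ring_axioms)
  have "{0..1::int} = {0, 1}" by auto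
  moreover have "range bit_int = {0, 1}"
  proof (rule antisym)
    show "range bit_int \<subseteq> {0, 1}" by (rule image_subsetI) (simp add: bit_int_def)
    show "{0, 1} \<subseteq> range bit_int" using rangeI[of bit_int 0] rangeI[of bit_int 1] by (simp add: bit_int_def)
  qed
  moreover have "inj bit_int" by (metis bit_int_of_int injI)
  ultimately show "bij_betw bit_int UNIV (carrier (residue_ring 2))"
    by (simp add: bij_betw_def residue_ring_def)
  fix a b :: bit
  show "bit_int (a + b) = bit_int a \<oplus>\<^bsub>residue_ring 2\<^esub> bit_int b" "bit_int (a * b) = bit_int a \<otimes>\<^bsub>residue_ring 2\<^esub> bit_int b"
    by (cases a; cases b; simp add: bit_int_def residue_ring_def)+
qed (simp_all add: bit_int_def residue_ring_def)

section \<open>Reduction to planes\<close>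

context fmodel
begin

lemma span_trans: "x \<in> span \<Longrightarrow> y \<in> span \<Longrightarrow> x \<oplus>\<^bsub>LG\<^esub> y \<in> span"
proof (induction rule: span.induct)
  case span_zero
  interpret G: abelian_group LG by (rule LG_group)
  show ?case using span_zero span_car by simp
next
  case (span_add a b x)
  then show ?case using span_shift[OF span_add(1,2,3), of y] span_car span.span_add by metis
qed

text \<open>An isometry of \<open>B'\<close> plus a hyperbolic form with a hyperbolic form yields a
  basis \<open>U\<close> for which \<lambda> is standard. The same basis makes \<lambda> standard
  for \<open>B\<close> plus the hyperbolic form, where \<mu> may be different, and
  \<open>hyperbolic_planes\<close> applies.\<close>

lemma span_same_hermitian:
  assumes B: "nonsing m B" and B': "nonsing m B'" and hm: "\<And>i j. i < m \<Longrightarrow> j < m \<Longrightarrow> hm B' i j = hm B i j"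
    and zero: "cl m B' = \<zero>\<^bsub>LG\<^esub>"
  shows "cl m B \<in> span"
proof -
  have "cl 0 hy = cl m B'" using zero LG_zero by metis
  then have "steq (fm 0 hy) (fm m B')" by (simp add: cl_eq nonsing_0 B')
  then obtain x y where "miso (0 + 2 * x) (bs 0 hy hy) (m + 2 * y) (bs m B' hy)"
    unfolding steq_miso[OF nonsing_0 B'] by blast
  moreover have "bs 0 hy hy = hy" by (simp add: bs_def fun_eq_iff)
  ultimately have "miso (2 * x) hy (m + 2 * y) (bs m B' hy)" by simp
  then obtain U V where U: "\<And>i j. i < 2 * x \<Longrightarrow> j < 2 * x \<Longrightarrow> bl (m + 2 * y) (hm (bs m B' hy)) (U i) (U j) = hm hy i j"
    and V: "\<And>l q. l < m + 2 * y \<Longrightarrow> q < m + 2 * y \<Longrightarrow> (\<Sum>i<2 * x. V l i * U i q) = dl l q"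
    unfolding miso_def by blast
  define D where "D = bs m B hy"
  define C where "C i j = bl (m + 2 * y) D (U i) (U j)" for i j
  have "hm (bs m B' hy) i j = hm D i j" if "i < m + 2 * y" "j < m + 2 * y" for i j
    using hm by (simp add: D_def hm_bs) (simp add: bs_def)
  then have "bl (m + 2 * y) (hm D) v w = bl (m + 2 * y) (hm (bs m B' hy)) v w" for v w
    unfolding bl_def by (intro sum.cong refl) simp
  then have hC: "hm C i j = hm hy i j" if "i < 2 * x" "j < 2 * x" for i j
    using U[OF that] unfolding bl_hm by (simp add: hm_def[of C] C_def)
  have nC: "nonsing (2 * x) C" by (rule nonsing_cong[OF nonsing_hy]) (simp add: hC)
  have nD: "nonsing (m + 2 * y) D" unfolding D_def by (rule nonsing_bs[OF B nonsing_hy])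
  have "bl (m + 2 * y) (hm D) (U i) (U j) = hm C i j" for i j
    unfolding bl_hm by (simp add: hm_def[of C] C_def)
  then have "miso (2 * x) C (m + 2 * y) D"
    unfolding miso_def using V by (intro exI[of _ U] exI[of _ V]) (simp add: C_def Lam_zero)
  then have "cl (2 * x) C = cl (m + 2 * y) D" by (rule cl_eqI[OF miso_eqv[OF nC nD]])
  also have "\<dots> = cl m B \<oplus>\<^bsub>LG\<^esub> cl (2 * y) hy" unfolding D_def by (rule LG_add[OF B nonsing_hy, symmetric])
  also have "\<dots> = cl m B"
  proof -
    interpret G: abelian_group LG by (rule LG_group)
    show ?thesis by (simp add: cl_hyp cl_car[OF B])
  qed
  finally show ?thesis using hyperbolic_planes[OF hC, of x span] span.intros by metis
qed

end

context fmodel_const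
begin

text \<open>The diagonal of \<open>hm A\<close> has the form a + eps s(a) and is constant, so it
  vanishes by \<open>alt\<close>. The leading basis vector is therefore isotropic with constant
  pairings and can be split off, and the rest again has constant entries.\<close>

lemma span_alternating:
  assumes alt: "\<And>a. a + eps * s a \<in> range \<kappa> \<Longrightarrow> a + eps * s a = 0"
    and A: "nonsing n A" "\<And>i j. i < n \<Longrightarrow> j < n \<Longrightarrow> hm A i j \<in> range \<kappa>"
  shows "cl n A \<in> span"
  using A
proof (induction n arbitrary: A rule: less_induct)
  case (less n)
  show ?case
  proof (cases "n = 0")
    case True
    then show ?thesis using LG_zero[of A] span_zero by simp
  next
    case False
    then have 0: "0 < n" by simp
    have d: "(\<lambda>i. \<kappa> (dl 0 i)) = dl 0" by (simp add: k_dl fun_eq_iff)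
    define r where "r j = \<pi> (hm A 0 j)" for j
    have r: "hm A 0 j = \<kappa> (r j)" if "j < n" for j
      using less.prems(2)[OF 0 that] by (auto simp: r_def p_k)
    have "hm A 0 0 = 0" using alt[of "A 0 0"] less.prems(2)[OF 0 0] by (simp add: hm_def)
    then have iso: "bl n (hm A) (\<lambda>i. \<kappa> (dl 0 i)) (\<lambda>i. \<kappa> (dl 0 i)) = 0" unfolding d by (simp add: bl_dl 0)
    have one: "(\<Sum>i<n. dl 0 i * dl i 0) = (1::'e)" using 0 by simp (simp add: dl_def)
    have const: "(\<Sum>i<n. \<kappa> (dl 0 i) * hm A i j) = \<kappa> (r j)" if "j < n" for j
      using r[OF that] 0 by (simp add: k_dl)
    obtain n' a b B where n: "n = 2 + n'" and ab: "a \<in> Hh" "b \<in> Hh" and B: "nonsing n' B"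
      and eq: "cl n A = sy a b \<oplus>\<^bsub>LG\<^esub> cl n' B"
      and X: "\<And>X. kclosed X \<Longrightarrow> (\<forall>i<n. \<forall>j<n. hm A i j \<in> X) \<Longrightarrow> (\<forall>i<n'. \<forall>j<n'. hm B i j \<in> X)"
      using split_isotropic[OF less.prems(1) one iso const] by meson
    have "kclosed (range \<kappa>)" unfolding kclosed_def
      by (auto simp: k_add[symmetric] k_mult[symmetric]) (metis k_zero rangeI)
    then have "cl n' B \<in> span" using X[of "range \<kappa>"] less.prems(2) B n by (intro less.IH) auto
    then show ?thesis unfolding eq by (intro span_add ab)
  qed
qed

end

section \<open>Matrices over Z[t] that are linear in t\<close>

lemma primitive_multiple:
  fixes v :: "nat \<Rightarrow> 'e::euclidean_ring"
  shows "\<exists>g w c. (\<forall>i<n. v i = g * w i) \<and> (n \<noteq> 0 \<longrightarrow> (\<Sum>i<n. w i * c i) = 1)"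
proof (induction n)
  case (Suc n)
  then obtain g w c where v: "\<And>i. i < n \<Longrightarrow> v i = g * w i" and c: "n \<noteq> 0 \<Longrightarrow> (\<Sum>i<n. w i * c i) = 1" by blast
  show ?case
  proof (cases "n = 0")
    case True
    then show ?thesis by (intro exI[of _ "v 0"] exI[of _ "\<lambda>_. 1"]) simp
  next
    case False
    obtain h p q x y where h: "g = h * p" "v n = h * q" and xy: "x * p + y * q = 1" using bezout_ex[of g "v n"] by blast
    define w' where "w' i = (if i < n then p * w i else q)" for i
    define c' where "c' i = (if i < n then x * c i else y)" for i
    have "(\<Sum>i<n. w' i * c' i) = p * x * (\<Sum>i<n. w i * c i)"
      unfolding sum_distrib_left by (intro sum.cong refl) (simp add: w'_def c'_def ac_simps)
    then have "(\<Sum>i<Suc n. w' i * c' i) = 1" using c[OF False] xy by (simp add: w'_def c'_def ac_simps)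
    moreover have "v i = h * w' i" if "i < Suc n" for i using that v h by (auto simp: w'_def ac_simps less_Suc_eq)
    ultimately show ?thesis by blast
  qed
qed simp

locale fmodel_Zt = fmodel R \<sigma> \<rho> "twist e" k
  for R :: "('a, 'x) ring_scheme" (structure) and \<sigma> and \<rho> :: "int poly \<Rightarrow> 'a" and e k +
  assumes e: "e = 1 \<or> e = -1"
begin

lemma ee: "e * e = 1" using e by auto

sublocale fmodel_const R \<sigma> \<rho> "twist e" k "\<lambda>c. [:c:]" "\<lambda>p. coeff p 0"
  by unfold_locales (simp_all add: twist_def coeff_mult one_pCons)

lemma degree_hm:
  assumes "degree (A i j) \<le> 1" "degree (A j i) \<le> 1"
  shows "degree (hm A i j) \<le> 1"
proof (rule degree_le, intro allI impI)
  fix n :: nat assume "1 < n"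
  then have "coeff (A i j) n = 0" "coeff (A j i) n = 0" using assms by (simp_all add: coeff_eq_0)
  then show "coeff (hm A i j) n = 0" by (simp add: hm_def eps_def coeff_twist)
qed

text \<open>Higman's trick with u = t trades the terms of top degree d + 2 for new entries of degree
  at most d + 1. Each round triples the size of the matrix and lowers the degree bound by
  one.\<close>

lemma linearize:
  "nonsing n A \<Longrightarrow> (\<And>i j. i < n \<Longrightarrow> j < n \<Longrightarrow> degree (A i j) \<le> Suc d) \<Longrightarrow>
    \<exists>m B. nonsing m B \<and> cl m B = cl n A \<and> (\<forall>i<m. \<forall>j<m. degree (B i j) \<le> 1)"
proof (induction d arbitrary: n A)
  case 0
  then show ?case by (intro exI[of _ n] exI[of _ A]) simp
next
  case (Suc d)
  \<comment> \<open>The factor -e makes s(t) Q cancel the top coefficient, because s(t) = e t and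
    e^2 = 1.\<close>
  define Q where "Q i j = Polynomial.monom (- e * coeff (A i j) (Suc (Suc d))) (Suc d)" for i j
  define B where "B = hig n A TT Q"
  have s: "twist e TT = [:0, e:]" by (simp add: twist_def pcompose_pCons)
  have "degree (B i j) \<le> Suc d" if "i < n + 2 * n" "j < n + 2 * n" for i j
  proof -
    have "degree (A i j + twist e TT * Q i j) \<le> Suc d" if "i < n" "j < n" for i j
    proof (rule degree_le, intro allI impI)
      fix l assume l: "Suc d < l"
      have "twist e TT * Q i j = Polynomial.monom (- coeff (A i j) (Suc (Suc d))) (Suc (Suc d))"
        using ee by (simp add: s Q_def monom_Suc smult_monom mult.assoc[symmetric])
      moreover have "coeff (A i j) l = 0" if "l \<noteq> Suc (Suc d)"
        using Suc.prems(2)[OF \<open>i < n\<close> \<open>j < n\<close>] l that by (simp add: coeff_eq_0)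
      ultimately show "coeff (A i j + twist e TT * Q i j) l = 0" by auto
    qed
    moreover have "degree (Q i j) \<le> Suc d" for i j unfolding Q_def by (rule degree_monom_le)
    moreover have "degree (twist e TT :: int poly) \<le> Suc d" by (simp add: s)
    moreover have "degree (hy i j :: int poly) \<le> Suc d" for i j by (simp add: hy_def)
    ultimately show ?thesis unfolding B_def hig_def by simp
  qed
  then obtain m C where "nonsing m C" "cl m C = cl (n + 2 * n) B" "\<forall>i<m. \<forall>j<m. degree (C i j) \<le> 1"
    using Suc.IH[of "n + 2 * n" B] higman(1)[OF Suc.prems(1)] unfolding B_def by blast
  then show ?case using higman(2)[OF Suc.prems(1)] unfolding B_def by metis
qed

lemma linear_form:
  assumes A: "nonsing n A"
  shows "\<exists>m B. nonsing m B \<and> cl m B = cl n A \<and> (\<forall>i<m. \<forall>j<m. degree (hm B i j) \<le> 1)"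
proof -
  define d where "d = (\<Sum>i<n. \<Sum>j<n. degree (A i j))"
  have "degree (A i j) \<le> Suc d" if "i < n" "j < n" for i j
  proof -
    have "degree (A i j) \<le> (\<Sum>j<n. degree (A i j))" using that by (intro member_le_sum) auto
    also have "\<dots> \<le> d" unfolding d_def using that by (intro member_le_sum) auto
    finally show ?thesis by simp
  qed
  then obtain m B where "nonsing m B" "cl m B = cl n A" "\<And>i j. i < m \<Longrightarrow> j < m \<Longrightarrow> degree (B i j) \<le> 1"
    using linearize[OF A, of d] by blast
  then show ?thesis using degree_hm by (intro exI[of _ m] exI[of _ B]) simp
qed

text \<open>The leading coefficient of the inverse of a linear matrix \<open>S + tK\<close> is annihilated by \<open>K\<close>
  and is isotropic for \<open>S\<close>.\<close>

lemma isotropic_vector: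
  assumes A: "nonsing n A" and deg: "\<And>i j. i < n \<Longrightarrow> j < n \<Longrightarrow> degree (hm A i j) \<le> 1"
    and nonconst: "\<exists>i<n. \<exists>j<n. coeff (hm A i j) 1 \<noteq> 0"
  shows "\<exists>v c :: nat \<Rightarrow> int. (\<Sum>i<n. v i * c i) = 1 \<and> (\<forall>j<n. (\<Sum>i<n. v i * coeff (hm A i j) 1) = 0) \<and>
    (\<Sum>j<n. (\<Sum>i<n. v i * coeff (hm A i j) 0) * v j) = 0"
proof -
  define S where "S i j = coeff (hm A i j) 0" for i j
  define K where "K i j = coeff (hm A i j) 1" for i j
  have h: "hm A i j = [:S i j, K i j:]" if "i < n" "j < n" for i j
  proof (rule poly_eqI)
    fix l show "coeff (hm A i j) l = coeff [:S i j, K i j:] l"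
      using deg[OF that] by (auto simp: S_def K_def coeff_pCons coeff_eq_0 split: nat.split)
  qed
  \<comment> \<open>The sign in the symmetry of the coefficient matrix of t: the involution
    contributes e, the symmetry of \<lambda> contributes \<open>eps\<close>.\<close>
  define z where "z = (if even k then e else - e)"
  have Ksym: "K i j = z * K j i" for i j
    unfolding K_def by (subst hm_sym) (simp add: eps_def coeff_twist z_def)
  obtain g where gh: "\<And>i j. i < n \<Longrightarrow> j < n \<Longrightarrow> (\<Sum>k<n. g i k * hm A k j) = dl i j"
    and hg: "\<And>i j. i < n \<Longrightarrow> j < n \<Longrightarrow> (\<Sum>k<n. hm A i k * g k j) = dl i j"
    using A unfolding nonsing_def by blast
  define G where "G l i k = coeff (g i k) l" for l i k
  have cm: "coeff (p * [:a, b:]) (Suc l) = coeff p (Suc l) * a + coeff p l * b" for p :: "int poly" and a b l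
    by (simp add: mult.commute)
  have cS: "(\<Sum>k<n. G (Suc l) i k * S k j) + (\<Sum>k<n. G l i k * K k j) = 0" if "i < n" "j < n" for l i j
  proof -
    have "coeff (dl i j :: int poly) (Suc l) = (\<Sum>k<n. coeff (g i k * hm A k j) (Suc l))"
      using gh[OF that] by (simp add: coeff_sum[symmetric])
    also have "\<dots> = (\<Sum>k<n. G (Suc l) i k * S k j + G l i k * K k j)"
      using that by (intro sum.cong refl) (simp only: h cm G_def lessThan_iff)
    finally show ?thesis by (simp add: sum.distrib dl_def split: if_splits)
  qed
  have c0: "(\<Sum>k<n. S i k * G 0 k j) = dl i j" if "i < n" "j < n" for i j
  proof -
    have "coeff (dl i j :: int poly) 0 = (\<Sum>k<n. coeff (hm A i k * g k j) 0)"
      using hg[OF that] by (simp add: coeff_sum[symmetric])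
    then show ?thesis by (simp add: coeff_mult S_def G_def dl_def split: if_splits)
  qed
  define d where "d = Max (insert 0 ((\<lambda>(i, k). degree (g i k)) ` ({..<n} \<times> {..<n})))"
  have dmax: "degree (g i k) \<le> d" if "i < n" "k < n" for i k
    unfolding d_def by (rule Max_ge) (use that in auto)
  have top: "(\<Sum>k<n. G d i k * K k j) = 0" if "i < n" "j < n" for i j
  proof -
    have "G (Suc d) i k = 0" if "k < n" for k using dmax[OF \<open>i < n\<close> that] by (simp add: G_def coeff_eq_0)
    then have "(\<Sum>k<n. G (Suc d) i k * S k j) = 0" by (intro sum.neutral) simp
    then show ?thesis using cS[OF that, of d] by simp
  qed
  \<comment> \<open>A constant inverse would be annihilated by K; being also inverse to S at t = 0,
    it would force K = 0.\<close>
  have "d \<noteq> 0"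
  proof
    assume d: "d = 0"
    have "K i j = 0" if ij: "i < n" "j < n" for i j
    proof -
      have "K i j = (\<Sum>k<n. dl i k * K k j)" using ij by simp
      also have "\<dots> = (\<Sum>k<n. (\<Sum>l<n. S i l * G 0 l k) * K k j)" using ij by (intro sum.cong refl) (simp add: c0)
      also have "\<dots> = (\<Sum>l<n. S i l * (\<Sum>k<n. G 0 l k * K k j))" by (rule sum_mult_assoc)
      also have "\<dots> = 0" using top[unfolded d] ij by (intro sum.neutral) simp
      finally show ?thesis .
    qed
    then show False using nonconst unfolding K_def by blast
  qed
  then obtain d' where d': "d = Suc d'" using not0_implies_Suc by blast
  have "d \<in> insert 0 ((\<lambda>(i, k). degree (g i k)) ` ({..<n} \<times> {..<n}))" unfolding d_def by (rule Max_in) auto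
  then obtain i k where i: "i < n" and kk: "k < n" and dik: "degree (g i k) = d" using \<open>d \<noteq> 0\<close> by auto
  then have nz: "G d i k \<noteq> 0" using \<open>d \<noteq> 0\<close> leading_coeff_neq_0[of "g i k"] by (cases "g i k = 0") (auto simp: G_def)
  have n0: "n \<noteq> 0" using i by simp
  \<comment> \<open>A nonzero row of the leading coefficient is divided by its content, since only a
    unimodular vector can be split off.\<close>
  obtain a w c where w: "\<And>m. m < n \<Longrightarrow> G d i m = a * w m" and c: "(\<Sum>m<n. w m * c m) = (1::int)"
    using primitive_multiple[of n "G d i"] n0 by blast
  have a: "a \<noteq> 0" using nz w[OF kk] by auto
  have scale: "(\<Sum>m<n. G d i m * f m) = a * (\<Sum>m<n. w m * f m)" for f
    unfolding sum_distrib_left by (intro sum.cong refl) (simp add: w ac_simps)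
  have wK: "(\<Sum>m<n. w m * K m j) = 0" if "j < n" for j
    using top[OF i that] a unfolding scale by simp
  \<comment> \<open>By \<open>cS\<close> the row times S equals minus the row of the preceding
    coefficient times K. Pairing with w once more produces K w, which is zero because w K = 0 and K
    is symmetric up to the sign \<open>z\<close>.\<close>
  have "a * (\<Sum>j<n. (\<Sum>m<n. w m * S m j) * w j) = (\<Sum>j<n. (\<Sum>m<n. G d i m * S m j) * w j)"
    by (simp only: scale mult.assoc sum_distrib_left[symmetric])
  also have "\<dots> = (\<Sum>j<n. - (\<Sum>m<n. G d' i m * K m j) * w j)"
    using cS[OF i, of _ d'] unfolding d' by (intro sum.cong refl) (simp add: add_eq_0_iff2)
  also have "\<dots> = - (\<Sum>j<n. (\<Sum>m<n. G d' i m * K m j) * w j)" by (simp add: sum_negf)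
  also have "(\<Sum>j<n. (\<Sum>m<n. G d' i m * K m j) * w j) = (\<Sum>m<n. G d' i m * (\<Sum>j<n. K m j * w j))" by (rule sum_mult_assoc)
  also have "\<dots> = (\<Sum>m<n. G d' i m * (z * (\<Sum>j<n. w j * K j m)))"
    unfolding sum_distrib_left by (intro sum.cong refl) (subst Ksym, simp add: ac_simps)
  also have "\<dots> = 0" by (intro sum.neutral) (simp add: wK)
  finally have "(\<Sum>j<n. (\<Sum>m<n. w m * S m j) * w j) = 0" using a by simp
  then show ?thesis using c wK unfolding S_def K_def by blast
qed

text \<open>The isotropic vector is annihilated by the coefficient of t, so its pairings with the
  basis are constant and \<open>split_isotropic\<close> applies. Degree at most 1 is preserved and
  the rank drops by 2, until no entry depends on t.\<close>

lemma split_linear: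
  assumes "nonsing n A" "\<And>i j. i < n \<Longrightarrow> j < n \<Longrightarrow> degree (hm A i j) \<le> 1"
  shows "\<exists>x\<in>span. \<exists>m B. nonsing m B \<and> cl n A = x \<oplus>\<^bsub>LG\<^esub> cl m B \<and> (\<forall>i<m. \<forall>j<m. degree (hm B i j) = 0)"
  using assms
proof (induction n arbitrary: A rule: less_induct)
  case (less n)
  interpret G: abelian_group LG by (rule LG_group)
  show ?case
  proof (cases "\<exists>i<n. \<exists>j<n. coeff (hm A i j) 1 \<noteq> 0")
    case False
    have "degree (hm A i j) = 0" if "i < n" "j < n" for i j
      using less.prems(2)[OF that] False that by (metis One_nat_def leading_coeff_0_iff le_Suc_eq le_zero_eq degree_0)
    then show ?thesis using less.prems(1)
      by (intro bexI[OF _ span_zero] exI[of _ n] exI[of _ A]) (simp add: cl_car)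
  next
    case True
    obtain v c :: "nat \<Rightarrow> int" where v: "(\<Sum>i<n. v i * c i) = 1" "\<And>j. j < n \<Longrightarrow> (\<Sum>i<n. v i * coeff (hm A i j) 1) = 0"
      "(\<Sum>j<n. (\<Sum>i<n. v i * coeff (hm A i j) 0) * v j) = 0"
      using isotropic_vector[OF less.prems True] by blast
    define r where "r j = (\<Sum>i<n. v i * coeff (hm A i j) 0)" for j
    have const: "(\<Sum>i<n. [:v i:] * hm A i j) = [:r j:]" if j: "j < n" for j
    proof (rule poly_eqI)
      fix l
      have "coeff (\<Sum>i<n. [:v i:] * hm A i j) l = (\<Sum>i<n. v i * coeff (hm A i j) l)" by (simp add: coeff_sum)
      also have "\<dots> = coeff [:r j:] l"
      proof (cases l)
        case (Suc l')
        show ?thesis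
        proof (cases l')
          case 0
          then show ?thesis using Suc v(2)[OF j] by simp
        next
          case (Suc l'')
          then have "coeff (hm A i j) l = 0" if "i < n" for i using less.prems(2)[OF that j] \<open>l = Suc l'\<close> by (intro coeff_eq_0) simp
          then show ?thesis using \<open>l = Suc l'\<close> by simp
        qed
      qed (simp add: r_def)
      finally show "coeff (\<Sum>i<n. [:v i:] * hm A i j) l = coeff [:r j:] l" .
    qed
    have "bl n (hm A) (\<lambda>i. [:v i:]) (\<lambda>i. [:v i:]) = (\<Sum>j<n. (\<Sum>i<n. [:v i:] * hm A i j) * [:v j:])"
      unfolding bl_left s_k ..
    also have "\<dots> = (\<Sum>j<n. [:r j * v j:])" by (intro sum.cong refl) (simp add: const del: mult_pCons_left)
    also have "\<dots> = [:\<Sum>j<n. r j * v j:]" by (rule k_sum[symmetric])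
    finally have iso: "bl n (hm A) (\<lambda>i. [:v i:]) (\<lambda>i. [:v i:]) = 0" using v(3) by (simp add: r_def)
    obtain n' a b B where n: "n = 2 + n'" and ab: "a \<in> Hh" "b \<in> Hh" and B: "nonsing n' B"
      and eq: "cl n A = sy a b \<oplus>\<^bsub>LG\<^esub> cl n' B"
      and X: "\<And>X. kclosed X \<Longrightarrow> (\<forall>i<n. \<forall>j<n. hm A i j \<in> X) \<Longrightarrow> (\<forall>i<n'. \<forall>j<n'. hm B i j \<in> X)"
      using split_isotropic[OF less.prems(1) v(1) iso const] by meson
    have "kclosed {p. degree p \<le> 1}" unfolding kclosed_def
      by (auto intro: degree_add_le order.trans[OF degree_smult_le])
    then have "degree (hm B i j) \<le> 1" if "i < n'" "j < n'" for i j using X[of "{p. degree p \<le> 1}"] less.prems(2) that by blast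
    then obtain x m C where x: "x \<in> span" and C: "nonsing m C" and eq': "cl n' B = x \<oplus>\<^bsub>LG\<^esub> cl m C"
      and deg: "\<forall>i<m. \<forall>j<m. degree (hm C i j) = 0"
      using less.IH[of n' B] n B by auto
    have "cl n A = (sy a b \<oplus>\<^bsub>LG\<^esub> x) \<oplus>\<^bsub>LG\<^esub> cl m C" unfolding eq eq' by (rule span_shift[OF ab x cl_car[OF C]])
    then show ?thesis using span_add[OF ab x] C deg by blast
  qed
qed

text \<open>A constant diagonal entry a - s(a) has value a(0) - a(0) = 0 at t = 0. The constant
  remainder is therefore alternating and splits into planes as well.\<close>

lemma span_skew:
  assumes k: "odd k" and A: "nonsing n A"
  shows "cl n A \<in> span"
proof -
  obtain m B where B: "nonsing m B" "cl m B = cl n A" "\<forall>i<m. \<forall>j<m. degree (hm B i j) \<le> 1"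
    using linear_form[OF A] by blast
  obtain x m' C where x: "x \<in> span" and C: "nonsing m' C" and eq: "cl m B = x \<oplus>\<^bsub>LG\<^esub> cl m' C"
    and deg: "\<forall>i<m'. \<forall>j<m'. degree (hm C i j) = 0"
    using split_linear[OF B(1)] B(3) by blast
  have "cl m' C \<in> span"
  proof (rule span_alternating[OF _ C])
    fix a :: "int poly" assume "a + eps * twist e a \<in> range (\<lambda>c. [:c:])"
    then obtain c where c: "a + eps * twist e a = [:c:]" by blast
    have "coeff (a + eps * twist e a) 0 = 0" using k by (simp add: eps_def coeff_twist)
    then show "a + eps * twist e a = 0" by (simp add: c)
  next
    fix i j assume "i < m'" "j < m'"
    then show "hm C i j \<in> range (\<lambda>c. [:c:])" using deg degree_eq_zeroE by blast
  qed
  then show ?thesis using span_trans[OF x] eq B(2) by simp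
qed

end

section \<open>Coordinates on the kernel of the augmentation\<close>

text \<open>Presents \<open>NL\<close> as the polynomials c with c(0) = 0 modulo those of the form w
  + w^2, with V_j acting by substitution of t^j. The module structure is derived from this
  information alone.\<close>

locale witt_coords =
  fixes e k :: int and R :: "('a, 'x) ring_scheme" and E :: "bit poly \<Rightarrow> (nat \<Rightarrow> 'a, nat \<Rightarrow> nat \<Rightarrow> 'a) qform set"
  assumes L_group: "abelian_group (L_group k (UP R) (poly_inv e R id))"
    and E_carrier: "coeff c 0 = 0 \<Longrightarrow> E c \<in> carrier (NL e k R id)"
    and E_onto: "x \<in> carrier (NL e k R id) \<Longrightarrow> \<exists>c. coeff c 0 = 0 \<and> x = E c"
    and E_add: "coeff c 0 = 0 \<Longrightarrow> coeff d 0 = 0 \<Longrightarrow> E (c + d) = E c \<oplus>\<^bsub>L_group k (UP R) (poly_inv e R id)\<^esub> E d"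
    and E_zero_iff: "coeff c 0 = 0 \<Longrightarrow> E c = \<zero>\<^bsub>L_group k (UP R) (poly_inv e R id)\<^esub> \<longleftrightarrow> (\<exists>w. c = w + w * w)"
    and E_stretch: "coeff c 0 = 0 \<Longrightarrow> 0 < j \<Longrightarrow> e = 1 \<or> odd j \<Longrightarrow>
      L_map k (UP R) (UP R) (poly_inv e R id) (V_map R j) (E c) = E (stretch j c)"

lemma NL_carrier: "carrier (NL e k R \<sigma>) = {x \<in> carrier (L_group k (UP R) (poly_inv e R \<sigma>)).
    L_map k (UP R) R \<sigma> (eval_zero R) x = \<zero>\<^bsub>L_group k R \<sigma>\<^esub>}"
  by (simp add: NL_def Let_def a_kernel_def')

text \<open>Reduction modulo 2 with a set-theoretic section \<open>lift\<close>. The last two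
  assumptions say that reduction embeds \<open>Hh\<close> modulo \<open>Lam\<close> into F_2[t],
  with representatives given by \<open>lift\<close>.\<close>

locale mod2_lift = fmodel_hom R \<sigma> \<rho> s k S \<tau> \<rho>' id f red
  for R :: "('a, 'x) ring_scheme" and \<sigma> and \<rho> :: "'b::comm_ring_1 \<Rightarrow> 'a" and s k
    and S :: "('c, 'w) ring_scheme" and \<tau> and \<rho>' :: "bit poly \<Rightarrow> 'c" and f red +
  fixes lift :: "bit poly \<Rightarrow> 'b"
  assumes lift_0: "lift 0 = 0" and red_lift: "red (lift c) = c"
    and lift_Hh: "a \<in> A.Hh \<Longrightarrow> lift (red a) \<in> A.Hh" and red_ker: "a \<in> A.Hh \<Longrightarrow> red a = 0 \<Longrightarrow> a \<in> A.Lam"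
begin

lemma symbols_lift: "symbols R \<sigma> \<rho> s k lift (red ` A.Hh)"
proof unfold_locales
  have neg: "red (- a) = red a" for a by (simp add: g_neg bit_poly_neg)
  have eps: "red A.eps = 1" by (simp add: A.eps_def neg)
  have gs: "red (s a) = red a" for a using g_s[of a] by simp
  have diff: "red (a - b) = red a + red b" for a b using g_add[of a "- b"] by (simp add: neg)
  have L: "c \<in> red ` A.Hh \<Longrightarrow> lift c \<in> A.Hh" for c using lift_Hh by blast
  have minus: "a \<in> A.Hh \<Longrightarrow> b \<in> A.Hh \<Longrightarrow> a - b \<in> A.Hh" for a b using A.Hh_add[OF _ A.Hh_neg, of a b] by simp
  have K: "a \<in> A.Hh \<Longrightarrow> b \<in> A.Hh \<Longrightarrow> red a = red b \<Longrightarrow> a - b \<in> A.Lam" for a b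
    by (rule red_ker[OF minus]) (simp_all add: diff)
  show "lift 0 = 0" by (rule lift_0)
  fix c d r assume c: "c \<in> red ` A.Hh"
  show "lift c \<in> A.Hh" by (rule L[OF c])
  have rrc: "lift r * lift c * s (lift r) \<in> A.Hh" by (rule A.Hh_conj[OF L[OF c]])
  have red_rrc: "red (lift r * lift c * s (lift r)) = r * r * c" by (simp add: g_mult gs red_lift ac_simps)
  show rrc_H: "r * r * c \<in> red ` A.Hh" using imageI[OF rrc, of red] unfolding red_rrc .
  show "lift r * lift c * s (lift r) - lift (r * r * c) \<in> A.Lam"
    by (rule K[OF rrc L[OF rrc_H]]) (simp add: red_rrc red_lift)
  have "A.eps * lift c \<in> A.Hh" using L[OF c] A.Hh_neg by (simp add: A.eps_def)
  then show "A.eps * lift c - lift c \<in> A.Lam" by (rule K[OF _ L[OF c]]) (simp add: g_mult eps del: g_eps)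
  assume d: "d \<in> red ` A.Hh"
  have sum: "lift c + lift d \<in> A.Hh" by (rule A.Hh_add[OF L[OF c] L[OF d]])
  show cd: "c + d \<in> red ` A.Hh" using imageI[OF sum, of red] by (simp add: g_add red_lift)
  show "lift c + lift d - lift (c + d) \<in> A.Lam" by (rule K[OF sum L[OF cd]]) (simp add: g_add red_lift)
next
  fix a assume a: "a \<in> A.Hh"
  have "a - lift (red a) \<in> A.Hh" using A.Hh_add[OF a A.Hh_neg[OF lift_Hh[OF a]]] by simp
  moreover have "red (a - lift (red a)) = 0" by (simp add: g_diff red_lift)
  ultimately show "\<exists>c\<in>red ` A.Hh. a - lift c \<in> A.Lam" using red_ker a by blast
qed

text \<open>Reduction sends the symbol to a vanishing plane class over F_2[t] with values
  \<open>h\<close> and \<open>\<theta> c\<close>, where the Arf invariant is available.\<close>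

lemma E_detect:
  assumes "symbol_map R \<sigma> \<rho> s k lift (red ` A.Hh) h \<theta> C" and c: "c \<in> C"
    and zero: "A.sy (lift h) (lift (\<theta> c)) = \<zero>\<^bsub>A.LG\<^esub>"
  shows "\<exists>w. c = w + w * w"
proof -
  interpret M: symbol_map R \<sigma> \<rho> s k lift "red ` A.Hh" h \<theta> C by fact
  interpret F: fmodel_F2 S \<tau> \<rho>' k by unfold_locales
  have "B.sy (red (lift h)) (red (lift (\<theta> c))) = L_map k R S \<tau> f (A.sy (lift h) (lift (\<theta> c)))"
    by (rule L_map_sy[symmetric]) (simp_all add: M.lift_Hh M.h_H M.th_H c)
  then have "B.sy h (\<theta> c) = \<zero>\<^bsub>B.LG\<^esub>" by (simp add: zero L_map_zero red_lift)
  then show ?thesis using F.arf_zero M.th_detect[OF c] by blast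
qed

end

locale fmodel_poly = fmodel R id \<rho> id k
  for R :: "('a, 'x) ring_scheme" and \<rho> :: "'b::comm_ring_1 \<Rightarrow> 'a" and k +
  fixes e :: int
  assumes e: "e = 1 \<or> e = -1"
begin

sublocale P: fmodel "UP R" "poly_inv e R id" prho "twist e" k
  by (rule poly_model[OF refl e])

lemma augmentation: "fmodel_hom (UP R) (poly_inv e R id) prho (twist e) R id \<rho> id (eval_zero R) (\<lambda>p. coeff p 0)"
  by unfold_locales (simp_all add: eval_zero_prho coeff_mult coeff_twist)

lemma constants: "fmodel_hom R id \<rho> id (UP R) (poly_inv e R id) prho (twist e) (\<lambda>x. prho [:un x:]) (\<lambda>a. [:a:])"
  by unfold_locales (simp_all add: twist_def one_pCons)

lemma verschiebung: "e = 1 \<or> odd j \<Longrightarrow>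
  fmodel_hom (UP R) (poly_inv e R id) prho (twist e) (UP R) (poly_inv e R id) prho (twist e) (V_map R j) (stretch j)"
  by unfold_locales (simp_all add: V_map_prho pcompose_add pcompose_mult pcompose_1 stretch_twist[OF e])

sublocale aug: fmodel_hom "UP R" "poly_inv e R id" prho "twist e" k R id \<rho> id "eval_zero R" "\<lambda>p. coeff p 0"
  by (rule augmentation)

text \<open>Generation by planes comes from the assumption \<open>span\<close>, relations from
  \<open>S_frob\<close>, and their completeness from the Arf invariant. What remains is to restrict
  coordinates to polynomials without constant term, which calls for comparison with the ring of
  constants in both directions.\<close>

lemma coords:
  assumes lift: "mod2_lift (UP R) (poly_inv e R id) prho (twist e) k S \<tau> \<rho>' f red lift"
    and map: "symbol_map (UP R) (poly_inv e R id) prho (twist e) k lift (red ` P.Hh) h \<theta> C"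
    and stretch_S: "\<And>c j. coeff c 0 = 0 \<Longrightarrow> 0 < j \<Longrightarrow> e = 1 \<or> odd j \<Longrightarrow>
      P.sy (lift (stretch j h)) (lift (stretch j (\<theta> c))) = P.sy (lift h) (lift (\<theta> (stretch j c)))"
    and lift_stretch: "\<And>c j. 0 < j \<Longrightarrow> stretch j (lift c) = lift (stretch j c)"
    and lift_c0: "\<And>c. coeff c 0 = 0 \<Longrightarrow> coeff (lift c) 0 = 0" and lift_1: "lift 1 = 1"
    and span: "\<And>n A. P.nonsing n A \<Longrightarrow> L_map k (UP R) R id (eval_zero R) (P.cl n A) = \<zero>\<^bsub>LG\<^esub> \<Longrightarrow> P.cl n A \<in> P.span"
  shows "witt_coords e k R (\<lambda>c. P.sy (lift h) (lift (\<theta> c)))"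
proof -
  interpret mod2_lift "UP R" "poly_inv e R id" prho "twist e" k S \<tau> \<rho>' f red lift by (rule lift)
  interpret M: symbol_map "UP R" "poly_inv e R id" prho "twist e" k lift "red ` P.Hh" h \<theta> C by (rule map)
  interpret GP: abelian_group P.LG by (rule P.LG_group)
  interpret GR: abelian_group LG by (rule LG_group)
  have E: "P.sy (lift h) (lift (\<theta> c)) = M.E c" for c by (simp add: M.E_def M.S_def)
  have lh: "lift h \<in> P.Hh" and lth: "c \<in> C \<Longrightarrow> lift (\<theta> c) \<in> P.Hh" for c by (simp_all add: M.lift_Hh M.h_H M.th_H)
  have aug: "L_map k (UP R) R id (eval_zero R) (M.E c) = sy (coeff (lift h) 0) (coeff (lift (\<theta> c)) 0)" if "c \<in> C" for c
    unfolding E[symmetric] by (rule aug.L_map_sy[OF lh lth[OF that]])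
  have zero: "L_map k (UP R) R id (eval_zero R) (M.E c) = \<zero>\<^bsub>LG\<^esub>" if c: "coeff c 0 = 0" for c
  proof -
    note cC = M.C_0[OF c]
    have H: "coeff (lift h) 0 \<in> Hh" "coeff (lift (\<theta> c)) 0 \<in> Hh"
      using aug.g_Hh[OF lh] aug.g_Hh[OF lth[OF cC]] .
    have "coeff (lift h) 0 = 0 \<or> coeff (lift (\<theta> c)) 0 = 0" using M.C_h[OF cC c] lift_c0 by blast
    then show ?thesis unfolding aug[OF cC]
    proof
      assume "coeff (lift h) 0 = 0"
      then show "sy (coeff (lift h) 0) (coeff (lift (\<theta> c)) 0) = \<zero>\<^bsub>LG\<^esub>" using sy_zero[OF H(2)] by simp
    next
      assume "coeff (lift (\<theta> c)) 0 = 0"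
      then show "sy (coeff (lift h) 0) (coeff (lift (\<theta> c)) 0) = \<zero>\<^bsub>LG\<^esub>"
        using sy_zero[OF H(1)] sy_swap[OF Hh_zero H(1)] by simp
    qed
  qed
  show ?thesis
    unfolding E
  proof (rule witt_coords.intro)
    show "abelian_group P.LG" by (rule P.LG_group)
    fix c :: "bit poly" assume c: "coeff c 0 = 0"
    note cC = M.C_0[OF c]
    show "M.E c \<in> carrier (NL e k R id)" unfolding NL_carrier using M.E_car[OF cC] zero[OF c] by simp
    show "M.E (c + d) = M.E c \<oplus>\<^bsub>P.LG\<^esub> M.E d" if "coeff d 0 = 0" for d
      by (rule M.E_add[OF cC M.C_0[OF that]])
    show "M.E c = \<zero>\<^bsub>P.LG\<^esub> \<longleftrightarrow> (\<exists>w. c = w + w * w)"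
    proof
      assume "M.E c = \<zero>\<^bsub>P.LG\<^esub>"
      then show "\<exists>w. c = w + w * w" unfolding E[symmetric] by (rule E_detect[OF map cC])
    next
      assume "\<exists>w. c = w + w * w"
      then obtain w where w: "c = w + w * w" by blast
      show "M.E c = \<zero>\<^bsub>P.LG\<^esub>"
      proof (cases "coeff w 0 = 0")
        case True
        then show ?thesis unfolding w by (intro M.E_artin M.C_0)
      next
        case False
        \<comment> \<open>The elements w and w + 1 have the same value of w + w^2, and w + 1 has no
          constant term, so it lies in \<open>C\<close>.\<close>
        then have "coeff (w + 1) 0 = 0" by (cases "coeff w 0") simp_all
        moreover have "c = (w + 1) + (w + 1) * (w + 1)" unfolding w bit_poly_square_add by (simp add: add_ac)
        ultimately show ?thesis using M.E_artin[OF M.C_0] by simp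
      qed
    qed
    fix j :: nat assume j: "0 < j" "e = 1 \<or> odd j"
    interpret V: fmodel_hom "UP R" "poly_inv e R id" prho "twist e" k "UP R" "poly_inv e R id" prho "twist e" "V_map R j" "stretch j"
      by (rule verschiebung[OF j(2)])
    show "L_map k (UP R) (UP R) (poly_inv e R id) (V_map R j) (M.E c) = M.E (stretch j c)"
      unfolding E[symmetric] V.L_map_sy[OF lh lth[OF cC]] lift_stretch[OF j(1)] by (rule stretch_S[OF c j])
  next
    fix x assume x: "x \<in> carrier (NL e k R id)"
    then have "x \<in> P.span" using span unfolding NL_carrier P.LG_carrier by blast
    then obtain c where c: "c \<in> C" "x = M.E c" using M.span_E by blast
    show "\<exists>c. coeff c 0 = 0 \<and> x = M.E c"
    proof (cases "coeff c 0 = 0")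
      case False
      \<comment> \<open>A constant term contributes the summand \<open>E 1\<close>. At t = 0 only
        \<open>sy 1 1\<close> survives, so the vanishing augmentation of x makes it zero over
        \<open>R\<close>, and extension of constants gives E 1 = 0.\<close>
      interpret K: fmodel_hom R id \<rho> id k "UP R" "poly_inv e R id" prho "twist e" "\<lambda>x. prho [:un x:]" "\<lambda>a. [:a:]"
        by (rule constants)
      have 1: "1 \<in> C" "h = 1" "\<theta> 1 = 1" using M.C_1[OF c(1) False] by blast+
      have 0: "coeff (c + 1) 0 = 0" using False by (cases "coeff c 0") simp_all
      have H1: "1 \<in> Hh" using aug.g_Hh[OF lh] by (simp add: 1 lift_1)
      have "x = M.E ((c + 1) + 1)" by (simp add: c add.assoc del: one_add_one)
      also have "\<dots> = M.E (c + 1) \<oplus>\<^bsub>P.LG\<^esub> M.E 1" by (rule M.E_add[OF M.C_0[OF 0] 1(1)])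
      finally have x1: "x = M.E (c + 1) \<oplus>\<^bsub>P.LG\<^esub> M.E 1" .
      have "\<zero>\<^bsub>LG\<^esub> = L_map k (UP R) R id (eval_zero R) (M.E (c + 1)) \<oplus>\<^bsub>LG\<^esub> L_map k (UP R) R id (eval_zero R) (M.E 1)"
        using x aug.L_map_add[OF M.E_car[OF M.C_0[OF 0]] M.E_car[OF 1(1)]] unfolding NL_carrier x1 by simp
      also have "\<dots> = sy 1 1" using zero[OF 0] aug[OF 1(1)] sy_car[OF H1 H1] by (simp add: 1 lift_1)
      finally have "sy 1 1 = \<zero>\<^bsub>LG\<^esub>" by simp
      then have "P.sy [:1:] [:1:] = \<zero>\<^bsub>P.LG\<^esub>" using K.L_map_sy[OF H1 H1] K.L_map_zero by simp
      then have "M.E 1 = \<zero>\<^bsub>P.LG\<^esub>" unfolding one_pCons[symmetric] E[symmetric] by (simp only: 1 lift_1)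
      then show ?thesis using x1 M.E_car[OF M.C_0[OF 0]] 0 by (intro exI[of _ "c + 1"]) simp
    qed (use c in blast)
  qed
qed

end

text \<open>Frobenius: on F_2[t] the operator V_2 is squaring, so V_2 - 1 sends d to d +
  d^2.\<close>

lemma bit_poly_square: "d * d = stretch 2 (d :: bit poly)"
proof (induction d)
  case (pCons a d)
  have aa: "a * a = a" by (cases a) simp_all
  have "pCons a d = [:a:] + TT * d" by simp
  then have "pCons a d * pCons a d = [:a:] * [:a:] + (TT * d) * (TT * d)" by (simp only: bit_poly_square_add)
  also have "\<dots> = [:a:] + (TT * TT) * (d * d)" by (simp add: aa ac_simps)
  also have "TT * TT = (Polynomial.monom 1 2 :: bit poly)" by (simp add: numeral_2_eq_2 monom_Suc)
  finally show ?case by (simp add: pCons pcompose_pCons)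
qed simp

lemma bit_poly_squares: "(\<forall>i. odd i \<longrightarrow> coeff c i = 0) \<longleftrightarrow> (\<exists>d. c = d * (d :: bit poly))"
proof
  assume *: "\<forall>i. odd i \<longrightarrow> coeff c i = 0"
  obtain p q where c: "c = p * p + TT * (q * q)" using bit_poly_sqrt[of c] by blast
  have "coeff q i = 0" for i
    using *[rule_format, of "Suc (2 * i)"] by (simp add: c bit_poly_square coeff_stretch)
  then have "q = 0" by (simp add: poly_eq_iff)
  then show "\<exists>d. c = d * d" using c by auto
qed (auto simp: bit_poly_square coeff_stretch)

lemma bit_poly_odd: "(\<forall>i. even i \<longrightarrow> coeff c i = 0) \<longleftrightarrow> (\<exists>d. c = TT * (d * (d :: bit poly)))"
proof
  assume *: "\<forall>i. even i \<longrightarrow> coeff c i = 0"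
  obtain p q where c: "c = p * p + TT * (q * q)" using bit_poly_sqrt[of c] by blast
  have "coeff p i = 0" for i
  proof -
    have "coeff (TT * (q * q)) (2 * i) = 0" by (cases i) (simp_all add: bit_poly_square coeff_stretch)
    then show ?thesis using *[rule_format, of "2 * i"] by (simp add: c bit_poly_square[of p] coeff_stretch)
  qed
  then have "p = 0" by (simp add: poly_eq_iff)
  then show "\<exists>d. c = TT * (d * d)" using c by auto
qed (auto simp: bit_poly_square coeff_stretch coeff_pCons split: nat.splits)

section \<open>The four coordinate systems\<close>

text \<open>Here the involution on F_2[t] is trivial and a + a = 0, so every hermitian matrix that
  arises is alternating. As F_2[t] is Euclidean, it can serve as its own ring of constants, and
  every class is a sum of planes for both parities of k.\<close>

lemma bit_coords: "\<exists>E. witt_coords 1 k (residue_ring 2) E"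
proof -
  interpret fmodel_poly "residue_ring 2" bit_int k 1
    by (intro fmodel_poly.intro bit_model fmodel_poly_axioms.intro) simp
  interpret F: fmodel_F2 "UP (residue_ring 2)" "poly_inv 1 (residue_ring 2) id" prho k
    using P.fmodel_axioms unfolding twist_1 by (rule fmodel_F2.intro)
  have Hh: "P.Hh = UNIV" unfolding twist_1 using F.Hh_UNIV by blast
  have L: "mod2_lift (UP (residue_ring 2)) (poly_inv 1 (residue_ring 2) id) prho (twist 1) k
      (UP (residue_ring 2)) (poly_inv 1 (residue_ring 2) id) prho id id id"
    unfolding twist_1 by unfold_locales (simp_all add: F.Lam_0 F.Hh_UNIV)
  have H: "id ` P.Hh = UNIV" by (simp add: Hh)
  interpret M: symbol_map "UP (residue_ring 2)" "poly_inv 1 (residue_ring 2) id" prho "twist 1" k id "id ` P.Hh" 1 "\<lambda>c. c" UNIV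
    by (rule symbols.symbol_map_all[OF mod2_lift.symbols_lift[OF L] H])
  interpret K: fmodel_const "UP (residue_ring 2)" "poly_inv 1 (residue_ring 2) id" prho "twist 1" k id id
    by unfold_locales (simp_all add: twist_1)
  have "witt_coords 1 k (residue_ring 2) (\<lambda>c. P.sy (id 1) (id c))"
  proof (rule coords[OF L M.symbol_map_axioms])
    fix n A assume A: "P.nonsing n A"
    show "P.cl n A \<in> P.span"
    proof (rule K.span_alternating[OF _ A])
      show "a + P.eps * twist 1 a = 0" for a by (simp add: P.eps_def twist_1 bit_poly_neg)
    qed simp
  qed (simp_all add: pcompose_1)
  then show ?thesis by blast
qed

section \<open>Reduction of integral polynomials modulo 2\<close>

definition red_poly :: "int poly \<Rightarrow> bit poly" where "red_poly = map_poly of_int"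
definition lift_poly :: "bit poly \<Rightarrow> int poly" where "lift_poly = map_poly bit_int"

lemma coeff_red [simp]: "coeff (red_poly p) i = of_int (coeff p i)"
  by (simp add: red_poly_def coeff_map_poly)

lemma coeff_lift [simp]: "coeff (lift_poly p) i = bit_int (coeff p i)"
  by (simp add: lift_poly_def coeff_map_poly bit_int_def)

lemma red_lift_poly: "red_poly (lift_poly c) = c"
  by (rule poly_eqI) (simp add: bit_int_of_int)

lemma of_int_bit_zero: "(of_int z :: bit) = 0 \<Longrightarrow> even z"
proof (rule ccontr)
  assume z: "(of_int z :: bit) = 0" "odd z"
  obtain q where q: "z = q + q + 1" using z(2) by (metis oddE mult_2)
  have "b + b = 0" for b :: bit by (cases b) simp_all
  then have "(of_int z :: bit) = 1" unfolding q by (simp only: of_int_add of_int_1 add_0_left)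
  then show False using z(1) by simp
qed

lemma red_poly_zero_iff: "red_poly a = 0 \<Longrightarrow> \<exists>b. a = b + b"
proof -
  assume "red_poly a = 0"
  have "2 dvd coeff a i" for i
  proof -
    have "(of_int (coeff a i) :: bit) = 0" using arg_cong[OF \<open>red_poly a = 0\<close>, of "\<lambda>p. coeff p i"] by simp
    then show ?thesis by (rule of_int_bit_zero)
  qed
  then have "a = map_poly (\<lambda>c. c div 2) a + map_poly (\<lambda>c. c div 2) a"
    by (intro poly_eqI, subst coeff_add) (simp add: coeff_map_poly)
  then show ?thesis by blast
qed

lemma red_poly_ring: "red_poly (a + b) = red_poly a + red_poly b" "red_poly (a * b) = red_poly a * red_poly b" "red_poly 1 = 1"
  by (rule poly_eqI, simp add: coeff_mult)+

context fmodel_Zt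
begin

definition sgn_k :: int where "sgn_k = (if even k then 1 else - 1)"

text \<open>The operator a + eps s(a) multiplies the coefficient of t^i by an integer which is 0 or
  2. Which powers survive depends on the parities of k and i and on e.\<close>

lemma Hh_iff: "a \<in> Hh \<longleftrightarrow> (\<forall>i. 1 + sgn_k * e ^ i = 0 \<or> coeff a i = 0)"
proof -
  have "coeff (a + eps * twist e a) i = (1 + sgn_k * e ^ i) * coeff a i" for i
    by (simp add: eps_def coeff_twist sgn_k_def algebra_simps)
  then have "a \<in> Hh \<longleftrightarrow> (\<forall>i. (1 + sgn_k * e ^ i) * coeff a i = 0)"
    unfolding Hh_def poly_eq_iff by simp
  then show ?thesis by simp
qed

lemma lift_red_Hh: "a \<in> Hh \<Longrightarrow> lift_poly (red_poly a) \<in> Hh"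
  unfolding Hh_iff by (auto simp: bit_int_def)

lemma red_Hh: "red_poly ` Hh = {c. \<forall>i. 1 + sgn_k * e ^ i = 0 \<or> coeff c i = 0}"
proof (intro equalityI subsetI)
  fix c :: "bit poly" assume "c \<in> {c. \<forall>i. 1 + sgn_k * e ^ i = 0 \<or> coeff c i = 0}"
  then have "lift_poly c \<in> Hh" unfolding Hh_iff by (auto simp: bit_int_def)
  then show "c \<in> red_poly ` Hh" using red_lift_poly[of c] image_eqI[of c red_poly "lift_poly c" Hh] by simp
next
  fix c assume "c \<in> red_poly ` Hh"
  then obtain a where a: "a \<in> Hh" "c = red_poly a" by blast
  have "1 + sgn_k * e ^ i = 0 \<or> coeff c i = 0" for i
    using a(1)[unfolded Hh_iff, rule_format, of i] a(2) by auto
  then show "c \<in> {c. \<forall>i. 1 + sgn_k * e ^ i = 0 \<or> coeff c i = 0}" by blast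
qed

text \<open>An element of \<open>Hh\<close> divisible by 2 is 2b with b again in \<open>Hh\<close>,
  and then it equals b - eps s(b).\<close>

lemma red_Hh_zero: "a \<in> Hh \<Longrightarrow> red_poly a = 0 \<Longrightarrow> a \<in> Lam"
proof -
  assume a: "a \<in> Hh" "red_poly a = 0"
  obtain b where b: "a = b + b" using red_poly_zero_iff[OF a(2)] by blast
  have "1 + sgn_k * e ^ i = 0 \<or> coeff b i = 0" for i
    using a(1)[unfolded Hh_iff b coeff_add, rule_format, of i] by auto
  then have "b \<in> Hh" unfolding Hh_iff by blast
  then have "eps * twist e b = - b" by (simp add: Hh_def add_eq_0_iff)
  then have "a = b - eps * twist e b" by (simp add: b)
  then show ?thesis unfolding Lam_def by blast
qed

end

lemma stretch_lift: "0 < j \<Longrightarrow> stretch j (lift_poly c) = lift_poly (stretch j c)"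
  by (rule poly_eqI) (simp add: coeff_stretch bit_int_def)

context
  fixes k e :: int
  assumes e: "e = 1 \<or> e = -1"
begin

interpretation fmodel_poly \<Z> id k e
  by (intro fmodel_poly.intro int_model fmodel_poly_axioms.intro e)

interpretation Z: fmodel_Zt "UP \<Z>" "poly_inv e \<Z> id" prho e k
  by (intro fmodel_Zt.intro P.fmodel_axioms fmodel_Zt_axioms.intro e)

text \<open>For odd k every class is a sum of planes. For even k a constant remainder
  \<open>C\<close> is left, which could represent a class of L_0(Z). Values in \<open>Hh\<close>
  have no constant term then, so planes vanish at t = 0, and the vanishing augmentation passes to
  \<open>C\<close>.\<close>

lemma NL_span:
  assumes A: "P.nonsing n A" and zero: "L_map k (UP \<Z>) \<Z> id (eval_zero \<Z>) (P.cl n A) = \<zero>\<^bsub>LG\<^esub>"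
  shows "P.cl n A \<in> P.span"
proof (cases "even k")
  case False
  then show ?thesis by (rule Z.span_skew[OF _ A])
next
  case True
  interpret G: abelian_group LG by (rule LG_group)
  interpret K: fmodel_hom \<Z> id id id k "UP \<Z>" "poly_inv e \<Z> id" prho "twist e" "\<lambda>x. prho [:un x:]" "\<lambda>a. [:a:]"
    by (rule constants)
  have Hh0: "coeff a 0 = 0" if "a \<in> P.Hh" for a
    using that[unfolded Z.Hh_iff, rule_format, of 0] True by (simp add: Z.sgn_k_def)
  have span0: "L_map k (UP \<Z>) \<Z> id (eval_zero \<Z>) x = \<zero>\<^bsub>LG\<^esub>" if "x \<in> P.span" for x
    using that
  proof (induction rule: P.span.induct)
    case (span_add a b x)
    have "sy (coeff a 0) (coeff b 0) = \<zero>\<^bsub>LG\<^esub>" using Hh0[OF span_add(1)] Hh0[OF span_add(2)] sy_zero[OF Hh_zero] by simp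
    then show ?case
      unfolding aug.L_map_add[OF P.sy_car[OF span_add(1,2)] P.span_car[OF span_add(3)]] aug.L_map_sy[OF span_add(1,2)] span_add(4)
      using G.l_zero[OF G.zero_closed] by argo
  qed (rule aug.L_map_zero)
  obtain m B where B: "P.nonsing m B" "P.cl m B = P.cl n A" "\<forall>i<m. \<forall>j<m. degree (P.hm B i j) \<le> 1"
    using Z.linear_form[OF A] by blast
  obtain x m' C where x: "x \<in> P.span" and C: "P.nonsing m' C" and eq: "P.cl m B = x \<oplus>\<^bsub>P.LG\<^esub> P.cl m' C"
    and deg: "\<forall>i<m'. \<forall>j<m'. degree (P.hm C i j) = 0"
    using Z.split_linear[OF B(1)] B(3) by blast
  have "L_map k (UP \<Z>) \<Z> id (eval_zero \<Z>) (P.cl m B) =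
      L_map k (UP \<Z>) \<Z> id (eval_zero \<Z>) x \<oplus>\<^bsub>LG\<^esub> L_map k (UP \<Z>) \<Z> id (eval_zero \<Z>) (P.cl m' C)"
    unfolding eq by (rule aug.L_map_add[OF P.span_car[OF x] P.cl_car[OF C]])
  also have "\<dots> = L_map k (UP \<Z>) \<Z> id (eval_zero \<Z>) (P.cl m' C)"
    unfolding span0[OF x] by (rule G.l_zero[OF aug.L_map_car[OF P.cl_car[OF C]]])
  also have "\<dots> = cl m' (aug.gm C)" by (rule aug.L_map_cl[OF C])
  finally have z: "cl m' (aug.gm C) = \<zero>\<^bsub>LG\<^esub>" unfolding B(2) zero by (rule sym)
  \<comment> \<open>The constant terms of \<open>C\<close>, regarded as a form over Z[t], have class
    zero. As \<open>hm C\<close> is constant, this form has the same \<lambda> as \<open>C\<close>,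
    while \<mu> may differ; \<open>span_same_hermitian\<close> bridges the difference.\<close>
  have cz: "P.cl m' (K.gm (aug.gm C)) = \<zero>\<^bsub>P.LG\<^esub>"
    using K.L_map_cl[OF aug.nonsing_gm[OF C]] unfolding z K.L_map_zero by (rule sym)
  have hmC: "P.hm (K.gm (aug.gm C)) i j = P.hm C i j" if "i < m'" "j < m'" for i j
  proof -
    have "degree (P.hm C i j) = 0" using deg that by blast
    then obtain c where c: "P.hm C i j = [:c:]" by (rule degree_eq_zeroE)
    have "P.hm (K.gm (aug.gm C)) i j = [:coeff (P.hm C i j) 0:]"
      unfolding K.hm_gm aug.hm_gm by (simp only: K.gm_def aug.gm_def)
    then show ?thesis unfolding c by (simp only: coeff_pCons_0)
  qed
  have "P.cl m' C \<in> P.span"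
    by (rule P.span_same_hermitian[OF C K.nonsing_gm[OF aug.nonsing_gm[OF C]] hmC cz])
  then show ?thesis unfolding B(2)[symmetric] eq by (rule P.span_trans[OF x])
qed

text \<open>For even k and e = 1 every coefficient is multiplied by 2 in a + eps s(a), so
  \<open>Hh\<close> is zero and all planes are hyperbolic.\<close>

lemma NL_trivial:
  assumes "even k" "e = 1"
  shows "carrier (NL e k \<Z> id) = {\<zero>\<^bsub>NL e k \<Z> id\<^esub>}"
proof -
  interpret G: abelian_group P.LG by (rule P.LG_group)
  have Hh: "a = 0" if "a \<in> P.Hh" for a
  proof (rule poly_eqI)
    fix i show "coeff a i = coeff 0 i"
      using that[unfolded Z.Hh_iff, rule_format, of i] assms by (simp add: Z.sgn_k_def)
  qed
  have sy0: "P.sy a b = \<zero>\<^bsub>P.LG\<^esub>" if "a \<in> P.Hh" "b \<in> P.Hh" for a b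
    unfolding Hh[OF that(1)] by (rule P.sy_zero[OF that(2)])
  have span0: "x = \<zero>\<^bsub>P.LG\<^esub>" if "x \<in> P.span" for x
    using that by (induction rule: P.span.induct) (simp_all only: sy0 G.l_zero[OF G.zero_closed])
  have 1: "x = \<zero>\<^bsub>P.LG\<^esub>" if x: "x \<in> carrier (NL e k \<Z> id)" for x
  proof -
    obtain n A where A: "P.nonsing n A" and xA: "x = P.cl n A" using x unfolding NL_carrier P.LG_carrier by blast
    have "L_map k (UP \<Z>) \<Z> id (eval_zero \<Z>) (P.cl n A) = \<zero>\<^bsub>LG\<^esub>" using x unfolding NL_carrier xA by blast
    then show ?thesis unfolding xA by (intro span0 NL_span[OF A])
  qed
  have 2: "\<zero>\<^bsub>P.LG\<^esub> \<in> carrier (NL e k \<Z> id)" using aug.L_map_zero G.zero_closed unfolding NL_carrier by blast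
  have 3: "\<zero>\<^bsub>NL e k \<Z> id\<^esub> = \<zero>\<^bsub>P.LG\<^esub>" by (simp add: NL_def Let_def)
  show ?thesis unfolding 3 using 1 2 by blast
qed

text \<open>The three cases correspond to admissible values with all, only even, or only odd powers
  of t; over F_2 these are all polynomials, the squares, and t times the squares.\<close>

lemma int_coords:
  assumes ke: "odd k \<or> e = -1"
  shows "\<exists>E. witt_coords e k \<Z> E"
proof -
  interpret B0: fmodel "residue_ring 2" id bit_int id k by (rule bit_model)
  interpret B: fmodel "UP (residue_ring 2)" "poly_inv 1 (residue_ring 2) id" B0.prho id k
    by (rule B0.poly_model[OF refl disjI1[OF refl], unfolded twist_1])
  have e2: "(of_int e :: bit) = 1" using e by auto
  have L: "mod2_lift (UP \<Z>) (poly_inv e \<Z> id) prho (twist e) k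
      (UP (residue_ring 2)) (poly_inv 1 (residue_ring 2) id) B0.prho (\<lambda>x. B0.prho (red_poly (P.un x))) red_poly lift_poly"
  proof unfold_locales
    show "red_poly (twist e a) = id (red_poly a)" for a by (rule poly_eqI) (simp add: coeff_twist e2)
    show "lift_poly 0 = 0" by (simp add: lift_poly_def)
    show "B0.prho (red_poly (P.un (prho a))) = B0.prho (red_poly a)" for a by (simp only: P.un_rho)
    show "red_poly (lift_poly c) = c" for c by (rule red_lift_poly)
    show "lift_poly (red_poly a) \<in> P.Hh" if "a \<in> P.Hh" for a by (rule Z.lift_red_Hh[OF that])
    show "a \<in> P.Lam" if "a \<in> P.Hh" "red_poly a = 0" for a by (rule Z.red_Hh_zero[OF that])
  qed (rule red_poly_ring)+
  note sy = mod2_lift.symbols_lift[OF L]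
  interpret S: symbols "UP \<Z>" "poly_inv e \<Z> id" prho "twist e" k lift_poly "red_poly ` P.Hh" by (rule sy)
  have l1: "lift_poly 1 = 1" by (rule poly_eqI) (simp add: bit_int_def)
  have c0: "coeff c 0 = 0 \<Longrightarrow> coeff (lift_poly c) 0 = 0" for c by (simp add: bit_int_def)
  consider "odd k" "e = 1" | "odd k" "e = -1" | "even k" "e = -1" using ke e by blast
  then show ?thesis
  proof cases
    case 1
    have H: "red_poly ` P.Hh = UNIV" unfolding Z.red_Hh Z.sgn_k_def using 1 by simp
    have "witt_coords e k \<Z> (\<lambda>c. P.sy (lift_poly 1) (lift_poly c))"
      by (rule coords[OF L S.symbol_map_all[OF H]]) (simp only: pcompose_1 | erule stretch_lift c0 | rule l1 | erule (1) NL_span)+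
    then show ?thesis by blast
  next
    case 2
    have H: "red_poly ` P.Hh = {c. \<exists>d. c = d * d}"
    proof -
      have "(1 + (if even k then 1 else - 1) * e ^ i = 0) = even i" for i using 2 by (cases "even i") simp_all
      then show ?thesis unfolding Z.red_Hh Z.sgn_k_def bit_poly_squares[symmetric] by blast
    qed
    have "witt_coords e k \<Z> (\<lambda>c. P.sy (lift_poly 1) (lift_poly (c * c)))"
      by (rule coords[OF L S.symbol_map_squares[OF H]]) (simp only: pcompose_1 pcompose_mult | erule stretch_lift c0 | rule l1 | erule (1) NL_span)+
    then show ?thesis by blast
  next
    case 3
    have H: "red_poly ` P.Hh = {c. \<exists>d. c = TT * (d * d)}"
    proof -
      have "(1 + (if even k then 1 else - 1) * e ^ i = 0) = odd i" for i using 3 by (cases "even i") simp_all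
      then show ?thesis unfolding Z.red_Hh Z.sgn_k_def bit_poly_odd[symmetric] by blast
    qed
    have "witt_coords e k \<Z> (\<lambda>c. P.sy (lift_poly TT) (lift_poly (TT * ((c div TT) * (c div TT)))))"
    proof (rule coords[OF L S.symbol_map_odd[OF H]])
      fix c :: "bit poly" and j :: nat assume "coeff c 0 = 0" "0 < j" "e = 1 \<or> odd j"
      then show "P.sy (lift_poly (stretch j TT)) (lift_poly (stretch j (TT * (c div TT * (c div TT))))) =
          P.sy (lift_poly TT) (lift_poly (TT * (stretch j c div TT * (stretch j c div TT))))"
        using S.stretch_odd[OF H, of j c] 3 unfolding S.S_def by simp
    qed (erule stretch_lift c0 | rule l1 | erule (1) NL_span)+
    then show ?thesis by blast
  qed
qed

end

section \<open>The Verschiebung algebra\<close>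

text \<open>The case of a single monomial is restricted to monomials of \<open>P\<close>, so that
  membership of \<open>P\<close> in a ring \<open>V_ring I\<close> can be exploited there.\<close>

lemma poly_mapping_sum_induct [case_names single add zero]:
  fixes P :: "'m \<Rightarrow>\<^sub>0 int"
  assumes single: "\<And>m z. m \<in> Poly_Mapping.keys P \<Longrightarrow> Q (Poly_Mapping.single m z)"
    and add: "\<And>f g. Q f \<Longrightarrow> Q g \<Longrightarrow> Q (f + g)" and zero: "Q 0"
  shows "Q P"
proof -
  have "Q (\<Sum>m\<in>A. Poly_Mapping.single m (Poly_Mapping.lookup P m))" if "A \<subseteq> Poly_Mapping.keys P" for A
    using finite_subset[OF that finite_keys] that by (induction A rule: finite_induct) (auto intro: single add zero)
  moreover have "P = (\<Sum>m\<in>Poly_Mapping.keys P. Poly_Mapping.single m (Poly_Mapping.lookup P m))"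
    by (rule poly_mapping_eqI) (simp add: lookup_sum lookup_single when_def in_keys_iff)
  ultimately show ?thesis by (metis order_refl)
qed

lemma V_ring_simps [simp]: "a \<oplus>\<^bsub>V_ring I\<^esub> b = a + b" "a \<otimes>\<^bsub>V_ring I\<^esub> b = a * b" "\<zero>\<^bsub>V_ring I\<^esub> = 0" "\<one>\<^bsub>V_ring I\<^esub> = 1"
  by (simp_all add: V_ring_def)

lemma V_carrier: "P \<in> carrier (V_ring I) \<longleftrightarrow> (\<forall>m\<in>Poly_Mapping.keys P. set_mset m \<subseteq> I)"
  by (simp add: V_ring_def)

lemma V_closed:
  assumes "a \<in> carrier (V_ring I)" "b \<in> carrier (V_ring I)"
  shows "a + b \<in> carrier (V_ring I)" "a * b \<in> carrier (V_ring I)"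
proof -
  show "a + b \<in> carrier (V_ring I)" using assms keys_add[of a b] unfolding V_carrier by blast
  show "a * b \<in> carrier (V_ring I)" unfolding V_carrier
  proof
    fix m assume "m \<in> Poly_Mapping.keys (a * b)"
    then obtain u v where "m = u + v" "u \<in> Poly_Mapping.keys a" "v \<in> Poly_Mapping.keys b" using keys_mult[of a b] by blast
    then show "set_mset m \<subseteq> I" using assms unfolding V_carrier by simp
  qed
qed

lemma V_uminus: "a \<in> carrier (V_ring I) \<Longrightarrow> - a \<in> carrier (V_ring I)"
  unfolding V_carrier by (simp add: in_keys_iff)

lemma V_single: "set_mset m \<subseteq> I \<Longrightarrow> Poly_Mapping.single m z \<in> carrier (V_ring I)"
  by (simp add: V_carrier)

lemma V_zero_one: "0 \<in> carrier (V_ring I)" "1 \<in> carrier (V_ring I)"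
  using V_single[of 0 I 1] by (simp_all add: V_carrier single_one)

lemma V_ring_ring: "ring (V_ring I)"
proof (rule ringI)
  show "abelian_group (V_ring I)"
  proof (rule abelian_groupI)
    fix x assume "x \<in> carrier (V_ring I)"
    then show "\<exists>y\<in>carrier (V_ring I). y \<oplus>\<^bsub>V_ring I\<^esub> x = \<zero>\<^bsub>V_ring I\<^esub>" by (intro bexI[of _ "- x"]) (simp_all add: V_uminus)
  qed (simp_all add: V_closed V_zero_one add_ac)
  show "Group.monoid (V_ring I)" by (rule monoidI) (simp_all add: V_closed V_zero_one mult_ac)
qed (simp_all add: algebra_simps)

text \<open>The action on F_2[t] for which the monomial \<open>m\<close> substitutes the power of t
  given by the product of \<open>m\<close>. It models the scalar multiplication of \<open>NL\<close>
  in coordinates.\<close>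

definition vact :: "(nat multiset \<Rightarrow>\<^sub>0 int) \<Rightarrow> bit poly \<Rightarrow> bit poly" where
  "vact P c = (\<Sum>m\<in>Poly_Mapping.keys P. Polynomial.smult (of_int (Poly_Mapping.lookup P m)) (stretch (\<Prod>\<^sub># m) c))"

lemma vact_superset:
  "finite A \<Longrightarrow> Poly_Mapping.keys P \<subseteq> A \<Longrightarrow> vact P c = (\<Sum>m\<in>A. Polynomial.smult (of_int (Poly_Mapping.lookup P m)) (stretch (\<Prod>\<^sub># m) c))"
  unfolding vact_def by (rule sum.mono_neutral_left) (auto simp: in_keys_iff)

lemma vact_add_left: "vact (P + Q) c = vact P c + vact Q c"
proof -
  let ?A = "Poly_Mapping.keys P \<union> Poly_Mapping.keys Q"
  have *: "vact X c = (\<Sum>m\<in>?A. Polynomial.smult (of_int (Poly_Mapping.lookup X m)) (stretch (\<Prod>\<^sub># m) c))"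
    if "Poly_Mapping.keys X \<subseteq> ?A" for X
    by (rule vact_superset[OF _ that]) simp
  show ?thesis unfolding *[OF keys_add] *[OF Un_upper1] *[OF Un_upper2]
    by (simp only: lookup_add of_int_add smult_add_left sum.distrib)
qed

lemma vact_add_right: "vact P (c + d) = vact P c + vact P d"
  by (simp add: vact_def pcompose_add smult_add_right sum.distrib)

lemma vact_single: "vact (Poly_Mapping.single m z) c = Polynomial.smult (of_int z) (stretch (\<Prod>\<^sub># m) c)"
  by (simp add: vact_def)

lemma vact_zero: "vact 0 c = 0" "vact P 0 = 0"
  by (simp_all add: vact_def)

lemma stretch_1: "stretch 1 c = (c :: 'r::comm_ring_1 poly)"
proof -
  have "Polynomial.monom (1::'r) 1 = TT" by (simp add: monom_Suc)
  then show ?thesis by simp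
qed

lemma vact_one: "vact 1 c = c"
  unfolding single_one[symmetric] vact_single using stretch_1[of c] by simp

lemma stretch_stretch: "stretch i (stretch j c) = stretch (i * j) (c :: 'r::comm_ring_1 poly)"
proof -
  have "pcompose (Polynomial.monom 1 j) (Polynomial.monom 1 i) = (Polynomial.monom 1 (i * j) :: 'r poly)"
    by (simp add: monom_altdef[of 1 j] stretch_power pcompose_pCons monom_power)
  then show ?thesis by (simp add: pcompose_assoc[symmetric])
qed

lemma vact_mult: "vact (P * Q) c = vact P (vact Q c)"
proof (induction P rule: poly_mapping_sum_induct)
  case (single m z)
  show ?case
  proof (induction Q rule: poly_mapping_sum_induct)
    case (single m' z')
    then show ?case by (simp add: mult_single vact_single pcompose_smult stretch_stretch)
  qed (simp_all add: distrib_left vact_add_left vact_add_right vact_zero)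
qed (simp_all add: distrib_right vact_add_left vact_zero)

text \<open>Treats both algebras at once: \<open>I\<close> lies between the odd primes and all
  primes. V_2 is allowed only when it respects the involution, that is for e = 1.\<close>

locale witt_coords_primes = witt_coords e k R E
  for e k and R :: "('a, 'x) ring_scheme" and E +
  fixes I :: "nat set"
  assumes odd_primes: "{p. prime p \<and> odd p} \<subseteq> I" and primes: "I \<subseteq> {p. prime p}"
    and sign: "e = 1 \<or> 2 \<notin> I"
begin

definition L where "L = L_group k (UP R) (poly_inv e R id)"
definition N where "N = NL e k R id"
definition V_op where "V_op j = L_map k (UP R) (UP R) (poly_inv e R id) (V_map R j)"

sublocale G: abelian_group L
  unfolding L_def by (rule L_group)

lemmas EL_add = E_add[folded L_def] and EL_zero_iff = E_zero_iff[folded L_def]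
  and EN_carrier = E_carrier[folded N_def] and EN_onto = E_onto[folded N_def]
  and EV_stretch = E_stretch[folded V_op_def]

lemma N_simps: "add N = add L" "\<zero>\<^bsub>N\<^esub> = \<zero>\<^bsub>L\<^esub>"
  "P \<odot>\<^bsub>N\<^esub> U = (\<Oplus>\<^bsub>L\<^esub>m\<in>Poly_Mapping.keys P. add_pow L (Poly_Mapping.lookup P m) (V_op (\<Prod>\<^sub># m) U))"
  by (simp_all add: NL_def Let_def N_def L_def V_op_def)

lemma E_car: "coeff c 0 = 0 \<Longrightarrow> E c \<in> carrier L"
  using EN_carrier unfolding N_def L_def NL_carrier by blast

lemma E_0: "E 0 = \<zero>\<^bsub>L\<^esub>"
  using EL_zero_iff[of 0] by (metis coeff_0 add_0 mult_zero_left)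

lemma E_double: "coeff c 0 = 0 \<Longrightarrow> E c \<oplus>\<^bsub>L\<^esub> E c = \<zero>\<^bsub>L\<^esub>"
  using EL_add[of c c] E_0 by simp

lemma E_pow: "coeff c 0 = 0 \<Longrightarrow> add_pow L (z :: int) (E c) = E (Polynomial.smult (of_int z) c)"
proof -
  assume c: "coeff c 0 = 0"
  have n: "add_pow L n (E c) = E (Polynomial.smult (of_nat n) c)" for n :: nat
  proof (induction n)
    case (Suc n)
    have "Polynomial.smult (of_nat (Suc n)) c = Polynomial.smult (of_nat n) c + c"
      by (simp only: of_nat_Suc smult_add_left smult_1_left add.commute)
    then have "E (Polynomial.smult (of_nat (Suc n)) c) = E (Polynomial.smult (of_nat n) c) \<oplus>\<^bsub>L\<^esub> E c"
      using EL_add[of "Polynomial.smult (of_nat n) c" c] c by (simp only: coeff_smult mult_zero_right)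
    then show ?case using Suc by (simp only: G.add.nat_pow_Suc)
  qed (simp add: E_0)
  show ?thesis
  proof (cases "0 \<le> z")
    case True
    then show ?thesis using n[of "nat z"] by (simp add: add_pow_int_ge)
  next
    case False
    define d where "d = Polynomial.smult (of_nat (nat (- z))) c"
    have d0: "coeff d 0 = 0" using c by (simp add: d_def)
    have "Polynomial.smult (of_int z) c = - d" using False by (simp add: d_def)
    then have "Polynomial.smult (of_int z) c = d" by (simp only: bit_poly_neg)
    moreover have "\<ominus>\<^bsub>L\<^esub> E d = E d" by (rule G.minus_equality[OF E_double[OF d0] E_car[OF d0] E_car[OF d0]])
    ultimately show ?thesis using False n[of "nat (- z)"] by (simp add: add_pow_int_lt d_def)
  qed
qed

lemma E_sum:
  "finite A \<Longrightarrow> (\<And>m. m \<in> A \<Longrightarrow> coeff (F m) 0 = 0) \<Longrightarrow> (\<Oplus>\<^bsub>L\<^esub>m\<in>A. E (F m)) = E (\<Sum>m\<in>A. F m)"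
proof (induction A rule: finite_induct)
  case (insert x A)
  have "(\<Oplus>\<^bsub>L\<^esub>m\<in>insert x A. E (F m)) = E (F x) \<oplus>\<^bsub>L\<^esub> (\<Oplus>\<^bsub>L\<^esub>m\<in>A. E (F m))"
    by (rule G.finsum_insert) (use insert E_car in auto)
  also have "\<dots> = E (F x + (\<Sum>m\<in>A. F m))" using insert by (simp add: EL_add coeff_sum)
  finally show ?case using insert by simp
qed (simp add: E_0)

lemma prod_pos: "set_mset m \<subseteq> I \<Longrightarrow> 0 < \<Prod>\<^sub># m"
  using primes by (induction m) (auto simp: prime_gt_0_nat)

lemma prod_odd: "set_mset m \<subseteq> I \<Longrightarrow> 2 \<notin># m \<Longrightarrow> odd (\<Prod>\<^sub># m)"
  using primes by (induction m) (auto dest: prime_odd_nat primes_dvd_imp_eq[OF two_is_prime_nat])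

lemma coeff_0_stretch: "0 < j \<Longrightarrow> coeff c 0 = 0 \<Longrightarrow> coeff (stretch j c) 0 = (0::bit)"
  by (simp only: coeff_stretch dvd_0_right div_0 if_True)

lemma vact_0:
  assumes "P \<in> carrier (V_ring I)" "coeff c 0 = 0"
  shows "coeff (vact P c) 0 = 0"
  unfolding vact_def coeff_sum
proof (rule sum.neutral, rule ballI)
  fix m assume "m \<in> Poly_Mapping.keys P"
  then have "0 < \<Prod>\<^sub># m" using assms(1) prod_pos unfolding V_carrier by blast
  from coeff_0_stretch[OF this assms(2)]
  show "coeff (Polynomial.smult (of_int (Poly_Mapping.lookup P m)) (stretch (\<Prod>\<^sub># m) c)) 0 = 0"
    by (simp only: coeff_smult mult_zero_right)
qed

lemma smult_E:
  assumes P: "P \<in> carrier (V_ring I)" and c: "coeff c 0 = 0"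
  shows "P \<odot>\<^bsub>N\<^esub> E c = E (vact P c)"
proof -
  have m: "0 < \<Prod>\<^sub># m" "e = 1 \<or> odd (\<Prod>\<^sub># m)" "coeff (stretch (\<Prod>\<^sub># m) c) 0 = 0" if "m \<in> Poly_Mapping.keys P" for m
  proof -
    have I: "set_mset m \<subseteq> I" using P that unfolding V_carrier by blast
    show "0 < \<Prod>\<^sub># m" by (rule prod_pos[OF I])
    then show "coeff (stretch (\<Prod>\<^sub># m) c) 0 = 0" using c by (rule coeff_0_stretch)
    show "e = 1 \<or> odd (\<Prod>\<^sub># m)" using sign prod_odd[OF I] I by blast
  qed
  define F where "F m = Polynomial.smult (of_int (Poly_Mapping.lookup P m)) (stretch (\<Prod>\<^sub># m) c)" for m
  have F0: "coeff (F m) 0 = 0" if "m \<in> Poly_Mapping.keys P" for m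
    unfolding F_def by (simp only: coeff_smult m(3)[OF that] mult_zero_right)
  have "add_pow L (Poly_Mapping.lookup P m) (V_op (\<Prod>\<^sub># m) (E c)) = E (F m)" if "m \<in> Poly_Mapping.keys P" for m
    unfolding F_def by (simp only: EV_stretch[OF c m(1,2)[OF that]] E_pow[OF m(3)[OF that]])
  then have "P \<odot>\<^bsub>N\<^esub> E c = (\<Oplus>\<^bsub>L\<^esub>m\<in>Poly_Mapping.keys P. E (F m))"
    unfolding N_simps using F0 by (intro G.finsum_cong'[OF refl funcsetI] E_car) simp_all
  also have "\<dots> = E (vact P c)" unfolding vact_def F_def[symmetric] by (rule E_sum[OF finite_keys F0])
  finally show ?thesis .
qed

text \<open>The polynomials without constant term as a module; \<open>E\<close> maps it onto
  \<open>NL\<close> and thereby carries the module axioms over.\<close>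

definition Cmod :: "(nat multiset \<Rightarrow>\<^sub>0 int, bit poly) module" where
  "Cmod = \<lparr>carrier = {c. coeff c 0 = 0}, monoid.mult = undefined, one = undefined, zero = 0, add = (+), module.smult = vact\<rparr>"

lemma Cmod_module: "left_module (V_ring I) Cmod"
proof (intro left_module.intro left_module_axioms.intro V_ring_ring)
  show "abelian_group Cmod"
  proof (rule abelian_groupI)
    fix x assume "x \<in> carrier Cmod"
    then show "\<exists>y\<in>carrier Cmod. y \<oplus>\<^bsub>Cmod\<^esub> x = \<zero>\<^bsub>Cmod\<^esub>" by (intro bexI[of _ x]) (simp_all add: Cmod_def)
  qed (simp_all add: Cmod_def add_ac)
qed (simp_all add: Cmod_def vact_add_left vact_add_right vact_mult vact_one vact_0)

lemma N_module: "left_module (V_ring I) N"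
proof (rule image_left_module[OF Cmod_module])
  show "E \<in> linear_maps (V_ring I) Cmod N"
    by (rule semilinearI) (simp_all add: Cmod_def EN_carrier EL_add N_simps(1,2) smult_E)
  show "E ` carrier Cmod = carrier N" using EN_carrier EN_onto by (auto simp: Cmod_def)
  show "E \<zero>\<^bsub>Cmod\<^esub> = \<zero>\<^bsub>N\<^esub>" by (simp add: Cmod_def N_simps(2) E_0)
qed

lemma regular_left_module: "left_module (V_ring I) (regular_module (V_ring I))"
proof (intro left_module.intro left_module_axioms.intro V_ring_ring)
  show "abelian_group (regular_module (V_ring I))"
  proof (rule abelian_groupI)
    fix x assume "x \<in> carrier (regular_module (V_ring I))"
    then show "\<exists>y\<in>carrier (regular_module (V_ring I)). y \<oplus>\<^bsub>regular_module (V_ring I)\<^esub> x = \<zero>\<^bsub>regular_module (V_ring I)\<^esub>"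
      by (intro bexI[of _ "- x"]) (simp_all add: regular_module_def V_uminus)
  qed (simp_all add: regular_module_def V_closed V_zero_one add_ac)
qed (simp_all add: regular_module_def V_closed algebra_simps)

text \<open>\<open>NL\<close> is cyclic, generated by the class of coordinate t. This is the map
  from the algebra that sends a scalar to its product with the generator.\<close>

definition orbit :: "(nat multiset \<Rightarrow>\<^sub>0 int) \<Rightarrow> (nat \<Rightarrow> 'a, nat \<Rightarrow> nat \<Rightarrow> 'a) qform set" where
  "orbit P = E (vact P TT)"

lemma orbit_0: "P \<in> carrier (V_ring I) \<Longrightarrow> coeff (vact P TT) 0 = 0"
  by (rule vact_0) simp_all

lemma orbit_linear: "orbit \<in> linear_maps (V_ring I) (regular_module (V_ring I)) N"
  by (rule semilinearI)
    (simp_all add: regular_module_def orbit_def EN_carrier EL_add N_simps(1,2) smult_E orbit_0 vact_add_left vact_mult)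

lemma stretch_TT: "stretch j TT = Polynomial.monom (1::bit) j"
  by (simp add: pcompose_pCons)

text \<open>For odd n the power t^n is the image of t under the V_p for the prime factors p of n,
  all odd. An even power is the square of t^j with j = n/2, hence has the same class as t^j; this
  also serves the algebra without V_2.\<close>

lemma orbit_monom: "0 < n \<Longrightarrow> \<exists>P\<in>carrier (V_ring I). E (Polynomial.monom 1 n) = orbit P"
proof (induction n rule: less_induct)
  case (less n)
  show ?case
  proof (cases "even n")
    case False
    have "set_mset (prime_factorization n) \<subseteq> I"
      using False odd_primes by (auto dest: in_prime_factors_imp_prime in_prime_factors_imp_dvd dvd_trans)
    moreover have "\<Prod>\<^sub># (prime_factorization n) = n" using less.prems by (simp add: prod_mset_prime_factorization_nat)
    ultimately show ?thesis
      by (intro bexI[of _ "Poly_Mapping.single (prime_factorization n) 1"]) (simp_all add: orbit_def vact_single stretch_TT V_single)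
  next
    case True
    then obtain j where j: "n = 2 * j" by blast
    let ?u = "Polynomial.monom (1::bit) j"
    have j0: "0 < j" using less.prems j by simp
    have u0: "coeff ?u 0 = 0" using j0 by simp
    have uu: "?u * ?u = Polynomial.monom 1 n" by (simp add: mult_monom j mult_2)
    have n0: "coeff (Polynomial.monom (1::bit) n) 0 = 0" using less.prems by simp
    have "E (?u + ?u * ?u) = \<zero>\<^bsub>L\<^esub>" using EL_zero_iff[of "?u + ?u * ?u"] u0 n0 unfolding uu[symmetric] by auto
    then have "E (Polynomial.monom 1 n) \<oplus>\<^bsub>L\<^esub> E ?u = \<zero>\<^bsub>L\<^esub>" unfolding uu using EL_add[OF n0 u0] by (simp add: add.commute)
    then have "E (Polynomial.monom 1 n) = E ?u"
      using G.minus_equality[OF _ E_car[OF u0] E_car[OF n0]] G.minus_equality[OF E_double[OF u0] E_car[OF u0] E_car[OF u0]] by simp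
    then show ?thesis using less.IH[of j] j0 j by simp
  qed
qed

lemma orbit_onto: "orbit ` carrier (V_ring I) = carrier N"
proof (intro equalityI subsetI)
  fix x assume "x \<in> carrier N"
  then obtain c where c: "coeff c 0 = 0" "x = E c" using EN_onto by blast
  have "\<exists>P\<in>carrier (V_ring I). E (\<Sum>i\<in>A. Polynomial.monom (coeff c i) i) = orbit P" if "finite A" for A
    using that
  proof (induction A rule: finite_induct)
    case empty
    show ?case by (intro bexI[of _ 0]) (simp_all add: orbit_def vact_zero V_zero_one)
  next
    case (insert i A)
    have z: "coeff (Polynomial.monom (coeff c j) j) 0 = 0" for j using c(1) by simp
    have "\<exists>P\<in>carrier (V_ring I). E (Polynomial.monom (coeff c i) i) = orbit P"
    proof (cases "coeff c i = 0")
      case True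
      then show ?thesis by (intro bexI[of _ 0]) (simp_all add: orbit_def vact_zero V_zero_one)
    next
      case False
      then have 1: "coeff c i = 1" by (cases "coeff c i") simp_all
      have "0 < i" using c(1) False by (cases i) auto
      then show ?thesis unfolding 1 using orbit_monom by blast
    qed
    then obtain P Q where P: "P \<in> carrier (V_ring I)" "E (Polynomial.monom (coeff c i) i) = orbit P"
      and Q: "Q \<in> carrier (V_ring I)" "E (\<Sum>i\<in>A. Polynomial.monom (coeff c i) i) = orbit Q" using insert.IH by blast
    have "E (Polynomial.monom (coeff c i) i + (\<Sum>i\<in>A. Polynomial.monom (coeff c i) i)) = orbit (P + Q)"
      using EL_add[OF z[of i], of "\<Sum>i\<in>A. Polynomial.monom (coeff c i) i"] EL_add[OF orbit_0[OF P(1)] orbit_0[OF Q(1)]] P Q z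
      by (simp only: coeff_sum sum.neutral_const orbit_def vact_add_left simp_thms)
    then show ?case using V_closed(1)[OF P(1) Q(1)] insert.hyps by (intro bexI[of _ "P + Q"]) simp_all
  qed
  from this[of "{..degree c}"] show "x \<in> orbit ` carrier (V_ring I)" unfolding poly_as_sum_of_monoms c(2) by auto
qed (use EN_carrier orbit_0 in \<open>auto simp: orbit_def\<close>)

definition gens :: "(nat multiset \<Rightarrow>\<^sub>0 int) set" where
  "gens = (if 2 \<in> I then {2, V_var 2 - 1} else {2})"

lemma two_V: "(2 :: nat multiset \<Rightarrow>\<^sub>0 int) = Poly_Mapping.single 0 2"
  by (metis single_numeral)

lemma gens_carrier: "gens \<subseteq> carrier (V_ring I)"
proof -
  have "2 \<in> carrier (V_ring I)" unfolding two_V by (rule V_single) simp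
  moreover have "V_var 2 - 1 \<in> carrier (V_ring I)" if "2 \<in> I"
    using V_closed(1)[OF V_single[of "{#2#}" I 1] V_uminus[OF V_zero_one(2)]] that by (simp add: V_var_def)
  ultimately show ?thesis by (simp add: gens_def)
qed

lemma vact_neg: "vact (- P) c = vact P c"
proof -
  have "vact (- P) c + vact P c = 0" using vact_add_left[of "- P" P c] by (simp add: vact_zero)
  then show ?thesis by (metis add_eq_0_iff bit_poly_neg)
qed

lemma orbit_gens:
  assumes g: "g \<in> gens" and Q: "Q \<in> carrier (V_ring I)"
  shows "orbit (Q * g) = \<zero>\<^bsub>L\<^esub>"
proof -
  define d where "d = vact Q TT"
  have d0: "coeff d 0 = 0" unfolding d_def by (rule orbit_0[OF Q])
  have eq: "vact (Q * g) TT = vact g d" unfolding mult.commute[of Q] vact_mult d_def ..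
  consider "g = 2" | "g = V_var 2 - 1" using g by (auto simp: gens_def split: if_splits)
  then show ?thesis
  proof cases
    case 1
    then have "vact g d = 0" unfolding 1 two_V vact_single by simp
    then show ?thesis using eq E_0 by (simp add: orbit_def)
  next
    case 2
    have "vact g d = vact (V_var 2) d + vact (- 1) d" unfolding 2 using vact_add_left[of "V_var 2" "- 1" d] by simp
    also have "\<dots> = d + d * d" by (simp add: vact_neg vact_one V_var_def vact_single bit_poly_square add.commute numeral_2_eq_2)
    finally have v: "vact g d = d + d * d" .
    have "coeff (d + d * d) 0 = 0" using d0 by (simp add: coeff_mult)
    then show ?thesis unfolding orbit_def eq v using EL_zero_iff by blast
  qed
qed

definition ker :: "(nat multiset \<Rightarrow>\<^sub>0 int) set" where
  "ker = {P \<in> carrier (V_ring I). orbit P = \<zero>\<^bsub>L\<^esub>}"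

lemma orbit_add: "P \<in> carrier (V_ring I) \<Longrightarrow> Q \<in> carrier (V_ring I) \<Longrightarrow> orbit (P + Q) = orbit P \<oplus>\<^bsub>L\<^esub> orbit Q"
  by (simp add: orbit_def vact_add_left EL_add orbit_0)

lemma ker_ideal: "ideal ker (V_ring I)"
proof (rule idealI[OF V_ring_ring])
  interpret V: ring "V_ring I" by (rule V_ring_ring)
  have neg: "\<ominus>\<^bsub>V_ring I\<^esub> P = - P" if "P \<in> carrier (V_ring I)" for P
    by (rule V.minus_equality) (simp_all add: that V_uminus)
  show "subgroup ker (add_monoid (V_ring I))"
  proof (rule V.add.subgroupI)
    show "ker \<noteq> {}" using V_zero_one(1) E_0 by (auto simp: ker_def orbit_def vact_zero)
    show "\<ominus>\<^bsub>V_ring I\<^esub> P \<in> ker" if "P \<in> ker" for P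
      using that neg by (simp add: ker_def V_uminus orbit_def vact_neg)
    show "P \<oplus>\<^bsub>V_ring I\<^esub> Q \<in> ker" if "P \<in> ker" "Q \<in> ker" for P Q
      using that by (simp add: ker_def V_closed orbit_add)
  qed (simp add: ker_def)
  fix a x assume a: "a \<in> ker" and x: "x \<in> carrier (V_ring I)"
  obtain w where w: "vact a TT = w + w * w" using a orbit_0 EL_zero_iff unfolding ker_def orbit_def by blast
  \<comment> \<open>The action commutes with squaring: substitution does, squaring is additive, and
    integer scalars are idempotent in F_2. So an element w + w^2 goes to one of the same
    form.\<close>
  have sq: "vact x (w * w) = vact x w * vact x w"
  proof (induction x rule: poly_mapping_sum_induct)
    case (single m z)
    have "of_int z * of_int z = (of_int z :: bit)" by (cases "of_int z :: bit") simp_all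
    then show ?case by (simp add: vact_single pcompose_mult)
  qed (simp_all add: vact_add_left bit_poly_square_add vact_zero)
  have xa: "x * a \<in> carrier (V_ring I)" using a x by (simp add: ker_def V_closed)
  have "vact (x * a) TT = vact x w + vact x w * vact x w" unfolding vact_mult w vact_add_right sq ..
  then have "orbit (x * a) = \<zero>\<^bsub>L\<^esub>" unfolding orbit_def EL_zero_iff[OF orbit_0[OF xa]] by blast
  then show "x \<otimes>\<^bsub>V_ring I\<^esub> a \<in> ker" "a \<otimes>\<^bsub>V_ring I\<^esub> x \<in> ker" using xa by (simp_all add: ker_def mult.commute)
qed

text \<open>For odd i the coefficients of w at i, 2i, 4i, and so on all equal the coefficient of c
  at i, because c has no even powers. They vanish beyond the degree of w, so all are zero.\<close>

lemma artin_odd: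
  assumes "w + w * w = (c :: bit poly)" and even: "\<And>n. even n \<Longrightarrow> coeff c n = 0" and i: "odd i"
  shows "coeff c i = 0"
proof -
  have "coeff w (i * 2 ^ l) = coeff c i" for l
  proof (induction l)
    case 0
    have "coeff c i = coeff w i" unfolding assms(1)[symmetric] using i by (simp add: bit_poly_square coeff_stretch)
    then show ?case by simp
  next
    case (Suc l)
    have "coeff w (i * 2 ^ Suc l) + coeff w (i * 2 ^ l) = coeff c (i * 2 ^ Suc l)"
      unfolding assms(1)[symmetric] by (simp add: bit_poly_square coeff_stretch)
    then have "coeff w (i * 2 ^ Suc l) + coeff w (i * 2 ^ l) = 0" using even[of "i * 2 ^ Suc l"] by simp
    then show ?case using Suc by (cases "coeff w (i * 2 ^ Suc l)"; cases "coeff w (i * 2 ^ l)") simp_all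
  qed
  from this[of "degree w"] show ?thesis
  proof -
    assume *: "coeff w (i * 2 ^ degree w) = coeff c i"
    have "degree w < 2 ^ degree w" by (rule less_exp)
    also have "\<dots> \<le> i * 2 ^ degree w" using i by (cases i) simp_all
    finally show ?thesis using * by (simp add: coeff_eq_0)
  qed
qed

text \<open>Distinct monomials without V_2 send t to distinct odd powers, by unique factorization.
  Hence the coefficients of the image of t are those of \<open>Q\<close> modulo 2, and
  \<open>artin_odd\<close> shows that they vanish.\<close>

lemma reduced_even:
  assumes Q: "Q \<in> ker" and red: "\<And>m. m \<in> Poly_Mapping.keys Q \<Longrightarrow> 2 \<notin># m" and m0: "m \<in> Poly_Mapping.keys Q"
  shows "even (Poly_Mapping.lookup Q m)"
proof -
  have QI: "set_mset m \<subseteq> I" if "m \<in> Poly_Mapping.keys Q" for m using Q that unfolding ker_def V_carrier by blast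
  have inj: "m = m'" if "m \<in> Poly_Mapping.keys Q" "m' \<in> Poly_Mapping.keys Q" "\<Prod>\<^sub># m = \<Prod>\<^sub># m'" for m m'
  proof -
    have "prime_factorization (\<Prod>\<^sub># n) = n" if "n \<in> Poly_Mapping.keys Q" for n
      using QI[OF that] primes by (intro prime_factorization_prod_mset_primes) blast
    then show ?thesis using that by metis
  qed
  have co: "coeff (vact Q TT) n = (\<Sum>m\<in>Poly_Mapping.keys Q. of_int (Poly_Mapping.lookup Q m) * (if \<Prod>\<^sub># m = n then 1 else 0))" for n
    unfolding vact_def by (simp add: coeff_sum stretch_TT)
  have Qc: "Q \<in> carrier (V_ring I)" and Q0: "E (vact Q TT) = \<zero>\<^bsub>L\<^esub>" using Q unfolding ker_def orbit_def by blast+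
  obtain w where w: "vact Q TT = w + w * w" using Q0 unfolding EL_zero_iff[OF orbit_0[OF Qc]] by blast
  have ev: "coeff (vact Q TT) n = 0" if "even n" for n
    unfolding co
  proof (rule sum.neutral, rule ballI)
    fix m assume m: "m \<in> Poly_Mapping.keys Q"
    have "\<Prod>\<^sub># m \<noteq> n" using prod_odd[OF QI[OF m] red[OF m]] that by blast
    then show "of_int (Poly_Mapping.lookup Q m) * (if \<Prod>\<^sub># m = n then 1 else 0) = (0 :: bit)" by simp
  qed
  have "coeff (vact Q TT) (\<Prod>\<^sub># m) = 0"
    by (rule artin_odd[OF w[symmetric] ev prod_odd[OF QI[OF m0] red[OF m0]]])
  moreover have "coeff (vact Q TT) (\<Prod>\<^sub># m) = (\<Sum>m'\<in>Poly_Mapping.keys Q. if m' = m then of_int (Poly_Mapping.lookup Q m) else 0)"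
    unfolding co
  proof (rule sum.cong[OF refl])
    fix m' assume m': "m' \<in> Poly_Mapping.keys Q"
    show "of_int (Poly_Mapping.lookup Q m') * (if \<Prod>\<^sub># m' = \<Prod>\<^sub># m then 1 else 0)
        = (if m' = m then of_int (Poly_Mapping.lookup Q m) else (0 :: bit))"
      using inj[OF m' m0] by (cases "m' = m") auto
  qed
  ultimately have "(of_int (Poly_Mapping.lookup Q m) :: bit) = 0" using m0 by simp
  then show ?thesis by (rule of_int_bit_zero)
qed

text \<open>Modulo V_2 - 1 every monomial is congruent to one without V_2. The reduced element still
  lies in the kernel, so its coefficients are even by \<open>reduced_even\<close>, and it is a
  multiple of 2.\<close>

lemma ker_Idl: "Idl\<^bsub>V_ring I\<^esub> gens = ker"
proof (rule antisym)
  interpret V: ring "V_ring I" by (rule V_ring_ring)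
  have "gens \<subseteq> ker"
    using orbit_gens[OF _ V_zero_one(2)] gens_carrier by (auto simp: ker_def)
  then show "Idl\<^bsub>V_ring I\<^esub> gens \<subseteq> ker" by (rule V.genideal_minimal[OF ker_ideal])
  define J where "J = Idl\<^bsub>V_ring I\<^esub> gens"
  have J: "ideal J (V_ring I)" unfolding J_def by (rule V.genideal_ideal[OF gens_carrier])
  interpret J: ideal J "V_ring I" by (rule J)
  have gJ: "g * Q \<in> J" if "g \<in> gens" "Q \<in> carrier (V_ring I)" for g Q
    using J.I_r_closed[of g Q] that V.genideal_self[OF gens_carrier] unfolding J_def by auto
  have Jadd: "a + b \<in> J" if "a \<in> J" "b \<in> J" for a b using J.a_closed[OF that] by simp
  have J0: "0 \<in> J" using J.zero_closed by simp
  define red where "red Q \<longleftrightarrow> Q \<in> carrier (V_ring I) \<and> (\<forall>m\<in>Poly_Mapping.keys Q. 2 \<notin># m)" for Q :: "nat multiset \<Rightarrow>\<^sub>0 int"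
  \<comment> \<open>Each factor V_2 is removed at the cost of a multiple of V_2 - 1. If 2 is not in
    \<open>I\<close>, no monomial contains such a factor.\<close>
  have strip: "\<exists>Q. red Q \<and> Poly_Mapping.single m z - Q \<in> J" if "set_mset m \<subseteq> I" for m z
    using that
  proof (induction "size m" arbitrary: m)
    case 0
    then show ?case by (intro exI[of _ "Poly_Mapping.single m z"]) (simp add: red_def V_single J0)
  next
    case (Suc l)
    show ?case
    proof (cases "2 \<in># m")
      case False
      then show ?thesis using Suc.prems by (intro exI[of _ "Poly_Mapping.single m z"]) (simp add: red_def V_single J0)
    next
      case True
      then obtain m' where m': "m = add_mset 2 m'" by (metis mset_add)
      have I': "set_mset m' \<subseteq> I" "2 \<in> I" using Suc.prems m' by auto
      obtain Q where Q: "red Q" "Poly_Mapping.single m' z - Q \<in> J" using Suc.hyps(1)[of m'] Suc.hyps(2) I' m' by auto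
      have "V_var 2 - 1 \<in> gens" using I' by (simp add: gens_def)
      note g = gJ[OF this V_single[OF I'(1), of z]]
      have "(V_var 2 - 1) * Poly_Mapping.single m' z = Poly_Mapping.single m z - Poly_Mapping.single m' z"
        by (simp add: V_var_def left_diff_distrib mult_single m')
      then have d: "Poly_Mapping.single m z - Poly_Mapping.single m' z \<in> J" using g by (simp only:)
      from Jadd[OF d Q(2)] have "Poly_Mapping.single m z - Q \<in> J" by simp
      then show ?thesis using Q(1) by blast
    qed
  qed
  show "ker \<subseteq> J"
  proof
    fix P assume P: "P \<in> ker"
    have "\<exists>Q. red Q \<and> P - Q \<in> J"
    proof (induction P rule: poly_mapping_sum_induct)
      case (single m z)
      then have "set_mset m \<subseteq> I" using P unfolding ker_def V_carrier by blast
      then show ?case by (rule strip)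
    next
      case (add f g)
      then obtain F G where F: "red F" "f - F \<in> J" and G: "red G" "g - G \<in> J" by blast
      have FG: "F \<in> carrier (V_ring I)" "G \<in> carrier (V_ring I)" using F(1) G(1) unfolding red_def by blast+
      have "2 \<notin># m" if "m \<in> Poly_Mapping.keys (F + G)" for m
        using subsetD[OF keys_add that] F(1) G(1) unfolding red_def by blast
      then have "red (F + G)" unfolding red_def using V_closed(1)[OF FG] by blast
      moreover have "(f + g) - (F + G) \<in> J" using Jadd[OF F(2) G(2)] by (simp only: add_diff_add)
      ultimately show ?case by blast
    next
      case zero
      show ?case by (intro exI[of _ 0]) (simp add: red_def V_zero_one J0)
    qed
    then obtain Q where Q: "red Q" "P - Q \<in> J" by blast
    have Qc: "Q \<in> carrier (V_ring I)" using Q(1) by (simp add: red_def)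
    have PQ: "P - Q \<in> ker" using Q(2) \<open>Idl\<^bsub>V_ring I\<^esub> gens \<subseteq> ker\<close> unfolding J_def by blast
    interpret K: ideal ker "V_ring I" by (rule ker_ideal)
    have "orbit P = orbit (P - Q) \<oplus>\<^bsub>L\<^esub> orbit Q"
      using orbit_add[of "P - Q" Q] PQ Qc unfolding ker_def by simp
    then have "orbit Q = \<zero>\<^bsub>L\<^esub>" using P PQ E_car[OF orbit_0[OF Qc]] unfolding ker_def orbit_def by simp
    then have Qk: "Q \<in> ker" using Qc unfolding ker_def by blast
    have "\<exists>Q'\<in>carrier (V_ring I). Q = 2 * Q'"
    proof -
      have ev: "even (Poly_Mapping.lookup Q m)" if "m \<in> Poly_Mapping.keys Q" for m
      proof (rule reduced_even[OF Qk _ that])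
        show "2 \<notin># m'" if "m' \<in> Poly_Mapping.keys Q" for m' using Q(1) that unfolding red_def by blast
      qed
      define Q' where "Q' = Poly_Mapping.map (\<lambda>z. z div 2) Q"
      have l: "Poly_Mapping.lookup Q' m = Poly_Mapping.lookup Q m div 2" for m by (simp add: Q'_def map.rep_eq when_def)
      have "Q = Q' + Q'"
      proof (rule poly_mapping_eqI)
        fix m show "Poly_Mapping.lookup Q m = Poly_Mapping.lookup (Q' + Q') m"
          unfolding lookup_add l using ev[of m] by (cases "Poly_Mapping.lookup Q m = 0") (auto simp: in_keys_iff)
      qed
      moreover have "Q' \<in> carrier (V_ring I)" using Qc unfolding V_carrier by (auto simp: in_keys_iff l)
      ultimately show ?thesis by (intro bexI[of _ Q']) (simp_all only: mult_2)
    qed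
    then obtain Q' where Q': "Q' \<in> carrier (V_ring I)" "Q = 2 * Q'" by blast
    have "2 \<in> gens" by (simp add: gens_def)
    then have "Q \<in> J" unfolding Q'(2) by (rule gJ[OF _ Q'(1)])
    from Jadd[OF Q(2) this] show "P \<in> J" by simp
  qed
qed

theorem N_iso: "module_iso (V_ring I) N (quotient_module (regular_module (V_ring I)) (Idl\<^bsub>V_ring I\<^esub> gens))"
proof (rule module_iso_sym, rule quotient_module_iso[OF regular_left_module N_module orbit_linear])
  show "orbit ` carrier (regular_module (V_ring I)) = carrier N" using orbit_onto by (simp add: regular_module_def)
  show "Idl\<^bsub>V_ring I\<^esub> gens = {x \<in> carrier (regular_module (V_ring I)). orbit x = \<zero>\<^bsub>N\<^esub>}"
    unfolding ker_Idl by (simp add: ker_def regular_module_def N_simps(2))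
qed

end

section \<open>The isomorphisms for the two algebras\<close>

lemma NL_iso_plus:
  assumes "witt_coords 1 k R E"
  shows "module_iso \<V> (NL 1 k R id) (quotient_module (regular_module \<V>) (Idl\<^bsub>\<V>\<^esub> {2, V_var 2 - 1}))"
proof -
  interpret witt_coords_primes 1 k R E "{p. prime p}"
    by (intro witt_coords_primes.intro assms witt_coords_primes_axioms.intro) auto
  show ?thesis using N_iso unfolding gens_def N_def by simp
qed

lemma NL_iso_minus:
  assumes "witt_coords (-1) k R E"
  shows "module_iso \<V>\<^sub>o\<^sub>d (NL (-1) k R id) (quotient_module (regular_module \<V>\<^sub>o\<^sub>d) (Idl\<^bsub>\<V>\<^sub>o\<^sub>d\<^esub> {2}))"
proof -
  interpret witt_coords_primes "-1" k R E "{p. prime p \<and> odd p}"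
    by (intro witt_coords_primes.intro assms witt_coords_primes_axioms.intro) auto
  show ?thesis using N_iso unfolding gens_def N_def by simp
qed

theorem theorem1p3:
  shows "(\<forall>k :: int. module_iso \<V> (NL 1 k (residue_ring 2) id) (NL 1 1 \<Z> id)) \<and>
    module_iso \<V> (NL 1 1 \<Z> id)
      (quotient_module (regular_module \<V>) (Idl\<^bsub>\<V>\<^esub> {2, V_var 2 - 1})) \<and>
    module_iso \<V>\<^sub>o\<^sub>d (NL (-1) 1 \<Z> id) (NL (-1) 0 \<Z> id) \<and>
    module_iso \<V>\<^sub>o\<^sub>d (NL (-1) 0 \<Z> id)
      (quotient_module (regular_module \<V>\<^sub>o\<^sub>d) (Idl\<^bsub>\<V>\<^sub>o\<^sub>d\<^esub> {2})) \<and>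
    carrier (NL 1 0 \<Z> id) = {\<zero>\<^bsub>NL 1 0 \<Z> id\<^esub>}"
proof -
  have bits: "module_iso \<V> (NL 1 k (residue_ring 2) id) (quotient_module (regular_module \<V>) (Idl\<^bsub>\<V>\<^esub> {2, V_var 2 - 1}))" for k
    by (rule exE[OF bit_coords NL_iso_plus])
  have "\<exists>E. witt_coords 1 1 \<Z> E" by (rule int_coords) simp_all
  then have ints: "module_iso \<V> (NL 1 1 \<Z> id) (quotient_module (regular_module \<V>) (Idl\<^bsub>\<V>\<^esub> {2, V_var 2 - 1}))"
    by (rule exE) (rule NL_iso_plus)
  \<comment> \<open>For e = -1 coordinates exist for either parity of k, so both groups are compared
    through the same quotient.\<close>
  have "\<exists>E. witt_coords (-1) k \<Z> E" for k by (rule int_coords) simp_all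
  then have minus: "module_iso \<V>\<^sub>o\<^sub>d (NL (-1) k \<Z> id) (quotient_module (regular_module \<V>\<^sub>o\<^sub>d) (Idl\<^bsub>\<V>\<^sub>o\<^sub>d\<^esub> {2}))" for k
    by (rule exE) (rule NL_iso_minus)
  show ?thesis
  proof (intro conjI allI)
    show "module_iso \<V> (NL 1 k (residue_ring 2) id) (NL 1 1 \<Z> id)" for k
      by (rule module_iso_trans[OF bits module_iso_sym[OF ints]])
    show "module_iso \<V>\<^sub>o\<^sub>d (NL (-1) 1 \<Z> id) (NL (-1) 0 \<Z> id)"
      by (rule module_iso_trans[OF minus module_iso_sym[OF minus]])
    show "carrier (NL 1 0 \<Z> id) = {\<zero>\<^bsub>NL 1 0 \<Z> id\<^esub>}" by (rule NL_trivial) simp_all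
  qed (rule ints minus)+
qed

end
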